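(* Let $Y$ be a compact manifold with an autonomous flow $\phi:\mathbb{R}\times Y\to Y$, let $\mu$ be a $\phi$-invariant Borel measure on $Y$, let $(E,\omega)\to Y$ be a symplectic vector bundle with vanishing first Chern class $c_1(E)=0$, let $\Phi$ be a symplectic cocycle on $E$ for $\phi$, and let $\tau$ be a homotopy class of trivializations of the complex determinant line bundle $\Lambda E$. Then there is a well-defined Ruelle density and Ruelle invariant \[\mathrm{ru}(\Phi,\tau):=\lim_{T\to\infty}\frac{\tilde u_T}{T}\in L^1(Y,\mu),\qquad \mathrm{Ru}(\Phi,\tau,\mu):=\int_Y \mathrm{ru}(\Phi,\tau)\cdot\mu ,\] where $\tilde u_T$ is the rotation function at time $T$; that is, the limit exists in $L^1(Y,\mu)$ and does not depend on the compatible complex structure $J$ on $E$ or on the unitary trivialization representing $\tau$ that are used to define $\tilde u_T$. Moreover, the Ruelle density and invariant satisfy the following properties. (a) (Covariance) If $\Psi:(E,\Phi)\to(E',\Phi')$ is a symplectic cocycle isomorphism that maps $\tau$ to $\tau'$, then $\mathrm{ru}(\Phi,\tau)=\mathrm{ru}(\Phi',\tau')$ and $\mathrm{Ru}(\Phi,\tau,\mu)=\mathrm{Ru}(\Phi',\tau',\mu)$. (b) (Direct sum) If $\Phi=\Phi_1\oplus\Phi_2$ is a direct sum of symplectic cocycles (on $E=E_1\oplus E_2$) and $\tau=\tau_1\otimes\tau_2$ with $\tau_i$ a homotopy class of trivializations of $\Lambda E_i$, then $\mathrm{ru}(\Phi_1\oplus\Phi_2,\tau_1\otimes\tau_2)=\mathrm{ru}(\Phi_1,\tau_1)+\mathrm{ru}(\Phi_2,\tau_2)$.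 (c) (Linearity) If $a\mu+b\nu$ is a positive combination of $\phi$-invariant Borel measures $\mu$ and $\nu$, then $\mathrm{Ru}(\Phi,\tau,a\mu+b\nu)=a\,\mathrm{Ru}(\Phi,\tau,\mu)+b\,\mathrm{Ru}(\Phi,\tau,\nu)$. (d) (Trivial bundle) If $\Phi$ is a symplectic cocycle on the trivial bundle $\mathbb{C}^n$ over $Y$ with the tautological trivialization $\tau_{\mathrm{std}}$, then for any rotation quasimorphism $q:\widetilde{\mathrm{Sp}}(2n)\to\mathbb{R}$, \[\mathrm{ru}(\Phi,\tau_{\mathrm{std}})=\lim_{T\to\infty}\frac{q\circ\widetilde\Phi_T}{T},\qquad \mathrm{Ru}(\Phi,\tau_{\mathrm{std}},\mu)=\lim_{T\to\infty}\frac1T\int_Y q\circ\widetilde\Phi_T\cdot\mu,\] where $\widetilde\Phi:\mathbb{R}\times Y\to\widetilde{\mathrm{Sp}}(2n)$ is the lift of $\Phi$ (regarded as a map $\mathbb{R}\times Y\to\mathrm{Sp}(2n)$) to the universal cover, equal to the identity on $0\times Y$, and $\widetilde\Phi_T=\widetilde\Phi(T,\cdot)$.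
   Context: Cocycles. Let $\rho:\mathbb{R}\times Y\to Y$ be the projection. A symplectic cocycle on $E$ for $\phi$ is a symplectic bundle map $\Phi:\rho^*E\to\phi^*E$, i.e. a family of linear symplectic isomorphisms $\Phi(t,x):E_x\to E_{\phi(t,x)}$, with $\Phi(s+t,x)=\Phi(t,\phi(s,x))\Phi(s,x)$. An isomorphism of symplectic cocycles $\Psi:(E,\Phi)\to(E',\Phi')$ is a symplectic bundle isomorphism over $\mathrm{id}_Y$ with $\Psi_{\phi(t,x)}\Phi(t,x)=\Phi'(t,x)\Psi_x$. Determinant bundle. A compatible complex structure $J$ on $E$ is a bundle endomorphism with $J^2=-\mathrm{Id}$ such that $\omega(\cdot,J\cdot)$ is a fiberwise inner product; it makes $E$ a Hermitian bundle. The space of such $J$ is contractible. $\Lambda E=\wedge^k_{\mathbb{C}}E$, $k=\mathrm{rank}_{\mathbb{C}}E$. A trivialization is a unitary bundle isomorphism $\Lambda E\simeq\mathbb{C}$; the set of homotopy classes of trivializations is canonically independent of $J$ and is nonempty iff $c_1(E)=0$. On $\mathbb{C}^n$ we use the standard symplectic form $\omega=\sum_j dx_j\wedge dy_j$ and $\mathrm{U}(n)=\mathrm{O}(2n)\cap\mathrm{Sp}(2n)$; the tautological trivialization $\tau_{\mathrm{std}}$ is the one induced by $\Lambda\mathbb{C}^n=\mathbb{C}$. Rotation function. Given $J$ and a unitary trivialization $\tau:\Lambda E\simeq\mathbb{C}$, take the polar decomposition $\Phi(t,x)=U(t,x)P(t,x)$ with $P(t,x):E_x\to E_x$ self-adjoint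 positive definite and $U(t,x):E_x\to E_{\phi(t,x)}$ unitary. Let $u(t,x)=\tau_{\phi(t,x)}\circ\Lambda U(t,x)\circ\tau_x^{-1}\in U(1)$. Let $\tilde u:\mathbb{R}\times Y\to\mathbb{R}$ be the unique lift with $\exp(2\pi i\tilde u)=u$ and $\tilde u|_{0\times Y}=0$. The rotation function at time $T$ is $\tilde u_T=\tilde u(T,\cdot)$. Rotation quasimorphisms. A quasimorphism on a group $G$ is a map $q:G\to\mathbb{R}$ with $|q(gh)-q(g)-q(h)|$ bounded uniformly in $g,h$; it is homogeneous if $q(g^k)=kq(g)$ for all $k\in\mathbb{Z}$. There is a unique homogeneous quasimorphism $\rho:\widetilde{\mathrm{Sp}}(2n)\to\mathbb{R}$ on the universal cover of $\mathrm{Sp}(2n)$ whose restriction to $\widetilde{\mathrm{U}}(n)$ is the lift of $\det_{\mathbb{C}}$, i.e. $\exp(2\pi i\rho)=\det_{\mathbb{C}}\circ\pi$ there, with $\pi$ the covering projection. A rotation quasimorphism is a quasimorphism $q$ with $|q-\rho|$ bounded.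
   Formalization: The invariant Borel measures are taken to be finite, and in (d) the functions q∘Φ̃_T are assumed Borel measurable for all large T, since otherwise u_T/T or q∘Φ̃_T/T need not lie in L¹ and the integrals are undefined. *)

theory Defs
  imports "HOL-Analysis.Analysis" "HOL-Algebra.Group"
begin

section \<open>Compact manifolds, flows and invariant measures\<close>

text \<open>
  Topological manifolds, possibly with boundary, of constant dimension \<open>m\<close>: every point has an
  open neighbourhood homeomorphic to a relatively open subset of the half space
  \<open>z\<^sub>0 \<ge> 0\<close> of the \<open>m\<close>-dimensional Euclidean space.  The Hausdorff property and
  second countability are imposed through the sort of \<open>'y\<close>.
\<close>

definition compact_manifold :: "'y::{t2_space,second_countable_topology} set \<Rightarrow> bool" where
  "compact_manifold Y \<longleftrightarrow> compact Y \<and>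
     (\<exists>m. \<forall>x\<in>Y. \<exists>U V. openin (top_of_set Y) U \<and> x \<in> U \<and>
        openin (subtopology (Euclidean_space m) {z. 0 \<le> z 0}) V \<and>
        top_of_set U homeomorphic_space subtopology (Euclidean_space m) V)"

definition continuous_flow :: "(real \<Rightarrow> 'y::topological_space \<Rightarrow> 'y) \<Rightarrow> bool" where
  "continuous_flow \<phi> \<longleftrightarrow>
     continuous_on UNIV (\<lambda>(t,x). \<phi> t x) \<and>
     (\<forall>x. \<phi> 0 x = x) \<and> (\<forall>s t x. \<phi> (s + t) x = \<phi> t (\<phi> s x))"

text \<open>Borel measures on a compact space are taken to be finite, so that bounded Borel functions
  are integrable.\<close>

definition invariant_measure ::
    "(real \<Rightarrow> 'y::topological_space \<Rightarrow> 'y) \<Rightarrow> 'y measure \<Rightarrow> bool" where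
  "invariant_measure \<phi> \<mu> \<longleftrightarrow>
     sets \<mu> = sets borel \<and> finite_measure \<mu> \<and> (\<forall>t. distr \<mu> borel (\<phi> t) = \<mu>)"

definition comb_measure ::
    "real \<Rightarrow> 'y::topological_space measure \<Rightarrow> real \<Rightarrow> 'y measure \<Rightarrow> 'y measure" where
  "comb_measure a \<mu> b \<nu> =
     measure_of UNIV (sets borel) (\<lambda>A. ennreal a * emeasure \<mu> A + ennreal b * emeasure \<nu> A)"


section \<open>Symplectic vector bundles\<close>

text \<open>The total space is a subset of a topological space and carries the subspace topology.  The
  fibrewise operations are only meaningful on vectors of one and the same fibre.\<close>

record ('y, 'e) symp_bundle =
  tot :: "'e set"
  prj :: "'e \<Rightarrow> 'y"
  vadd :: "'e \<Rightarrow> 'e \<Rightarrow> 'e"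
  vscale :: "real \<Rightarrow> 'e \<Rightarrow> 'e"
  vzero :: "'y \<Rightarrow> 'e"
  omega :: "'e \<Rightarrow> 'e \<Rightarrow> real"

definition fibre :: "('y, 'e) symp_bundle \<Rightarrow> 'y \<Rightarrow> 'e set" where
  "fibre E x = {v \<in> tot E. prj E v = x}"

definition fibre_linear ::
    "('y, 'e) symp_bundle \<Rightarrow> 'y \<Rightarrow> ('z, 'f) symp_bundle \<Rightarrow> 'z \<Rightarrow> ('e \<Rightarrow> 'f) \<Rightarrow> bool" where
  "fibre_linear E x F y A \<longleftrightarrow>
     (\<forall>v\<in>fibre E x. A v \<in> fibre F y) \<and>
     (\<forall>v\<in>fibre E x. \<forall>w\<in>fibre E x. A (vadd E v w) = vadd F (A v) (A w)) \<and>
     (\<forall>r. \<forall>v\<in>fibre E x. A (vscale E r v) = vscale F r (A v))"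

definition fibre_symplectic_iso ::
    "('y, 'e) symp_bundle \<Rightarrow> 'y \<Rightarrow> ('z, 'f) symp_bundle \<Rightarrow> 'z \<Rightarrow> ('e \<Rightarrow> 'f) \<Rightarrow> bool" where
  "fibre_symplectic_iso E x F y A \<longleftrightarrow>
     fibre_linear E x F y A \<and> bij_betw A (fibre E x) (fibre F y) \<and>
     (\<forall>v\<in>fibre E x. \<forall>w\<in>fibre E x. omega F (A v) (A w) = omega E v w)"

text \<open>
  The rank of a bundle is given by a finite index type \<open>'k\<close>: the complex rank is \<open>CARD('k)\<close>, and
  the real vector space underlying \<open>complex ^ 'k\<close> is the model fibre.  The fibrewise linear local
  trivializations \<open>h\<close> force the operations on each fibre to satisfy the vector space axioms.
\<close>

definition vector_bundle ::
    "'k::finite itself \<Rightarrow> ('y::topological_space, 'e::topological_space) symp_bundle \<Rightarrow> bool" where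
  "vector_bundle _ E \<longleftrightarrow>
     (\<forall>x. \<exists>U (h :: 'y \<times> (complex ^ 'k) \<Rightarrow> 'e) h'.
        open U \<and> x \<in> U \<and>
        homeomorphism (U \<times> UNIV) {v \<in> tot E. prj E v \<in> U} h h' \<and>
        (\<forall>y\<in>U. h (y, 0) = vzero E y \<and>
           (\<forall>z. prj E (h (y, z)) = y) \<and>
           (\<forall>z w. h (y, z + w) = vadd E (h (y, z)) (h (y, w))) \<and>
           (\<forall>r z. h (y, r *\<^sub>R z) = vscale E r (h (y, z)))))"

definition symplectic_vector_bundle ::
    "'k::finite itself \<Rightarrow> ('y::topological_space, 'e::topological_space) symp_bundle \<Rightarrow> bool" where
  "symplectic_vector_bundle K E \<longleftrightarrow>
     vector_bundle K E \<and>
     continuous_on {(v, w). v \<in> tot E \<and> w \<in> tot E \<and> prj E v = prj E w} (\<lambda>(v, w). omega E v w) \<and>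
     (\<forall>x. \<forall>u\<in>fibre E x. \<forall>v\<in>fibre E x. \<forall>w\<in>fibre E x. \<forall>r.
        omega E (vadd E u v) w = omega E u w + omega E v w \<and>
        omega E (vscale E r v) w = r * omega E v w \<and>
        omega E v w = - omega E w v) \<and>
     (\<forall>x. \<forall>v\<in>fibre E x. v \<noteq> vzero E x \<longrightarrow> (\<exists>w\<in>fibre E x. omega E v w \<noteq> 0))"

definition symplectic_cocycle ::
    "(real \<Rightarrow> 'y \<Rightarrow> 'y) \<Rightarrow> ('y::topological_space, 'e::topological_space) symp_bundle \<Rightarrow>
     (real \<Rightarrow> 'y \<Rightarrow> 'e \<Rightarrow> 'e) \<Rightarrow> bool" where
  "symplectic_cocycle \<phi> E \<Phi> \<longleftrightarrow>
     continuous_on (UNIV \<times> tot E) (\<lambda>(t, v). \<Phi> t (prj E v) v) \<and>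
     (\<forall>t x. fibre_symplectic_iso E x E (\<phi> t x) (\<Phi> t x)) \<and>
     (\<forall>s t x. \<forall>v\<in>fibre E x. \<Phi> (s + t) x v = \<Phi> t (\<phi> s x) (\<Phi> s x v))"

definition cocycle_iso ::
    "(real \<Rightarrow> 'y \<Rightarrow> 'y) \<Rightarrow>
     ('y::topological_space, 'e::topological_space) symp_bundle \<Rightarrow> (real \<Rightarrow> 'y \<Rightarrow> 'e \<Rightarrow> 'e) \<Rightarrow>
     ('y, 'f::topological_space) symp_bundle \<Rightarrow> (real \<Rightarrow> 'y \<Rightarrow> 'f \<Rightarrow> 'f) \<Rightarrow>
     ('e \<Rightarrow> 'f) \<Rightarrow> bool" where
  "cocycle_iso \<phi> E \<Phi> E' \<Phi>' \<Psi> \<longleftrightarrow>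
     (\<exists>\<Psi>'. homeomorphism (tot E) (tot E') \<Psi> \<Psi>') \<and>
     (\<forall>x. fibre_symplectic_iso E x E' x \<Psi>) \<and>
     (\<forall>t x. \<forall>v\<in>fibre E x. \<Psi> (\<Phi> t x v) = \<Phi>' t x (\<Psi> v))"


section \<open>The determinant line bundle and its trivializations\<close>

definition compatible_cs ::
    "('y, 'e::topological_space) symp_bundle \<Rightarrow> ('e \<Rightarrow> 'e) \<Rightarrow> bool" where
  "compatible_cs E J \<longleftrightarrow>
     continuous_on (tot E) J \<and>
     (\<forall>x. fibre_linear E x E x J \<and>
        (\<forall>v\<in>fibre E x. J (J v) = vscale E (-1) v) \<and>
        (\<forall>v\<in>fibre E x. \<forall>w\<in>fibre E x. omega E v (J w) = omega E w (J v)) \<and>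
        (\<forall>v\<in>fibre E x. v \<noteq> vzero E x \<longrightarrow> omega E v (J v) > 0))"

definition cscale :: "('y, 'e) symp_bundle \<Rightarrow> ('e \<Rightarrow> 'e) \<Rightarrow> complex \<Rightarrow> 'e \<Rightarrow> 'e" where
  "cscale E J c v = vadd E (vscale E (Re c) v) (vscale E (Im c) (J v))"

text \<open>The Hermitian form with real part \<open>\<omega>(\<cdot>, J \<cdot>)\<close>, complex linear in the first argument.\<close>

definition hermitian :: "('y, 'e) symp_bundle \<Rightarrow> ('e \<Rightarrow> 'e) \<Rightarrow> 'e \<Rightarrow> 'e \<Rightarrow> complex" where
  "hermitian E J v w = Complex (omega E v (J w)) (- omega E v w)"

definition families :: "('y, 'e) symp_bundle \<Rightarrow> 'y \<Rightarrow> ('k::finite \<Rightarrow> 'e) set" where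
  "families E x = {v. \<forall>i. v i \<in> fibre E x}"

definition alt_forms ::
    "('y, 'e) symp_bundle \<Rightarrow> ('e \<Rightarrow> 'e) \<Rightarrow> 'y \<Rightarrow> (('k::finite \<Rightarrow> 'e) \<Rightarrow> complex) set" where
  "alt_forms E J x =
     {\<alpha> \<in> extensional (families E x).
        (\<forall>v\<in>families E x. \<forall>i. \<forall>a\<in>fibre E x. \<forall>b\<in>fibre E x. \<forall>c.
           \<alpha> (v(i := vadd E a b)) = \<alpha> (v(i := a)) + \<alpha> (v(i := b)) \<and>
           \<alpha> (v(i := cscale E J c a)) = c * \<alpha> (v(i := a))) \<and>
        (\<forall>v\<in>families E x. \<forall>i j. i \<noteq> j \<and> v i = v j \<longrightarrow> \<alpha> v = 0)}"

text \<open>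
  For \<open>k = CARD('k)\<close>, the exterior power \<open>\<And>\<^sup>k E\<^sub>x\<close> over the complex numbers is realised as
  the dual of the space of alternating complex \<open>k\<close>-linear forms on \<open>E\<^sub>x\<close>; the decomposable
  \<open>v\<^sub>1 \<and> \<dots> \<and> v\<^sub>k\<close> is evaluation at \<open>(v\<^sub>1, \<dots>, v\<^sub>k)\<close>.  The factors are indexed by \<open>'k\<close>
  and need not be ordered.
\<close>

type_synonym ('e, 'k) det_elem = "(('k \<Rightarrow> 'e) \<Rightarrow> complex) \<Rightarrow> complex"

definition det_line ::
    "('y, 'e) symp_bundle \<Rightarrow> ('e \<Rightarrow> 'e) \<Rightarrow> 'y \<Rightarrow> ('e, 'k::finite) det_elem set" where
  "det_line E J x =
     {L \<in> extensional (alt_forms E J x).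
        \<forall>\<alpha>\<in>alt_forms E J x. \<forall>\<beta>\<in>alt_forms E J x. \<forall>c.
          L (\<lambda>v\<in>families E x. \<alpha> v + \<beta> v) = L \<alpha> + L \<beta> \<and>
          L (\<lambda>v\<in>families E x. c * \<alpha> v) = c * L \<alpha>}"

definition wedge ::
    "('y, 'e) symp_bundle \<Rightarrow> ('e \<Rightarrow> 'e) \<Rightarrow> 'y \<Rightarrow> ('k::finite \<Rightarrow> 'e) \<Rightarrow> ('e, 'k) det_elem" where
  "wedge E J x v = (\<lambda>\<alpha>\<in>alt_forms E J x. \<alpha> v)"

text \<open>The map \<open>\<Lambda>A\<close> of determinant lines induced by a complex linear map
  \<open>A : (E\<^sub>x, J) \<rightarrow> (F\<^sub>y, J')\<close>.\<close>

definition det_map ::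
    "('y, 'e) symp_bundle \<Rightarrow> 'y \<Rightarrow> ('z, 'f) symp_bundle \<Rightarrow> ('f \<Rightarrow> 'f) \<Rightarrow> 'z \<Rightarrow>
     ('e \<Rightarrow> 'f) \<Rightarrow> ('e, 'k::finite) det_elem \<Rightarrow> ('f, 'k) det_elem" where
  "det_map E x F J' y A L =
     (\<lambda>\<beta>\<in>alt_forms F J' y. L (\<lambda>v\<in>families E x. \<beta> (\<lambda>i. A (v i))))"

text \<open>
  A unitary trivialization consists of complex linear maps \<open>\<tau>\<^sub>x : \<Lambda>E\<^sub>x \<rightarrow> \<complex>\<close> that preserve the norm
  induced by the Hermitian metric, for which \<open>v\<^sub>1 \<and> \<dots> \<and> v\<^sub>k\<close> has squared norm the Gram determinant
  of the \<open>v\<^sub>i\<close>.  Continuity with respect to the bundle topology of \<open>\<Lambda>E\<close> amounts to continuity of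
  \<open>\<tau>\<^sub>x (v\<^sub>1 \<and> \<dots> \<and> v\<^sub>k)\<close> in the vectors \<open>v\<^sub>1, \<dots>, v\<^sub>k\<close>.
\<close>

type_synonym ('y, 'e, 'k) det_triv = "'y \<Rightarrow> ('e, 'k) det_elem \<Rightarrow> complex"

definition unitary_at ::
    "('y, 'e) symp_bundle \<Rightarrow> ('e \<Rightarrow> 'e) \<Rightarrow> ('y, 'e, 'k::finite) det_triv \<Rightarrow> 'y \<Rightarrow> bool" where
  "unitary_at E J \<tau> x \<longleftrightarrow>
     (\<forall>L\<in>det_line E J x. \<forall>M\<in>det_line E J x. \<forall>c.
        \<tau> x (\<lambda>\<alpha>\<in>alt_forms E J x. L \<alpha> + M \<alpha>) = \<tau> x L + \<tau> x M \<and>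
        \<tau> x (\<lambda>\<alpha>\<in>alt_forms E J x. c * L \<alpha>) = c * \<tau> x L) \<and>
     (\<forall>v\<in>families E x.
        complex_of_real ((cmod (\<tau> x (wedge E J x v)))\<^sup>2) =
          det (\<chi> (i::'k) (j::'k). hermitian E J (v i) (v j)))"

definition unitary_triv_on ::
    "'y set \<Rightarrow> ('y::topological_space, 'e::topological_space) symp_bundle \<Rightarrow> ('e \<Rightarrow> 'e) \<Rightarrow>
     ('y, 'e, 'k::finite) det_triv \<Rightarrow> bool" where
  "unitary_triv_on S E J \<tau> \<longleftrightarrow>
     (\<forall>x\<in>S. unitary_at E J \<tau> x) \<and>
     continuous_on (SIGMA x:S. families E x) (\<lambda>(x, v). \<tau> x (wedge E J x v))"

text \<open>
  Since the space of compatible complex structures is contractible, the homotopy classes of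
  trivializations for the various \<open>J\<close> are identified by transport along paths of complex
  structures.  Accordingly a homotopy class is a class of pairs \<open>(J, \<tau>)\<close> under homotopies of such
  pairs.
\<close>

definition triv_pair ::
    "('y::topological_space, 'e::topological_space) symp_bundle \<Rightarrow>
     ('e \<Rightarrow> 'e) \<times> ('y, 'e, 'k::finite) det_triv \<Rightarrow> bool" where
  "triv_pair E = (\<lambda>(J, \<tau>). compatible_cs E J \<and> unitary_triv_on UNIV E J \<tau>)"

definition homotopic_triv ::
    "('y::topological_space, 'e::topological_space) symp_bundle \<Rightarrow>
     ('e \<Rightarrow> 'e) \<times> ('y, 'e, 'k::finite) det_triv \<Rightarrow>
     ('e \<Rightarrow> 'e) \<times> ('y, 'e, 'k) det_triv \<Rightarrow> bool" where
  "homotopic_triv E p p' \<longleftrightarrow>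
     (\<exists>(J :: real \<Rightarrow> 'e \<Rightarrow> 'e) (\<tau> :: real \<Rightarrow> ('y, 'e, 'k) det_triv).
        (J 0, \<tau> 0) = p \<and> (J 1, \<tau> 1) = p' \<and>
        (\<forall>s\<in>{0..1}. triv_pair E (J s, \<tau> s)) \<and>
        continuous_on ({0..1} \<times> tot E) (\<lambda>(s, v). J s v) \<and>
        continuous_on ({0..1} \<times> (SIGMA x:UNIV. families E x))
          (\<lambda>(s, x, v). \<tau> s x (wedge E (J s) x v)))"

definition homotopy_class ::
    "('y::topological_space, 'e::topological_space) symp_bundle \<Rightarrow>
     ('e \<Rightarrow> 'e) \<times> ('y, 'e, 'k::finite) det_triv \<Rightarrow>
     (('e \<Rightarrow> 'e) \<times> ('y, 'e, 'k) det_triv) set" where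
  "homotopy_class E p = {p'. homotopic_triv E p p'}"

definition triv_class ::
    "('y::topological_space, 'e::topological_space) symp_bundle \<Rightarrow>
     (('e \<Rightarrow> 'e) \<times> ('y, 'e, 'k::finite) det_triv) set \<Rightarrow> bool" where
  "triv_class E T \<longleftrightarrow> (\<exists>p. triv_pair E p \<and> T = homotopy_class E p)"

definition push_triv ::
    "('y, 'e) symp_bundle \<Rightarrow> ('y, 'f) symp_bundle \<Rightarrow> ('e \<Rightarrow> 'f) \<Rightarrow>
     ('e \<Rightarrow> 'e) \<times> ('y, 'e, 'k::finite) det_triv \<Rightarrow> ('f \<Rightarrow> 'f) \<times> ('y, 'f, 'k) det_triv" where
  "push_triv E E' \<Psi> = (\<lambda>(J, \<tau>).
     let \<Psi>' = inv_into (tot E) \<Psi>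
     in (\<lambda>v. \<Psi> (J (\<Psi>' v)), \<lambda>x L. \<tau> x (det_map E' x E J x \<Psi>' L)))"


section \<open>Vanishing of the first Chern class\<close>

text \<open>
  The first Chern class of \<open>E\<close> is the image of the isomorphism class of the unitary line bundle
  \<open>\<Lambda>E\<close> under the connecting homomorphism from degree one Cech cohomology with coefficients
  \<open>U(1)\<close> to degree two Cech cohomology with integer coefficients: if the transition functions of
  local unitary trivializations are \<open>\<tau>\<^sub>i \<circ> \<tau>\<^sub>j\<^sup>-\<^sup>1 = exp (2 \<pi> i h\<^sub>i\<^sub>j)\<close>, it is represented, up
  to the choice of a global sign, by the cocycle \<open>h\<^sub>i\<^sub>j + h\<^sub>j\<^sub>k - h\<^sub>i\<^sub>k\<close>.  As every
  open cover is refined by one indexed by the points of \<open>Y\<close>, only covers \<open>x \<in> U x\<close> are considered.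
\<close>

definition chern_cocycle ::
    "'k::finite itself \<Rightarrow> ('y::topological_space, 'e::topological_space) symp_bundle \<Rightarrow>
     ('e \<Rightarrow> 'e) \<Rightarrow> ('y \<Rightarrow> 'y set) \<Rightarrow> ('y \<Rightarrow> 'y \<Rightarrow> 'y \<Rightarrow> 'y \<Rightarrow> int) \<Rightarrow> bool" where
  "chern_cocycle _ E J U c \<longleftrightarrow>
     (\<exists>(\<tau> :: 'y \<Rightarrow> ('y, 'e, 'k) det_triv) (h :: 'y \<Rightarrow> 'y \<Rightarrow> 'y \<Rightarrow> real).
        (\<forall>i. unitary_triv_on (U i) E J (\<tau> i)) \<and>
        (\<forall>i j. continuous_on (U i \<inter> U j) (h i j)) \<and>
        (\<forall>i j. \<forall>x \<in> U i \<inter> U j. \<forall>L\<in>det_line E J x.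
           \<tau> i x L = exp (2 * of_real pi * \<i> * of_real (h i j x)) * \<tau> j x L) \<and>
        (\<forall>i j k. \<forall>x \<in> U i \<inter> U j \<inter> U k.
           of_int (c i j k x) = h i j x + h j k x - h i k x))"

definition cech_coboundary ::
    "('y::topological_space \<Rightarrow> 'y set) \<Rightarrow> ('y \<Rightarrow> 'y \<Rightarrow> 'y \<Rightarrow> 'y \<Rightarrow> int) \<Rightarrow> bool" where
  "cech_coboundary U c \<longleftrightarrow>
     (\<exists>m :: 'y \<Rightarrow> 'y \<Rightarrow> 'y \<Rightarrow> int.
        (\<forall>i j. continuous_on (U i \<inter> U j) (\<lambda>x. real_of_int (m i j x))) \<and>
        (\<forall>i j k. \<forall>x \<in> U i \<inter> U j \<inter> U k. c i j k x = m i j x + m j k x - m i k x))"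

definition c1_vanishes ::
    "'k::finite itself \<Rightarrow> ('y::topological_space, 'e::topological_space) symp_bundle \<Rightarrow> bool" where
  "c1_vanishes K E \<longleftrightarrow>
     (\<exists>J. compatible_cs E J \<and>
        (\<exists>U c. (\<forall>x. open (U x) \<and> x \<in> U x) \<and> chern_cocycle K E J U c \<and> cech_coboundary U c))"


section \<open>Rotation functions and the Ruelle density\<close>

definition polar_decomposition ::
    "('y, 'e) symp_bundle \<Rightarrow> ('e \<Rightarrow> 'e) \<Rightarrow> 'y \<Rightarrow> 'y \<Rightarrow>
     ('e \<Rightarrow> 'e) \<Rightarrow> ('e \<Rightarrow> 'e) \<Rightarrow> ('e \<Rightarrow> 'e) \<Rightarrow> bool" where
  "polar_decomposition E J x y A U P \<longleftrightarrow>
     fibre_linear E x E x P \<and>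
     (\<forall>v\<in>fibre E x. \<forall>w\<in>fibre E x. omega E (P v) (J w) = omega E v (J (P w))) \<and>
     (\<forall>v\<in>fibre E x. v \<noteq> vzero E x \<longrightarrow> omega E (P v) (J v) > 0) \<and>
     fibre_linear E x E y U \<and> bij_betw U (fibre E x) (fibre E y) \<and>
     (\<forall>v\<in>fibre E x. U (J v) = J (U v)) \<and>
     (\<forall>v\<in>fibre E x. \<forall>w\<in>fibre E x. hermitian E J (U v) (U w) = hermitian E J v w) \<and>
     (\<forall>v\<in>fibre E x. A v = U (P v))"

text \<open>The endomorphism \<open>\<tau>\<^sub>\<phi>\<^sub>(\<^sub>t\<^sub>,\<^sub>x\<^sub>) \<circ> \<Lambda>U \<circ> \<tau>\<^sub>x\<^sup>-\<^sup>1\<close> of \<open>\<complex>\<close> is identified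
  with its value at 1.\<close>

definition rotation_phase ::
    "(real \<Rightarrow> 'y \<Rightarrow> 'y) \<Rightarrow> ('y, 'e) symp_bundle \<Rightarrow>
     ('e \<Rightarrow> 'e) \<times> ('y, 'e, 'k::finite) det_triv \<Rightarrow> (real \<Rightarrow> 'y \<Rightarrow> 'e \<Rightarrow> 'e) \<Rightarrow>
     real \<Rightarrow> 'y \<Rightarrow> complex" where
  "rotation_phase \<phi> E p \<Phi> t x = (case p of (J, \<tau>) \<Rightarrow>
     (THE u. \<exists>U P. polar_decomposition E J x (\<phi> t x) (\<Phi> t x) U P \<and>
        u = \<tau> (\<phi> t x) (det_map E x E J (\<phi> t x) U (inv_into (det_line E J x) (\<tau> x) 1))))"

definition rotation_function ::
    "(real \<Rightarrow> 'y \<Rightarrow> 'y) \<Rightarrow> ('y::topological_space, 'e) symp_bundle \<Rightarrow>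
     ('e \<Rightarrow> 'e) \<times> ('y, 'e, 'k::finite) det_triv \<Rightarrow> (real \<Rightarrow> 'y \<Rightarrow> 'e \<Rightarrow> 'e) \<Rightarrow>
     real \<Rightarrow> 'y \<Rightarrow> real" where
  "rotation_function \<phi> E p \<Phi> =
     (THE u. continuous_on UNIV (\<lambda>(t, x). u t x) \<and> (\<forall>x. u 0 x = 0) \<and>
        (\<forall>t x. exp (2 * of_real pi * \<i> * of_real (u t x)) = rotation_phase \<phi> E p \<Phi> t x))"

definition L1_limit :: "'y measure \<Rightarrow> (real \<Rightarrow> 'y \<Rightarrow> real) \<Rightarrow> ('y \<Rightarrow> real) \<Rightarrow> bool" where
  "L1_limit \<mu> F f \<longleftrightarrow>
     integrable \<mu> f \<and> (\<forall>\<^sub>F T in at_top. integrable \<mu> (F T)) \<and>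
     ((\<lambda>T. \<integral>x. \<bar>F T x - f x\<bar> \<partial>\<mu>) \<longlongrightarrow> 0) at_top"

definition is_ruelle_density ::
    "(real \<Rightarrow> 'y \<Rightarrow> 'y) \<Rightarrow> ('y::topological_space, 'e) symp_bundle \<Rightarrow>
     (real \<Rightarrow> 'y \<Rightarrow> 'e \<Rightarrow> 'e) \<Rightarrow> (('e \<Rightarrow> 'e) \<times> ('y, 'e, 'k::finite) det_triv) set \<Rightarrow>
     'y measure \<Rightarrow> ('y \<Rightarrow> real) \<Rightarrow> bool" where
  "is_ruelle_density \<phi> E \<Phi> \<tau> \<mu> f \<longleftrightarrow>
     (\<forall>p\<in>\<tau>. L1_limit \<mu> (\<lambda>T x. rotation_function \<phi> E p \<Phi> T x / T) f)"

text \<open>An element of \<open>L\<^sup>1(Y, \<mu>)\<close> is a function up to equality almost everywhere; \<open>ruelle_density\<close>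
  selects a representative.\<close>

definition ruelle_density ::
    "(real \<Rightarrow> 'y \<Rightarrow> 'y) \<Rightarrow> ('y::topological_space, 'e) symp_bundle \<Rightarrow>
     (real \<Rightarrow> 'y \<Rightarrow> 'e \<Rightarrow> 'e) \<Rightarrow> (('e \<Rightarrow> 'e) \<times> ('y, 'e, 'k::finite) det_triv) set \<Rightarrow>
     'y measure \<Rightarrow> 'y \<Rightarrow> real" where
  "ruelle_density \<phi> E \<Phi> \<tau> \<mu> = (SOME f. is_ruelle_density \<phi> E \<Phi> \<tau> \<mu> f)"

definition ruelle_invariant ::
    "(real \<Rightarrow> 'y \<Rightarrow> 'y) \<Rightarrow> ('y::topological_space, 'e) symp_bundle \<Rightarrow>
     (real \<Rightarrow> 'y \<Rightarrow> 'e \<Rightarrow> 'e) \<Rightarrow> (('e \<Rightarrow> 'e) \<times> ('y, 'e, 'k::finite) det_triv) set \<Rightarrow>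
     'y measure \<Rightarrow> real" where
  "ruelle_invariant \<phi> E \<Phi> \<tau> \<mu> = (\<integral>x. ruelle_density \<phi> E \<Phi> \<tau> \<mu> x \<partial>\<mu>)"

definition ruelle_data ::
    "(real \<Rightarrow> 'y \<Rightarrow> 'y) \<Rightarrow> ('y::topological_space, 'e::topological_space) symp_bundle \<Rightarrow>
     (real \<Rightarrow> 'y \<Rightarrow> 'e \<Rightarrow> 'e) \<Rightarrow>
     (('e \<Rightarrow> 'e) \<times> ('y, 'e, 'k::finite) det_triv) set \<Rightarrow> bool" where
  "ruelle_data \<phi> E \<Phi> \<tau> \<longleftrightarrow>
     symplectic_vector_bundle TYPE('k) E \<and> c1_vanishes TYPE('k) E \<and>
     symplectic_cocycle \<phi> E \<Phi> \<and> triv_class E \<tau>"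


section \<open>Direct sums\<close>

definition sum_bundle ::
    "('y, 'e) symp_bundle \<Rightarrow> ('y, 'f) symp_bundle \<Rightarrow> ('y, 'e \<times> 'f) symp_bundle" where
  "sum_bundle E F =
     \<lparr>tot = {(v, w). v \<in> tot E \<and> w \<in> tot F \<and> prj E v = prj F w},
      prj = (\<lambda>(v, w). prj E v),
      vadd = (\<lambda>(v, w) (v', w'). (vadd E v v', vadd F w w')),
      vscale = (\<lambda>r (v, w). (vscale E r v, vscale F r w)),
      vzero = (\<lambda>x. (vzero E x, vzero F x)),
      omega = (\<lambda>(v, w) (v', w'). omega E v v' + omega F w w')\<rparr>"

definition sum_cocycle ::
    "(real \<Rightarrow> 'y \<Rightarrow> 'e \<Rightarrow> 'e) \<Rightarrow> (real \<Rightarrow> 'y \<Rightarrow> 'f \<Rightarrow> 'f) \<Rightarrow> real \<Rightarrow> 'y \<Rightarrow> 'e \<times> 'f \<Rightarrow> 'e \<times> 'f"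
  where
  "sum_cocycle \<Phi> \<Psi> t x = map_prod (\<Phi> t x) (\<Psi> t x)"

text \<open>
  \<open>\<tau> = \<tau>\<^sub>1 \<otimes> \<tau>\<^sub>2\<close> under the canonical isomorphism from \<open>\<Lambda>E \<otimes> \<Lambda>F\<close> to \<open>\<Lambda>(E \<oplus> F)\<close> that sends
  \<open>(v\<^sub>1 \<and> \<dots> \<and> v\<^sub>k) \<otimes> (w\<^sub>1 \<and> \<dots> \<and> w\<^sub>l)\<close> to
  \<open>v\<^sub>1 \<and> \<dots> \<and> v\<^sub>k \<and> w\<^sub>1 \<and> \<dots> \<and> w\<^sub>l\<close>.
\<close>

definition is_tensor_triv ::
    "('y, 'e) symp_bundle \<Rightarrow> ('e \<Rightarrow> 'e) \<times> ('y, 'e, 'k::finite) det_triv \<Rightarrow>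
     ('y, 'f) symp_bundle \<Rightarrow> ('f \<Rightarrow> 'f) \<times> ('y, 'f, 'l::finite) det_triv \<Rightarrow>
     ('e \<times> 'f \<Rightarrow> 'e \<times> 'f) \<times> ('y, 'e \<times> 'f, 'k + 'l) det_triv \<Rightarrow> bool" where
  "is_tensor_triv E p\<^sub>1 F p\<^sub>2 p \<longleftrightarrow>
     (case (p\<^sub>1, p\<^sub>2, p) of ((J\<^sub>1, \<tau>\<^sub>1), (J\<^sub>2, \<tau>\<^sub>2), (J, \<tau>)) \<Rightarrow>
        J = map_prod J\<^sub>1 J\<^sub>2 \<and>
        (\<forall>x. \<forall>v\<in>families E x. \<forall>w\<in>families F x.
           \<tau> x (wedge (sum_bundle E F) J x
              (case_sum (\<lambda>i. (v i, vzero F x)) (\<lambda>j. (vzero E x, w j)))) =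
           \<tau>\<^sub>1 x (wedge E J\<^sub>1 x v) * \<tau>\<^sub>2 x (wedge F J\<^sub>2 x w)))"

definition tensor_class ::
    "('y::topological_space, 'e::topological_space) symp_bundle \<Rightarrow>
     (('e \<Rightarrow> 'e) \<times> ('y, 'e, 'k::finite) det_triv) set \<Rightarrow>
     ('y, 'f::topological_space) symp_bundle \<Rightarrow>
     (('f \<Rightarrow> 'f) \<times> ('y, 'f, 'l::finite) det_triv) set \<Rightarrow>
     (('e \<times> 'f \<Rightarrow> 'e \<times> 'f) \<times> ('y, 'e \<times> 'f, 'k + 'l) det_triv) set" where
  "tensor_class E T\<^sub>1 F T\<^sub>2 =
     (\<Union>p\<^sub>1\<in>T\<^sub>1. \<Union>p\<^sub>2\<in>T\<^sub>2. \<Union>p\<in>{p. triv_pair (sum_bundle E F) p \<and> is_tensor_triv E p\<^sub>1 F p\<^sub>2 p}.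
        homotopy_class (sum_bundle E F) p)"


section \<open>Trivial bundles and rotation quasimorphisms\<close>

definition std_form :: "complex ^ 'n::finite \<Rightarrow> complex ^ 'n \<Rightarrow> real" where
  "std_form v w = (\<Sum>j\<in>UNIV. Re (v $ j) * Im (w $ j) - Im (v $ j) * Re (w $ j))"

definition trivial_bundle :: "('y, 'y \<times> (complex ^ 'n::finite)) symp_bundle" where
  "trivial_bundle =
     \<lparr>tot = UNIV, prj = fst,
      vadd = (\<lambda>(x, v) (_, w). (x, v + w)),
      vscale = (\<lambda>r (x, v). (x, r *\<^sub>R v)),
      vzero = (\<lambda>x. (x, 0)),
      omega = (\<lambda>(_, v) (_, w). std_form v w)\<rparr>"

definition std_cs :: "'y \<times> (complex ^ 'n::finite) \<Rightarrow> 'y \<times> (complex ^ 'n)" where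
  "std_cs = (\<lambda>(x, v). (x, \<i> *s v))"

text \<open>The identification of \<open>\<Lambda>\<complex>\<^sup>n\<close> with \<open>\<complex>\<close> sends \<open>v\<^sub>1 \<and> \<dots> \<and> v\<^sub>n\<close> to the determinant of the
  matrix with columns \<open>v\<^sub>1, \<dots>, v\<^sub>n\<close>.\<close>

definition std_triv :: "('y, 'y \<times> (complex ^ 'n::finite), 'n) det_triv" where
  "std_triv x L = L (\<lambda>v\<in>families trivial_bundle x. det (\<chi> i j. snd (v j) $ i))"

definition std_class ::
    "(('y::topological_space \<times> (complex ^ 'n::finite) \<Rightarrow> 'y \<times> (complex ^ 'n)) \<times>
      ('y, 'y \<times> (complex ^ 'n), 'n) det_triv) set" where
  "std_class = homotopy_class trivial_bundle (std_cs, std_triv)"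

definition Sp_group :: "((complex ^ 'n::finite) \<Rightarrow>\<^sub>L (complex ^ 'n)) set" where
  "Sp_group = {A. \<forall>v w. std_form (blinfun_apply A v) (blinfun_apply A w) = std_form v w}"

definition U_group :: "((complex ^ 'n::finite) \<Rightarrow>\<^sub>L (complex ^ 'n)) set" where
  "U_group = {A \<in> Sp_group. \<forall>v. norm (blinfun_apply A v) = norm v}"

text \<open>Any model of the universal covering group of \<open>Sp(2n)\<close>, unique up to isomorphism.\<close>

definition universal_cover_Sp ::
    "'g::topological_space monoid \<Rightarrow>
     ('g \<Rightarrow> ((complex ^ 'n::finite) \<Rightarrow>\<^sub>L (complex ^ 'n))) \<Rightarrow> bool" where
  "universal_cover_Sp G \<pi> \<longleftrightarrow>
     group G \<and>
     continuous_on (carrier G \<times> carrier G) (\<lambda>(g, h). g \<otimes>\<^bsub>G\<^esub> h) \<and>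
     continuous_on (carrier G) (m_inv G) \<and>
     covering_space (carrier G) \<pi> Sp_group \<and> simply_connected (carrier G) \<and>
     (\<forall>g\<in>carrier G. \<forall>h\<in>carrier G. \<pi> (g \<otimes>\<^bsub>G\<^esub> h) = \<pi> g o\<^sub>L \<pi> h)"

definition quasimorphism :: "'g monoid \<Rightarrow> ('g \<Rightarrow> real) \<Rightarrow> bool" where
  "quasimorphism G q \<longleftrightarrow>
     (\<exists>D. \<forall>g\<in>carrier G. \<forall>h\<in>carrier G. \<bar>q (g \<otimes>\<^bsub>G\<^esub> h) - q g - q h\<bar> \<le> D)"

definition homogeneous :: "'g monoid \<Rightarrow> ('g \<Rightarrow> real) \<Rightarrow> bool" where
  "homogeneous G q \<longleftrightarrow> (\<forall>g\<in>carrier G. \<forall>k::int. q (g [^]\<^bsub>G\<^esub> k) = of_int k * q g)"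

text \<open>The homogeneous quasimorphism \<open>\<rho>\<close> restricting to the continuous lift of the complex
  determinant on the preimage of \<open>U(n)\<close>, which is the universal cover of \<open>U(n)\<close>.  The normalisation
  of the lift at the unit is a consequence of homogeneity.\<close>

definition is_rotation_rho ::
    "'g::topological_space monoid \<Rightarrow> ('g \<Rightarrow> ((complex ^ 'n::finite) \<Rightarrow>\<^sub>L (complex ^ 'n))) \<Rightarrow>
     ('g \<Rightarrow> real) \<Rightarrow> bool" where
  "is_rotation_rho G \<pi> \<rho> \<longleftrightarrow>
     quasimorphism G \<rho> \<and> homogeneous G \<rho> \<and>
     continuous_on {g \<in> carrier G. \<pi> g \<in> U_group} \<rho> \<and>
     (\<forall>g\<in>carrier G. \<pi> g \<in> U_group \<longrightarrow>
        exp (2 * of_real pi * \<i> * of_real (\<rho> g)) = det (matrix (blinfun_apply (\<pi> g))))"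

definition rotation_quasimorphism ::
    "'g::topological_space monoid \<Rightarrow> ('g \<Rightarrow> ((complex ^ 'n::finite) \<Rightarrow>\<^sub>L (complex ^ 'n))) \<Rightarrow>
     ('g \<Rightarrow> real) \<Rightarrow> bool" where
  "rotation_quasimorphism G \<pi> q \<longleftrightarrow>
     quasimorphism G q \<and>
     (\<exists>\<rho>. is_rotation_rho G \<pi> \<rho> \<and> (\<exists>C. \<forall>g\<in>carrier G. \<bar>q g - \<rho> g\<bar> \<le> C))"

definition cocycle_matrix ::
    "(real \<Rightarrow> 'y \<Rightarrow> 'y \<times> (complex ^ 'n::finite) \<Rightarrow> 'y \<times> (complex ^ 'n)) \<Rightarrow>
     real \<Rightarrow> 'y \<Rightarrow> ((complex ^ 'n) \<Rightarrow>\<^sub>L (complex ^ 'n))" where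
  "cocycle_matrix \<Phi> t x = Blinfun (\<lambda>v. snd (\<Phi> t x (x, v)))"

definition is_cocycle_lift ::
    "'g::topological_space monoid \<Rightarrow> ('g \<Rightarrow> ((complex ^ 'n::finite) \<Rightarrow>\<^sub>L (complex ^ 'n))) \<Rightarrow>
     (real \<Rightarrow> 'y::topological_space \<Rightarrow> 'y \<times> (complex ^ 'n) \<Rightarrow> 'y \<times> (complex ^ 'n)) \<Rightarrow>
     (real \<Rightarrow> 'y \<Rightarrow> 'g) \<Rightarrow> bool" where
  "is_cocycle_lift G \<pi> \<Phi> \<Phi>' \<longleftrightarrow>
     continuous_on UNIV (\<lambda>(t, x). \<Phi>' t x) \<and>
     (\<forall>t x. \<Phi>' t x \<in> carrier G \<and> \<pi> (\<Phi>' t x) = cocycle_matrix \<Phi> t x) \<and>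
     (\<forall>x. \<Phi>' 0 x = \<one>\<^bsub>G\<^esub>)"

end

theory Submission
  imports Defs "HOL-Computational_Algebra.Fundamental_Theorem_Algebra"
begin

text \<open>In unitary frames the phase of a symplectic map \<open>A\<close> is that of \<open>det C\<^sub>A\<close>, where
  \<open>C\<^sub>A\<close> and \<open>D\<^sub>A\<close> are the complex linear and antilinear parts of \<open>A\<close>.  Since
  \<open>C\<^bsub>BA\<^esub> = C\<^sub>B C\<^sub>A + D\<^sub>B D\<^sub>A\<close> and \<open>det (C\<^sub>B C\<^sub>A + r D\<^sub>B D\<^sub>A)\<close>, for \<open>r\<close> in the unit interval,
  is a nowhere vanishing polynomial of degree at most \<open>k\<close> in \<open>r\<close>, the rotation function is
  additive along the flow up to an error \<open>k / 2\<close>.  For such a quasi-cocycle \<open>F\<close> the averages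
  \<open>F\<^sub>T / T\<close> are Cauchy in \<open>L\<^sup>2\<close>, by the parallelogram law as in the mean ergodic theorem.
  The same bound, applied along a path of trivializations, shows that homotopic ones have rotation
  functions at bounded distance, and bounded perturbations do not affect the limit.  On a trivial
  bundle the unitary part of the lifted path computes the rotation function, and the positive part
  changes a rotation quasimorphism by a bounded amount only.\<close>

section \<open>Complex linear parts of symplectic maps\<close>

text \<open>For a symplectic map and its inverse alike, |C v|^2 = |v|^2 + |D v|^2. Hence both D_A
  C_A^-1 and C_B^-1 D_B strictly decrease norms, and the two estimates meet in the middle of C_B C_A
  + r D_B D_A to make it injective. Seen from a root off the unit interval, that interval subtends
  an angle of at most half a turn; this is where k / 2 comes from.

  Phases determine lifts only up to integers. Every comparison of lifts is therefore carried along a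
  second parameter, starting from a position where the product of the antilinear parts vanishes and
  the lifts are known. The resulting constants do not depend on time, which is all that the averages
  require.

  The other obstacle is that unitary frames exist at each point but are not chosen continuously.
  Continuity is always read off from values of the trivialization on wedges of continuous families
  of vectors, in which the chosen frames cancel.\<close>

lemma i_i_cmult [simp]: "\<i> *s (\<i> *s v) = - (v :: complex ^ 'n)"
  by (simp add: vec_eq_iff)

lemma i_cmult_linear:
  fixes v w :: "complex ^ 'n"
  shows "\<i> *s (v + w) = \<i> *s v + \<i> *s w" "\<i> *s (v - w) = \<i> *s v - \<i> *s w"
    "\<i> *s (- v) = - (\<i> *s v)" "\<i> *s (r *\<^sub>R v) = r *\<^sub>R (\<i> *s v)" "\<i> *s (0 :: complex ^ 'n) = 0"
  by (auto simp: vec_eq_iff algebra_simps)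

lemma inner_i_i: "(\<i> *s v) \<bullet> (\<i> *s w) = v \<bullet> (w :: complex ^ 'n)"
  by (simp add: inner_vec_def inner_complex_def add.commute)

lemma inner_i_skew: "(\<i> *s v) \<bullet> w = - (v \<bullet> (\<i> *s (w :: complex ^ 'n)))"
  by (simp add: inner_vec_def inner_complex_def sum_negf [symmetric])

lemma std_form_inner: "std_form v w = (\<i> *s v) \<bullet> w"
  by (simp add: std_form_def inner_vec_def inner_complex_def algebra_simps)

lemma std_form_i: "std_form v (\<i> *s w) = v \<bullet> w"
  by (simp add: std_form_inner inner_i_i)

lemma scaleR_eq_cmult: "r *\<^sub>R v = complex_of_real r *s (v :: complex ^ 'n)"
  by (simp add: vec_eq_iff complex_eq_iff)

lemma cmult_decomp: "c *s v = Re c *\<^sub>R v + Im c *\<^sub>R (\<i> *s (v :: complex ^ 'n))"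
  by (simp add: vec_eq_iff complex_eq_iff)

lemma continuous_on_cmult_i [continuous_intros]:
  "continuous_on S f \<Longrightarrow> continuous_on S (\<lambda>x. \<i> *s (f x :: complex ^ 'n))"
  unfolding vector_scalar_mult_def by (intro continuous_intros)

definition sympl :: "(complex ^ 'n \<Rightarrow> complex ^ 'n) \<Rightarrow> bool" where
  "sympl A \<longleftrightarrow> linear A \<and> (\<forall>v w. std_form (A v) (A w) = std_form v w)"

definition cpart :: "(complex ^ 'n \<Rightarrow> complex ^ 'n) \<Rightarrow> complex ^ 'n \<Rightarrow> complex ^ 'n" where
  "cpart A v = (1/2) *\<^sub>R (A v - \<i> *s A (\<i> *s v))"

definition dpart :: "(complex ^ 'n \<Rightarrow> complex ^ 'n) \<Rightarrow> complex ^ 'n \<Rightarrow> complex ^ 'n" where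
  "dpart A v = (1/2) *\<^sub>R (A v + \<i> *s A (\<i> *s v))"

definition clinear :: "(complex ^ 'n \<Rightarrow> complex ^ 'n) \<Rightarrow> bool" where
  "clinear A \<longleftrightarrow> linear A \<and> (\<forall>v. A (\<i> *s v) = \<i> *s A v)"

definition cdet :: "(complex ^ 'n \<Rightarrow> complex ^ 'n) \<Rightarrow> complex" where
  "cdet A = det (matrix A)"

lemma cpart_dpart: "cpart A v + dpart A v = A v"
  by (simp add: cpart_def dpart_def scaleR_add_left [symmetric] algebra_simps)

lemma clinear_vs: assumes "clinear A" shows "Vector_Spaces.linear (*s) (*s) A"
proof unfold_locales
  have l: "linear A" using assms by (simp add: clinear_def)
  show "A (v + w) = A v + A w" for v w by (rule linear_add[OF l])
  show "A (c *s v) = c *s A v" for c v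
    using assms unfolding cmult_decomp[of c]
    by (simp add: linear_add[OF l] linear_scale[OF l] clinear_def)
qed

lemma clinearI:
  "(\<And>v w. A (v + w) = A v + A w) \<Longrightarrow> (\<And>r v. A (r *\<^sub>R v) = r *\<^sub>R A v) \<Longrightarrow>
   (\<And>v. A (\<i> *s v) = \<i> *s A v) \<Longrightarrow> clinear A"
  unfolding clinear_def by (auto intro: linearI)

lemma clinear_cmult: "clinear A \<Longrightarrow> A (c *s v) = c *s A v"
  using clinear_vs vec.linear_scale by blast

lemma matrix_clinear: "clinear A \<Longrightarrow> matrix A *v v = A v"
  using clinear_vs matrix_works by blast

lemma cdet_compose: "clinear A \<Longrightarrow> clinear B \<Longrightarrow> cdet (\<lambda>v. B (A v)) = cdet B * cdet A"
  unfolding cdet_def using matrix_compose_gen[of A B] clinear_vs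
  by (metis (no_types, lifting) comp_def det_mul matrix_compose_gen ext)

lemma cdet_nonzero:
  assumes "clinear A" and "\<And>v. A v = 0 \<Longrightarrow> v = 0"
  shows "cdet A \<noteq> 0"
proof -
  have "inj ((*v) (matrix A))"
    by (rule injI) (metis assms clinear_def eq_iff_diff_eq_0 linear_diff matrix_clinear)
  then show ?thesis
    unfolding cdet_def
    by (simp add: invertible_det_nz[symmetric] invertible_left_inverse matrix_left_invertible_injective)
qed

lemma cdet_id [simp]: "cdet (\<lambda>v :: complex ^ 'n. v) = 1"
proof -
  have "matrix (\<lambda>v. v :: complex ^ 'n) = mat 1"
    by (simp add: matrix_def mat_def vec_eq_iff axis_def)
  then show ?thesis by (simp add: cdet_def)
qed

lemma clinear_cpart: assumes "linear A" shows "clinear (cpart A)"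
proof (rule clinearI)
  interpret linear A by fact
  show "cpart A (v + w) = cpart A v + cpart A w" for v w
    by (simp add: cpart_def add i_cmult_linear algebra_simps)
  show "cpart A (r *\<^sub>R v) = r *\<^sub>R cpart A v" for r v
    by (simp add: cpart_def scale i_cmult_linear algebra_simps)
  show "cpart A (\<i> *s v) = \<i> *s cpart A v" for v
    by (simp add: cpart_def neg i_cmult_linear algebra_simps)
qed

lemma dpart_linear: assumes "linear A" shows "linear (dpart A)"
proof (rule linearI)
  interpret linear A by fact
  show "dpart A (v + w) = dpart A v + dpart A w" for v w
    by (simp add: dpart_def add i_cmult_linear algebra_simps)
  show "dpart A (r *\<^sub>R v) = r *\<^sub>R dpart A v" for r v
    by (simp add: dpart_def scale i_cmult_linear algebra_simps)
qed

lemma dpart_i: assumes "linear A" shows "dpart A (\<i> *s v) = - (\<i> *s dpart A v)"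
  by (simp add: dpart_def linear_neg[OF assms] i_cmult_linear algebra_simps)

text \<open>A product of two antilinear maps is complex linear and a mixed product is antilinear, so
  the four terms of the composite sort by type.\<close>

lemma cpart_compose:
  assumes "linear B" "linear A"
  shows "cpart (\<lambda>v. B (A v)) v = cpart B (cpart A v) + dpart B (dpart A v)"
proof -
  interpret B: linear B by fact
  have 1: "A (\<i> *s v) = \<i> *s cpart A v - \<i> *s dpart A v"
    using cpart_dpart[of A "\<i> *s v"] clinear_cpart[OF assms(2)] dpart_i[OF assms(2)]
    by (simp add: clinear_def)
  have 2: "A v = cpart A v + dpart A v" by (simp add: cpart_dpart)
  show ?thesis
    unfolding cpart_def[of "\<lambda>v. B (A v)"] 1 2 B.add B.diff
    unfolding cpart_def[of B] dpart_def[of B] by (simp add: i_cmult_linear algebra_simps)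
qed

lemma dpart_compose:
  assumes "linear B" "linear A"
  shows "dpart (\<lambda>v. B (A v)) v = cpart B (dpart A v) + dpart B (cpart A v)"
proof -
  have "cpart (\<lambda>v. B (A v)) v + dpart (\<lambda>v. B (A v)) v = B (cpart A v) + B (dpart A v)"
    using linear_add[OF assms(1)] by (simp add: cpart_dpart flip: linear_add[OF assms(1)])
  then show ?thesis
    unfolding cpart_compose[OF assms] by (simp add: cpart_dpart[of B, symmetric])
qed

lemma sympl_linear: "sympl A \<Longrightarrow> linear A"
  by (simp add: sympl_def)

text \<open>The two parts are half the difference and half the sum of a = A v and b = i A (i v).
  Their squared norms therefore differ by the inner product of a and b up to sign, and that product
  is -|v|^2 because \<open>A\<close> preserves the form.\<close>

lemma sympl_norm:
  assumes "sympl A"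
  shows "(norm (cpart A v))\<^sup>2 = (norm v)\<^sup>2 + (norm (dpart A v))\<^sup>2"
proof -
  define a b where "a = A v" and "b = \<i> *s A (\<i> *s v)"
  have "a \<bullet> b = - std_form (A v) (A (\<i> *s v))"
    unfolding a_def b_def std_form_inner by (simp add: inner_i_skew)
  also have "\<dots> = - (v \<bullet> v)"
    using assms by (simp add: sympl_def std_form_i)
  finally have ab: "a \<bullet> b = - (v \<bullet> v)" .
  have *: "cpart A v = (1/2) *\<^sub>R (a - b)" "dpart A v = (1/2) *\<^sub>R (a + b)"
    by (simp_all add: cpart_def dpart_def a_def b_def)
  show ?thesis
    unfolding power2_norm_eq_inner *
    by (simp add: inner_diff inner_add inner_commute[of b a] ab field_simps)
qed

lemma sympl_cpart_inj: "sympl A \<Longrightarrow> cpart A v = 0 \<Longrightarrow> v = 0"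
  using sympl_norm[of A v] by (simp add: add_nonneg_eq_0_iff)

lemma sympl_cdet_nonzero: "sympl A \<Longrightarrow> cdet (cpart A) \<noteq> 0"
  by (rule cdet_nonzero[OF clinear_cpart sympl_cpart_inj]) (auto simp: sympl_def)

lemma sympl_dpart_less: "sympl A \<Longrightarrow> v \<noteq> 0 \<Longrightarrow> norm (dpart A v) < norm (cpart A v)"
  using sympl_norm[of A v] by (smt (verit) norm_ge_zero power_mono zero_less_norm_iff zero_less_power)

lemma sympl_inj: assumes "sympl A" shows "inj A"
  unfolding linear_injective_0[OF sympl_linear[OF assms]]
proof (intro allI impI)
  fix v assume "A v = 0"
  then have "v \<bullet> v = std_form 0 (A (\<i> *s v))" using assms by (metis std_form_i sympl_def)
  then show "v = 0" by (simp add: std_form_inner i_cmult_linear)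
qed

lemma sympl_surj: "sympl A \<Longrightarrow> surj A"
  using linear_injective_imp_surjective sympl_inj sympl_linear by blast

lemma sympl_inv: assumes "sympl A" shows "sympl (inv_into UNIV A)"
proof -
  have *: "A (inv_into UNIV A v) = v" for v using sympl_surj[OF assms] by (simp add: surj_f_inv_f)
  have "linear (inv_into UNIV A)"
  proof (rule linearI)
    show "inv_into UNIV A (v + w) = inv_into UNIV A v + inv_into UNIV A w" for v w
      by (rule injD[OF sympl_inj[OF assms]]) (simp add: * linear_add[OF sympl_linear[OF assms]])
    show "inv_into UNIV A (r *\<^sub>R v) = r *\<^sub>R inv_into UNIV A v" for r v
      by (rule injD[OF sympl_inj[OF assms]]) (simp add: * linear_scale[OF sympl_linear[OF assms]])
  qed
  moreover have "std_form (inv_into UNIV A v) (inv_into UNIV A w) = std_form v w" for v w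
    using assms unfolding sympl_def by (metis *)
  ultimately show ?thesis by (simp add: sympl_def)
qed

lemma sympl_compose: "sympl A \<Longrightarrow> sympl B \<Longrightarrow> sympl (\<lambda>v. B (A v))"
  unfolding sympl_def using linear_compose[of A B] by (auto simp: o_def)

lemma sympl_id: "sympl (\<lambda>v. v)"
  by (simp add: sympl_def linear_iff)

lemma cpart_id [simp]: "cpart (\<lambda>v. v) = (\<lambda>v. v)" "dpart (\<lambda>v. v) = (\<lambda>v. 0)"
  by (auto simp: cpart_def dpart_def fun_eq_iff simp flip: scaleR_add_left)

text \<open>While \<open>sympl_dpart_less\<close> makes D_B C_B^-1 contracting, this is the same for
  C_B^-1 D_B, the order needed for the outer factor of a composite. The inverse of \<open>B\<close>
  turns one into the other: it has a vector \<open>w\<close> whose complex linear part is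
  \<open>y\<close> and whose antilinear part is \<open>- x\<close>, and
  \<open>sympl_dpart_less\<close> applies to \<open>w\<close>.\<close>

lemma cpart_eq_dpart_less:
  assumes "sympl B" and eq: "cpart B x = dpart B y" and "y \<noteq> 0"
  shows "norm x < norm y"
proof -
  define B' where "B' = inv_into UNIV B"
  have B': "sympl B'" unfolding B'_def by (rule sympl_inv[OF assms(1)])
  have l: "linear B" "linear B'" using assms(1) B' by (simp_all add: sympl_def)
  have id: "(\<lambda>v. B' (B v)) = (\<lambda>v. v)"
    by (simp add: B'_def inv_f_f sympl_inj[OF assms(1)])
  have c1: "cpart B' (cpart B v) + dpart B' (dpart B v) = v" for v
    using cpart_compose[OF l(2,1), of v] by (simp add: id)
  have d1: "cpart B' (dpart B v) + dpart B' (cpart B v) = 0" for v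
    using dpart_compose[OF l(2,1), of v] by (simp add: id)
  define w where "w = cpart B y - dpart B x"
  have lc: "linear (cpart B')" "linear (dpart B')"
    using clinear_cpart[OF l(2)] dpart_linear[OF l(2)] by (auto simp: clinear_def)
  have "cpart B' w = cpart B' (cpart B y) + dpart B' (cpart B x)"
    using d1[of x] by (simp add: w_def linear_diff[OF lc(1)] algebra_simps eq_neg_iff_add_eq_0)
  then have y: "cpart B' w = y" using c1[of y] by (simp add: eq)
  have "dpart B' w = - (cpart B' (dpart B y) + dpart B' (dpart B x))"
    using d1[of y] by (simp add: w_def linear_diff[OF lc(2)] algebra_simps eq_neg_iff_add_eq_0)
  then have x: "dpart B' w = - x" using c1[of x] eq by metis
  have "w \<noteq> 0" using y assms(3) linear_0[OF lc(1)] by auto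
  then show ?thesis using sympl_dpart_less[OF B', of w] by (simp add: x y)
qed

lemma clinear_mix:
  assumes "linear A" "linear B"
  shows "clinear (\<lambda>v. cpart B (cpart A v) + r *\<^sub>R dpart B (dpart A v))"
proof -
  have c: "clinear (cpart A)" "clinear (cpart B)" and d: "linear (dpart A)" "linear (dpart B)"
    using assms clinear_cpart dpart_linear by auto
  then have l: "linear (cpart A)" "linear (cpart B)" by (auto simp: clinear_def)
  show ?thesis
    using c d by (intro clinearI)
      (auto simp: linear_add[OF l(1)] linear_add[OF l(2)] linear_add[OF d(1)] linear_add[OF d(2)]
        linear_scale[OF l(1)] linear_scale[OF l(2)] linear_scale[OF d(1)] linear_scale[OF d(2)]
        linear_neg[OF d(2)] dpart_i[OF assms(1)] dpart_i[OF assms(2)]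
        clinear_def i_cmult_linear algebra_simps)
qed

text \<open>On a kernel vector \<open>v\<close> the complex linear part of \<open>B\<close> at C_A v
  equals its antilinear part at - r D_A v. The outer factor then gives |C_A v| \<le> |D_A v|, which
  the inner factor excludes unless \<open>v = 0\<close>.\<close>

lemma cdet_mix_nonzero:
  assumes A: "sympl A" and B: "sympl B" and r: "0 \<le> r" "r \<le> 1"
  shows "cdet (\<lambda>v. cpart B (cpart A v) + r *\<^sub>R dpart B (dpart A v)) \<noteq> 0"
proof (rule cdet_nonzero[OF clinear_mix])
  show "linear A" "linear B" using A B by (auto simp: sympl_def)
  fix v assume "cpart B (cpart A v) + r *\<^sub>R dpart B (dpart A v) = 0"
  then have eq: "cpart B (cpart A v) = dpart B (- r *\<^sub>R dpart A v)"
    using dpart_linear[OF sympl_linear[OF B]]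
    by (simp add: linear_scale linear_neg eq_neg_iff_add_eq_0)
  show "v = 0"
  proof (rule ccontr)
    assume v: "v \<noteq> 0"
    have "norm (cpart A v) \<le> norm (- r *\<^sub>R dpart A v)"
    proof (cases "- r *\<^sub>R dpart A v = 0")
      case True
      then have "cpart A v = 0"
        using eq sympl_cpart_inj[OF B] linear_0[OF dpart_linear[OF sympl_linear[OF B]]] by metis
      then show ?thesis by simp
    qed (use cpart_eq_dpart_less[OF B eq] in simp)
    also have "\<dots> \<le> norm (dpart A v)"
      using r by (simp add: mult_left_le_one_le)
    finally show False using sympl_dpart_less[OF A v] by simp
  qed
qed

section \<open>Variation of the argument\<close>

definition eip :: "real \<Rightarrow> complex" where
  "eip a = exp (2 * of_real pi * \<i> * of_real a)"

lemma eip_cis: "eip a = cis (2 * pi * a)"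
  by (simp add: eip_def cis_conv_exp mult_ac)

lemma eip_simps [simp]: "eip 0 = 1" "norm (eip a) = 1" "eip a \<noteq> 0"
  by (simp_all add: eip_def norm_exp_eq_Re)

lemma eip_add: "eip (a + b) = eip a * eip b"
  by (simp add: eip_cis cis_mult algebra_simps)

lemma eip_diff: "eip (a - b) = eip a / eip b"
  by (simp add: eip_cis cis_divide algebra_simps)

lemma eip_eq_1: "eip a = 1 \<longleftrightarrow> a \<in> \<int>"
proof -
  have "eip a = 1 \<longleftrightarrow> (\<exists>n::int. 2 * pi * a = of_int (2 * n) * pi)"
    unfolding eip_def exp_eq_1 by (auto simp: mult_ac)
  also have "\<dots> \<longleftrightarrow> (\<exists>n::int. a = of_int n)" by (auto simp: field_simps)
  finally show ?thesis by (auto simp: Ints_def)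
qed

lemma sgn_exp: "sgn (exp z) = eip (Im z / (2 * pi))"
  unfolding sgn_eq exp_eq_polar[of z] by (simp add: eip_cis norm_mult)

text \<open>The difference of two lifts is continuous with integer values, hence constant on a
  connected set. All identifications of lifts below go through this.\<close>

lemma eip_lifts_diff:
  fixes a b :: "'a::topological_space \<Rightarrow> real"
  assumes "connected S" "continuous_on S a" "continuous_on S b"
    and eq: "\<And>x. x \<in> S \<Longrightarrow> eip (a x) = eip (b x)" and "x \<in> S" "y \<in> S"
  shows "a x - b x = a y - b y"
proof -
  have int: "a x - b x \<in> \<int>" if "x \<in> S" for x
    using eq[OF that] by (simp add: eip_diff flip: eip_eq_1)
  have "(\<lambda>x. a x - b x) constant_on S"
  proof (rule continuous_discrete_range_constant[OF assms(1)])
    show "continuous_on S (\<lambda>x. a x - b x)" using assms by (intro continuous_intros)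
    show "\<exists>e>0. \<forall>y. y \<in> S \<and> a y - b y \<noteq> a x - b x \<longrightarrow> e \<le> norm (a y - b y - (a x - b x))"
      if "x \<in> S" for x
    proof (intro exI[of _ 1] conjI allI impI)
      fix y assume "y \<in> S \<and> a y - b y \<noteq> a x - b x"
      then have "a y - b y - (a x - b x) \<in> \<int>" "a y - b y - (a x - b x) \<noteq> 0"
        using int that by (auto intro: Ints_diff)
      then show "1 \<le> norm (a y - b y - (a x - b x))"
        unfolding real_norm_def by (rule Ints_nonzero_abs_ge1)
    qed simp
  qed
  then show ?thesis using assms(5,6) by (auto simp: constant_on_def)
qed

text \<open>Induction on the degree, splitting off a root \<open>z\<close>. As t runs through the
  unit interval the argument of t - z changes by at most half a turn, and the quotient polynomial
  accounts for the rest.\<close>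

lemma poly_argument_variation:
  fixes p :: "complex poly"
  assumes "\<And>t. t \<in> {0..1} \<Longrightarrow> sgn (poly p (of_real t)) = eip (a t)"
    and "continuous_on {0..1::real} a"
  shows "\<bar>a 1 - a 0\<bar> \<le> degree p / 2"
  using assms
proof (induction "degree p" arbitrary: p a)
  case 0
  then obtain c where p: "p = [:c:]" by (metis degree_eq_zeroE)
  have "a 1 - 0 = a 0 - 0 - (0::real) + 0"
    using eip_lifts_diff[of "{0..1::real}" a "\<lambda>_. a 0" 1 0] 0(2)[of 0] 0(2) 0(3) p by simp
  then show ?case by simp
next
  case (Suc n)
  obtain z where z: "poly p z = 0"
    using fundamental_theorem_of_algebra[of p] Suc(2) by (metis constant_degree nat.distinct(1))
  then obtain q where p: "p = [:-z, 1:] * q" by (metis poly_eq_0_iff_dvd dvdE)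
  have "q \<noteq> 0" using Suc(2) p by auto
  then have dq: "n = degree q" using Suc(2) p by (simp add: degree_mult_eq del: mult_pCons_left)
  have nz: "complex_of_real t - z \<noteq> 0" if "t \<in> {0..1}" for t
    using Suc(3)[OF that] z by (metis eip_simps(3) eq_iff_diff_eq_0 sgn_zero)
  have z0: "z \<noteq> 0" using nz[of 0] by simp
  \<comment> \<open>The argument of t - z relative to its starting value - z. The quotient 1 - t / z
    starts at 1 and meets the nonpositive reals only if \<open>z\<close> lies in the unit interval,
    so the principal branch is continuous along it.\<close>
  define l where "l t = Im (Ln (1 - complex_of_real t / z)) / (2 * pi)" for t
  have np: "1 - complex_of_real t / z \<notin> \<real>\<^sub>\<le>\<^sub>0" if t: "t \<in> {0..1}" for t
  proof
    assume "1 - complex_of_real t / z \<in> \<real>\<^sub>\<le>\<^sub>0"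
    then obtain s where s: "s \<le> 0" "1 - complex_of_real t / z = of_real s"
      by (auto elim!: nonpos_Reals_cases)
    then have "complex_of_real t = of_real (1 - s) * z" using z0 by (simp add: field_simps)
    then have "z = of_real (t / (1 - s))" using s(1) by (simp add: field_simps)
    moreover have "t / (1 - s) \<in> {0..1}" using t s(1) by (auto simp: field_simps)
    ultimately show False using nz by fastforce
  qed
  have cl: "continuous_on {0..1} l"
    unfolding l_def by (intro continuous_intros) (use np z0 in auto)
  have sl: "sgn (complex_of_real t - z) = eip (l t) * sgn (- z)" if t: "t \<in> {0..1}" for t
  proof -
    have "1 - complex_of_real t / z \<noteq> 0" using np[OF t] by auto
    then have "sgn (1 - complex_of_real t / z) = eip (l t)"
      unfolding l_def by (metis sgn_exp exp_Ln)
    moreover have "complex_of_real t - z = (1 - complex_of_real t / z) * (- z)"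
      using z0 by (simp add: field_simps)
    ultimately show ?thesis by (metis sgn_mult)
  qed
  obtain c where c: "sgn (- z) = eip c"
    by (metis sgn_exp exp_Ln neg_equal_0_iff_equal z0)
  have "\<bar>(a 1 - l 1 - c) - (a 0 - l 0 - c)\<bar> \<le> degree q / 2"
  proof (rule Suc(1)[OF dq])
    fix t :: real assume t: "t \<in> {0..1}"
    have "eip (a t) = sgn ((complex_of_real t - z) * poly q (of_real t))"
      using Suc(3)[OF t] by (simp add: p algebra_simps)
    then have "eip (a t) = (eip (l t) * eip c) * sgn (poly q (of_real t))"
      by (simp only: sgn_mult sl[OF t] c)
    then show "sgn (poly q (of_real t)) = eip (a t - l t - c)"
      by (simp add: eip_diff)
  qed (intro continuous_intros cl Suc(4))
  moreover have "\<bar>l 1 - l 0\<bar> \<le> 1 / 2"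
  proof -
    have "1 - 1 / z \<noteq> 0" using np[of 1] by auto
    then show ?thesis
      using mpi_less_Im_Ln[of "1 - 1/z"] Im_Ln_le_pi[of "1 - 1/z"]
      by (simp add: l_def abs_le_iff divide_simps)
  qed
  moreover have "real (degree p) = real (degree q) + 1" using dq Suc(2) by linarith
  ultimately show ?case by linarith
qed

text \<open>Every term of the Leibniz expansion is a product of as many affine factors as the matrix
  has rows.\<close>

lemma det_affine_poly:
  fixes P Q :: "complex ^ 'n ^ 'n"
  shows "\<exists>p. degree p \<le> CARD('n) \<and> (\<forall>z. poly p z = det (\<chi> i j. P $ i $ j + z * Q $ i $ j))"
proof (intro exI conjI allI)
  define p where "p = (\<Sum>\<sigma> | \<sigma> permutes (UNIV :: 'n set). [:of_int (sign \<sigma>):] *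
                   (\<Prod>i\<in>UNIV. [:P $ i $ \<sigma> i, Q $ i $ \<sigma> i:]))"
  show "poly p z = det (\<chi> i j. P $ i $ j + z * Q $ i $ j)" for z
    by (simp add: p_def det_def poly_sum poly_prod algebra_simps)
  show "degree p \<le> CARD('n)"
    unfolding p_def
  proof (rule degree_sum_le)
    fix \<sigma>
    have "degree (\<Prod>i\<in>UNIV. [:P $ i $ \<sigma> i, Q $ i $ \<sigma> i:]) \<le>
        sum (degree \<circ> (\<lambda>i. [:P $ i $ \<sigma> i, Q $ i $ \<sigma> i:])) UNIV"
      by (rule degree_prod_sum_le) simp
    also have "\<dots> \<le> (\<Sum>i\<in>(UNIV::'n set). 1)" by (rule sum_mono) simp
    finally show "degree ([:of_int (sign \<sigma>):] * (\<Prod>i\<in>UNIV. [:P $ i $ \<sigma> i, Q $ i $ \<sigma> i:])) \<le> CARD('n)"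
      by (intro order_trans[OF degree_mult_le]) simp
  qed simp
qed

text \<open>The determinant of \<open>C\<^sub>B C\<^sub>A + r D\<^sub>B D\<^sub>A\<close> interpolates between the product of the
  determinants of the complex linear parts and that of the complex linear part of the product; it is
  a polynomial in \<open>r\<close>, whose argument varies by at most \<open>\<pi>\<close> for each root.\<close>

lemma composition_argument_variation:
  fixes A B :: "real \<Rightarrow> complex ^ 'n \<Rightarrow> complex ^ 'n"
  assumes sympl: "\<And>s. s \<in> {0..1} \<Longrightarrow> sympl (A s)" "\<And>s. s \<in> {0..1} \<Longrightarrow> sympl (B s)"
    and cont: "continuous_on ({0..1} \<times> {0..1})
      (\<lambda>(s, r). cdet (\<lambda>v. cpart (B s) (cpart (A s) v) + r *\<^sub>R dpart (B s) (dpart (A s) v)))"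
    and D0: "\<And>v. dpart (B 0) (dpart (A 0) v) = 0"
    and ca: "continuous_on {0..1} a" and cb: "continuous_on {0..1} b" and cc: "continuous_on {0..1} c"
    and a: "\<And>s. s \<in> {0..1} \<Longrightarrow> eip (a s) = sgn (cdet (cpart (A s)))"
    and b: "\<And>s. s \<in> {0..1} \<Longrightarrow> eip (b s) = sgn (cdet (cpart (B s)))"
    and c: "\<And>s. s \<in> {0..1} \<Longrightarrow> eip (c s) = sgn (cdet (cpart (\<lambda>v. B s (A s v))))"
  shows "\<bar>(c 1 - a 1 - b 1) - (c 0 - a 0 - b 0)\<bar> \<le> CARD('n) / 2"
proof -
  define M where "M s r = (\<lambda>v. cpart (B s) (cpart (A s) v) + r *\<^sub>R dpart (B s) (dpart (A s) v))" for s r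
  have lin: "linear (A s)" "linear (B s)" if "s \<in> {0..1}" for s
    using sympl that by (auto simp: sympl_def)
  have nz: "cdet (M s r) \<noteq> 0" if "s \<in> {0..1}" "r \<in> {0..1}" for s r
    unfolding M_def using sympl that by (intro cdet_mix_nonzero) auto
  \<comment> \<open>A logarithm over the whole square gives one argument \<open>h s r\<close> of the
    interpolating determinant for both parameters at once.\<close>
  have "contractible ({0..1::real} \<times> {0..1::real})"
    by (intro convex_imp_contractible convex_Times convex_real_interval)
  then obtain g where g: "continuous_on ({0..1} \<times> {0..1}) g"
     "\<And>x. x \<in> {0..1} \<times> {0..1} \<Longrightarrow> (\<lambda>(s, r). cdet (M s r)) x = exp (g x)"
    using continuous_logarithm_on_contractible[OF cont[folded M_def]] nz by (metis (no_types, lifting) SigmaE case_prod_conv)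
  define h where "h s r = Im (g (s, r)) / (2 * pi)" for s r
  have h: "eip (h s r) = sgn (cdet (M s r))" if "s \<in> {0..1}" "r \<in> {0..1}" for s r
    using g(2)[of "(s, r)"] that by (simp add: h_def sgn_exp)
  have ch1: "continuous_on {0..1} (\<lambda>s. h s r)" if "r \<in> {0..1}" for r
    unfolding h_def using that
    by (intro continuous_intros continuous_on_compose2[OF g(1)]) auto
  have ch2: "continuous_on {0..1} (\<lambda>r. h s r)" if "s \<in> {0..1}" for s
    unfolding h_def using that
    by (intro continuous_intros continuous_on_compose2[OF g(1)]) auto
  have M1: "M s 1 = cpart (\<lambda>v. B s (A s v))" if "s \<in> {0..1}" for s
    by (simp add: M_def cpart_compose[OF lin(2)[OF that] lin(1)[OF that]] fun_eq_iff)
  have M0: "cdet (M s 0) = cdet (cpart (B s)) * cdet (cpart (A s))" if "s \<in> {0..1}" for s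
    using cdet_compose[OF clinear_cpart[OF lin(1)[OF that]] clinear_cpart[OF lin(2)[OF that]]]
    by (simp add: M_def)
  \<comment> \<open>The four sides of the square: along r = 1 the argument follows \<open>c\<close>,
    along r = 0 it follows a + b, at s = 0 it is constant in r. Only the side s = 1 contributes, and
    there the determinant is a polynomial in r.\<close>
  have 1: "h 1 1 - c 1 = h 0 1 - c 0"
    by (rule eip_lifts_diff[of "{0..1}"]) (use ch1[of 1] cc c h M1 in auto)
  have 2: "h 1 0 - (a 1 + b 1) = h 0 0 - (a 0 + b 0)"
    by (rule eip_lifts_diff[of "{0..1}"])
      (use ch1[of 0] ca cb a b h M0 in \<open>auto simp: sgn_mult eip_add intro!: continuous_intros\<close>)
  have M00: "M 0 r = M 0 0" for r by (simp add: M_def D0 fun_eq_iff)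
  have 3: "h 0 1 - h 0 0 = h 0 0 - h 0 0"
  proof (rule eip_lifts_diff[of "{0..1::real}" "h 0" "\<lambda>_. h 0 0" 1 0])
    show "eip (h 0 r) = eip (h 0 0)" if "r \<in> {0..1}" for r
      using h[of 0 r] h[of 0 0] that by (metis M00 atLeastAtMost_iff order_refl zero_le_one)
  qed (use ch2 in auto)
  have 4: "\<bar>h 1 1 - h 1 0\<bar> \<le> CARD('n) / 2"
  proof -
    define P Q where "P = matrix (\<lambda>v. cpart (B 1) (cpart (A 1) v))"
      and "Q = matrix (\<lambda>v. dpart (B 1) (dpart (A 1) v))"
    obtain p where p: "degree p \<le> CARD('n)" "\<And>z. poly p z = det (\<chi> i j. P $ i $ j + z * Q $ i $ j)"
      using det_affine_poly by blast
    have "cdet (M 1 r) = poly p (of_real r)" for r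
      unfolding p(2) cdet_def M_def P_def Q_def
      by (intro arg_cong[of _ _ det]) (simp add: vec_eq_iff matrix_def complex_eq_iff)
    then have "\<bar>h 1 1 - h 1 0\<bar> \<le> degree p / 2"
      by (intro poly_argument_variation ch2) (auto simp: h)
    then show ?thesis using p(1) by linarith
  qed
  show ?thesis using 1 2 3 4 by linarith
qed

section \<open>Joint lifts of families of paths\<close>

lemma continuous_on_sections:
  assumes "continuous_on UNIV (\<lambda>(t, x). f t x)"
  shows "continuous_on S (f t)" "continuous_on S' (\<lambda>t. f t x)"
proof -
  have 1: "continuous_on S (\<lambda>x. (t, x))" and 2: "continuous_on S' (\<lambda>t. (t, x))"
    by (intro continuous_intros)+
  show "continuous_on S (f t)" "continuous_on S' (\<lambda>t. f t x)"
    using continuous_on_compose2[OF assms 1] continuous_on_compose2[OF assms 2] by auto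
qed

lemma path_lift_eip:
  fixes w :: "real \<Rightarrow> complex"
  assumes "continuous_on UNIV w" "\<And>t. w t \<noteq> 0" "sgn (w 0) = 1"
  shows "\<exists>l. continuous_on UNIV l \<and> l 0 = 0 \<and> (\<forall>t. eip (l t) = sgn (w t))"
proof -
  obtain g where g: "continuous_on UNIV g" "\<And>t. w t = exp (g t)"
    using continuous_logarithm_on_contractible[of UNIV w] assms
    by (metis UNIV_I contractible_UNIV)
  define l where "l t = Im (g t) / (2 * pi) - Im (g 0) / (2 * pi)" for t
  have "eip (l t) = sgn (w t)" for t
    using assms(3) by (simp add: l_def eip_diff g(2) sgn_exp)
  moreover have "continuous_on UNIV l"
    unfolding l_def by (intro continuous_intros g) simp
  ultimately show ?thesis by (intro exI[of _ l]) (simp add: l_def)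
qed

text \<open>Time is cut into \<open>m\<close> steps so short that consecutive values stay at
  distance below 1, simultaneously for all points near \<open>x0\<close>. The quotients of
  consecutive values then avoid the negative axis, and the sum of their principal arguments is a
  continuous lift. No connectedness of the space of \<open>x\<close> enters.\<close>

lemma local_joint_lift:
  fixes v :: "real \<Rightarrow> 'x::topological_space \<Rightarrow> complex"
  assumes cont: "continuous_on UNIV (\<lambda>(t, x). v t x)"
    and nv: "\<And>t x. norm (v t x) = 1" and v0: "\<And>x. v 0 x = 1" and n: "0 < n"
  shows "\<exists>N l. open N \<and> x0 \<in> N \<and> continuous_on ({-n..n} \<times> N) (\<lambda>(t, x). l t x) \<and>
     (\<forall>t\<in>{-n..n}. \<forall>x\<in>N. eip (l t x) = v t x) \<and> (\<forall>x\<in>N. l 0 x = 0)"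
proof -
  have cv: "continuous_on S (\<lambda>z. v (f z) (g z))"
    if "continuous_on S f" "continuous_on S g" for f g and S :: "'z::topological_space set"
    using continuous_on_compose2[OF cont, of S "\<lambda>z. (f z, g z)"] that
    by (auto intro!: continuous_intros)
  have "uniformly_continuous_on {-n..n} (\<lambda>t. v t x0)"
    by (intro compact_uniformly_continuous cv continuous_intros) auto
  then obtain d where d: "d > 0" "\<And>t t'. t \<in> {-n..n} \<Longrightarrow> t' \<in> {-n..n} \<Longrightarrow> dist t' t < d \<Longrightarrow>
      dist (v t' x0) (v t x0) < 1"
    unfolding uniformly_continuous_on_def by (metis zero_less_one)
  \<comment> \<open>Pairs of nearby times. The bound d / 2 with a weak inequality keeps the set
    closed, hence compact for the tube lemma, while the strict bound \<open>d\<close> still applies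
    on it.\<close>
  define K where "K = ({-n..n} \<times> {-n..n}) \<inter> {p. dist (fst p) (snd p) \<le> d / 2}"
  have "compact K"
    unfolding K_def by (intro compact_Int_closed compact_Times closed_Collect_le continuous_intros) auto
  define W where "W = {q :: 'x \<times> (real \<times> real).
      dist (v (fst (snd q)) (fst q)) (v (snd (snd q)) (fst q)) < 1}"
  have "open W"
    unfolding W_def by (intro open_Collect_less continuous_on_dist cv continuous_intros)
  have "{x0} \<times> K \<subseteq> W"
    using d by (auto simp: K_def W_def dist_commute)
  obtain N where N: "x0 \<in> N" "open N" "N \<times> K \<subseteq> W"
    using Elementary_Topology.tube_lemma[OF \<open>compact K\<close> \<open>open W\<close> \<open>{x0} \<times> K \<subseteq> W\<close>] by metis
  obtain m :: nat where m: "n / m \<le> d / 2" "m > 0"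
  proof -
    obtain m :: nat where m: "n / (d / 2) < m" using reals_Archimedean2 by blast
    have "0 < n / (d / 2)" using d(1) n by simp
    then have pos: "0 < real m" using m by linarith
    have "n < real m * (d / 2)" using m d(1) by (simp add: pos_divide_less_eq)
    then have "n / m \<le> d / 2" using pos by (simp add: pos_divide_le_eq mult.commute)
    moreover have "m > 0" using pos by simp
    ultimately show ?thesis by (rule that)
  qed
  define q where "q j t x = v (real (Suc j) * t / m) x / v (real j * t / m) x" for j t x
  define l where "l t x = (\<Sum>j<m. Im (Ln (q j t x)) / (2 * pi))" for t x
  have vnz: "v t x \<noteq> 0" for t x using nv[of t x] by auto
  have cq: "continuous_on UNIV (\<lambda>(t, x). q j t x)" for j
    unfolding q_def split_def using m(2) by (intro continuous_intros cv) (auto simp: vnz)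
  have q: "q j t x \<notin> \<real>\<^sub>\<le>\<^sub>0" if "t \<in> {-n..n}" "x \<in> N" "j < m" for j t x
  proof
    have *: "real k * t / m \<in> {-n..n}" if "k \<le> m" for k
    proof -
      have "\<bar>real k * t\<bar> \<le> m * n" 
        unfolding abs_mult using \<open>t \<in> _\<close> \<open>k \<le> m\<close> by (intro mult_mono) auto
      then show ?thesis using m(2) by (auto simp: abs_le_iff field_simps)
    qed
    have "\<bar>t\<bar> / m \<le> n / m" using that m by (intro divide_right_mono) auto
    then have "\<bar>t\<bar> / m \<le> d / 2" using m(1) by linarith
    then have "dist (real (Suc j) * t / m) (real j * t / m) \<le> d / 2"
      by (simp add: dist_real_def diff_divide_distrib[symmetric] left_diff_distrib[symmetric])
    then have "(x, (real (Suc j) * t / m, real j * t / m)) \<in> W"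
      using N(3) that *[of "Suc j"] *[of j] by (auto simp: K_def)
    then have d1: "dist (v (real (Suc j) * t / m) x) (v (real j * t / m) x) < 1"
      by (simp add: W_def)
    assume "q j t x \<in> \<real>\<^sub>\<le>\<^sub>0"
    then obtain s where s: "s \<le> 0" "q j t x = of_real s" by (auto elim!: nonpos_Reals_cases)
    \<comment> \<open>A quotient s \<le> 0 would put the two unit complex numbers at distance 1 - s,
      which is at least 1.\<close>
    then have "v (real (Suc j) * t / m) x - v (real j * t / m) x = of_real (s - 1) * v (real j * t / m) x"
      unfolding q_def using vnz by (simp add: field_simps)
    then have "dist (v (real (Suc j) * t / m) x) (v (real j * t / m) x) = \<bar>s - 1\<bar>"
      by (simp only: dist_norm norm_mult nv norm_of_real mult_1_right)
    then show False using d1 s(1) by auto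
  qed
  show ?thesis
  proof (intro exI[of _ N] exI[of _ l] conjI ballI N(1,2))
    show "continuous_on ({-n..n} \<times> N) (\<lambda>(t, x). l t x)"
      unfolding l_def split_def
      by (intro continuous_intros continuous_on_subset[OF cq[unfolded split_def]]) (use q in auto)
    show "l 0 x = 0" if "x \<in> N" for x
      by (simp add: l_def q_def vnz)
    fix t x assume t: "t \<in> {-n..n}" and x: "x \<in> N"
    have e: "eip (Im (Ln (q j t x)) / (2 * pi)) = q j t x" for j
    proof -
      have "q j t x \<noteq> 0" "norm (q j t x) = 1" by (simp_all add: q_def vnz norm_divide nv)
      then show ?thesis by (simp add: sgn_exp[symmetric] sgn_eq)
    qed
    have "eip (\<Sum>j<k. Im (Ln (q j t x)) / (2 * pi)) = (\<Prod>j<k. q j t x)" for k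
      by (induction k) (auto simp: eip_add e)
    then have "eip (l t x) = (\<Prod>j<m. v (real (Suc j) * t / m) x / v (real j * t / m) x)"
      by (simp add: l_def q_def)
    also have "\<dots> = v (real m * t / m) x / v (real 0 * t / m) x"
      by (rule prod_lessThan_telescope[where f = "\<lambda>j. v (real j * t / m) x"]) (rule vnz)
    finally show "eip (l t x) = v t x" using m v0 by simp
  qed
qed

text \<open>The lift is chosen along each time line separately. Vanishing at time 0 makes it unique
  there, so it coincides with the continuous local lifts and inherits their continuity in both
  variables.\<close>

lemma joint_lift:
  fixes w :: "real \<Rightarrow> 'x::t2_space \<Rightarrow> complex"
  assumes cont: "continuous_on UNIV (\<lambda>(t, x). w t x)"
    and nz: "\<And>t x. w t x \<noteq> 0" and w0: "\<And>x. sgn (w 0 x) = 1"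
  shows "\<exists>L. continuous_on UNIV (\<lambda>(t, x). L t x) \<and> (\<forall>x. L 0 x = 0) \<and>
      (\<forall>t x. eip (L t x) = sgn (w t x))"
proof -
  have "\<forall>x. \<exists>l. continuous_on UNIV l \<and> l 0 = 0 \<and> (\<forall>t. eip (l t) = sgn (w t x))"
    using path_lift_eip[OF continuous_on_sections(2)[OF cont] nz w0] by blast
  then obtain L' where L': "\<And>x. continuous_on UNIV (L' x)" "\<And>x. L' x 0 = 0"
    "\<And>x t. eip (L' x t) = sgn (w t x)" by metis
  define L where "L t x = L' x t" for t x
  have cs: "continuous_on UNIV (\<lambda>(t, x). sgn (w t x))"
    using continuous_on_sgn[OF cont] nz by (auto simp: split_def)
  have "continuous (at (t0, x0)) (\<lambda>(t, x). L t x)" for t0 x0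
  proof -
    define n where "n = \<bar>t0\<bar> + 1"
    have n: "0 < n" by (simp add: n_def)
    obtain N l where N: "open N" "x0 \<in> N" "continuous_on ({-n..n} \<times> N) (\<lambda>(t, x). l t x)"
       "\<And>t x. t \<in> {-n..n} \<Longrightarrow> x \<in> N \<Longrightarrow> eip (l t x) = sgn (w t x)" "\<And>x. x \<in> N \<Longrightarrow> l 0 x = 0"
      using local_joint_lift[OF cs _ w0 n, of x0] nz by (auto simp: norm_sgn)
    have eq: "L t x = l t x" if "t \<in> {-n..n}" "x \<in> N" for t x
    proof -
      have "continuous_on {-n..n} (\<lambda>t. l t x)"
        using continuous_on_compose2[OF N(3), of "{-n..n}" "\<lambda>t. (t, x)"] that
        by (simp add: continuous_on_Pair image_subset_iff)
      then have "l t x - L t x = l 0 x - L 0 x"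
        using n that N(4) L' by (intro eip_lifts_diff[of "{-n..n}"])
          (auto simp: L_def intro: continuous_on_subset[OF L'(1)])
      then show ?thesis using N(5) that by (simp add: L_def L')
    qed
    have "continuous_on ({-n<..<n} \<times> N) (\<lambda>(t, x). L t x)"
      by (rule continuous_on_eq[OF continuous_on_subset[OF N(3)]]) (auto simp: eq)
    moreover have "open ({-n<..<n} \<times> N)" "(t0, x0) \<in> {-n<..<n} \<times> N"
      using N(1,2) by (auto simp: open_Times n_def)
    ultimately show ?thesis using continuous_on_eq_continuous_at by blast
  qed
  then have "continuous_on UNIV (\<lambda>(t, x). L t x)"
    by (auto intro: continuous_at_imp_continuous_on)
  then show ?thesis
    by (intro exI[of _ L]) (auto simp: L_def L')
qed

section \<open>A mean ergodic theorem for quasi-cocycles\<close>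

lemma integrable_continuous_compact:
  fixes h :: "'y::topological_space \<Rightarrow> real"
  assumes "compact (UNIV :: 'y set)" "continuous_on UNIV h" "sets \<mu> = sets borel" "finite_measure \<mu>"
  shows "integrable \<mu> h"
proof -
  interpret finite_measure \<mu> by fact
  have "bounded (h ` UNIV)"
    by (intro compact_imp_bounded compact_continuous_image assms)
  then obtain B where "\<And>x. norm (h x) \<le> B" by (auto simp: bounded_iff)
  moreover have "h \<in> borel_measurable \<mu>"
    using borel_measurable_continuous_onI[OF assms(2)] measurable_cong_sets[OF assms(3) refl] by blast
  ultimately show ?thesis by (intro integrable_const_bound[of _ B]) auto
qed

text \<open>Both sides compare the two ways of splitting the sum of the first m + n terms. It trades
  a long sum of shifts by \<open>m\<close> for a short sum of shifts by \<open>n\<close>.\<close>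

lemma sum_shift_diff:
  fixes g :: "nat \<Rightarrow> real"
  shows "(\<Sum>j<n. g (m + j) - g j) = (\<Sum>i<m. g (n + i) - g i)"
proof -
  have "(\<Sum>j<m + n. g j) = (\<Sum>j<m. g j) + (\<Sum>j<n. g (m + j))" for m n
    by (induction n) auto
  from this[of m n] this[of n m] show ?thesis
    by (simp add: sum_subtractf add.commute)
qed

text \<open>This is all that the ergodic argument knows about the rotation function, which enters
  with \<open>C\<close> equal to half the complex rank.\<close>

locale quasi_cocycle =
  fixes \<phi> :: "real \<Rightarrow> 'y::topological_space \<Rightarrow> 'y" and \<mu> :: "'y measure"
    and F :: "real \<Rightarrow> 'y \<Rightarrow> real" and C :: real
  assumes compact: "compact (UNIV :: 'y set)"
    and flow: "continuous_flow \<phi>" and inv: "invariant_measure \<phi> \<mu>"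
    and contF: "continuous_on UNIV (\<lambda>(t, x). F t x)"
    and quasi: "\<And>s t x. \<bar>F (s + t) x - F s x - F t (\<phi> s x)\<bar> \<le> C"
begin

lemma sets_mu: "sets \<mu> = sets borel" and fin: "finite_measure \<mu>"
  using inv by (auto simp: invariant_measure_def)

lemma C_nonneg: "0 \<le> C"
  using quasi[of 0 0 undefined] by (rule order_trans[OF abs_ge_zero])

lemma cont_phi: "continuous_on UNIV (\<phi> t)"
proof -
  have "continuous_on UNIV (\<lambda>(t, x). \<phi> t x)" using flow by (simp add: continuous_flow_def)
  then show ?thesis by (rule continuous_on_sections)
qed

lemma cont_F: "continuous_on UNIV (F t)"
  by (rule continuous_on_sections(1)[OF contF])

lemma integrable_cont: "continuous_on UNIV h \<Longrightarrow> integrable \<mu> (h :: 'y \<Rightarrow> real)"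
  by (rule integrable_continuous_compact[OF compact _ sets_mu fin])

lemma integral_phi:
  assumes "continuous_on UNIV (h :: 'y \<Rightarrow> real)"
  shows "(\<integral>x. h (\<phi> t x) \<partial>\<mu>) = (\<integral>x. h x \<partial>\<mu>)"
proof -
  have m: "\<phi> t \<in> measurable \<mu> borel" "h \<in> borel_measurable borel"
    using borel_measurable_continuous_onI[OF cont_phi[of t]] borel_measurable_continuous_onI[OF assms]
      measurable_cong_sets[OF sets_mu refl] by blast+
  have "(\<integral>x. h (\<phi> t x) \<partial>\<mu>) = (\<integral>x. h x \<partial>(distr \<mu> borel (\<phi> t)))"
    by (rule integral_distr[symmetric, OF m])
  then show ?thesis using inv by (simp add: invariant_measure_def)
qed

lemma F_bounded: "\<exists>B\<ge>0. \<forall>t\<in>{0..m}. \<forall>x. \<bar>F t x\<bar> \<le> B"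
proof -
  have "compact ((\<lambda>(t, x). F t x) ` ({0..m} \<times> UNIV))"
    by (intro compact_continuous_image continuous_on_subset[OF contF] compact_Times compact) auto
  then obtain B where "\<forall>z\<in>(\<lambda>(t, x). F t x) ` ({0..m} \<times> UNIV). norm z \<le> B"
    using compact_imp_bounded bounded_iff by blast
  then have "\<bar>F t x\<bar> \<le> B" if "t \<in> {0..m}" for t x using that by auto
  then have "\<bar>F t x\<bar> \<le> \<bar>B\<bar>" if "t \<in> {0..m}" for t x using that by (metis abs_ge_self order_trans)
  then show ?thesis by (intro exI[of _ "\<bar>B\<bar>"]) auto
qed

text \<open>Division by zero makes \<open>b 0\<close> the zero function, so that continuity and the
  uniform bound hold for every \<open>n\<close>.\<close>

definition b :: "nat \<Rightarrow> 'y \<Rightarrow> real" where "b n x = F (real n) x / real n"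

lemma cont_b [continuous_intros]: "continuous_on S (b n)"
  unfolding b_def by (cases "n = 0") (auto intro!: continuous_intros continuous_on_subset[OF cont_F])

text \<open>Each unit of time adds at most B + C to \<open>F\<close>, where \<open>B\<close> bounds
  \<open>F\<close> on times in the unit interval; growth is therefore linear.\<close>

lemma b_bounded: "\<exists>K\<ge>0. \<forall>n x. \<bar>b n x\<bar> \<le> K"
proof -
  obtain B where B: "B \<ge> 0" "\<And>t x. t \<in> {0..1} \<Longrightarrow> \<bar>F t x\<bar> \<le> B" using F_bounded[of 1] by blast
  have F: "\<bar>F (real n) x\<bar> \<le> (real n + 1) * (B + C)" for n x
  proof (induction n)
    case 0 then show ?case using B(2)[of 0 x] C_nonneg by simp
  next
    case (Suc n)
    have "\<bar>F (real n + 1) x\<bar> \<le> \<bar>F (real n) x\<bar> + \<bar>F 1 (\<phi> (real n) x)\<bar> + C"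
      using quasi[of "real n" 1 x] by linarith
    also have "\<dots> \<le> (real n + 1) * (B + C) + B + C" using Suc B(2)[of 1 "\<phi> (real n) x"] by simp
    finally show ?case by (simp add: algebra_simps)
  qed
  have "\<bar>b n x\<bar> \<le> 2 * (B + C)" for n x
  proof (cases "n = 0")
    case False
    have "\<bar>F (real n) x\<bar> \<le> (2 * real n) * (B + C)"
      using F[of n x] False B(1) C_nonneg
      by (elim order_trans) (intro mult_right_mono, auto)
    then show ?thesis using False by (simp add: b_def field_simps abs_divide)
  qed (use B C_nonneg in \<open>simp add: b_def\<close>)
  then show ?thesis using B(1) C_nonneg by (intro exI[of _ "2 * (B + C)"]) auto
qed

text \<open>By quasi-additivity the orbit sum of F_m is the sum of F_(m+j) - F_j over j < n, up to n
  C. Exchanging \<open>m\<close> and \<open>n\<close> by \<open>sum_shift_diff\<close> turns this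
  into m terms F_(n+i) - F_i, each close to F_n. Dividing by m n leaves C / m, which persists for
  large \<open>n\<close>, and a boundary term that decays.\<close>

lemma average_b:
  assumes "m > 0"
  shows "\<exists>c\<ge>0. \<forall>n>0. \<forall>x. \<bar>(\<Sum>j<n. b m (\<phi> (real j) x)) / real n - b n x\<bar> \<le> C / m + c / n"
proof -
  obtain c where c: "c \<ge> 0" "\<And>t x. t \<in> {0..real m} \<Longrightarrow> \<bar>F t x\<bar> \<le> c" using F_bounded[of m] by blast
  have "\<bar>(\<Sum>j<n. b m (\<phi> (real j) x)) / real n - b n x\<bar> \<le> C / m + (C + 2 * c) / n" if n: "n > 0" for n x
  proof -
    have 1: "\<bar>(\<Sum>j<n. F m (\<phi> (real j) x)) - (\<Sum>j<n. F (real (m + j)) x - F (real j) x)\<bar> \<le> n * C"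
    proof -
      have "\<bar>\<Sum>j<n. F m (\<phi> (real j) x) - (F (real (m + j)) x - F (real j) x)\<bar> \<le> (\<Sum>j<n. C)"
      proof (intro order_trans[OF sum_abs] sum_mono)
        fix j show "\<bar>F m (\<phi> (real j) x) - (F (real (m + j)) x - F (real j) x)\<bar> \<le> C"
          using quasi[of "real j" "real m" x] by (simp add: add.commute)
      qed
      then show ?thesis by (simp add: sum_subtractf)
    qed
    have 2: "\<bar>(\<Sum>i<m. F (real (n + i)) x - F (real i) x) - m * F n x\<bar> \<le> m * (C + 2 * c)"
    proof -
      have "\<bar>\<Sum>i<m. (F (real (n + i)) x - F (real i) x) - F n x\<bar> \<le> (\<Sum>i<m. C + 2 * c)"
      proof (intro order_trans[OF sum_abs] sum_mono)
        fix i assume "i \<in> {..<m}"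
        then have "\<bar>F (real i) x\<bar> \<le> c" "\<bar>F (real i) (\<phi> (real n) x)\<bar> \<le> c" by (auto intro!: c)
        then show "\<bar>F (real (n + i)) x - F (real i) x - F (real n) x\<bar> \<le> C + 2 * c"
          using quasi[of "real n" "real i" x] by simp
      qed
      then show ?thesis by (simp add: sum_subtractf)
    qed
    have "(\<Sum>j<n. b m (\<phi> (real j) x)) / real n - b n x =
        ((\<Sum>j<n. F m (\<phi> (real j) x)) - m * F n x) / (m * n)"
      using n assms by (simp add: b_def sum_divide_distrib[symmetric] field_simps)
    also have "\<bar>\<dots>\<bar> \<le> (n * C + m * (C + 2 * c)) / (m * n)"
      unfolding abs_divide using 1 2 sum_shift_diff[where g = "\<lambda>j. F (real j) x" and m = m and n = n]
      by (simp add: divide_right_mono)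
    also have "\<dots> = C / m + (C + 2 * c) / n" using n assms by (simp add: field_simps)
    finally show ?thesis .
  qed
  then show ?thesis using c(1) C_nonneg by (intro exI[of _ "C + 2 * c"]) auto
qed

text \<open>Orbit averages do not increase the L^2 norm: the square of a mean is at most the mean of
  the squares, and all its terms have the same integral by invariance.\<close>

lemma integral_square_average:
  assumes h: "continuous_on UNIV (h :: 'y \<Rightarrow> real)" and n: "n > 0"
  shows "(\<integral>x. ((\<Sum>j<n. h (\<phi> (real j) x)) / real n)\<^sup>2 \<partial>\<mu>) \<le> (\<integral>x. (h x)\<^sup>2 \<partial>\<mu>)"
proof -
  have hc [continuous_intros]: "continuous_on UNIV (\<lambda>x. h (\<phi> t x))" for t
    using continuous_on_compose2[OF h cont_phi] by blast
  have "(\<integral>x. ((\<Sum>j<n. h (\<phi> (real j) x)) / real n)\<^sup>2 \<partial>\<mu>) \<le>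
      (\<integral>x. (\<Sum>j<n. (h (\<phi> (real j) x))\<^sup>2) / real n \<partial>\<mu>)"
  proof (rule integral_mono)
    fix x
    have "(\<Sum>j<n. h (\<phi> (real j) x))\<^sup>2 \<le> (\<Sum>j<n. (h (\<phi> (real j) x))\<^sup>2) * real n"
      using sum_squared_le_sum_of_squares[of "\<lambda>j. h (\<phi> (real j) x)" "{..<n}"] by simp
    then show "((\<Sum>j<n. h (\<phi> (real j) x)) / real n)\<^sup>2 \<le> (\<Sum>j<n. (h (\<phi> (real j) x))\<^sup>2) / real n"
      using n by (simp add: power_divide power2_eq_square[of "real n"] field_simps)
  qed (intro integrable_cont continuous_intros; use n in simp)+
  also have "\<dots> = (\<Sum>j<n. \<integral>x. (h (\<phi> (real j) x))\<^sup>2 \<partial>\<mu>) / real n"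
    by (simp add: integrable_cont continuous_intros)
  also have "\<dots> = (\<integral>x. (h x)\<^sup>2 \<partial>\<mu>)"
    using n integral_phi[of "\<lambda>x. (h x)\<^sup>2"] h by (simp add: continuous_on_power)
  finally show ?thesis .
qed

text \<open>For large \<open>n\<close> both \<open>b m\<close> and \<open>b m'\<close>, hence also
  their midpoint, have orbit averages close to \<open>b n\<close>. Since averaging does not increase
  the L^2 norm, \<open>b n\<close> is asymptotically no longer than the midpoint.\<close>

lemma square_integral_le_midpoint:
  "\<exists>e\<ge>0. \<forall>m>0. \<forall>m'>0. \<exists>c\<ge>0. \<forall>n>0.
    (\<integral>x. (b n x)\<^sup>2 \<partial>\<mu>) \<le> (\<integral>x. ((b m x + b m' x) / 2)\<^sup>2 \<partial>\<mu>) + (e / m + e / m') / 2 + c / real n"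
proof -
  obtain K where K: "K \<ge> 0" "\<And>n x. \<bar>b n x\<bar> \<le> K" using b_bounded by blast
  define M where "M = measure \<mu> (space \<mu>)"
  interpret finite_measure \<mu> by (rule fin)
  show ?thesis
  \<comment> \<open>Origin of the constant: the difference of the squares of \<open>b n\<close> and
    of the average is at most 2 K times their distance, integrated over the total mass
    \<open>M\<close>; the distance contributes the mean of C / m and C / m'.\<close>
  proof (rule exI[of _ "2 * K * C * M"], intro conjI allI impI)
    show "0 \<le> 2 * K * C * M" using K C_nonneg by (simp add: M_def)
    fix m m' :: nat assume m: "m > 0" "m' > 0"
    obtain c c' where c: "c \<ge> 0" "\<And>n x. n > 0 \<Longrightarrow> \<bar>(\<Sum>j<n. b m (\<phi> (real j) x)) / real n - b n x\<bar> \<le> C / m + c / n"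
      and c': "c' \<ge> 0" "\<And>n x. n > 0 \<Longrightarrow> \<bar>(\<Sum>j<n. b m' (\<phi> (real j) x)) / real n - b n x\<bar> \<le> C / m' + c' / n"
      using average_b[OF m(1)] average_b[OF m(2)] by metis
    define g where "g x = (b m x + b m' x) / 2" for x
    have cg: "continuous_on UNIV g" unfolding g_def by (intro continuous_intros) auto
    have cgp [continuous_intros]: "continuous_on UNIV (\<lambda>x. g (\<phi> t x))" for t
      using continuous_on_compose2[OF cg cont_phi] by blast
    show "\<exists>c\<ge>0. \<forall>n>0. (\<integral>x. (b n x)\<^sup>2 \<partial>\<mu>) \<le> (\<integral>x. ((b m x + b m' x) / 2)\<^sup>2 \<partial>\<mu>) +
        (2 * K * C * M / m + 2 * K * C * M / m') / 2 + c / real n"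
    proof (intro exI[of _ "K * (c + c') * M"] conjI allI impI)
      show "0 \<le> K * (c + c') * M" using K c(1) c'(1) by (simp add: M_def)
      fix n :: nat assume n: "n > 0"
      define a where "a x = (\<Sum>j<n. g (\<phi> (real j) x)) / real n" for x
      define e where "e = (C / m + C / m' + (c + c') / n) / 2"
      have ca [continuous_intros]: "continuous_on UNIV a"
        unfolding a_def using n by (intro continuous_intros) auto
      have "(b n x)\<^sup>2 \<le> (a x)\<^sup>2 + 2 * K * e" for x
      proof -
        have a: "a x = ((\<Sum>j<n. b m (\<phi> (real j) x)) / real n + (\<Sum>j<n. b m' (\<phi> (real j) x)) / real n) / 2"
          by (simp add: a_def g_def sum.distrib add_divide_distrib flip: sum_divide_distrib)
        have e: "\<bar>b n x - a x\<bar> \<le> e"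
          unfolding e_def using c(2)[OF n, of x] c'(2)[OF n, of x] unfolding a
          by (simp add: add_divide_distrib abs_le_iff)
        have "\<bar>a x\<bar> \<le> K"
        proof -
          have "\<bar>\<Sum>j<n. g (\<phi> (real j) x)\<bar> \<le> (\<Sum>j<n. K)"
          proof (intro order_trans[OF sum_abs] sum_mono)
            fix j show "\<bar>g (\<phi> (real j) x)\<bar> \<le> K"
              using K(2)[of m "\<phi> (real j) x"] K(2)[of m' "\<phi> (real j) x"] by (simp add: g_def)
          qed
          then show ?thesis using n by (simp add: a_def field_simps abs_divide)
        qed
        then have "\<bar>b n x + a x\<bar> \<le> 2 * K" using K(2)[of n x] by linarith
        then have "\<bar>b n x - a x\<bar> * \<bar>b n x + a x\<bar> \<le> e * (2 * K)"
          using e by (intro mult_mono) auto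
        then have "(b n x - a x) * (b n x + a x) \<le> e * (2 * K)"
          by (metis abs_ge_self abs_mult order_trans)
        then show ?thesis by (simp add: power2_eq_square algebra_simps)
      qed
      then have "(\<integral>x. (b n x)\<^sup>2 \<partial>\<mu>) \<le> (\<integral>x. (a x)\<^sup>2 + 2 * K * e \<partial>\<mu>)"
        by (intro integral_mono integrable_cont continuous_intros) auto
      also have "\<dots> = (\<integral>x. (a x)\<^sup>2 \<partial>\<mu>) + 2 * K * e * M"
        by (subst Bochner_Integration.integral_add) (auto simp: M_def intro!: integrable_cont continuous_intros)
      also have "(\<integral>x. (a x)\<^sup>2 \<partial>\<mu>) \<le> (\<integral>x. (g x)\<^sup>2 \<partial>\<mu>)"
        unfolding a_def by (rule integral_square_average[OF cg n])
      finally show "(\<integral>x. (b n x)\<^sup>2 \<partial>\<mu>) \<le> (\<integral>x. ((b m x + b m' x) / 2)\<^sup>2 \<partial>\<mu>) +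
        (2 * K * C * M / m + 2 * K * C * M / m') / 2 + K * (c + c') * M / n"
        unfolding g_def e_def by (simp add: field_simps)
    qed
  qed
qed

text \<open>The usual argument for minimizing sequences in a Hilbert space: the squared norms of
  \<open>b m\<close> and \<open>b m'\<close> nearly attain a limiting value \<open>l\<close>, the
  midpoint cannot fall much below it, and the parallelogram law forces the two functions
  together.\<close>

lemma b_Cauchy_square:
  assumes "d > 0"
  shows "\<exists>N. \<forall>m\<ge>N. \<forall>m'\<ge>N. (\<integral>x. (b m x - b m' x)\<^sup>2 \<partial>\<mu>) \<le> 16 * d"
proof -
  obtain e where e: "e \<ge> 0" "\<forall>m>0. \<forall>m'>0. \<exists>c\<ge>0. \<forall>n>0.
    (\<integral>x. (b n x)\<^sup>2 \<partial>\<mu>) \<le> (\<integral>x. ((b m x + b m' x) / 2)\<^sup>2 \<partial>\<mu>) + (e / m + e / m') / 2 + c / real n"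
    using square_integral_le_midpoint by blast
  define a where "a n = (\<integral>x. (b n x)\<^sup>2 \<partial>\<mu>)" for n
  \<comment> \<open>The summand e / m makes \<open>l\<close> useful from both sides: it is a lower
    bound up to vanishing terms, and the midpoint inequality with two equal indices makes it an
    eventual upper bound for the squared norms.\<close>
  define l where "l = (INF m\<in>{0<..}. a m + e / real m)"
  have a0: "0 \<le> a n" for n by (simp add: a_def)
  have bdd: "bdd_below ((\<lambda>m. a m + e / real m) ` {0<..})"
    using a0 e(1) by (intro bdd_belowI[of _ 0]) auto
  have ne: "(\<lambda>m. a m + e / real m) ` {0<..} \<noteq> {}" by auto
  then have "\<exists>y\<in>(\<lambda>m. a m + e / real m) ` {0<..}. y < l + d"
    using cInf_less_iff[OF ne bdd, folded l_def, of "l + d"] assms by simp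
  then obtain m0 :: nat where m0: "m0 > 0" "a m0 + e / m0 < l + d" by (elim bexE imageE) simp
  have la: "l \<le> a n + e / n" if "n > 0" for n
    unfolding l_def using that by (intro cINF_lower bdd) auto
  have small: "\<exists>N>0. \<forall>n\<ge>N. c / real n \<le> d" if "c \<ge> 0" for c :: real
  proof -
    obtain N :: nat where N: "c / d < N" using reals_Archimedean2 by blast
    have "c / real n \<le> d" if "n \<ge> Suc N" for n
    proof -
      have "c / d \<le> real n" using N that by linarith
      then show ?thesis using assms that by (simp add: field_simps)
    qed
    then show ?thesis by blast
  qed
  obtain c0 where c0: "c0 \<ge> 0" "\<And>n. n > 0 \<Longrightarrow> a n \<le> a m0 + e / m0 + c0 / real n"
    using e(2)[rule_format, OF m0(1) m0(1)] by (auto simp: a_def)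
  obtain N1 N2 where N1: "N1 > 0" "\<And>n. n \<ge> N1 \<Longrightarrow> c0 / real n \<le> d"
    and N2: "N2 > 0" "\<And>n. n \<ge> N2 \<Longrightarrow> e / real n \<le> d" using small[OF c0(1)] small[OF e(1)] by metis
  have a_le: "a n \<le> l + 2 * d" if "n \<ge> N1" for n
    using c0(2)[of n] N1(1) N1(2)[OF that] m0(2) that by force
  show ?thesis
  proof (intro exI[of _ "max N1 N2"] allI impI)
    fix m m' assume mm: "max N1 N2 \<le> m" "max N1 N2 \<le> m'"
    then have pos: "m > 0" "m' > 0" using N1 by auto
    define I where "I = (\<integral>x. ((b m x + b m' x) / 2)\<^sup>2 \<partial>\<mu>)"
    obtain c where c: "c \<ge> 0" "\<And>n. n > 0 \<Longrightarrow> a n \<le> I + (e / m + e / m') / 2 + c / real n"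
      using e(2)[rule_format, OF pos] by (auto simp: a_def I_def)
    obtain N where N: "N > 0" "\<And>n. n \<ge> N \<Longrightarrow> (c + e) / real n \<le> d"
      using small[of "c + e"] c(1) e(1) by auto
    have "l \<le> a N + e / N" by (rule la[OF N(1)])
    also have "\<dots> \<le> I + (e / m + e / m') / 2 + (c + e) / N"
      using c(2)[OF N(1)] by (simp add: add_divide_distrib)
    also have "\<dots> \<le> I + 2 * d"
    proof -
      have "e / m \<le> d" "e / m' \<le> d" "(c + e) / N \<le> d" using N N2(2) mm by auto
      moreover have "I + (x + y) / 2 + z \<le> I + 2 * d" if "x \<le> d" "y \<le> d" "z \<le> d" for x y z
      proof -
        have "x + y \<le> 2 * d" using that by simp
        then have "(x + y) / 2 \<le> d" by simp
        then have "(x + y) / 2 + z \<le> d + d" using that(3) by (rule add_mono)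
        then show ?thesis unfolding mult_2 by (metis add.assoc add_left_mono)
      qed
      ultimately show ?thesis by blast
    qed
    finally have lI: "l \<le> I + 2 * d" .
    \<comment> \<open>Parallelogram law. With squared norms at most l + 2 d and squared midpoint
      norm at least l - 2 d it gives 4 (l + 2 d) - 4 (l - 2 d) = 16 d.\<close>
    have "(\<integral>x. (b m x - b m' x)\<^sup>2 \<partial>\<mu>) = (\<integral>x. 2 * (b m x)\<^sup>2 + 2 * (b m' x)\<^sup>2 - 4 * ((b m x + b m' x) / 2)\<^sup>2 \<partial>\<mu>)"
      by (intro Bochner_Integration.integral_cong) (auto simp: power2_eq_square field_simps)
    also have "\<dots> = 2 * a m + 2 * a m' - 4 * I"
      unfolding a_def I_def
      by (subst Bochner_Integration.integral_diff Bochner_Integration.integral_add;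
          (intro integrable_cont continuous_intros)?; simp?)+
    also have "\<dots> \<le> 16 * d"
      using lI a_le[of m] a_le[of m'] mm by simp
    finally show "(\<integral>x. (b m x - b m' x)\<^sup>2 \<partial>\<mu>) \<le> 16 * d" .
  qed
qed

lemma b_Cauchy_L1:
  assumes "\<epsilon> > 0"
  shows "\<exists>N. \<forall>m\<ge>N. \<forall>m'\<ge>N. (\<integral>x. norm (b m x - b m' x) \<partial>\<mu>) < \<epsilon>"
proof -
  interpret finite_measure \<mu> by (rule fin)
  define M where "M = measure \<mu> (space \<mu>)"
  have M: "M \<ge> 0" by (simp add: M_def)
  define \<eta> where "\<eta> = \<epsilon> / (2 * (M + 1))"
  have \<eta>: "\<eta> > 0" "\<eta> * M \<le> \<epsilon> / 2" using assms M by (auto simp: \<eta>_def field_simps)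
  \<comment> \<open>Chosen so that 16 d / \<eta> equals a quarter of \<epsilon>.\<close>
  define d where "d = \<epsilon> * \<eta> / 64"
  have "d > 0" using assms \<eta> by (simp add: d_def)
  then obtain N where N: "\<And>m m'. m \<ge> N \<Longrightarrow> m' \<ge> N \<Longrightarrow> (\<integral>x. (b m x - b m' x)\<^sup>2 \<partial>\<mu>) \<le> 16 * d"
    using b_Cauchy_square by metis
  have "(\<integral>x. norm (b m x - b m' x) \<partial>\<mu>) < \<epsilon>" if "m \<ge> N" "m' \<ge> N" for m m'
  proof -
    \<comment> \<open>This pointwise inequality passes from L^2 to L^1 on a finite measure space in
      place of the Cauchy-Schwarz inequality.\<close>
    have "\<bar>z\<bar> \<le> \<eta> + z\<^sup>2 / \<eta>" for z
    proof (cases "\<bar>z\<bar> \<le> \<eta>")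
      case False
      then have "\<bar>z\<bar> * \<eta> \<le> \<bar>z\<bar> * \<bar>z\<bar>" by (intro mult_left_mono) auto
      then have "\<bar>z\<bar> \<le> z\<^sup>2 / \<eta>" using \<eta> by (simp add: field_simps power2_eq_square)
      then show ?thesis using \<eta> by linarith
    qed (use \<eta> in \<open>auto intro: order_trans\<close>)
    then have "(\<integral>x. norm (b m x - b m' x) \<partial>\<mu>) \<le> (\<integral>x. \<eta> + (b m x - b m' x)\<^sup>2 / \<eta> \<partial>\<mu>)"
      using \<eta> by (intro integral_mono integrable_cont continuous_intros) auto
    also have "\<dots> = \<eta> * M + (\<integral>x. (b m x - b m' x)\<^sup>2 \<partial>\<mu>) / \<eta>"
      using \<eta> by (subst Bochner_Integration.integral_add) (auto simp: M_def intro!: integrable_cont continuous_intros)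
    also have "\<dots> \<le> \<epsilon> / 2 + 16 * d / \<eta>"
      using N[OF that] \<eta> by (intro add_mono divide_right_mono) auto
    also have "\<dots> < \<epsilon>" using \<eta> assms by (simp add: d_def)
    finally show ?thesis .
  qed
  then show ?thesis by blast
qed

text \<open>A subsequence of the L^1 Cauchy sequence \<open>b\<close> converges almost everywhere
  and supplies the candidate \<open>f\<close>. The uniform bound \<open>K\<close> gives convergence
  in mean by domination, the Cauchy property extends it to all integer times, and real times are
  compared with their integer parts.\<close>

lemma L1_limit_exists: "\<exists>f. L1_limit \<mu> (\<lambda>T x. F T x / T) f"
proof -
  interpret finite_measure \<mu> by (rule fin)
  define M where "M = measure \<mu> (space \<mu>)"
  obtain K where K: "K \<ge> 0" "\<And>n x. \<bar>b n x\<bar> \<le> K" using b_bounded by blast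
  obtain B where B: "B \<ge> 0" "\<And>t x. t \<in> {0..1} \<Longrightarrow> \<bar>F t x\<bar> \<le> B" using F_bounded[of 1] by blast
  have ib: "integrable \<mu> (b n)" for n by (intro integrable_cont cont_b)
  then have mb [measurable]: "b n \<in> borel_measurable \<mu>" for n by auto
  obtain r where r: "strict_mono r" "AE x in \<mu>. Cauchy (\<lambda>i. b (r i) x)"
    using cauchy_L1_AE_cauchy_subseq[of \<mu> b] ib b_Cauchy_L1 by blast
  define f where "f x = lim (\<lambda>i. b (r i) x)" for x
  have fm [measurable]: "f \<in> borel_measurable \<mu>" unfolding f_def by measurable
  have lim: "AE x in \<mu>. (\<lambda>i. b (r i) x) \<longlonglongrightarrow> f x"
    using r(2) by eventually_elim (simp add: f_def Cauchy_convergent_iff convergent_LIMSEQ_iff)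
  have "AE x in \<mu>. \<bar>f x\<bar> \<le> K"
    using lim
  proof eventually_elim
    case (elim x)
    have "(\<lambda>i. \<bar>b (r i) x\<bar>) \<longlonglongrightarrow> \<bar>f x\<bar>" using elim by (intro tendsto_intros)
    then show ?case by (rule LIMSEQ_le_const2) (use K in auto)
  qed
  then have fi: "integrable \<mu> f" by (intro integrable_const_bound[of _ K]) auto
  have "(\<lambda>i. \<integral>x. \<bar>b (r i) x - f x\<bar> \<partial>\<mu>) \<longlonglongrightarrow> (\<integral>x. 0 \<partial>\<mu>)"
  proof (rule integral_dominated_convergence[where w = "\<lambda>_. 2 * K"])
    show "AE x in \<mu>. (\<lambda>i. \<bar>b (r i) x - f x\<bar>) \<longlonglongrightarrow> 0"
      using lim by eventually_elim (simp add: tendsto_rabs_zero_iff LIM_zero_iff)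
    show "AE x in \<mu>. norm \<bar>b (r i) x - f x\<bar> \<le> 2 * K" for i
      using \<open>AE x in \<mu>. \<bar>f x\<bar> \<le> K\<close>
    proof eventually_elim
      case (elim x) then show ?case using K(2)[of "r i" x] by simp
    qed
  qed auto
  then have rlim: "(\<lambda>i. \<integral>x. \<bar>b (r i) x - f x\<bar> \<partial>\<mu>) \<longlonglongrightarrow> 0" by simp
  have blim: "(\<lambda>n. \<integral>x. \<bar>b n x - f x\<bar> \<partial>\<mu>) \<longlonglongrightarrow> 0"
  proof (rule LIMSEQ_I)
    fix e :: real assume e: "e > 0"
    obtain N where N: "\<And>m m'. m \<ge> N \<Longrightarrow> m' \<ge> N \<Longrightarrow> (\<integral>x. norm (b m x - b m' x) \<partial>\<mu>) < e / 2"
      using b_Cauchy_L1[of "e / 2"] e by auto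
    obtain i0 where i0: "\<And>i. i \<ge> i0 \<Longrightarrow> norm ((\<integral>x. \<bar>b (r i) x - f x\<bar> \<partial>\<mu>) - 0) < e / 2"
      using LIMSEQ_D[OF rlim, of "e / 2"] e by auto
    define i where "i = max i0 N"
    have ri: "r i \<ge> N" using seq_suble[OF r(1), of i] by (simp add: i_def)
    have "(\<integral>x. \<bar>b n x - f x\<bar> \<partial>\<mu>) < e" if "n \<ge> N" for n
    proof -
      have "(\<integral>x. \<bar>b n x - f x\<bar> \<partial>\<mu>) \<le> (\<integral>x. \<bar>b n x - b (r i) x\<bar> + \<bar>b (r i) x - f x\<bar> \<partial>\<mu>)"
        by (intro integral_mono integrable_abs Bochner_Integration.integrable_diff
              Bochner_Integration.integrable_add ib fi) auto
      also have "\<dots> = (\<integral>x. \<bar>b n x - b (r i) x\<bar> \<partial>\<mu>) + (\<integral>x. \<bar>b (r i) x - f x\<bar> \<partial>\<mu>)"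
        by (intro Bochner_Integration.integral_add integrable_abs Bochner_Integration.integrable_diff ib fi)
      also have "\<dots> < e"
        using N[OF that ri] i0[of i] by (simp add: i_def)
      finally show ?thesis .
    qed
    then show "\<exists>no. \<forall>n\<ge>no. norm ((\<integral>x. \<bar>b n x - f x\<bar> \<partial>\<mu>) - 0) < e" by auto
  qed
  have iF: "integrable \<mu> (\<lambda>x. F T x / T)" for T
    by (intro integrable_divide_zero integrable_cont cont_F)
  \<comment> \<open>Passing from T to its integer part changes \<open>F\<close> by at most B + C,
    since less than one unit of time is cut off; changing the denominator costs at most another
    K.\<close>
  have close: "\<bar>F T x / T - b (nat \<lfloor>T\<rfloor>) x\<bar> \<le> (B + C + K) / T" if T: "T \<ge> 1" for T x
  proof -
    define n where "n = nat \<lfloor>T\<rfloor>"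
    have n: "real n \<le> T" "T - n \<le> 1" "real n \<ge> 1" "n \<ge> 1" using T by (auto simp: n_def; linarith)+
    have 1: "\<bar>F T x - F n x\<bar> \<le> B + C"
      using quasi[of "real n" "T - n" x] B(2)[of "T - n" "\<phi> n x"] n by auto
    have "F T x / T - b n x = (F T x - F n x - b n x * (T - n)) / T"
      using n T by (simp add: b_def field_simps)
    also have "\<bar>\<dots>\<bar> \<le> (B + C + K) / T"
    proof -
      have "\<bar>b n x * (T - n)\<bar> \<le> K * 1"
        unfolding abs_mult using K n by (intro mult_mono) auto
      then show ?thesis unfolding abs_divide using 1 T by (intro divide_mono) auto
    qed
    finally show ?thesis by (simp add: n_def)
  qed
  have "((\<lambda>T. \<integral>x. \<bar>F T x / T - f x\<bar> \<partial>\<mu>) \<longlongrightarrow> 0) at_top"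
  proof (rule tendsto_sandwich[of "\<lambda>_. 0" _ _ "\<lambda>T. (B + C + K) * M / T + (\<integral>x. \<bar>b (nat \<lfloor>T\<rfloor>) x - f x\<bar> \<partial>\<mu>)"])
    have "((\<lambda>T::real. (B + C + K) * M / T) \<longlongrightarrow> 0) at_top"
      by (intro tendsto_divide_0[OF tendsto_const] filterlim_at_top_imp_at_infinity filterlim_ident)
    moreover have "filterlim (\<lambda>T::real. nat \<lfloor>T\<rfloor>) sequentially at_top"
      by (intro filterlim_compose[OF filterlim_nat_sequentially] filterlim_floor_sequentially)
    from filterlim_compose[OF blim this]
    have "((\<lambda>T::real. \<integral>x. \<bar>b (nat \<lfloor>T\<rfloor>) x - f x\<bar> \<partial>\<mu>) \<longlongrightarrow> 0) at_top" by simp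
    ultimately show "((\<lambda>T. (B + C + K) * M / T + (\<integral>x. \<bar>b (nat \<lfloor>T\<rfloor>) x - f x\<bar> \<partial>\<mu>)) \<longlongrightarrow> 0) at_top"
      by (rule tendsto_add_zero)
    show "\<forall>\<^sub>F T in at_top. (\<integral>x. \<bar>F T x / T - f x\<bar> \<partial>\<mu>) \<le>
        (B + C + K) * M / T + (\<integral>x. \<bar>b (nat \<lfloor>T\<rfloor>) x - f x\<bar> \<partial>\<mu>)"
      using eventually_ge_at_top[of 1]
    proof eventually_elim
      case (elim T)
      have "(\<integral>x. \<bar>F T x / T - f x\<bar> \<partial>\<mu>) \<le> (\<integral>x. (B + C + K) / T + \<bar>b (nat \<lfloor>T\<rfloor>) x - f x\<bar> \<partial>\<mu>)"
      proof (rule integral_mono)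
        show "\<bar>F T x / T - f x\<bar> \<le> (B + C + K) / T + \<bar>b (nat \<lfloor>T\<rfloor>) x - f x\<bar>" for x
          using close[OF elim, of x] by linarith
      qed (intro integrable_abs Bochner_Integration.integrable_diff
              Bochner_Integration.integrable_add ib fi iF integrable_const)+
      also have "\<dots> = (B + C + K) * M / T + (\<integral>x. \<bar>b (nat \<lfloor>T\<rfloor>) x - f x\<bar> \<partial>\<mu>)"
        by (subst Bochner_Integration.integral_add)
          (auto simp: M_def intro!: integrable_abs Bochner_Integration.integrable_diff ib fi)
      finally show ?case .
    qed
  qed auto
  then show ?thesis
    unfolding L1_limit_def using fi iF by (intro exI[of _ f]) auto
qed

end

section \<open>Alternating forms and unitary frames\<close>

text \<open>Expand the value with \<open>a + b\<close> in both slots, which is zero.\<close>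

lemma alternating_swap:
  fixes F :: "('k \<Rightarrow> complex ^ 'm) \<Rightarrow> complex"
  assumes add: "\<And>v i a b. F (v(i := a + b)) = F (v(i := a)) + F (v(i := b))"
    and alt: "\<And>v i j. i \<noteq> j \<Longrightarrow> v i = v j \<Longrightarrow> F v = 0" and "i \<noteq> j"
  shows "F (v(i := a, j := b)) = - F (v(i := b, j := a))"
proof -
  have tw: "v(j := a, i := b) = v(i := b, j := a)" for a b using assms(3) by (rule fun_upd_twist[symmetric])
  have "0 = F (v(i := a + b, j := a + b))" by (rule alt[OF assms(3), symmetric]) (use assms(3) in auto)
  also have "\<dots> = F (v(i := a + b, j := a)) + F (v(i := a + b, j := b))" by (rule add)
  also have "\<dots> = F (v(j := a, i := a + b)) + F (v(j := b, i := a + b))" by (simp add: tw)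
  also have "\<dots> = F (v(j := a, i := b)) + F (v(j := b, i := a)) + F (v(j := a, i := a)) + F (v(j := b, i := b))"
    by (simp add: add)
  also have "F (v(j := a, i := a)) = 0" by (rule alt[OF assms(3)]) (use assms(3) in auto)
  also have "F (v(j := b, i := b)) = 0" by (rule alt[OF assms(3)]) (use assms(3) in auto)
  finally have "F (v(j := a, i := b)) + F (v(j := b, i := a)) = 0" by (simp only: add_0_right)
  then show ?thesis unfolding tw eq_neg_iff_add_eq_0 by (subst add.commute)
qed

lemma multilinear_sum:
  fixes F :: "('k \<Rightarrow> complex ^ 'm) \<Rightarrow> complex"
  assumes add: "\<And>v i a b. F (v(i := a + b)) = F (v(i := a)) + F (v(i := b))"
    and scale: "\<And>v i c a. F (v(i := c *s a)) = c * F (v(i := a))"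
  shows "finite A \<Longrightarrow> F (v(i := (\<Sum>j\<in>A. c j *s w j))) = (\<Sum>j\<in>A. c j * F (v(i := w j)))"
proof (induction A rule: finite_induct)
  case empty
  have "F (v(i := 0 *s 0)) = 0 * F (v(i := 0))" by (rule scale)
  then show ?case by (simp only: sum.empty vector_smult_lzero mult_zero_left)
qed (simp add: add scale del: fun_upd_apply)

text \<open>Multilinearity reduces to standard basis vectors in all slots. A repeated basis vector
  gives zero, and a permutation of the basis is reached from the identity by transpositions, each of
  which only changes the sign.\<close>

lemma alternating_zero:
  fixes F :: "('k::finite \<Rightarrow> complex ^ 'k) \<Rightarrow> complex"
  assumes add: "\<And>v i a b. F (v(i := a + b)) = F (v(i := a)) + F (v(i := b))"
    and scale: "\<And>v i c a. F (v(i := c *s a)) = c * F (v(i := a))"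
    and alt: "\<And>v i j. i \<noteq> j \<Longrightarrow> v i = v j \<Longrightarrow> F v = 0"
    and zero: "F (\<lambda>j. axis j 1) = 0"
  shows "F v = 0"
proof -
  have base: "F (\<lambda>i. axis (s i) 1) = 0" for s
  proof (cases "inj s")
    case False
    then obtain i j where "i \<noteq> j" "s i = s j" by (auto simp: inj_on_def)
    then show ?thesis by (intro alt[of i j]) auto
  next
    case True
    then have "s permutes UNIV"
      using finite_UNIV_inj_surj[of s] by (intro bij_imp_permutes) (auto simp: bij_betw_def)
    with finite[of UNIV] show ?thesis
    proof (induction s rule: permutes_rev_induct)
      case id show ?case using zero by simp
    next
      case (swap a b p)
      show ?case
      proof (cases "a = b")
        case False
        define w where "w i = (axis (p i) 1 :: complex ^ 'k)" for i
        have eq: "(\<lambda>i. axis ((p \<circ> Transposition.transpose a b) i) 1) = w(a := w b, b := w a)"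
          using False by (auto simp: w_def fun_eq_iff Transposition.transpose_def)
        have "F (w(a := w b, b := w a)) = - F (w(a := w a, b := w b))"
          by (rule alternating_swap[OF add alt False])
        also have "w(a := w a, b := w b) = w" by simp
        also have "F w = 0" using swap by (simp add: w_def[abs_def])
        finally show ?thesis unfolding eq by (simp only: minus_zero)
      qed (use swap in simp)
    qed
  qed
  \<comment> \<open>Induction on the set of slots that need not yet hold a basis vector.\<close>
  have "F v = 0" if "finite S" "\<And>i. i \<notin> S \<Longrightarrow> \<exists>j. v i = axis j 1" for S v
    using that
  proof (induction S arbitrary: v rule: finite_induct)
    case empty
    then have "\<forall>i. \<exists>j. v i = axis j 1" by simp
    then obtain s where "\<forall>i. v i = axis (s i) 1" by metis
    then have "v = (\<lambda>i. axis (s i) 1)" by auto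
    then show ?case using base by simp
  next
    case (insert i S)
    have "F v = F (v(i := (\<Sum>j\<in>UNIV. v i $ j *s axis j 1)))" by (simp add: basis_expansion)
    also have "\<dots> = (\<Sum>j\<in>UNIV. v i $ j * F (v(i := axis j 1)))"
      by (rule multilinear_sum[OF add scale finite])
    also have "\<dots> = 0"
    proof (intro sum.neutral ballI)
      fix j
      have "F (v(i := axis j 1)) = 0"
        by (rule insert.IH) (use insert.prems in auto)
      then show "v i $ j * F (v(i := axis j 1)) = 0" by simp
    qed
    finally show ?case .
  qed
  from this[of UNIV] show ?thesis by simp
qed

definition col_det :: "('k::finite \<Rightarrow> complex ^ 'k) \<Rightarrow> complex" where
  "col_det v = det (\<chi> i j. v j $ i)"

lemma col_det_row: "col_det v = det (\<chi> i. v i)"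
proof -
  have "(\<chi> i j. v j $ i) = transpose (\<chi> i. v i)" by (simp add: transpose_def vec_eq_iff)
  then show ?thesis by (simp add: col_det_def det_transpose)
qed

lemma col_det_add: "col_det (v(i := a + b)) = col_det (v(i := a)) + col_det (v(i := b))"
proof -
  have *: "(\<chi> j. (v(i := a)) j) = (\<chi> j. if j = i then a else v j)" for a
    by (simp add: vec_eq_iff)
  show ?thesis unfolding col_det_row * by (rule det_row_add)
qed

lemma col_det_scale: "col_det (v(i := c *s a)) = c * col_det (v(i := a))"
proof -
  have *: "(\<chi> j. (v(i := a)) j) = (\<chi> j. if j = i then a else v j)" for a
    by (simp add: vec_eq_iff)
  show ?thesis unfolding col_det_row * by (rule det_row_mul)
qed

lemma col_det_alt: "i \<noteq> j \<Longrightarrow> v i = v j \<Longrightarrow> col_det v = 0"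
  unfolding col_det_row by (rule det_identical_rows[of i j]) (auto simp: row_def vec_eq_iff)

lemma col_det_axis [simp]: "col_det (\<lambda>j :: 'k::finite. axis j 1) = 1"
proof -
  have "(\<chi> i j. axis j 1 $ i) = (mat 1 :: complex ^ 'k ^ 'k)" by (simp add: mat_def axis_def vec_eq_iff)
  then show ?thesis by (simp add: col_det_def)
qed

lemma cdet_col: "cdet M = col_det (\<lambda>j. M (axis j 1))"
  by (simp add: cdet_def col_det_def matrix_def)

text \<open>The two sides agree on the standard basis, so their difference falls under
  \<open>alternating_zero\<close>. Product and block formulas for determinants are read off from
  this, as is the one-dimensionality of the determinant line.\<close>

lemma alternating_eq_det:
  fixes F :: "('k::finite \<Rightarrow> complex ^ 'k) \<Rightarrow> complex"
  assumes add: "\<And>v i a b. F (v(i := a + b)) = F (v(i := a)) + F (v(i := b))"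
    and scale: "\<And>v i c a. F (v(i := c *s a)) = c * F (v(i := a))"
    and alt: "\<And>v i j. i \<noteq> j \<Longrightarrow> v i = v j \<Longrightarrow> F v = 0"
  shows "F v = col_det v * F (\<lambda>j. axis j 1)"
proof -
  define D where "D v = F v - col_det v * F (\<lambda>j. axis j 1)" for v
  have "D v = 0"
    by (rule alternating_zero)
      (auto simp: D_def add scale col_det_add col_det_scale alt col_det_alt algebra_simps
        simp del: fun_upd_apply)
  then show ?thesis by (simp add: D_def)
qed

text \<open>Gram--Schmidt: the vectors already chosen do not span, since they are the image of a
  noninjective linear endomorphism of \<open>complex ^ 'k\<close>.\<close>

lemma compatible_unitary_basis:
  fixes J :: "complex ^ 'k \<Rightarrow> complex ^ 'k" and W :: "complex ^ 'k \<Rightarrow> complex ^ 'k \<Rightarrow> real"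
  assumes J: "linear J" "\<And>v. J (J v) = - v"
    and Wadd: "\<And>u v w. W (u + v) w = W u w + W v w" and Wsc: "\<And>r v w. W (r *\<^sub>R v) w = r * W v w"
    and Wskew: "\<And>v w. W v w = - W w v" and WJ: "\<And>v w. W v (J w) = W w (J v)"
    and Wpos: "\<And>v. v \<noteq> 0 \<Longrightarrow> 0 < W v (J v)"
  shows "\<exists>g :: complex ^ 'k \<Rightarrow> _. linear g \<and> (\<forall>v. g (\<i> *s v) = J (g v)) \<and> (\<forall>v w. W (g v) (g w) = std_form v w)"
proof -
  have WJJ: "W (J v) (J w) = W v w" for v w
    using WJ[of "J v" w] J(2)[of v] Wskew[of w "- v"] Wsc[of "-1" v w] by simp
  have WJl: "W (J v) w = - W v (J w)" for v w using WJ[of v w] Wskew[of "J v" w] by simp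
  have linW: "linear (\<lambda>v. W v w)" for w by (rule linearI) (auto simp: Wadd Wsc)
  \<comment> \<open>The candidate frame spanned over the complex structure by the vectors
    \<open>e\<close>. Coordinates outside \<open>S\<close> are ignored, so the map is singular as
    long as an index is missing, and for S = UNIV it is the result.\<close>
  define G where "G e S v = (\<Sum>j\<in>S. Re (v $ j) *\<^sub>R e j + Im (v $ j) *\<^sub>R J (e j))"
    for e :: "'k \<Rightarrow> complex ^ 'k" and S v
  have linG: "linear (G e S)" for e S
    by (rule linearI) (auto simp: G_def algebra_simps sum.distrib scaleR_sum_right)
  define ON where "ON e S \<longleftrightarrow> (\<forall>i\<in>S. \<forall>j\<in>S. W (e i) (e j) = 0 \<and> W (e i) (J (e j)) = (if i = j then 1 else 0))"
    for e :: "'k \<Rightarrow> complex ^ 'k" and S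
  have WG: "W (G e S v) (e j) = - Im (v $ j)" "W (G e S v) (J (e j)) = Re (v $ j)"
    if "ON e S" "j \<in> S" for e S v j
  proof -
    have 1: "W (e i) (e j) = 0" "W (e i) (J (e j)) = (if i = j then 1 else 0)" if "i \<in> S" for i
      using \<open>ON e S\<close> that \<open>j \<in> S\<close> by (auto simp: ON_def)
    have "W (G e S v) (e j) = (\<Sum>i\<in>S. if i = j then - Im (v $ i) else 0)"
      unfolding G_def linear_sum[OF linW] by (intro sum.cong) (auto simp: Wadd Wsc WJl 1)
    then show "W (G e S v) (e j) = - Im (v $ j)" using that by simp
    have "W (G e S v) (J (e j)) = (\<Sum>i\<in>S. if i = j then Re (v $ i) else 0)"
      unfolding G_def linear_sum[OF linW] by (intro sum.cong) (auto simp: Wadd Wsc WJJ 1)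
    then show "W (G e S v) (J (e j)) = Re (v $ j)" using that by simp
  qed
  have ex: "\<exists>e. ON e S" if "finite S" for S
    using that
  proof (induction S rule: finite_induct)
    case empty show ?case by (simp add: ON_def)
  next
    case (insert k S)
    then obtain e where e: "ON e S" by blast
    have "G e S (axis k 1) = 0" using insert(2) by (auto simp: G_def axis_def intro!: sum.neutral)
    then have "\<not> inj (G e S)"
      using linear_injective_0[OF linG, of e S] by (auto simp: axis_eq_0_iff)
    then have "\<not> surj (G e S)"
      using linear_surjective_imp_injective[OF linG] by blast
    then obtain u where u: "u \<notin> range (G e S)" by blast
    \<comment> \<open>The Hermitian products of \<open>u\<close> with the vectors already chosen. By
      \<open>WG\<close> these are the coordinates whose subtraction makes the remainder orthogonal
      to every \<open>e j\<close> and \<open>J (e j)\<close>.\<close>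
    define z where "z = (\<chi> j. Complex (W u (J (e j))) (- W u (e j)))"
    define u' where "u' = u - G e S z"
    have "u' \<noteq> 0" using u by (auto simp: u'_def)
    then have pos: "0 < W u' (J u')" by (rule Wpos)
    have Wd: "W (a - b) c = W a c - W b c" for a b c by (rule linear_diff[OF linW])
    have o: "W u' (e j) = 0" "W u' (J (e j)) = 0" if "j \<in> S" for j
      unfolding u'_def Wd WG[OF e that] by (simp_all add: z_def)
    define n where "n = 1 / sqrt (W u' (J u'))"
    have n: "n * (n * W u' (J u')) = 1" using pos by (simp add: n_def)
    have Wr: "W v (r *\<^sub>R w) = r * W v w" for v w r using Wskew[of v] Wsc by (metis mult_minus_right)
    have self: "W v v = 0" for v using Wskew[of v v] by simp
    have o': "W (e j) u' = 0" "W (e j) (J u') = 0" if "j \<in> S" for j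
      using o[OF that] Wskew[of "e j" u'] WJ[of "e j" u'] by simp_all
    have "ON (e(k := n *\<^sub>R u')) (insert k S)"
      unfolding ON_def using e insert(2) o o' n
      by (auto simp: ON_def linear_scale[OF J(1)] Wr Wsc self)
    then show ?case by blast
  qed
  from ex[OF finite[of UNIV]] obtain e where e: "ON e UNIV" by (rule exE)
  have Wr: "W v (r *\<^sub>R w) = r * W v w" "W v (a + b) = W v a + W v b" for v w r a b
    using Wskew[of v] Wsc Wadd by (metis mult_minus_right, metis minus_add_distrib)
  have linW2: "linear (W v)" for v by (rule linearI) (auto simp: Wr)
  show ?thesis
  proof (intro exI[of _ "G e UNIV"] conjI allI linG)
    show "G e UNIV (\<i> *s v) = J (G e UNIV v)" for v
      by (simp add: G_def linear_sum[OF J(1)] linear_add[OF J(1)] linear_scale[OF J(1)] J(2) add.commute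
          sum.distrib sum_negf sum_subtractf)
    have "W (G e UNIV v) (G e UNIV w) = (\<Sum>j\<in>UNIV. Re (w $ j) * - Im (v $ j) + Im (w $ j) * Re (v $ j))" for v w
      unfolding G_def[of e UNIV w] linear_sum[OF linW2] Wr by (simp add: WG[OF e])
    then show "W (G e UNIV v) (G e UNIV w) = std_form v w" for v w
      by (simp add: std_form_def algebra_simps)
  qed
qed

section \<open>Frames of a fibre and coordinates on its determinant line\<close>

definition real_frame :: "('y, 'e) symp_bundle \<Rightarrow> 'y \<Rightarrow> (complex ^ 'k::finite \<Rightarrow> 'e) \<Rightarrow> bool" where
  "real_frame E x g \<longleftrightarrow> bij_betw g UNIV (fibre E x) \<and> g 0 = vzero E x \<and>
     (\<forall>v w. g (v + w) = vadd E (g v) (g w)) \<and> (\<forall>r v. g (r *\<^sub>R v) = vscale E r (g v))"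

definition complex_frame ::
    "('y, 'e) symp_bundle \<Rightarrow> ('e \<Rightarrow> 'e) \<Rightarrow> 'y \<Rightarrow> (complex ^ 'k::finite \<Rightarrow> 'e) \<Rightarrow> bool" where
  "complex_frame E J x g \<longleftrightarrow> real_frame E x g \<and> (\<forall>v. g (\<i> *s v) = J (g v))"

text \<open>The last clause removes the freedom of a phase: in such a frame a unitary trivialization
  takes a wedge to the determinant of the coordinate vectors, and two such frames differ by a
  special unitary matrix.\<close>

definition unitary_frame ::
    "('y, 'e) symp_bundle \<Rightarrow> ('e \<Rightarrow> 'e) \<Rightarrow> ('y, 'e, 'k::finite) det_triv \<Rightarrow> 'y \<Rightarrow> (complex ^ 'k \<Rightarrow> 'e) \<Rightarrow> bool" where
  "unitary_frame E J \<tau> x g \<longleftrightarrow> complex_frame E J x g \<and>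
     (\<forall>v w. omega E (g v) (g w) = std_form v w) \<and> \<tau> x (wedge E J x (\<lambda>j. g (axis j 1))) = 1"

context
  fixes E :: "('y, 'e) symp_bundle" and x :: 'y and g :: "complex ^ 'k::finite \<Rightarrow> 'e"
  assumes g: "real_frame E x g"
begin

lemma frame_in [simp]: "g v \<in> fibre E x"
  using g by (auto simp: real_frame_def bij_betw_def)

lemma frame_inv: "inv_into UNIV g (g v) = v" "u \<in> fibre E x \<Longrightarrow> g (inv_into UNIV g u) = u"
  using g by (auto simp: real_frame_def bij_betw_def f_inv_into_f)

lemma frame_eq_iff: "g v = g w \<longleftrightarrow> v = w"
  using g by (auto simp: real_frame_def bij_betw_def inj_on_def)

lemma frame_ops: "g 0 = vzero E x" "vadd E (g v) (g w) = g (v + w)" "vscale E r (g v) = g (r *\<^sub>R v)"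
  using g by (auto simp: real_frame_def)

lemma frame_cases: "u \<in> fibre E x \<Longrightarrow> (\<And>v. u = g v \<Longrightarrow> P) \<Longrightarrow> P"
  using frame_inv(2) by metis

lemma frame_families: "(\<lambda>j. g (v j)) \<in> families E x"
  by (simp add: families_def)

lemma families_frame_cases:
  assumes "u \<in> families E x" and P: "\<And>v. u = (\<lambda>j. g (v j)) \<Longrightarrow> P"
  shows P
proof (rule P)
  show "u = (\<lambda>j. g (inv_into UNIV g (u j)))"
    using assms(1) by (simp add: families_def frame_inv(2))
qed

end

lemma complex_frame_real: "complex_frame E J x g \<Longrightarrow> real_frame E x g"
  by (simp add: complex_frame_def)

lemma complex_frame_cscale: "complex_frame E J x g \<Longrightarrow> cscale E J c (g v) = g (c *s v)"
  unfolding cscale_def cmult_decomp[of c] by (simp add: complex_frame_def real_frame_def)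

lemma alt_forms_ops:
  assumes "\<alpha> \<in> alt_forms E J x" "\<beta> \<in> alt_forms E J x"
    and "\<And>a b. a \<in> fibre E x \<Longrightarrow> b \<in> fibre E x \<Longrightarrow> vadd E a b \<in> fibre E x"
    and "\<And>c a. a \<in> fibre E x \<Longrightarrow> cscale E J c a \<in> fibre E x"
  shows "(\<lambda>v\<in>families E x. \<alpha> v + \<beta> v) \<in> alt_forms E J x" "(\<lambda>v\<in>families E x. c * \<alpha> v) \<in> alt_forms E J x"
proof -
  have u: "v(i := a) \<in> families E x" if "v \<in> families E x" "a \<in> fibre E x" for v i a
    using that by (simp add: families_def)
  show "(\<lambda>v\<in>families E x. \<alpha> v + \<beta> v) \<in> alt_forms E J x" "(\<lambda>v\<in>families E x. c * \<alpha> v) \<in> alt_forms E J x"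
    using assms unfolding alt_forms_def
    by (auto simp: u assms(3,4) distrib_left)
qed

context
  fixes E :: "('y, 'e) symp_bundle" and J :: "'e \<Rightarrow> 'e" and x :: 'y and g :: "complex ^ 'k::finite \<Rightarrow> 'e"
  assumes g: "complex_frame E J x g"
begin

text \<open>Pulled back by the frame, \<alpha> is an alternating form on the model space, where
  \<open>alternating_eq_det\<close> applies.\<close>

lemma alt_form_frame:
  assumes \<alpha>: "\<alpha> \<in> alt_forms E J x"
  shows "\<alpha> (\<lambda>j. g (v j)) = col_det v * \<alpha> (\<lambda>j. g (axis j 1))"
proof (rule alternating_eq_det[of "\<lambda>v. \<alpha> (\<lambda>j. g (v j))"])
  note r = complex_frame_real[OF g]
  have A: "\<alpha> (v(i := vadd E a b)) = \<alpha> (v(i := a)) + \<alpha> (v(i := b))"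
      "\<alpha> (v(i := cscale E J c a)) = c * \<alpha> (v(i := a))"
    if "v \<in> families E x" "a \<in> fibre E x" "b \<in> fibre E x" for v i a b c
    using \<alpha> that by (auto simp: alt_forms_def)
  have "\<forall>v\<in>families E x. \<forall>i j. i \<noteq> j \<and> v i = v j \<longrightarrow> \<alpha> v = 0"
    using \<alpha> unfolding alt_forms_def by blast
  then have B: "\<alpha> v = 0" if "v \<in> families E x" "i \<noteq> j" "v i = v j" for v i j
    using that by blast
  have upd: "(\<lambda>j. g ((v(i := a)) j)) = (\<lambda>j. g (v j))(i := g a)" for v i a by (auto simp: fun_eq_iff)
  show "\<alpha> (\<lambda>j. g ((v(i := a + b)) j)) = \<alpha> (\<lambda>j. g ((v(i := a)) j)) + \<alpha> (\<lambda>j. g ((v(i := b)) j))" for v i a b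
    unfolding upd frame_ops(2)[OF r, symmetric]
    by (rule A(1)[OF frame_families[OF r] frame_in[OF r] frame_in[OF r]])
  show "\<alpha> (\<lambda>j. g ((v(i := c *s a)) j)) = c * \<alpha> (\<lambda>j. g ((v(i := a)) j))" for v i a c
    unfolding upd complex_frame_cscale[OF g, symmetric]
    by (rule A(2)[OF frame_families[OF r] frame_in[OF r] frame_in[OF r]])
  show "\<alpha> (\<lambda>j. g (v j)) = 0" if "i \<noteq> j" "v i = v j" for v i j
    using B[OF frame_families[OF r] that(1)] that(2) by simp
qed

text \<open>The generator of the line of alternating forms that takes the value 1 on the frame.
  Evaluation on it is the coordinate of an element of the determinant line. The restriction to
  families matches the extensionality required in \<open>alt_forms\<close>.\<close>

definition frame_form :: "('k \<Rightarrow> 'e) \<Rightarrow> complex" where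
  "frame_form = (\<lambda>v\<in>families E x. col_det (\<lambda>j. inv_into UNIV g (v j)))"

lemma frame_form_frame [simp]: "frame_form (\<lambda>j. g (v j)) = col_det v"
  by (simp add: frame_form_def frame_families[OF complex_frame_real[OF g]] frame_inv[OF complex_frame_real[OF g]])

lemma frame_form_alt: "frame_form \<in> alt_forms E J x"
proof -
  note r = complex_frame_real[OF g]
  have upd: "(\<lambda>j. g (v j))(i := g a) = (\<lambda>j. g ((v(i := a)) j))" for v i a by (auto simp: fun_eq_iff)
  have 1: "frame_form (v(i := vadd E a b)) = frame_form (v(i := a)) + frame_form (v(i := b)) \<and>
      frame_form (v(i := cscale E J c a)) = c * frame_form (v(i := a))"
    if fb: "v \<in> families E x" "a \<in> fibre E x" "b \<in> fibre E x" for v i a b c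
  proof -
    obtain v' where "v = (\<lambda>j. g (v' j))" using families_frame_cases[OF r fb(1)] by blast
    moreover obtain a' where "a = g a'" using frame_cases[OF r fb(2)] by blast
    moreover obtain b' where "b = g b'" using frame_cases[OF r fb(3)] by blast
    ultimately show ?thesis
      by (simp add: frame_ops[OF r] complex_frame_cscale[OF g] upd col_det_add col_det_scale del: fun_upd_apply)
  qed
  have 2: "frame_form v = 0" if v: "v \<in> families E x" "i \<noteq> j" "v i = v j" for v i j
  proof -
    obtain v' where v': "v = (\<lambda>j. g (v' j))" using families_frame_cases[OF r v(1)] by blast
    then have "v' i = v' j" using v(3) by (simp add: frame_eq_iff[OF r])
    then show ?thesis unfolding v' using col_det_alt[OF v(2)] by simp
  qed
  show ?thesis unfolding alt_forms_def using 1 2 by (auto simp: frame_form_def)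
qed

lemma wedge_frame:
  "wedge E J x (\<lambda>j. g (v j)) = (\<lambda>\<alpha>\<in>alt_forms E J x. col_det v * wedge E J x (\<lambda>j. g (axis j 1)) \<alpha>)"
  by (auto simp: wedge_def alt_form_frame[of _ v] fun_eq_iff)

lemma fibre_closed:
  "a \<in> fibre E x \<Longrightarrow> b \<in> fibre E x \<Longrightarrow> vadd E a b \<in> fibre E x" "a \<in> fibre E x \<Longrightarrow> cscale E J c a \<in> fibre E x"
  using frame_cases[OF complex_frame_real[OF g]] frame_in[OF complex_frame_real[OF g]]
    frame_ops[OF complex_frame_real[OF g]] complex_frame_cscale[OF g] by metis+

lemma wedge_in_det_line:
  fixes v :: "'k \<Rightarrow> 'e"
  shows "v \<in> families E x \<Longrightarrow> wedge E J x v \<in> det_line E J x"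
  unfolding det_line_def
proof (intro CollectI conjI ballI allI)
  show "wedge E J x v \<in> extensional (alt_forms E J x)" by (simp add: wedge_def)
  fix \<alpha> \<beta> :: "('k \<Rightarrow> 'e) \<Rightarrow> complex" and c
  assume v: "v \<in> families E x" and a: "\<alpha> \<in> alt_forms E J x" "\<beta> \<in> alt_forms E J x"
  note o = alt_forms_ops[OF a fibre_closed(1) fibre_closed(2)]
  show "wedge E J x v (\<lambda>v\<in>families E x. \<alpha> v + \<beta> v) = wedge E J x v \<alpha> + wedge E J x v \<beta>"
    and "wedge E J x v (\<lambda>v\<in>families E x. c * \<alpha> v) = c * wedge E J x v \<alpha>"
    by (simp_all only: wedge_def restrict_apply' o a v)
qed

text \<open>Every alternating form is a multiple of \<open>frame_form\<close>, so a linear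
  functional on forms is fixed by its value there.\<close>

lemma det_line_frame:
  assumes "L \<in> det_line E J x"
  shows "L = (\<lambda>\<alpha>\<in>alt_forms E J x. L frame_form * wedge E J x (\<lambda>j. g (axis j 1)) \<alpha>)"
proof
  fix \<alpha>
  show "L \<alpha> = (\<lambda>\<alpha>\<in>alt_forms E J x. L frame_form * wedge E J x (\<lambda>j. g (axis j 1)) \<alpha>) \<alpha>"
  proof (cases "\<alpha> \<in> alt_forms E J x")
    case True
    have eq: "\<alpha> = (\<lambda>v\<in>families E x. \<alpha> (\<lambda>j. g (axis j 1)) * frame_form v)"
    proof
      fix v
      show "\<alpha> v = (\<lambda>v\<in>families E x. \<alpha> (\<lambda>j. g (axis j 1)) * frame_form v) v"
      proof (cases "v \<in> families E x")
        case v: True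
        then obtain v' where "v = (\<lambda>j. g (v' j))"
          using families_frame_cases[OF complex_frame_real[OF g]] by blast
        then show ?thesis using alt_form_frame[OF True, of v'] v by simp
      qed (use True in \<open>auto simp: alt_forms_def extensional_def\<close>)
    qed
    have "\<forall>\<beta>\<in>alt_forms E J x. \<forall>c. L (\<lambda>v\<in>families E x. c * \<beta> v) = c * L \<beta>"
      using assms unfolding det_line_def by blast
    then have "L (\<lambda>v\<in>families E x. \<alpha> (\<lambda>j. g (axis j 1)) * frame_form v) = \<alpha> (\<lambda>j. g (axis j 1)) * L frame_form"
      using frame_form_alt by blast
    with arg_cong[OF eq, of L] have "L \<alpha> = \<alpha> (\<lambda>j. g (axis j 1)) * L frame_form" by (rule trans)
    then show ?thesis using True by (simp add: wedge_def)
  qed (use assms in \<open>auto simp: det_line_def extensional_def\<close>)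
qed

context
  fixes \<tau> :: "('y, 'e, 'k) det_triv"
  assumes u: "unitary_at E J \<tau> x"
begin

lemma triv_cmult: "L \<in> det_line E J x \<Longrightarrow> \<tau> x (\<lambda>\<alpha>\<in>alt_forms E J x. c * L \<alpha>) = c * \<tau> x L"
  using u unfolding unitary_at_def by blast

lemma triv_wedge_frame:
  "\<tau> x (wedge E J x (\<lambda>j. g (v j))) = col_det v * \<tau> x (wedge E J x (\<lambda>j. g (axis j 1)))"
  by (subst wedge_frame) (rule triv_cmult[OF wedge_in_det_line[OF frame_families[OF complex_frame_real[OF g]]]])

lemma triv_det_line:
  assumes "L \<in> det_line E J x"
  shows "\<tau> x L = L frame_form * \<tau> x (wedge E J x (\<lambda>j. g (axis j 1)))"
  using arg_cong[OF det_line_frame[OF assms], of "\<tau> x"]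
    triv_cmult[OF wedge_in_det_line[OF frame_families[OF complex_frame_real[OF g]]]] by (rule trans)

end
end

lemma unitary_frame_complex: "unitary_frame E J \<tau> x g \<Longrightarrow> complex_frame E J x g"
  by (simp add: unitary_frame_def)

lemma unitary_frame_real: "unitary_frame E J \<tau> x g \<Longrightarrow> real_frame E x g"
  by (simp add: unitary_frame_def complex_frame_def)

lemma triv_wedge_unitary_frame:
  assumes "unitary_frame E J \<tau> x g" "unitary_at E J \<tau> x"
  shows "\<tau> x (wedge E J x (\<lambda>j. g (v j))) = col_det v"
  using triv_wedge_frame[OF unitary_frame_complex[OF assms(1)] assms(2), of v] assms(1)
  by (simp add: unitary_frame_def)

text \<open>Makes the inverse in the definition of \<open>rotation_phase\<close> explicit.
  Injectivity of \<tau> on the determinant line holds because an element of that line is determined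
  by one coordinate, which \<tau> recovers.\<close>

lemma inv_triv_unitary_frame:
  assumes g: "unitary_frame E J \<tau> x g" and u: "unitary_at E J \<tau> x"
  shows "inv_into (det_line E J x) (\<tau> x) 1 = wedge E J x (\<lambda>j. g (axis j 1))"
proof -
  have c: "complex_frame E J x g" using g by (rule unitary_frame_complex)
  have "inj_on (\<tau> x) (det_line E J x)"
  proof (rule inj_onI)
    fix L M assume L: "L \<in> det_line E J x" and M: "M \<in> det_line E J x" and "\<tau> x L = \<tau> x M"
    then have "L (frame_form E x g) = M (frame_form E x g)"
      using triv_det_line[OF c u L] triv_det_line[OF c u M] g by (simp add: unitary_frame_def)
    then show "L = M" by (subst det_line_frame[OF c L], subst det_line_frame[OF c M]) simp
  qed
  moreover have "wedge E J x (\<lambda>j. g (axis j 1)) \<in> det_line E J x"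
    by (rule wedge_in_det_line[OF c frame_families[OF complex_frame_real[OF c]]])
  ultimately show ?thesis by (rule inv_into_f_eq) (use g in \<open>simp add: unitary_frame_def\<close>)
qed

lemma unitary_frame_hermitian:
  assumes "unitary_frame E J \<tau> x g"
  shows "hermitian E J (g v) (g w) = Complex (v \<bullet> w) (- std_form v w)"
proof -
  have "J (g w) = g (\<i> *s w)" using assms by (simp add: unitary_frame_def complex_frame_def)
  then show ?thesis using assms by (simp add: hermitian_def unitary_frame_def std_form_i)
qed

section \<open>Bundle charts and pointwise existence of unitary frames\<close>

definition bundle_chart ::
    "('y::topological_space, 'e::topological_space) symp_bundle \<Rightarrow> 'y set \<Rightarrow>
     ('y \<times> (complex ^ 'k::finite) \<Rightarrow> 'e) \<Rightarrow> ('e \<Rightarrow> 'y \<times> (complex ^ 'k)) \<Rightarrow> bool" where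
  "bundle_chart E U h h' \<longleftrightarrow> open U \<and> homeomorphism (U \<times> UNIV) {v \<in> tot E. prj E v \<in> U} h h' \<and>
        (\<forall>y\<in>U. h (y, 0) = vzero E y \<and>
           (\<forall>z. prj E (h (y, z)) = y) \<and>
           (\<forall>z w. h (y, z + w) = vadd E (h (y, z)) (h (y, w))) \<and>
           (\<forall>r z. h (y, r *\<^sub>R z) = vscale E r (h (y, z))))"

lemma vector_bundle_chart:
  "vector_bundle TYPE('k::finite) E \<longleftrightarrow>
    (\<forall>x. \<exists>U (h :: 'y::topological_space \<times> (complex ^ 'k) \<Rightarrow> 'e::topological_space) h'. x \<in> U \<and> bundle_chart E U h h')"
  unfolding vector_bundle_def bundle_chart_def by (simp only: conj_left_commute)

lemma chart_real_frame:
  assumes "bundle_chart E U h h'" "x \<in> U"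
  shows "real_frame E x (\<lambda>z. h (x, z))"
proof -
  have h: "homeomorphism (U \<times> UNIV) {v \<in> tot E. prj E v \<in> U} h h'"
    and p: "\<forall>y\<in>U. h (y, 0) = vzero E y \<and> (\<forall>z. prj E (h (y, z)) = y) \<and>
           (\<forall>z w. h (y, z + w) = vadd E (h (y, z)) (h (y, w))) \<and>
           (\<forall>r z. h (y, r *\<^sub>R z) = vscale E r (h (y, z)))"
    using assms(1) by (auto simp: bundle_chart_def)
  have b: "bij_betw h (U \<times> UNIV) {v \<in> tot E. prj E v \<in> U}"
    by (rule bij_betw_byWitness[where f' = h']) (use h in \<open>auto simp: homeomorphism_def\<close>)
  have "inj (\<lambda>z. h (x, z))"
    using b assms(2) by (auto simp: bij_betw_def inj_on_def)
  moreover have "range (\<lambda>z. h (x, z)) = fibre E x"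
  proof (intro Set.set_eqI iffI)
    show "u \<in> fibre E x" if "u \<in> range (\<lambda>z. h (x, z))" for u
      using that p assms(2) bij_betwE[OF b] by (auto simp: fibre_def)
    fix u assume u: "u \<in> fibre E x"
    then have "u \<in> h ` (U \<times> UNIV)" using b assms(2) by (auto simp: fibre_def bij_betw_def)
    then obtain y z where yz: "y \<in> U" "u = h (y, z)" by auto
    then show "u \<in> range (\<lambda>z. h (x, z))" using p u by (auto simp: fibre_def)
  qed
  ultimately show ?thesis using p assms(2) by (simp add: real_frame_def bij_betw_def)
qed

lemma vector_bundle_real_frame:
  assumes "vector_bundle TYPE('k::finite) E"
  shows "\<exists>g :: complex ^ 'k \<Rightarrow> 'e::topological_space. real_frame E x g"
proof -
  obtain U h h' where "x \<in> U" "bundle_chart E U (h :: _ \<times> (complex ^ 'k) \<Rightarrow> 'e) h'"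
    using assms unfolding vector_bundle_chart by blast
  then show ?thesis using chart_real_frame by blast
qed

lemma std_form_axis: "std_form (axis i 1) (axis j 1) = 0"
proof -
  have "Im (axis i (1::complex) $ m) = 0" for i m :: 'a by (simp add: axis_def)
  then show ?thesis by (simp add: std_form_def)
qed

text \<open>The form and the complex structure are carried to the model space, where Gram-Schmidt
  yields an orthonormal frame. Its Gram matrix is the identity, so \<tau> takes a value
  \<open>c\<close> of modulus one on its wedge, and that phase is absorbed into one basis
  vector.\<close>

lemma exists_unitary_frame:
  fixes E :: "('y::topological_space, 'e::topological_space) symp_bundle" and \<tau> :: "('y, 'e, 'k::finite) det_triv"
  assumes E: "symplectic_vector_bundle TYPE('k) E" and J: "compatible_cs E J" and \<tau>: "unitary_at E J \<tau> x"
  shows "\<exists>g. unitary_frame E J \<tau> x g"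
proof -
  have vb: "vector_bundle TYPE('k) E" using E by (simp add: symplectic_vector_bundle_def)
  obtain h :: "complex ^ 'k \<Rightarrow> 'e" where h: "real_frame E x h"
    using vector_bundle_real_frame[OF vb] by blast
  note hs = frame_in[OF h] frame_ops[OF h]
  define J0 where "J0 v = inv_into UNIV h (J (h v))" for v
  define W where "W v w = omega E (h v) (h w)" for v w
  have fl: "fibre_linear E x E x J" and JJ: "\<And>v. v \<in> fibre E x \<Longrightarrow> J (J v) = vscale E (-1) v"
    and Jsym: "\<And>v w. v \<in> fibre E x \<Longrightarrow> w \<in> fibre E x \<Longrightarrow> omega E v (J w) = omega E w (J v)"
    and Jpos: "\<And>v. v \<in> fibre E x \<Longrightarrow> v \<noteq> vzero E x \<Longrightarrow> omega E v (J v) > 0"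
    using J by (auto simp: compatible_cs_def)
  have hJ: "h (J0 v) = J (h v)" for v
    unfolding J0_def by (rule frame_inv(2)[OF h]) (use fl hs in \<open>auto simp: fibre_linear_def\<close>)
  have om: "omega E (vadd E u v) w = omega E u w + omega E v w" "omega E (vscale E r v) w = r * omega E v w"
     "omega E v w = - omega E w v" if "u \<in> fibre E x" "v \<in> fibre E x" "w \<in> fibre E x" for u v w r
    using E that unfolding symplectic_vector_bundle_def by blast+
  have "\<exists>g0 :: complex ^ 'k \<Rightarrow> _. linear g0 \<and> (\<forall>v. g0 (\<i> *s v) = J0 (g0 v)) \<and> (\<forall>v w. W (g0 v) (g0 w) = std_form v w)"
  proof (rule compatible_unitary_basis)
    show "linear J0"
    proof (rule linearI; subst frame_eq_iff[OF h, symmetric])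
      show "h (J0 (a + b)) = h (J0 a + J0 b)" for a b
        using fl hs(1) by (simp add: hJ flip: hs(3)) (simp add: fibre_linear_def)
      show "h (J0 (r *\<^sub>R a)) = h (r *\<^sub>R J0 a)" for r a
        using fl hs(1) by (simp add: hJ flip: hs(4)) (simp add: fibre_linear_def)
    qed
    show "J0 (J0 v) = - v" for v
    proof (subst frame_eq_iff[OF h, symmetric])
      show "h (J0 (J0 v)) = h (- v)" using JJ[OF hs(1), of v] by (simp add: hJ hs(4))
    qed
    show "W (u + v) w = W u w + W v w" for u v w
      unfolding W_def hs(3)[symmetric] by (rule om(1)[OF hs(1) hs(1) hs(1)])
    show "W (r *\<^sub>R v) w = r * W v w" for v w r
      unfolding W_def hs(4)[symmetric] by (rule om(2)[OF hs(1) hs(1) hs(1)])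
    show "W v w = - W w v" for v w
      unfolding W_def by (rule om(3)[OF hs(1) hs(1) hs(1)])
    show "W v (J0 w) = W w (J0 v)" for v w using Jsym[OF hs(1) hs(1)] by (simp add: W_def hJ)
    show "0 < W v (J0 v)" if "v \<noteq> 0" for v
      using Jpos[OF hs(1), of v] that frame_eq_iff[OF h, of v 0] by (simp add: W_def hJ hs(2))
  qed
  then obtain g0 :: "complex ^ 'k \<Rightarrow> complex ^ 'k" where g0: "linear g0" "\<And>v. g0 (\<i> *s v) = J0 (g0 v)" "\<And>v w. W (g0 v) (g0 w) = std_form v w"
    by blast
  have bij: "bij g0"
  proof -
    have "inj g0" unfolding linear_injective_0[OF g0(1)]
    proof (intro allI impI)
      fix v assume "g0 v = 0"
      then have "std_form v (\<i> *s v) = W 0 (g0 (\<i> *s v))" by (simp flip: g0(3))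
      moreover have "W 0 w = 0" for w using om(2)[OF hs(1) hs(1) hs(1), of 0 0 w] by (simp add: W_def hs(4))
      ultimately show "v = 0" by (simp add: std_form_i)
    qed
    then show ?thesis using linear_injective_imp_surjective[OF g0(1)] by (simp add: bij_def)
  qed
  define g where "g v = h (g0 v)" for v
  have cf: "complex_frame E J x g"
    unfolding complex_frame_def real_frame_def
  proof (intro conjI allI)
    show "bij_betw g UNIV (fibre E x)"
      using bij_betw_trans[OF bij[unfolded bij_betw_def[symmetric]], of h "fibre E x"] h
      by (simp add: g_def[abs_def] real_frame_def comp_def)
    show "g 0 = vzero E x" "g (v + w) = vadd E (g v) (g w)" "g (r *\<^sub>R v) = vscale E r (g v)" for v w r
      by (simp_all add: g_def linear_0[OF g0(1)] linear_add[OF g0(1)] linear_scale[OF g0(1)] hs)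
    show "g (\<i> *s v) = J (g v)" for v by (simp add: g_def g0(2) hJ)
  qed
  have og: "omega E (g v) (g w) = std_form v w" for v w using g0(3) by (simp add: g_def W_def)
  define c where "c = \<tau> x (wedge E J x (\<lambda>j. g (axis j 1)))"
  have "hermitian E J (g v) (g w) = Complex (v \<bullet> w) (- std_form v w)" for v w
  proof -
    have "J (g w) = g (\<i> *s w)" using cf by (simp add: complex_frame_def)
    then show ?thesis by (simp add: hermitian_def og std_form_i)
  qed
  then have eq: "(\<chi> i j. hermitian E J (g (axis i 1)) (g (axis j 1))) = (mat 1 :: complex ^ 'k ^ 'k)"
    by (simp add: vec_eq_iff mat_def complex_eq_iff std_form_axis inner_axis_axis)
  have "\<forall>v\<in>families E x. complex_of_real ((cmod (\<tau> x (wedge E J x v)))\<^sup>2) =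
      det (\<chi> (i::'k) (j::'k). hermitian E J (v i) (v j))"
    using \<tau> unfolding unitary_at_def by (rule conjunct2)
  from this[rule_format, OF frame_families[OF complex_frame_real[OF cf]], of "\<lambda>j. axis j 1"]
  have "complex_of_real ((cmod c)\<^sup>2) = 1" by (simp only: eq det_I c_def)
  then have "(cmod c)\<^sup>2 = 1" by (simp only: of_real_eq_1_iff)
  then have "cmod c = 1" using norm_ge_zero[of c] by (auto simp: power2_eq_1_iff)
  then have c0: "c \<noteq> 0" "cmod (inverse c) = 1" by (auto simp: norm_inverse)
  obtain k0 :: 'k where True by blast
  \<comment> \<open>Dividing a single coordinate by \<open>c\<close> is unitary because
    \<open>c\<close> has modulus one, and multiplies the wedge of the frame by the inverse of
    \<open>c\<close>.\<close>
  define R where "R v = (\<chi> i. if i = k0 then inverse c * v $ i else v $ i)" for v :: "complex ^ 'k"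
  define R' where "R' v = (\<chi> i. if i = k0 then c * v $ i else v $ i)" for v :: "complex ^ 'k"
  have "bij R" by (rule o_bij[of R']) (auto simp: R_def R'_def fun_eq_iff vec_eq_iff c0)
  have gR: "complex_frame E J x (\<lambda>v. g (R v))"
    unfolding complex_frame_def real_frame_def
  proof (intro conjI allI)
    show "bij_betw (\<lambda>v. g (R v)) UNIV (fibre E x)"
      using bij_betw_trans[OF \<open>bij R\<close>[unfolded bij_betw_def[symmetric]], of g "fibre E x"] cf
      by (simp add: complex_frame_def real_frame_def comp_def)
    have R: "R 0 = 0" "R (v + w) = R v + R w" "R (r *\<^sub>R v) = r *\<^sub>R R v" "R (\<i> *s v) = \<i> *s R v" for v w r
      by (auto simp: R_def vec_eq_iff algebra_simps)
    show "g (R 0) = vzero E x" "g (R (v + w)) = vadd E (g (R v)) (g (R w))"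
        "g (R (r *\<^sub>R v)) = vscale E r (g (R v))" "g (R (\<i> *s v)) = J (g (R v))" for v w r
      using cf by (simp_all add: R complex_frame_def real_frame_def)
  qed
  have "std_form (R v) (R w) = std_form v w" for v w
  proof -
    have 1: "Re (a * u) * Im (a * z) - Im (a * u) * Re (a * z) = Re u * Im z - Im u * Re z" 
      if "cmod a = 1" for a u z
    proof -
      have "Re (a * u) * Im (a * z) - Im (a * u) * Re (a * z) = Im (cnj (a * u) * (a * z))"
        by (simp add: algebra_simps)
      also have "cnj (a * u) * (a * z) = (a * cnj a) * (cnj u * z)" by (simp add: mult_ac)
      also have "a * cnj a = 1" using that by (simp add: complex_norm_square[symmetric])
      finally show ?thesis by simp
    qed
    show ?thesis unfolding std_form_def R_def
      by (intro sum.cong) (auto simp: 1[OF c0(2)] simp del: times_complex.simps)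
  qed
  moreover have "\<tau> x (wedge E J x (\<lambda>j. g (R (axis j 1)))) = 1"
  proof -
    have "(\<lambda>j. R (axis j 1)) = (\<lambda>j. axis j 1)(k0 := inverse c *s axis k0 1)"
      by (auto simp: R_def fun_eq_iff vec_eq_iff axis_def)
    then have "col_det (\<lambda>j. R (axis j 1)) = inverse c * col_det ((\<lambda>j. axis j 1)(k0 := axis k0 1))"
      by (simp only: col_det_scale)
    also have "(\<lambda>j. axis j 1)(k0 := axis k0 1) = (\<lambda>j. axis j 1 :: complex ^ 'k)" by auto
    finally have "col_det (\<lambda>j. R (axis j 1)) = inverse c" by simp
    with triv_wedge_frame[OF cf \<tau>, of "\<lambda>j. R (axis j 1)"] c0(1) show ?thesis by (simp add: c_def)
  qed
  ultimately show ?thesis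
    using gR og by (intro exI[of _ "\<lambda>v. g (R v)"]) (simp add: unitary_frame_def)
qed

section \<open>Square roots of positive operators\<close>

text \<open>For a symmetric operator the quadratic form controls the norm: polarise T u \<bullet> w
  and take \<open>w\<close> parallel to \<open>T u\<close> with the length of
  \<open>u\<close>.\<close>

lemma symmetric_norm_le:
  fixes T :: "'a::real_inner \<Rightarrow> 'a"
  assumes T: "linear T" and sym: "\<And>v w. T v \<bullet> w = v \<bullet> T w"
    and q: "\<And>v. \<bar>T v \<bullet> v\<bar> \<le> r * (norm v)\<^sup>2"
  shows "norm (T u) \<le> r * norm u"
proof (cases "T u = 0 \<or> u = 0")
  case True
  moreover have "0 \<le> r * (norm u)\<^sup>2" using q[of u] by (rule order_trans[OF abs_ge_zero])
  then have "0 \<le> r * norm u" if "u \<noteq> 0" using that by (simp add: zero_le_mult_iff)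
  ultimately show ?thesis using linear_0[OF T] by (cases "u = 0") auto
next
  case False
  have *: "T u \<bullet> w \<le> r / 2 * ((norm u)\<^sup>2 + (norm w)\<^sup>2)" for w
  proof -
    have "4 * (T u \<bullet> w) = T (u + w) \<bullet> (u + w) - T (u - w) \<bullet> (u - w)"
      using sym[of w u] by (simp add: linear_add[OF T] linear_diff[OF T] algebra_simps inner_commute)
    also have "\<dots> \<le> r * (norm (u + w))\<^sup>2 + r * (norm (u - w))\<^sup>2"
      using q[of "u + w"] q[of "u - w"] by linarith
    also have "\<dots> = 2 * r * ((norm u)\<^sup>2 + (norm w)\<^sup>2)"
      by (simp add: power2_norm_eq_inner algebra_simps inner_commute)
    finally show ?thesis by (simp add: algebra_simps)
  qed
  define w where "w = (norm u / norm (T u)) *\<^sub>R T u"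
  have nw: "norm w = norm u" using False by (simp add: w_def)
  have "T u \<bullet> w = norm u * norm (T u)"
    using False by (simp add: w_def power2_norm_eq_inner[symmetric] power2_eq_square)
  then have "norm u * norm (T u) \<le> norm u * (r * norm u)"
    using *[of w] by (simp add: nw power2_eq_square mult_ac)
  then show ?thesis using False by (simp add: mult_le_cancel_left_pos)
qed

text \<open>If \<open>X = (T + X\<^sup>2) / 2\<close>, then \<open>(1 - X)\<^sup>2 = 1 - T\<close>.  For \<open>\<parallel>T\<parallel> \<le> r < 1\<close> this equation has a
  unique solution in the ball of radius \<open>1 - sqrt (1 - r)\<close>.\<close>

definition sqfix :: "real \<Rightarrow> ('a::euclidean_space \<Rightarrow>\<^sub>L 'a) \<Rightarrow> ('a \<Rightarrow>\<^sub>L 'a)" where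
  "sqfix r T = (THE X. norm X \<le> 1 - sqrt (1 - r) \<and> (1/2) *\<^sub>R (T + (X o\<^sub>L X)) = X)"

lemma blinfun_square_diff: "(X o\<^sub>L X) - (Y o\<^sub>L Y) = (X o\<^sub>L (X - Y)) + ((X - Y) o\<^sub>L Y)"
  by (rule blinfun_eqI) (simp add: blinfun.diff_left blinfun.diff_right blinfun.add_left)

context
  fixes r :: real
  assumes r: "0 \<le> r" "r < 1"
begin

text \<open>On the ball of radius \<rho> the difference of squares contributes (|X| + |Y|) / 2 \<le>
  \<rho> as Lipschitz factor. Allowing different operators \<open>T\<close> and \<open>S\<close>
  serves continuity of the fixed point; T = S gives the contraction.\<close>

lemma square_step_contraction:
  fixes X Y :: "'a::euclidean_space \<Rightarrow>\<^sub>L 'a"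
  assumes "norm X \<le> \<rho>" "norm Y \<le> \<rho>"
  shows "norm ((1/2) *\<^sub>R (T + (X o\<^sub>L X)) - (1/2) *\<^sub>R (S + (Y o\<^sub>L Y))) \<le> norm (T - S) / 2 + \<rho> * norm (X - Y)"
proof -
  have "(1/2) *\<^sub>R (T + (X o\<^sub>L X)) - (1/2) *\<^sub>R (S + (Y o\<^sub>L Y)) =
      (1/2) *\<^sub>R ((T - S) + ((X o\<^sub>L X) - (Y o\<^sub>L Y)))"
    by (simp add: algebra_simps)
  also have "norm \<dots> \<le> (norm (T - S) + norm ((X o\<^sub>L X) - (Y o\<^sub>L Y))) / 2"
    using norm_triangle_ineq[of "T - S" "(X o\<^sub>L X) - (Y o\<^sub>L Y)"] by simp
  also have "norm ((X o\<^sub>L X) - (Y o\<^sub>L Y)) \<le> norm X * norm (X - Y) + norm (X - Y) * norm Y"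
    unfolding blinfun_square_diff
    by (intro order_trans[OF norm_triangle_ineq] add_mono norm_blinfun_compose)
  also have "\<dots> \<le> \<rho> * norm (X - Y) + norm (X - Y) * \<rho>"
    using assms by (intro add_mono mult_right_mono mult_left_mono) auto
  finally show ?thesis by (simp add: field_simps)
qed

text \<open>The third identity says that the radius solves \<rho> = (r + \<rho>^2) / 2, which is
  exactly what makes the iteration preserve the ball.\<close>

lemma radius: "0 \<le> 1 - sqrt (1 - r)" "1 - sqrt (1 - r) < 1"
    "(r + (1 - sqrt (1 - r))\<^sup>2) / 2 = 1 - sqrt (1 - r)"
proof -
  show "0 \<le> 1 - sqrt (1 - r)" "1 - sqrt (1 - r) < 1" using r by auto
  have "(sqrt (1 - r))\<^sup>2 = 1 - r" using r by simp
  then show "(r + (1 - sqrt (1 - r))\<^sup>2) / 2 = 1 - sqrt (1 - r)" by (simp add: power2_diff)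
qed

text \<open>Running the Banach fixed point theorem inside a closed set \<open>C\<close> that the
  iteration preserves gives a fixed point in \<open>C\<close>. Symmetry and commutation relations of
  the square root are obtained by taking them as \<open>C\<close>.\<close>

lemma sqfix_unique:
  fixes T :: "'a::euclidean_space \<Rightarrow>\<^sub>L 'a"
  assumes T: "norm T \<le> r" and C: "closed C" "0 \<in> C" "\<And>X. X \<in> C \<Longrightarrow> (1/2) *\<^sub>R (T + (X o\<^sub>L X)) \<in> C"
  shows "\<exists>!X. X \<in> C \<inter> cball 0 (1 - sqrt (1 - r)) \<and> (1/2) *\<^sub>R (T + (X o\<^sub>L X)) = X"
proof -
  define \<rho> where "\<rho> = 1 - sqrt (1 - r)"
  have "\<exists>!X\<in>C \<inter> cball 0 \<rho>. (1/2) *\<^sub>R (T + (X o\<^sub>L X)) = X"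
  proof (rule Banach_fix)
    show "complete (C \<inter> cball 0 \<rho>)" using C(1) by (simp add: complete_eq_closed closed_Int)
    show "C \<inter> cball 0 \<rho> \<noteq> {}" using C(2) radius(1) by (auto simp: \<rho>_def)
    show "0 \<le> \<rho>" "\<rho> < 1" using radius by (simp_all add: \<rho>_def)
    show "(\<lambda>X. (1/2) *\<^sub>R (T + (X o\<^sub>L X))) ` (C \<inter> cball 0 \<rho>) \<subseteq> C \<inter> cball 0 \<rho>"
    proof clarify
      fix X assume X: "X \<in> C" "X \<in> cball 0 \<rho>"
      have "norm (X o\<^sub>L X) \<le> \<rho> * \<rho>"
        using X radius(1) by (intro order_trans[OF norm_blinfun_compose] mult_mono) (auto simp: \<rho>_def)
      then have "norm (T + (X o\<^sub>L X)) / 2 \<le> (r + \<rho>\<^sup>2) / 2"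
        using norm_triangle_ineq[of T "X o\<^sub>L X"] T by (simp add: power2_eq_square)
      then show "(1/2) *\<^sub>R (T + (X o\<^sub>L X)) \<in> C \<inter> cball 0 \<rho>"
        using C(3)[OF X(1)] radius(3) by (simp add: \<rho>_def)
    qed
    show "dist ((1/2) *\<^sub>R (T + (X o\<^sub>L X))) ((1/2) *\<^sub>R (T + (Y o\<^sub>L Y))) \<le> \<rho> * dist X Y"
      if "X \<in> C \<inter> cball 0 \<rho>" "Y \<in> C \<inter> cball 0 \<rho>" for X Y
      using square_step_contraction[of X \<rho> Y T T] that by (simp add: dist_norm)
  qed
  then show ?thesis by (simp only: \<rho>_def conj_assoc)
qed

lemma sqfix_ex:
  fixes T :: "'a::euclidean_space \<Rightarrow>\<^sub>L 'a"
  shows "norm T \<le> r \<Longrightarrow> \<exists>!X. norm X \<le> 1 - sqrt (1 - r) \<and> (1/2) *\<^sub>R (T + (X o\<^sub>L X)) = X"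
  using sqfix_unique[of T UNIV] by simp

lemma sqfix:
  fixes T :: "'a::euclidean_space \<Rightarrow>\<^sub>L 'a"
  assumes T: "norm T \<le> r"
  shows "norm (sqfix r T) \<le> 1 - sqrt (1 - r)" "(1/2) *\<^sub>R (T + (sqfix r T o\<^sub>L sqfix r T)) = sqfix r T"
  using theI'[OF sqfix_ex[OF T]] by (auto simp: sqfix_def)

text \<open>Uniqueness in the whole ball identifies the fixed point found in \<open>C\<close> with
  \<open>sqfix\<close>.\<close>

lemma sqfix_mem:
  fixes T :: "'a::euclidean_space \<Rightarrow>\<^sub>L 'a"
  assumes T: "norm T \<le> r"
    and "closed C" "0 \<in> C" "\<And>X. X \<in> C \<Longrightarrow> (1/2) *\<^sub>R (T + (X o\<^sub>L X)) \<in> C"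
  shows "sqfix r T \<in> C"
proof -
  from sqfix_unique[OF assms] obtain X where X: "X \<in> C" "norm X \<le> 1 - sqrt (1 - r)"
    "(1/2) *\<^sub>R (T + (X o\<^sub>L X)) = X" by auto
  then have "X = sqfix r T" using sqfix_ex[OF T] sqfix[OF T] by blast
  then show ?thesis using X by simp
qed

text \<open>Two fixed points satisfy |X - Y| \<le> |T - S| / 2 + \<rho> |X - Y|; solving for |X - Y|
  gives the Lipschitz constant.\<close>

lemma continuous_on_sqfix: "continuous_on {T :: 'a::euclidean_space \<Rightarrow>\<^sub>L 'a. norm T \<le> r} (sqfix r)"
proof -
  define \<rho> where "\<rho> = 1 - sqrt (1 - r)"
  have \<rho>: "0 < 2 * (1 - \<rho>)" using radius(2) by (simp add: \<rho>_def)
  have lip: "dist (sqfix r T) (sqfix r S) \<le> 1 / (2 * (1 - \<rho>)) * dist T S"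
    if T: "norm T \<le> r" and S: "norm S \<le> r" for T S :: "'a \<Rightarrow>\<^sub>L 'a"
  proof -
    have "norm (sqfix r T - sqfix r S) \<le> norm (T - S) / 2 + \<rho> * norm (sqfix r T - sqfix r S)"
      using square_step_contraction[of "sqfix r T" \<rho> "sqfix r S" T S] sqfix(1)[OF T] sqfix(1)[OF S]
      by (simp add: sqfix(2)[OF T] sqfix(2)[OF S] \<rho>_def)
    then have "2 * (1 - \<rho>) * norm (sqfix r T - sqfix r S) \<le> norm (T - S)"
      by (simp add: algebra_simps)
    then show ?thesis using \<rho> by (simp add: dist_norm pos_le_divide_eq mult.commute)
  qed
  show ?thesis
    by (rule lipschitz_on_continuous_on[of "1 / (2 * (1 - \<rho>))"], rule lipschitz_onI)
      (use \<rho> lip in auto)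
qed

end

text \<open>Division by \<open>M\<close> brings T = 1 - S / M into norm at most 1 - m / M < 1, and
  the square root of \<open>S\<close> is sqrt M (1 - X) with X the fixed point for T. Keeping
  \<open>m\<close> and \<open>M\<close> as parameters makes the root continuous on the operators
  that share these bounds.\<close>

definition possqrt :: "real \<Rightarrow> real \<Rightarrow> ('a::euclidean_space \<Rightarrow>\<^sub>L 'a) \<Rightarrow> ('a \<Rightarrow>\<^sub>L 'a)" where
  "possqrt m M S = sqrt M *\<^sub>R (id_blinfun - sqfix (1 - m / M) (id_blinfun - (1 / M) *\<^sub>R S))"

definition bounded_positive :: "real \<Rightarrow> real \<Rightarrow> ('a::euclidean_space \<Rightarrow>\<^sub>L 'a) \<Rightarrow> bool" where
  "bounded_positive m M S \<longleftrightarrow> (\<forall>v w. S v \<bullet> w = v \<bullet> S w) \<and>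
     (\<forall>v. m * (norm v)\<^sup>2 \<le> S v \<bullet> v \<and> S v \<bullet> v \<le> M * (norm v)\<^sup>2)"

context
  fixes m M :: real
  assumes mM: "0 < m" "m \<le> M"
begin

lemma bounded_positive_norm:
  assumes "bounded_positive m M S"
  shows "norm (id_blinfun - (1 / M) *\<^sub>R S) \<le> 1 - m / M"
proof (rule norm_blinfun_bound)
  show "0 \<le> 1 - m / M" using mM by simp
  fix u
  have "norm ((\<lambda>v. v - (1 / M) *\<^sub>R S v) u) \<le> (1 - m / M) * norm u"
  proof (rule symmetric_norm_le)
    show "linear (\<lambda>v. v - (1 / M) *\<^sub>R S v)"
      by (rule linearI) (simp_all add: blinfun.add_right blinfun.scaleR_right algebra_simps)
    show "(v - (1 / M) *\<^sub>R S v) \<bullet> w = v \<bullet> (w - (1 / M) *\<^sub>R S w)" for v w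
      using assms by (simp add: bounded_positive_def inner_diff)
    fix v
    define s where "s = S v \<bullet> v"
    have "m * (norm v)\<^sup>2 \<le> s" "s \<le> M * (norm v)\<^sup>2"
      using assms by (auto simp: bounded_positive_def s_def)
    then have 1: "m / M * (norm v)\<^sup>2 \<le> s / M" and 2: "s / M \<le> (norm v)\<^sup>2"
      using mM by (simp_all add: field_simps)
    have e: "(v - (1 / M) *\<^sub>R S v) \<bullet> v = (norm v)\<^sup>2 - s / M"
      by (simp add: inner_diff power2_norm_eq_inner s_def)
    show "\<bar>(v - (1 / M) *\<^sub>R S v) \<bullet> v\<bar> \<le> (1 - m / M) * (norm v)\<^sup>2"
      unfolding e left_diff_distrib using 1 2 by linarith
  qed
  then show "norm (blinfun_apply (id_blinfun - (1 / M) *\<^sub>R S) u) \<le> (1 - m / M) * norm u"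
    by (simp add: blinfun.diff_left blinfun.scaleR_left)
qed

text \<open>The square relation is the fixed point equation rewritten. Symmetry and commutation with
  an operator \<open>R\<close> are closed conditions preserved by the iteration, so
  \<open>sqfix_mem\<close> yields them. Positivity follows from |X| < 1.\<close>

lemma possqrt:
  assumes S: "bounded_positive m M S"
  shows "possqrt m M S (possqrt m M S v) = S v"
    and "possqrt m M S v \<bullet> w = v \<bullet> possqrt m M S w"
    and "v \<noteq> 0 \<Longrightarrow> 0 < possqrt m M S v \<bullet> v"
    and "(\<And>v. blinfun_apply R (S v) = S (R v)) \<Longrightarrow> R (possqrt m M S v) = possqrt m M S (R v)"
proof -
  define r where "r = 1 - m / M"
  define T where "T = id_blinfun - (1 / M) *\<^sub>R S"
  define X where "X = sqfix r T"
  have r: "0 \<le> r" "r < 1" using mM by (auto simp: r_def)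
  have T: "norm T \<le> r" unfolding T_def r_def by (rule bounded_positive_norm[OF S])
  note X = sqfix[OF r T, folded X_def] sqfix_mem[OF r T, folded X_def]
  have P: "possqrt m M S v = sqrt M *\<^sub>R (v - X v)" for v
    by (simp add: possqrt_def X_def r_def T_def blinfun.scaleR_left blinfun.diff_left)
  have Tv: "T v = v - (1 / M) *\<^sub>R S v" for v
    by (simp add: T_def blinfun.scaleR_left blinfun.diff_left)
  have step: "((1/2) *\<^sub>R (T + (Z o\<^sub>L Z))) v = (1/2) *\<^sub>R (T v + Z (Z v))" for Z v
    by (simp add: blinfun.scaleR_left blinfun.add_left)
  have XX: "X v = (1/2) *\<^sub>R (T v + X (X v))" for v
    using step[of X v] by (simp add: X(2))
  have h: "v - X v - X (v - X v) = (1 / M) *\<^sub>R S v" for v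
  proof -
    have "2 *\<^sub>R X v = T v + X (X v)" using arg_cong[OF XX[of v], of "\<lambda>z. 2 *\<^sub>R z"] by simp
    then show ?thesis unfolding Tv by (simp add: blinfun.diff_right scaleR_2 algebra_simps)
  qed
  have "possqrt m M S (possqrt m M S v) = (sqrt M * sqrt M) *\<^sub>R (v - X v - X (v - X v))"
    unfolding P by (simp add: blinfun.scaleR_right blinfun.diff_right algebra_simps del: real_sqrt_mult_self)
  then show "possqrt m M S (possqrt m M S v) = S v"
    unfolding h using mM by simp
  have symS: "S v \<bullet> w = v \<bullet> S w" for v w using S by (simp add: bounded_positive_def)
  have "X \<in> {Z. \<forall>v w. blinfun_apply Z v \<bullet> w = v \<bullet> Z w}"
  proof (rule X(3))
    show "closed {Z :: 'a \<Rightarrow>\<^sub>L 'a. \<forall>v w. Z v \<bullet> w = v \<bullet> Z w}"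
      by (intro closed_Collect_all closed_Collect_eq continuous_intros)
    show "(1/2) *\<^sub>R (T + (Z o\<^sub>L Z)) \<in> {Z. \<forall>v w. blinfun_apply Z v \<bullet> w = v \<bullet> Z w}"
      if "Z \<in> {Z. \<forall>v w. blinfun_apply Z v \<bullet> w = v \<bullet> Z w}" for Z
      using that by (simp add: step Tv inner_add inner_diff symS)
  qed simp
  then have symX: "X v \<bullet> w = v \<bullet> X w" for v w by simp
  show "possqrt m M S v \<bullet> w = v \<bullet> possqrt m M S w"
    unfolding P by (simp add: inner_diff symX)
  show "0 < possqrt m M S v \<bullet> v" if "v \<noteq> 0"
  proof -
    have "X v \<bullet> v \<le> norm (X v) * norm v" by (rule norm_cauchy_schwarz)
    also have "norm (X v) \<le> (1 - sqrt (1 - r)) * norm v"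
      using X(1) norm_blinfun[of X v] by (meson mult_right_mono norm_ge_zero order_trans)
    finally have "X v \<bullet> v \<le> (1 - sqrt (1 - r)) * (v \<bullet> v)"
      by (simp add: mult_right_mono power2_norm_eq_inner[symmetric] power2_eq_square mult.assoc)
    also have "\<dots> < 1 * (v \<bullet> v)" using that r by (intro mult_strict_right_mono) auto
    finally show ?thesis unfolding P using mM by (simp add: inner_diff)
  qed
  show "R (possqrt m M S v) = possqrt m M S (R v)" if R: "\<And>v. R (S v) = S (R v)"
  proof -
    have "X \<in> {Z. \<forall>v. R (blinfun_apply Z v) = Z (R v)}"
    proof (rule X(3))
      show "closed {Z. \<forall>v. R (blinfun_apply Z v) = Z (R v)}"
        by (intro closed_Collect_all closed_Collect_eq continuous_intros)
      show "(1/2) *\<^sub>R (T + (Z o\<^sub>L Z)) \<in> {Z. \<forall>v. R (blinfun_apply Z v) = Z (R v)}"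
        if "Z \<in> {Z. \<forall>v. R (blinfun_apply Z v) = Z (R v)}" for Z
        using that by (simp add: step Tv blinfun.add_right blinfun.diff_right blinfun.scaleR_right R)
    qed simp
    then show ?thesis unfolding P by (simp add: blinfun.diff_right blinfun.scaleR_right)
  qed
qed

lemma continuous_on_possqrt: "continuous_on {S. bounded_positive m M S} (possqrt m M)"
  unfolding possqrt_def using mM bounded_positive_norm
  by (intro continuous_intros continuous_on_compose2[OF continuous_on_sqfix]) auto

end

section \<open>Polar decomposition of symplectic maps\<close>

lemma linear_blinfun: "linear (blinfun_apply P)"
  by (simp add: blinfun.bounded_linear_right bounded_linear.linear)

definition gram_op :: "(complex ^ 'n \<Rightarrow> complex ^ 'n) \<Rightarrow> (complex ^ 'n) \<Rightarrow>\<^sub>L (complex ^ 'n)" where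
  "gram_op N = Blinfun (\<lambda>v. adjoint N (N v))"

lemma gram_op: assumes "linear N" shows "gram_op N v = adjoint N (N v)" "gram_op N v \<bullet> w = N v \<bullet> N w"
proof -
  have "bounded_linear (\<lambda>v. adjoint N (N v))"
    using linear_compose[OF assms adjoint_linear[OF assms]]
    by (simp add: linear_linear[symmetric] comp_def linear_conv_bounded_linear)
  then show 1: "gram_op N v = adjoint N (N v)" for v
    by (simp add: gram_op_def bounded_linear_Blinfun_apply)
  show "gram_op N v \<bullet> w = N v \<bullet> N w"
    using adjoint_works[OF assms, of w "N v"] by (simp add: 1 inner_commute)
qed

text \<open>An upper bound of a symplectic map bounds its inverse as well: |v|^2 is the form
  evaluated at N v and N (i v), which is at most |N v| times B |v|.\<close>

lemma sympl_norm_lower: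
  assumes N: "sympl N" and B: "\<And>v. norm (N v) \<le> B * norm v" "0 < B"
  shows "norm v \<le> B * norm (N v)"
proof (cases "v = 0")
  case False
  have ni: "norm (\<i> *s v) = norm v" for v :: "complex ^ 'a" by (simp add: norm_eq_sqrt_inner inner_i_i)
  have "(norm v)\<^sup>2 = std_form (N v) (N (\<i> *s v))"
    using N by (simp add: sympl_def std_form_i power2_norm_eq_inner)
  also have "\<dots> \<le> norm (\<i> *s N v) * norm (N (\<i> *s v))"
    unfolding std_form_inner by (rule norm_cauchy_schwarz)
  also have "\<dots> \<le> norm (N v) * (B * norm v)"
    using B(1)[of "\<i> *s v"] by (simp add: ni mult_left_mono)
  finally have "norm v * norm v \<le> norm v * (B * norm (N v))" by (simp add: power2_eq_square mult_ac)
  then show ?thesis using False by (simp add: mult_le_cancel_left_pos)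
qed (use B(2) in simp)

text \<open>The square root of N^T N. For symplectic N of norm at most \<open>B\<close> its
  quadratic form lies between 1 / B^2 and B^2, by \<open>sympl_norm_lower\<close>.\<close>

definition polar_pos :: "real \<Rightarrow> (complex ^ 'n \<Rightarrow> complex ^ 'n) \<Rightarrow> (complex ^ 'n) \<Rightarrow>\<^sub>L (complex ^ 'n)" where
  "polar_pos B N = possqrt (1 / B\<^sup>2) (B\<^sup>2) (gram_op N)"

lemma gram_op_bounded_positive:
  assumes N: "sympl N" and B: "\<And>v. norm (N v) \<le> B * norm v" "1 \<le> B"
  shows "bounded_positive (1 / B\<^sup>2) (B\<^sup>2) (gram_op N)"
  unfolding bounded_positive_def
proof (intro conjI allI)
  have l: "linear N" using N by (simp add: sympl_def)
  note g = gram_op(2)[OF l]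
  show "gram_op N v \<bullet> w = v \<bullet> gram_op N w" for v w by (metis g inner_commute)
  fix v
  have "norm v \<le> B * norm (N v)" using sympl_norm_lower[OF N B(1)] B(2) by simp
  then have "(norm v)\<^sup>2 \<le> B\<^sup>2 * (norm (N v))\<^sup>2" by (metis norm_ge_zero power_mono power_mult_distrib)
  then show "1 / B\<^sup>2 * (norm v)\<^sup>2 \<le> gram_op N v \<bullet> v"
    using B(2) by (simp add: g power2_norm_eq_inner[symmetric] field_simps)
  have "(norm (N v))\<^sup>2 \<le> (B * norm v)\<^sup>2" using B by (intro power_mono) auto
  then show "gram_op N v \<bullet> v \<le> B\<^sup>2 * (norm v)\<^sup>2"
    by (simp add: g power2_norm_eq_inner[symmetric] power_mult_distrib)
qed

lemma polar_bounds: assumes "1 \<le> (B::real)" shows "0 < 1 / B\<^sup>2" "1 / B\<^sup>2 \<le> B\<^sup>2"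
proof -
  have "1 \<le> B\<^sup>2" using assms by (simp add: one_le_power)
  then show "0 < 1 / B\<^sup>2" "1 / B\<^sup>2 \<le> B\<^sup>2"
    using mult_mono[of 1 "B\<^sup>2" 1 "B\<^sup>2"] by (auto simp: divide_simps power2_eq_square)
qed

context
  fixes N :: "complex ^ 'n \<Rightarrow> complex ^ 'n" and B :: real
  assumes N: "sympl N" and B: "\<And>v. norm (N v) \<le> B * norm v" "1 \<le> B"
begin

lemmas polar_props = possqrt[OF polar_bounds[OF B(2)] gram_op_bounded_positive[OF N B], folded polar_pos_def]

lemma polar_pos_sq: "polar_pos B N v \<bullet> polar_pos B N w = N v \<bullet> N w"
  using polar_props(2)[of "polar_pos B N v" w] gram_op(2)[of N v w] N
  by (simp add: polar_props(1) sympl_def)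

lemma polar_pos_bij: "bij (polar_pos B N)"
proof -
  have l: "linear (polar_pos B N)" by (simp add: linear_blinfun)
  have "inj (polar_pos B N)"
    unfolding linear_injective_0[OF l] using polar_props(3) by (metis inner_zero_left less_irrefl)
  then show ?thesis using linear_injective_imp_surjective[OF l] by (simp add: bij_def)
qed

text \<open>The positive part P is again symplectic. With S = N^T N one has S i S = i, so the
  conjugate R = - i P i of P is a square root of the inverse of S that commutes with P. Then (P R)^2
  = 1, and positivity of P and R leaves only P R = 1.\<close>

lemma polar_pos_i: "polar_pos B N (\<i> *s polar_pos B N v) = \<i> *s v"
proof -
  define P where "P = blinfun_apply (polar_pos B N)"
  define S where "S = blinfun_apply (gram_op N)"
  note pp = polar_props[folded P_def S_def]
  have l: "linear N" using N by (simp add: sympl_def)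
  have lP: "linear P" by (simp add: P_def linear_blinfun)
  have S: "S v = adjoint N (N v)" for v by (simp add: S_def gram_op(1)[OF l])
  \<comment> \<open>Symplecticity in adjoint form is N^T i N = i; as N is onto, also N i N^T = i.
    Together these give S i S = i.\<close>
  have aj: "adjoint N (\<i> *s N v) = \<i> *s v" for v
  proof -
    have "w \<bullet> adjoint N (\<i> *s N v) = w \<bullet> (\<i> *s v)" for w
      using N by (simp add: adjoint_works[OF l] sympl_def std_form_inner inner_commute[of w] inner_commute[of "N w"])
    then show ?thesis by (meson inner_eq_zero_iff vector_eq_ldot)
  qed
  have ja: "N (\<i> *s adjoint N u) = \<i> *s u" for u
  proof -
    obtain v where "N v = - (\<i> *s u)" using sympl_surj[OF N] by (metis surjD)
    then have u: "u = \<i> *s N v" by (simp add: i_cmult_linear)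
    show ?thesis unfolding u aj by (simp add: linear_neg[OF l])
  qed
  have SjS: "S (\<i> *s S v) = \<i> *s v" for v by (simp add: S ja aj)
  have lS: "linear S" by (simp add: S_def linear_blinfun)
  have surS: "\<exists>u. S u = w" for w
    using SjS[of "- (\<i> *s w)"] by (metis i_cmult_linear(3) i_i_cmult minus_minus)
  \<comment> \<open>Conjugation of P by i, since the inverse of i is - i.\<close>
  define R where "R = Blinfun (\<lambda>v. - (\<i> *s P (\<i> *s v)))"
  have "linear (\<lambda>v. - (\<i> *s P (\<i> *s v)))"
    by (rule linearI) (simp_all add: i_cmult_linear linear_add[OF lP] linear_scale[OF lP])
  then have R: "R v = - (\<i> *s P (\<i> *s v))" for v
    unfolding R_def by (simp add: bounded_linear_Blinfun_apply linear_conv_bounded_linear)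
  have PS: "P (S v) = S (P v)" for v
    using pp(4)[of "gram_op N" v] by (simp add: S_def)
  have "R (S v) = S (R v)" for v
  proof -
    obtain u where u: "S u = \<i> *s v" using surS by blast
    have "S (\<i> *s P (\<i> *s v)) = \<i> *s P u"
      by (simp add: u[symmetric] PS SjS)
    moreover have "\<i> *s S v = u"
    proof -
      have "v = - (\<i> *s S u)" by (simp add: u)
      then have "S v = - (\<i> *s u)" by (metis SjS linear_neg[OF lS])
      then show ?thesis by (simp add: i_cmult_linear)
    qed
    ultimately show ?thesis by (simp add: R linear_neg[OF lS])
  qed
  then have RP: "R (P v) = P (R v)" for v using pp(4)[of R v] by (simp add: S_def)
  have PRPR: "P (R (P (R v))) = v" for v
  proof -
    have "P (R (P (R v))) = P (P (R (R v)))" by (simp add: RP)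
    also have "\<dots> = S (R (R v))" by (simp add: pp(1))
    also have "R (R v) = - (\<i> *s S (\<i> *s v))"
      by (simp add: R i_cmult_linear linear_neg[OF lP] pp(1))
    also have "S \<dots> = v" by (simp add: linear_neg[OF lS] SjS)
    finally show ?thesis .
  qed
  \<comment> \<open>If P R differs from the identity, the involution P R has a nonzero vector w with
    P R w = - w. Positivity of P makes R w \<bullet> w nonpositive, while as a conjugate of P it
    must be positive.\<close>
  have "P (R v) = v" for v
  proof (rule ccontr)
    assume ne: "P (R v) \<noteq> v"
    define w where "w = v - P (R v)"
    have "w \<noteq> 0" using ne by (simp add: w_def)
    have PRw: "P (R w) = - w" 
      by (simp add: w_def blinfun.diff_right linear_diff[OF lP] PRPR)
    have "0 \<le> P (R w) \<bullet> R w" using pp(3)[of "R w"] by (cases "R w = 0") auto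
    then have "R w \<bullet> w \<le> 0" by (simp add: PRw inner_commute)
    moreover have "R w \<bullet> w = P (\<i> *s w) \<bullet> (\<i> *s w)" by (simp add: R inner_i_skew)
    moreover have "\<i> *s w \<noteq> 0" using \<open>w \<noteq> 0\<close> inner_i_i[of w w] by (metis inner_eq_zero_iff)
    ultimately show False using pp(3)[of "\<i> *s w"] by simp
  qed
  from this[of "- (\<i> *s v)"] show ?thesis
    by (simp add: R i_cmult_linear P_def blinfun.minus_right)
qed

lemma polar_pos_sympl: "sympl (polar_pos B N)"
  unfolding sympl_def
proof (intro conjI allI)
  show "linear (polar_pos B N)" by (simp add: linear_blinfun)
  show "std_form (polar_pos B N v) (polar_pos B N w) = std_form v w" for v w
    using polar_props(2)[of "\<i> *s polar_pos B N v" w] by (simp add: std_form_inner polar_pos_i)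
qed

definition polar_unit :: "complex ^ 'n \<Rightarrow> complex ^ 'n" where
  "polar_unit v = N (inv_into UNIV (polar_pos B N) v)"

lemma polar_unit_pos: "polar_unit (polar_pos B N v) = N v"
  using polar_pos_bij by (simp add: polar_unit_def bij_def)

lemma polar_cases: obtains w where "v = polar_pos B N w"
  using polar_pos_bij by (metis bij_def surjD)

lemma polar_unit_inner: "polar_unit v \<bullet> polar_unit w = v \<bullet> w"
proof -
  obtain v' w' where "v = polar_pos B N v'" "w = polar_pos B N w'" by (metis polar_cases)
  then show ?thesis by (simp add: polar_unit_pos polar_pos_sq)
qed

text \<open>Only the last clause has content. If i P u = P z, then N z and i N u have the same inner
  product with every N w: both reduce to the form at w and u, using that P and N are symplectic. The
  vectors N w exhaust the space.\<close>

lemma polar_unit_clinear: "clinear polar_unit"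
proof (rule clinearI)
  have l: "linear N" using N by (simp add: sympl_def)
  show "polar_unit (v + w) = polar_unit v + polar_unit w" for v w
  proof -
    obtain v' w' where "v = polar_pos B N v'" "w = polar_pos B N w'" by (metis polar_cases)
    then show ?thesis by (simp add: polar_unit_pos linear_add[OF l] flip: blinfun.add_right)
  qed
  show "polar_unit (r *\<^sub>R v) = r *\<^sub>R polar_unit v" for r v
  proof -
    obtain v' where "v = polar_pos B N v'" by (metis polar_cases)
    then show ?thesis by (simp add: polar_unit_pos linear_scale[OF l] flip: blinfun.scaleR_right)
  qed
  show "polar_unit (\<i> *s v) = \<i> *s polar_unit v" for v
  proof -
    obtain u where u: "v = polar_pos B N u" by (metis polar_cases)
    obtain z where z: "\<i> *s v = polar_pos B N z" by (metis polar_cases)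
    have "N w \<bullet> N z = N w \<bullet> (\<i> *s N u)" for w
    proof -
      have "N w \<bullet> N z = polar_pos B N w \<bullet> (\<i> *s polar_pos B N u)"
        using polar_pos_sq[of w z] by (simp add: z[symmetric] u)
      also have "\<dots> = w \<bullet> (\<i> *s u)"
        using polar_props(2)[of w "\<i> *s polar_pos B N u"] by (simp add: polar_pos_i)
      also have "\<dots> = - std_form w u" by (simp add: std_form_inner inner_i_skew)
      also have "\<dots> = - std_form (N w) (N u)" using N by (simp add: sympl_def)
      also have "\<dots> = N w \<bullet> (\<i> *s N u)" by (simp add: std_form_inner inner_i_skew)
      finally show ?thesis .
    qed
    then have "w \<bullet> N z = w \<bullet> (\<i> *s N u)" for w using sympl_surj[OF N] by (metis surjD)
    then have "N z = \<i> *s N u" by (meson vector_eq_ldot)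
    then show ?thesis using z u by (simp add: polar_unit_pos)
  qed
qed

end

text \<open>A complex linear symmetric operator has a real determinant, as its matrix is Hermitian.
  Along the segment from the identity to \<open>H\<close> the operators stay injective, so this real
  determinant cannot change sign.\<close>

lemma cdet_positive:
  assumes H: "clinear H" and sym: "\<And>v w. H v \<bullet> w = v \<bullet> H w" and pos: "\<And>v. v \<noteq> 0 \<Longrightarrow> 0 < H v \<bullet> v"
  shows "sgn (cdet H) = 1"
proof -
  have real: "Im (cdet K) = 0" if K: "clinear K" "\<And>v w. K v \<bullet> w = v \<bullet> K w" for K :: "complex ^ 'a \<Rightarrow> complex ^ 'a"
  proof -
    have inn: "v $ i = Complex (v \<bullet> axis i 1) (v \<bullet> (\<i> *s axis i 1))" for v :: "complex ^ 'a" and i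
    proof -
      have "\<i> *s axis i 1 = (axis i \<i> :: complex ^ 'a)" by (simp add: vec_eq_iff axis_def)
      then show ?thesis by (simp add: inner_axis complex_eq_iff inner_complex_def)
    qed
    have "cnj (K (axis j 1) $ i) = K (axis i 1) $ j" for i j
    proof -
      have Ki: "K (\<i> *s v) = \<i> *s K v" for v using K(1) by (simp add: clinear_def)
      have "K (axis j 1) \<bullet> (\<i> *s axis i 1) = axis j 1 \<bullet> (\<i> *s K (axis i 1))" by (simp add: K(2) Ki)
      also have "\<dots> = - (K (axis i 1) \<bullet> (\<i> *s axis j 1))"
        by (subst inner_commute) (rule inner_i_skew)
      finally have b: "K (axis j 1) \<bullet> (\<i> *s axis i 1) = - (K (axis i 1) \<bullet> (\<i> *s axis j 1))" .
      have a: "K (axis j 1) \<bullet> axis i 1 = K (axis i 1) \<bullet> axis j 1" by (metis K(2) inner_commute)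
      show ?thesis
        unfolding inn[of "K (axis j 1)" i] inn[of "K (axis i 1)" j] complex_cnj b minus_minus a by (rule refl)
    qed
    then have "cnj (matrix K $ i $ j) = transpose (matrix K) $ i $ j" for i j
      by (simp add: matrix_def transpose_def)
    moreover have "cnj (det A) = det (\<chi> i j. cnj (A $ i $ j))" for A :: "complex ^ 'a ^ 'a"
      by (simp add: det_def)
    ultimately have "cnj (cdet K) = det (\<chi> i j. transpose (matrix K) $ i $ j)"
      by (simp add: cdet_def)
    then have "cnj (cdet K) = cdet K" by (simp add: det_transpose cdet_def)
    then show ?thesis by (simp add: complex_eq_iff)
  qed
  define K where "K t v = (1 - t) *\<^sub>R v + t *\<^sub>R H v" for t :: real and v
  have l: "linear H" using H by (simp add: clinear_def)
  have Kc: "clinear (K t)" for t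
    using H by (intro clinearI) (auto simp: K_def clinear_def linear_add[OF l] linear_scale[OF l] i_cmult_linear algebra_simps)
  have nz: "cdet (K t) \<noteq> 0" if "t \<in> {0..1}" for t
  proof (rule cdet_nonzero[OF Kc])
    fix v assume K0: "K t v = 0"
    show "v = 0"
    proof (rule ccontr)
      assume v: "v \<noteq> 0"
      have "((1 - t) *\<^sub>R v + t *\<^sub>R H v) \<bullet> v = 0" using K0 by (simp add: K_def)
      then have "0 = (1 - t) * (v \<bullet> v) + t * (H v \<bullet> v)" by (simp only: inner_add_left inner_scaleR_left)
      moreover have p: "0 < v \<bullet> v" "0 < H v \<bullet> v" using v pos by auto
      have "0 < (1 - t) * (v \<bullet> v) + t * (H v \<bullet> v)"
      proof (cases "t = 0")
        case False
        then have "0 < t * (H v \<bullet> v)" using p that by simp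
        moreover have "0 \<le> (1 - t) * (v \<bullet> v)" using that by (intro mult_nonneg_nonneg) auto
        ultimately show ?thesis by linarith
      qed (use p in simp)
      ultimately show False by simp
    qed
  qed
  have "continuous_on {0..1} (\<lambda>t. Re (cdet (K t)))"
    unfolding cdet_def matrix_def K_def det_def
    by (simp, intro continuous_intros)
  moreover have "K 0 = (\<lambda>v. v)" by (simp add: K_def fun_eq_iff)
  then have "cdet (K 0) = 1" by simp
  moreover have "Re (cdet (K t)) \<noteq> 0" if "t \<in> {0..1}" for t
    using nz[OF that] real[OF Kc, of t] sym by (auto simp: K_def inner_add complex_eq_iff)
  ultimately have "0 < Re (cdet (K 1))"
    using IVT2'[of "\<lambda>t. Re (cdet (K t))" 1 0 0] by (smt (verit) atLeastAtMost_iff one_complex.simps(1))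
  moreover have "K 1 = H" by (simp add: K_def fun_eq_iff)
  ultimately have "0 < Re (cdet H)" "cdet H = of_real (Re (cdet H))"
    using real[OF H sym] by (auto simp: complex_eq_iff)
  then show ?thesis by (metis of_real_1 sgn_of_real sgn_pos)
qed

text \<open>Since U is complex linear, the complex linear part of U P is U times that of P. The
  latter is the mean of P and its conjugate by i, hence symmetric and positive, and its determinant
  contributes no phase. This replaces polar decompositions by complex linear parts from here
  on.\<close>

lemma polar_phase:
  assumes NUP: "\<And>v. N v = U (P v)" and U: "clinear U" and P: "linear P"
    and sym: "\<And>v w. P v \<bullet> w = v \<bullet> P w" and pos: "\<And>v. v \<noteq> 0 \<Longrightarrow> 0 < P v \<bullet> v"
  shows "sgn (cdet (cpart N)) = sgn (cdet U)"
proof -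
  have lU: "linear U" and Ui: "\<And>v. U (\<i> *s v) = \<i> *s U v" using U by (auto simp: clinear_def)
  have "cpart N = (\<lambda>v. U (cpart P v))"
    by (rule ext) (simp add: cpart_def NUP linear_scale[OF lU] linear_diff[OF lU] Ui)
  then have "cdet (cpart N) = cdet U * cdet (cpart P)"
    using cdet_compose[OF clinear_cpart[OF P] U] by simp
  moreover have "sgn (cdet (cpart P)) = 1"
  proof (rule cdet_positive[OF clinear_cpart[OF P]])
    have *: "(\<i> *s P (\<i> *s v)) \<bullet> w = v \<bullet> (\<i> *s P (\<i> *s w))" for v w
      using sym[of "\<i> *s v" "\<i> *s w"] inner_i_skew[of v "P (\<i> *s w)"] by (simp add: inner_i_skew)
    show "cpart P v \<bullet> w = v \<bullet> cpart P w" for v w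
      by (simp add: cpart_def inner_diff sym *)
    show "0 < cpart P v \<bullet> v" if "v \<noteq> 0" for v
    proof -
      have "\<i> *s v \<noteq> 0" using that inner_i_i[of v v] by (metis inner_eq_zero_iff)
      then have "0 < P (\<i> *s v) \<bullet> (\<i> *s v)" by (rule pos)
      then show ?thesis using pos[OF that] by (simp add: cpart_def inner_diff inner_i_skew)
    qed
  qed
  ultimately show ?thesis by (simp add: sgn_mult)
qed

lemma sympl_bound: assumes "linear N" obtains B where "1 \<le> B" "\<And>v. norm (N v) \<le> B * norm (v :: complex ^ 'n)"
proof -
  obtain B where B: "\<And>v. norm (N v) \<le> B * norm v" using linear_bounded[OF assms] by blast
  have "norm (N v) \<le> max 1 B * norm v" for v
    by (rule order_trans[OF B mult_right_mono]) auto
  then show ?thesis by (intro that[of "max 1 B"]) auto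
qed

section \<open>The rotation phase in unitary frames\<close>

text \<open>The content is that an alternating form pulls back to an alternating form; only then
  does the restricted functional \<open>wedge\<close> evaluate it instead of returning a default
  value.\<close>

lemma det_map_wedge:
  fixes g :: "complex ^ 'k::finite \<Rightarrow> 'e" and v :: "'k \<Rightarrow> 'e"
  assumes g: "complex_frame E J x g" and lin: "fibre_linear E x F y U"
    and UJ: "\<And>v. v \<in> fibre E x \<Longrightarrow> U (J v) = J' (U v)" and v: "v \<in> families E x"
  shows "det_map E x F J' y U (wedge E J x v) = wedge F J' y (\<lambda>i. U (v i))"
proof -
  note r = complex_frame_real[OF g]
  have Jf: "J a \<in> fibre E x" if "a \<in> fibre E x" for a
    using frame_cases[OF r that] g frame_in[OF r] by (metis complex_frame_def)
  have sf: "vscale E c a \<in> fibre E x" if "a \<in> fibre E x" for a c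
    using frame_cases[OF r that] frame_ops(3)[OF r] frame_in[OF r] by metis
  have Uf: "U a \<in> fibre F y" if "a \<in> fibre E x" for a using lin that by (simp add: fibre_linear_def)
  have Ua: "U (vadd E a b) = vadd F (U a) (U b)" if "a \<in> fibre E x" "b \<in> fibre E x" for a b
    using lin that by (simp add: fibre_linear_def)
  have Us: "U (vscale E c a) = vscale F c (U a)" if "a \<in> fibre E x" for a c
    using lin that by (simp add: fibre_linear_def)
  have Uc: "U (cscale E J c a) = cscale F J' c (U a)" if "a \<in> fibre E x" for a c
    using that by (simp add: cscale_def Ua Us sf Jf UJ)
  have upd: "(\<lambda>i. U ((v(j := a)) i)) = (\<lambda>i. U (v i))(j := U a)" for v :: "'k \<Rightarrow> 'e" and j a by auto
  have fam: "(\<lambda>i. U (v i)) \<in> families F y" if "v \<in> families E x" for v :: "'k \<Rightarrow> _"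
    using that Uf by (simp add: families_def)
  have famu: "v(j := a) \<in> families E x" if "v \<in> families E x" "a \<in> fibre E x" for v :: "'k \<Rightarrow> _" and j a
    using that by (simp add: families_def)
  have pull: "(\<lambda>v\<in>families E x. \<beta> (\<lambda>i. U (v i))) \<in> alt_forms E J x"
    if \<beta>: "\<beta> \<in> alt_forms F J' y" for \<beta> :: "('k \<Rightarrow> _) \<Rightarrow> complex"
  proof -
    have A: "\<beta> (v(i := vadd F a b)) = \<beta> (v(i := a)) + \<beta> (v(i := b))"
        "\<beta> (v(i := cscale F J' c a)) = c * \<beta> (v(i := a))"
      if "v \<in> families F y" "a \<in> fibre F y" "b \<in> fibre F y" for v i a b c
      using \<beta> that by (auto simp: alt_forms_def)
    have "\<forall>v\<in>families F y. \<forall>i j. i \<noteq> j \<and> v i = v j \<longrightarrow> \<beta> v = 0"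
      using \<beta> unfolding alt_forms_def by blast
    then have B: "\<beta> v = 0" if "v \<in> families F y" "i \<noteq> j" "v i = v j" for v i j using that by blast
    have 1: "\<beta> (\<lambda>i. U ((v(j := vadd E a b)) i)) = \<beta> (\<lambda>i. U ((v(j := a)) i)) + \<beta> (\<lambda>i. U ((v(j := b)) i))"
      and 2: "\<beta> (\<lambda>i. U ((v(j := cscale E J c a)) i)) = c * \<beta> (\<lambda>i. U ((v(j := a)) i))"
      if "v \<in> families E x" "a \<in> fibre E x" "b \<in> fibre E x" for v j a b c
      unfolding upd Ua[OF that(2,3)] Uc[OF that(2)]
      by (rule A(1)[OF fam[OF that(1)] Uf[OF that(2)] Uf[OF that(3)]],
          rule A(2)[OF fam[OF that(1)] Uf[OF that(2)] Uf[OF that(3)]])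
    have 3: "\<beta> (\<lambda>i. U (v i)) = 0" if "v \<in> families E x" "i \<noteq> j" "v i = v j" for v i j
      by (rule B[OF fam[OF that(1)] that(2)]) (simp add: that(3))
    show ?thesis
      unfolding alt_forms_def
      by (intro CollectI conjI ballI allI impI restrict_extensional;
          (elim conjE)?; simp only: restrict_apply' famu fibre_closed[OF g] 1 2 3)
  qed
  show ?thesis
    unfolding det_map_def wedge_def by (rule restrict_ext) (simp only: restrict_apply' pull v)
qed

lemma frame_rep:
  fixes g :: "complex ^ 'k::finite \<Rightarrow> 'e" and g' :: "complex ^ 'k \<Rightarrow> 'f"
  assumes A: "fibre_symplectic_iso E x F y A"
    and g: "unitary_frame E J \<tau> x g" and g': "unitary_frame F J' \<tau>' y g'"
  shows "\<exists>N. sympl N \<and> (\<forall>v. A (g v) = g' (N v))"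
proof -
  note r = unitary_frame_real[OF g] and r' = unitary_frame_real[OF g']
  define N where "N v = inv_into UNIV g' (A (g v))" for v
  have Af: "A (g v) \<in> fibre F y" for v
    using A frame_in[OF r] by (simp add: fibre_symplectic_iso_def fibre_linear_def)
  have N: "g' (N v) = A (g v)" for v unfolding N_def by (rule frame_inv(2)[OF r' Af])
  have "sympl N"
    unfolding sympl_def
  proof (intro conjI allI linearI)
    show "N (v + w) = N v + N w" for v w
    proof (subst frame_eq_iff[OF r', symmetric])
      show "g' (N (v + w)) = g' (N v + N w)"
        using A frame_in[OF r] unfolding frame_ops(2)[OF r', symmetric] N frame_ops(2)[OF r, symmetric]
        by (simp add: fibre_symplectic_iso_def fibre_linear_def)
    qed
    show "N (c *\<^sub>R v) = c *\<^sub>R N v" for v c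
    proof (subst frame_eq_iff[OF r', symmetric])
      show "g' (N (c *\<^sub>R v)) = g' (c *\<^sub>R N v)"
        using A frame_in[OF r] unfolding frame_ops(3)[OF r', symmetric] N frame_ops(3)[OF r, symmetric]
        by (simp add: fibre_symplectic_iso_def fibre_linear_def)
    qed
    fix v w
    have "std_form (N v) (N w) = omega F (g' (N v)) (g' (N w))" using g' by (simp add: unitary_frame_def)
    also have "\<dots> = omega E (g v) (g w)"
      unfolding N using A frame_in[OF r] by (simp add: fibre_symplectic_iso_def)
    also have "\<dots> = std_form v w" using g by (simp add: unitary_frame_def)
    finally show "std_form (N v) (N w) = std_form v w" .
  qed
  then show ?thesis using N by metis
qed

text \<open>Every polar decomposition yields the same number, which gives the definite description
  in \<open>rotation_phase\<close> its uniqueness.\<close>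

lemma polar_decomposition_phase:
  fixes g :: "complex ^ 'k::finite \<Rightarrow> 'e"
  assumes g: "unitary_frame E J \<tau> x g" and g': "unitary_frame E J \<tau> y g'"
    and ux: "unitary_at E J \<tau> x" and uy: "unitary_at E J \<tau> y"
    and A: "\<And>v. A (g v) = g' (N v)" and pd: "polar_decomposition E J x y A U P"
  shows "\<tau> y (det_map E x E J y U (inv_into (det_line E J x) (\<tau> x) 1)) = sgn (cdet (cpart N))"
proof -
  note c = unitary_frame_complex[OF g] and c' = unitary_frame_complex[OF g']
  note r = unitary_frame_real[OF g] and r' = unitary_frame_real[OF g']
  note gf = frame_in[OF r] and gf' = frame_in[OF r']
  have Pl: "fibre_linear E x E x P" and Ul: "fibre_linear E x E y U"
    and Ps: "\<And>v w. v \<in> fibre E x \<Longrightarrow> w \<in> fibre E x \<Longrightarrow> omega E (P v) (J w) = omega E v (J (P w))"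
    and Pp: "\<And>v. v \<in> fibre E x \<Longrightarrow> v \<noteq> vzero E x \<Longrightarrow> omega E (P v) (J v) > 0"
    and UJ: "\<And>v. v \<in> fibre E x \<Longrightarrow> U (J v) = J (U v)"
    and Uh: "\<And>v w. v \<in> fibre E x \<Longrightarrow> w \<in> fibre E x \<Longrightarrow> hermitian E J (U v) (U w) = hermitian E J v w"
    and AUP: "\<And>v. v \<in> fibre E x \<Longrightarrow> A v = U (P v)"
    using pd unfolding polar_decomposition_def by blast+
  have Jg: "J (g v) = g (\<i> *s v)" "J (g' v) = g' (\<i> *s v)" for v
    using c c' by (simp_all add: complex_frame_def)
  have og: "omega E (g v) (g w) = std_form v w" for v w using g by (simp add: unitary_frame_def)
  define U0 where "U0 v = inv_into UNIV g' (U (g v))" for v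
  define P0 where "P0 v = inv_into UNIV g (P (g v))" for v
  have U0: "g' (U0 v) = U (g v)" for v
    unfolding U0_def by (rule frame_inv(2)[OF r']) (use Ul gf in \<open>simp add: fibre_linear_def\<close>)
  have P0: "g (P0 v) = P (g v)" for v
    unfolding P0_def by (rule frame_inv(2)[OF r]) (use Pl gf in \<open>simp add: fibre_linear_def\<close>)
  have "clinear U0"
  proof (rule clinearI; subst frame_eq_iff[OF r', symmetric])
    show "g' (U0 (v + w)) = g' (U0 v + U0 w)" for v w
      unfolding frame_ops(2)[OF r', symmetric] U0 frame_ops(2)[OF r, symmetric]
      using Ul gf by (simp add: fibre_linear_def)
    show "g' (U0 (t *\<^sub>R v)) = g' (t *\<^sub>R U0 v)" for t v
      unfolding frame_ops(3)[OF r', symmetric] U0 frame_ops(3)[OF r, symmetric]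
      using Ul gf by (simp add: fibre_linear_def)
    show "g' (U0 (\<i> *s v)) = g' (\<i> *s U0 v)" for v
      unfolding Jg[symmetric] U0 by (rule UJ[OF gf])
  qed
  moreover have "linear P0"
  proof (rule linearI; subst frame_eq_iff[OF r, symmetric])
    show "g (P0 (v + w)) = g (P0 v + P0 w)" for v w
      unfolding frame_ops(2)[OF r, symmetric] P0 using Pl gf frame_ops(2)[OF r, symmetric]
      by (simp add: fibre_linear_def)
    show "g (P0 (t *\<^sub>R v)) = g (t *\<^sub>R P0 v)" for t v
      unfolding frame_ops(3)[OF r, symmetric] P0 using Pl gf frame_ops(3)[OF r, symmetric]
      by (simp add: fibre_linear_def)
  qed
  moreover have "P0 v \<bullet> w = v \<bullet> P0 w" for v w
    using Ps[OF gf gf, of v w] unfolding P0[symmetric] Jg og std_form_i .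
  moreover have "0 < P0 v \<bullet> v" if "v \<noteq> 0" for v
  proof -
    have "g v \<noteq> vzero E x" using that frame_eq_iff[OF r, of v 0] frame_ops(1)[OF r] by simp
    from Pp[OF gf this] show ?thesis unfolding P0[symmetric] Jg og std_form_i .
  qed
  moreover have "N v = U0 (P0 v)" for v
  proof -
    have "g' (N v) = g' (U0 (P0 v))" using AUP[OF gf, of v] by (simp add: U0 P0 A)
    then show ?thesis by (simp add: frame_eq_iff[OF r'])
  qed
  ultimately have "sgn (cdet (cpart N)) = sgn (cdet U0)" by (intro polar_phase[of N U0 P0]) auto
  moreover have w: "det_map E x E J y U (inv_into (det_line E J x) (\<tau> x) 1) = wedge E J y (\<lambda>i. g' (U0 (axis i 1)))"
    unfolding inv_triv_unitary_frame[OF g ux] U0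
    by (rule det_map_wedge[OF c Ul UJ frame_families[OF r]])
  moreover have t: "\<tau> y (wedge E J y (\<lambda>i. g' (U0 (axis i 1)))) = cdet U0"
    unfolding cdet_col by (rule triv_wedge_unitary_frame[OF g' uy])
  \<comment> \<open>The image of the frame under \<open>U\<close> has the identity as Gram matrix,
    so the determinant is its own sign.\<close>
  moreover have "cmod (cdet U0) = 1"
  proof -
    have "hermitian E J (g' (U0 v)) (g' (U0 w)) = Complex (v \<bullet> w) (- std_form v w)" for v w
      unfolding U0 using Uh[OF gf gf] unitary_frame_hermitian[OF g] by simp
    then have eq: "(\<chi> i j. hermitian E J (g' (U0 (axis i 1))) (g' (U0 (axis j 1)))) = (mat 1 :: complex ^ 'k ^ 'k)"
      by (simp add: vec_eq_iff mat_def complex_eq_iff std_form_axis inner_axis_axis)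
    have "\<forall>v\<in>families E y. complex_of_real ((cmod (\<tau> y (wedge E J y v)))\<^sup>2) =
        det (\<chi> (i::'k) (j::'k). hermitian E J (v i) (v j))"
      using uy unfolding unitary_at_def by (rule conjunct2)
    from this[rule_format, OF frame_families[OF r'], of "\<lambda>j. U0 (axis j 1)"]
    have "complex_of_real ((cmod (cdet U0))\<^sup>2) = 1" by (simp only: eq det_I t)
    then have "(cmod (cdet U0))\<^sup>2 = 1" by (simp only: of_real_eq_1_iff)
    then show ?thesis using norm_ge_zero[of "cdet U0"] by (auto simp: power2_eq_1_iff)
  qed
  ultimately show ?thesis by (simp add: sgn_eq)
qed

lemma polar_decomposition_exists:
  fixes g :: "complex ^ 'k::finite \<Rightarrow> 'e"
  assumes g: "unitary_frame E J \<tau> x g" and g': "unitary_frame E J \<tau> y g'"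
    and N: "sympl N" and A: "\<And>v. A (g v) = g' (N v)"
  shows "\<exists>U P. polar_decomposition E J x y A U P"
proof -
  note c = unitary_frame_complex[OF g] and c' = unitary_frame_complex[OF g']
  note r = unitary_frame_real[OF g] and r' = unitary_frame_real[OF g']
  note gf = frame_in[OF r] and gf' = frame_in[OF r']
  note iv = frame_inv(1)[OF r]
  have Jg: "J (g v) = g (\<i> *s v)" "J (g' v) = g' (\<i> *s v)" for v
    using c c' by (simp_all add: complex_frame_def)
  have og: "omega E (g v) (g w) = std_form v w" "omega E (g' v) (g' w) = std_form v w" for v w
    using g g' by (simp_all add: unitary_frame_def)
  obtain B where B: "\<And>v. norm (N v) \<le> B * norm v" "1 \<le> B"
    using sympl_bound[OF sympl_linear[OF N]] by metis
  note pp = polar_props[OF N B] and pl = polar_pos_sympl[OF N B]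
  define U0 where "U0 = polar_unit N B"
  have U0: "clinear U0" "\<And>v w. U0 v \<bullet> U0 w = v \<bullet> w" "\<And>v. U0 (polar_pos B N v) = N v"
    unfolding U0_def using polar_unit_clinear[OF N B] polar_unit_inner[OF N B] polar_unit_pos[OF N B] by auto
  have lU: "linear U0" and Ui: "\<And>v. U0 (\<i> *s v) = \<i> *s U0 v" using U0(1) by (auto simp: clinear_def)
  have bU: "bij U0"
  proof -
    have "inj U0" unfolding linear_injective_0[OF lU] using U0(2) by (metis inner_eq_zero_iff)
    then show ?thesis using linear_injective_imp_surjective[OF lU] by (simp add: bij_def)
  qed
  define U where "U v = g' (U0 (inv_into UNIV g v))" for v
  define P where "P v = g (polar_pos B N (inv_into UNIV g v))" for v
  have Ug: "U (g v) = g' (U0 v)" and Pg: "P (g v) = g (polar_pos B N v)" for v by (simp_all add: U_def P_def iv)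
  have all: "(\<forall>v\<in>fibre E x. Q v) \<longleftrightarrow> (\<forall>v. Q (g v))" for Q
    using gf frame_cases[OF r] by metis
  have "bij_betw g' UNIV (fibre E y)" "bij_betw (inv_into UNIV g) (fibre E x) UNIV"
    using r r' by (simp_all add: real_frame_def bij_betw_inv_into)
  then have "bij_betw U (fibre E x) (fibre E y)"
    using bij_betw_trans[OF bij_betw_trans[OF _ bU[unfolded bij_betw_def[symmetric]]]]
    unfolding U_def[abs_def] by (fastforce simp: comp_def)
  moreover have "hermitian E J (g' v) (g' w) = Complex (v \<bullet> w) (- std_form v w)"
      "hermitian E J (g v) (g w) = Complex (v \<bullet> w) (- std_form v w)" for v w
    using unitary_frame_hermitian[OF g] unitary_frame_hermitian[OF g'] by auto
  moreover have "g v = vzero E x \<longleftrightarrow> v = 0" for v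
    using frame_eq_iff[OF r, of v 0] frame_ops(1)[OF r] by simp
  moreover have "0 < v \<bullet> polar_pos B N v" if "v \<noteq> 0" for v
    using pp(3)[OF that] by (simp add: inner_commute)
  moreover have "std_form (U0 v) (U0 w) = std_form v w" for v w
    using U0(2)[of "\<i> *s v" w] by (simp add: std_form_inner Ui)
  ultimately have "polar_decomposition E J x y A U P"
    unfolding polar_decomposition_def fibre_linear_def all
    by (auto simp: Ug Pg Jg og A gf gf' frame_ops[OF r] frame_ops[OF r'] std_form_i U0 Ui
        linear_add[OF lU] linear_scale[OF lU] blinfun.add_right blinfun.scaleR_right
        pp(2) pp(3))
  then show ?thesis by blast
qed

lemma rotation_phase_frame:
  fixes g :: "complex ^ 'k::finite \<Rightarrow> 'e"
  assumes "unitary_frame E J \<tau> x g" "unitary_frame E J \<tau> (\<phi> t x) g'"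
    and "unitary_at E J \<tau> x" "unitary_at E J \<tau> (\<phi> t x)"
    and "sympl N" "\<And>v. \<Phi> t x (g v) = g' (N v)"
  shows "rotation_phase \<phi> E (J, \<tau>) \<Phi> t x = sgn (cdet (cpart N))"
proof -
  note ph = polar_decomposition_phase[where A = "\<Phi> t x" and N = N, OF assms(1-4,6)]
  obtain U P where UP: "polar_decomposition E J x (\<phi> t x) (\<Phi> t x) U P"
    using polar_decomposition_exists[where A = "\<Phi> t x" and N = N, OF assms(1,2,5,6)] by blast
  show ?thesis
    unfolding rotation_phase_def prod.case
    by (rule the_equality) (use UP ph in auto)
qed

section \<open>Continuous families of vectors and operators\<close>

lemma continuous_on_locally:
  assumes "\<And>z. z \<in> S \<Longrightarrow> \<exists>T. openin (top_of_set S) T \<and> z \<in> T \<and> continuous_on T F"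
  shows "continuous_on S F"
  unfolding continuous_on_topological
proof (intro ballI allI impI)
  fix z B assume z: "z \<in> S" and B: "open B" "F z \<in> B"
  obtain T where T: "openin (top_of_set S) T" "z \<in> T" "continuous_on T F" using assms[OF z] by blast
  obtain W where W: "open W" "T = S \<inter> W" using T(1) by (auto simp: openin_open)
  obtain A where "open A" "z \<in> A" "\<forall>y\<in>T. y \<in> A \<longrightarrow> F y \<in> B"
    using T B unfolding continuous_on_topological by metis
  then show "\<exists>A. open A \<and> z \<in> A \<and> (\<forall>y\<in>S. y \<in> A \<longrightarrow> F y \<in> B)"
    using W T(2) by (intro exI[of _ "A \<inter> W"]) auto
qed

text \<open>The projection of a bundle need not be continuous on the total space, whose topology is only
  prescribed over small open sets; continuity of a family of vectors is therefore considered
  together with continuity of its base points.\<close>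

definition bcont ::
    "('y::topological_space, 'e::topological_space) symp_bundle \<Rightarrow> 'x::topological_space set \<Rightarrow>
     ('x \<Rightarrow> 'y) \<Rightarrow> ('x \<Rightarrow> 'e) \<Rightarrow> bool" where
  "bcont E S b f \<longleftrightarrow> continuous_on S b \<and> continuous_on S f \<and> (\<forall>z\<in>S. f z \<in> fibre E (b z))"

text \<open>Continuity of a family of fibre maps is tested on continuous families of vectors. This
  composes freely and needs no topology on the homomorphisms between fibres.\<close>

definition opcont ::
    "('y::topological_space, 'e::topological_space) symp_bundle \<Rightarrow> 'x::topological_space set \<Rightarrow>
     ('x \<Rightarrow> 'y) \<Rightarrow> ('x \<Rightarrow> 'y) \<Rightarrow> ('x \<Rightarrow> 'e \<Rightarrow> 'e) \<Rightarrow> bool" where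
  "opcont E S b b' A \<longleftrightarrow> (\<forall>f. bcont E S b f \<longrightarrow> bcont E S b' (\<lambda>z. A z (f z)))"

lemma opcontD: "opcont E S b b' A \<Longrightarrow> bcont E S b f \<Longrightarrow> bcont E S b' (\<lambda>z. A z (f z))"
  by (simp add: opcont_def)

lemma opcont_id: "opcont E S b b (\<lambda>z v. v)"
  by (simp add: opcont_def)

lemma bcont_const: "v \<in> fibre E x \<Longrightarrow> bcont E S (\<lambda>_. x) (\<lambda>_. v)"
  by (simp add: bcont_def)

text \<open>Complex linear part with respect to \<open>J\<close> on the source and \<open>J'\<close>
  on the target; the two differ when complex structures vary along a homotopy. The target structure
  acts on the target fibre, where the sums are formed.\<close>

definition bcpart :: "('y, 'e) symp_bundle \<Rightarrow> ('e \<Rightarrow> 'e) \<Rightarrow> ('e \<Rightarrow> 'e) \<Rightarrow> ('e \<Rightarrow> 'e) \<Rightarrow> 'e \<Rightarrow> 'e" where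
  "bcpart E J J' A v = vscale E (1/2) (vadd E (A v) (vscale E (-1) (J' (A (J v)))))"

definition bdpart :: "('y, 'e) symp_bundle \<Rightarrow> ('e \<Rightarrow> 'e) \<Rightarrow> ('e \<Rightarrow> 'e) \<Rightarrow> ('e \<Rightarrow> 'e) \<Rightarrow> 'e \<Rightarrow> 'e" where
  "bdpart E J J' A v = vscale E (1/2) (vadd E (A v) (J' (A (J v))))"

lemma bcpart_frame:
  assumes g: "complex_frame E J x g" and g': "complex_frame E J' y g'" and A: "\<And>v. A (g v) = g' (N v)"
  shows "bcpart E J J' A (g v) = g' (cpart N v)" "bdpart E J J' A (g v) = g' (dpart N v)"
proof -
  have Jg: "J (g v) = g (\<i> *s v)" "J' (g' v) = g' (\<i> *s v)" for v
    using g g' by (simp_all add: complex_frame_def)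
  note r' = complex_frame_real[OF g']
  show "bcpart E J J' A (g v) = g' (cpart N v)" "bdpart E J J' A (g v) = g' (dpart N v)"
    by (simp_all add: bcpart_def bdpart_def Jg A frame_ops[OF r'] cpart_def dpart_def)
qed

lemma col_det_clinear:
  assumes M: "clinear M"
  shows "col_det (\<lambda>j. M (v j)) = cdet M * col_det v"
proof -
  have upd: "(\<lambda>j. M ((v(i := a)) j)) = (\<lambda>j. M (v j))(i := M a)" for v i a by auto
  have "col_det (\<lambda>j. M (v j)) = col_det v * col_det (\<lambda>j. M (axis j 1))"
  proof (rule alternating_eq_det)
    show "col_det (\<lambda>j. M ((v(i := a + b)) j)) = col_det (\<lambda>j. M ((v(i := a)) j)) + col_det (\<lambda>j. M ((v(i := b)) j))"
      for v i a b unfolding upd using M by (simp add: clinear_def linear_add col_det_add del: fun_upd_apply)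
    show "col_det (\<lambda>j. M ((v(i := c *s a)) j)) = c * col_det (\<lambda>j. M ((v(i := a)) j))" for v i c a
      unfolding upd clinear_cmult[OF M] by (rule col_det_scale)
    show "col_det (\<lambda>j. M (v j)) = 0" if "i \<noteq> j" "v i = v j" for v i j
      by (rule col_det_alt[OF that(1)]) (simp add: that(2))
  qed
  then show ?thesis by (simp add: cdet_col)
qed

context
  fixes E :: "('y::topological_space, 'e::topological_space) symp_bundle" and U :: "'y set"
    and h :: "'y \<times> (complex ^ 'k::finite) \<Rightarrow> 'e" and h'
  assumes ch: "bundle_chart E U h h'"
begin

lemma chart_open: "open U" and
  chart_homeo: "homeomorphism (U \<times> UNIV) {v \<in> tot E. prj E v \<in> U} h h'"
  using ch by (auto simp: bundle_chart_def)

lemma chart_coords: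
  assumes "v \<in> fibre E y" "y \<in> U"
  shows "h (y, snd (h' v)) = v"
proof -
  obtain z where "v = h (y, z)" using frame_cases[OF chart_real_frame[OF ch assms(2)] assms(1)] by blast
  then have "h' v = (y, z)" using chart_homeo assms by (simp add: homeomorphism_def)
  then show ?thesis using \<open>v = h (y, z)\<close> by simp
qed

lemma bcont_coords:
  assumes "bcont E S b f" "T \<subseteq> S" "b ` T \<subseteq> U"
  shows "continuous_on T (\<lambda>z. snd (h' (f z)))"
proof -
  have "continuous_on T f" using assms by (auto simp: bcont_def intro: continuous_on_subset)
  moreover have "f ` T \<subseteq> {v \<in> tot E. prj E v \<in> U}" using assms by (auto simp: bcont_def fibre_def)
  moreover have "continuous_on {v \<in> tot E. prj E v \<in> U} h'" using chart_homeo by (simp add: homeomorphism_def)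
  ultimately show ?thesis by (intro continuous_on_snd continuous_on_compose2[of _ h' T f])
qed

lemma continuous_chart:
  assumes "continuous_on T b" "continuous_on T c" "b ` T \<subseteq> U"
  shows "continuous_on T (\<lambda>z. h (b z, c z))"
proof -
  have "continuous_on (U \<times> UNIV) h" using chart_homeo by (simp add: homeomorphism_def)
  then show ?thesis by (rule continuous_on_compose2) (use assms in \<open>auto intro: continuous_on_Pair\<close>)
qed

end

context
  fixes E :: "('y::topological_space, 'e::topological_space) symp_bundle" and K :: "'k::finite itself"
  assumes vb: "vector_bundle TYPE('k) E"
begin

text \<open>\<open>S\<close> is covered by preimages of chart domains under \<open>b\<close>. They
  are open because the base points vary continuously, whereas the projection of the bundle cannot be
  used for this.\<close>

lemma bcont_local:
  assumes b: "continuous_on S b" and f: "\<And>z. z \<in> S \<Longrightarrow> f z \<in> fibre E (b z)"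
    and loc: "\<And>U (h :: 'y \<times> (complex ^ 'k) \<Rightarrow> 'e) h' T. bundle_chart E U h h' \<Longrightarrow> T \<subseteq> S \<Longrightarrow> b ` T \<subseteq> U \<Longrightarrow>
      continuous_on T b \<Longrightarrow> continuous_on T f"
  shows "bcont E S b f"
proof -
  have "continuous_on S f"
  proof (rule continuous_on_locally)
    fix z assume z: "z \<in> S"
    obtain U h h' where ch: "b z \<in> U" "bundle_chart E U (h :: 'y \<times> (complex ^ 'k) \<Rightarrow> 'e) h'"
      using vb unfolding vector_bundle_chart by blast
    define T where "T = S \<inter> b -` U"
    have "openin (top_of_set S) T"
      unfolding T_def using b chart_open[OF ch(2)] by (rule continuous_openin_preimage_gen)
    moreover have "z \<in> T" using z ch(1) by (simp add: T_def)
    moreover have "continuous_on T f"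
      by (rule loc[OF ch(2)]) (auto simp: T_def intro: continuous_on_subset[OF b])
    ultimately show "\<exists>T. openin (top_of_set S) T \<and> z \<in> T \<and> continuous_on T f" by blast
  qed
  then show ?thesis using b f by (simp add: bcont_def)
qed

lemma fibre_ops:
  "v \<in> fibre E x \<Longrightarrow> w \<in> fibre E x \<Longrightarrow> vadd E v w \<in> fibre E x" "v \<in> fibre E x \<Longrightarrow> vscale E r v \<in> fibre E x"
proof -
  obtain g :: "complex ^ 'k \<Rightarrow> 'e" where g: "real_frame E x g" using vector_bundle_real_frame[OF vb] by blast
  show "v \<in> fibre E x \<Longrightarrow> w \<in> fibre E x \<Longrightarrow> vadd E v w \<in> fibre E x" "v \<in> fibre E x \<Longrightarrow> vscale E r v \<in> fibre E x"
    using frame_cases[OF g] frame_in[OF g] frame_ops[OF g] by metis+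
qed

lemma bcont_vadd:
  assumes f: "bcont E S b f" and g: "bcont E S b g"
  shows "bcont E S b (\<lambda>z. vadd E (f z) (g z))"
proof (rule bcont_local)
  show "continuous_on S b" using f by (simp add: bcont_def)
  show "vadd E (f z) (g z) \<in> fibre E (b z)" if "z \<in> S" for z
    using f g that by (simp add: bcont_def fibre_ops)
  fix U and h :: "'y \<times> (complex ^ 'k) \<Rightarrow> 'e" and h' T
  assume ch: "bundle_chart E U h h'" and T: "T \<subseteq> S" "b ` T \<subseteq> U" "continuous_on T b"
  have "continuous_on T (\<lambda>z. h (b z, snd (h' (f z)) + snd (h' (g z))))"
    using T by (intro continuous_chart[OF ch] continuous_on_add bcont_coords[OF ch f] bcont_coords[OF ch g])
  moreover have "h (b z, snd (h' (f z)) + snd (h' (g z))) = vadd E (f z) (g z)" if "z \<in> T" for z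
  proof -
    have z: "b z \<in> U" "f z \<in> fibre E (b z)" "g z \<in> fibre E (b z)" using T that f g by (auto simp: bcont_def)
    show ?thesis
      using frame_ops(2)[OF chart_real_frame[OF ch z(1)], of "snd (h' (f z))" "snd (h' (g z))"]
      by (simp add: chart_coords[OF ch z(2,1)] chart_coords[OF ch z(3,1)])
  qed
  ultimately show "continuous_on T (\<lambda>z. vadd E (f z) (g z))" by (rule continuous_on_eq)
qed

lemma bcont_vscale:
  assumes f: "bcont E S b f" and r: "continuous_on S r"
  shows "bcont E S b (\<lambda>z. vscale E (r z) (f z))"
proof (rule bcont_local)
  show "continuous_on S b" using f by (simp add: bcont_def)
  show "vscale E (r z) (f z) \<in> fibre E (b z)" if "z \<in> S" for z
    using f that by (simp add: bcont_def fibre_ops)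
  fix U and h :: "'y \<times> (complex ^ 'k) \<Rightarrow> 'e" and h' T
  assume ch: "bundle_chart E U h h'" and T: "T \<subseteq> S" "b ` T \<subseteq> U" "continuous_on T b"
  have "continuous_on T (\<lambda>z. h (b z, r z *\<^sub>R snd (h' (f z))))"
    using T by (intro continuous_chart[OF ch] continuous_on_scaleR bcont_coords[OF ch f] continuous_on_subset[OF r])
  moreover have "h (b z, r z *\<^sub>R snd (h' (f z))) = vscale E (r z) (f z)" if "z \<in> T" for z
  proof -
    have z: "b z \<in> U" "f z \<in> fibre E (b z)" using T that f by (auto simp: bcont_def)
    show ?thesis
      using frame_ops(3)[OF chart_real_frame[OF ch z(1)], of "r z" "snd (h' (f z))"]
      by (simp add: chart_coords[OF ch z(2,1)])
  qed
  ultimately show "continuous_on T (\<lambda>z. vscale E (r z) (f z))" by (rule continuous_on_eq)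
qed

lemma opcont_parts:
  assumes "opcont E S b b J" "opcont E S b b' A" "opcont E S b' b' J'"
  shows "opcont E S b b' (\<lambda>z. bcpart E (J z) (J' z) (A z))" "opcont E S b b' (\<lambda>z. bdpart E (J z) (J' z) (A z))"
  unfolding opcont_def bcpart_def bdpart_def
  using assms by (auto intro!: bcont_vadd bcont_vscale continuous_on_const elim!: opcontD)

text \<open>The section with constant coordinates in a chart.\<close>

lemma local_section:
  assumes "v \<in> fibre E x"
  shows "\<exists>U f. open U \<and> x \<in> U \<and> bcont E U (\<lambda>y. y) f \<and> f x = v"
proof -
  obtain U h h' where ch: "x \<in> U" "bundle_chart E U (h :: 'y \<times> (complex ^ 'k) \<Rightarrow> 'e) h'"
    using vb unfolding vector_bundle_chart by blast
  have "bcont E U (\<lambda>y. y) (\<lambda>y. h (y, snd (h' v)))"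
    unfolding bcont_def using frame_in[OF chart_real_frame[OF ch(2)]]
    by (auto intro!: continuous_chart[OF ch(2)] continuous_on_id continuous_on_const)
  then show ?thesis
    using ch chart_open[OF ch(2)] chart_coords[OF ch(2) assms ch(1)] by blast
qed

lemma local_sections:
  assumes "\<And>j :: 'j::finite. v j \<in> fibre E x"
  shows "\<exists>U f. open U \<and> x \<in> U \<and> (\<forall>j. bcont E U (\<lambda>y. y) (f j) \<and> f j x = v j)"
proof -
  obtain U f where U: "\<And>j. open (U j) \<and> x \<in> U j \<and> bcont E (U j) (\<lambda>y. y) (f j) \<and> f j x = v j"
    using local_section[OF assms] by metis
  have "bcont E (\<Inter>j. U j) (\<lambda>y. y) (f j)" for j
    using U[of j] unfolding bcont_def by (auto intro: continuous_on_subset)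
  moreover have "open (\<Inter>j. U j)" using U by (intro open_INT) auto
  ultimately show ?thesis using U by (intro exI[of _ "\<Inter>j. U j"] exI[of _ f]) auto
qed

end

lemma opcont_cs:
  assumes "compatible_cs E J"
  shows "opcont E S b b (\<lambda>z. J)"
  unfolding opcont_def bcont_def
proof (intro allI impI conjI; elim conjE)
  fix f assume f: "continuous_on S f" "\<forall>z\<in>S. f z \<in> fibre E (b z)"
  show "continuous_on S (\<lambda>z. J (f z))"
    by (rule continuous_on_compose2[of "tot E" J]) (use assms f in \<open>auto simp: compatible_cs_def fibre_def\<close>)
  show "\<forall>z\<in>S. J (f z) \<in> fibre E (b z)"
    using f assms by (auto simp: compatible_cs_def fibre_linear_def)
qed

lemma opcont_cs_path:
  assumes "continuous_on ({0..1} \<times> tot E) (\<lambda>(s, v). J s v)" "\<And>s. s \<in> {0..1} \<Longrightarrow> compatible_cs E (J s)"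
    and "continuous_on S s" "s ` S \<subseteq> {0..1::real}"
  shows "opcont E S b b (\<lambda>z. J (s z))"
  unfolding opcont_def bcont_def
proof (intro allI impI conjI; elim conjE)
  fix f assume f: "continuous_on S f" "\<forall>z\<in>S. f z \<in> fibre E (b z)"
  have "continuous_on S (\<lambda>z. (\<lambda>(s, v). J s v) (s z, f z))"
    by (rule continuous_on_compose2[OF assms(1)])
      (use assms f in \<open>auto simp: fibre_def intro!: continuous_on_Pair\<close>)
  then show "continuous_on S (\<lambda>z. J (s z) (f z))" by simp
  show "\<forall>z\<in>S. J (s z) (f z) \<in> fibre E (b z)"
    using f assms(2,4) by (auto simp: compatible_cs_def fibre_linear_def)
qed

lemma continuous_flow_compose:
  assumes "continuous_flow \<phi>" "continuous_on S t" "continuous_on S b"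
  shows "continuous_on S (\<lambda>z. \<phi> (t z) (b z))"
proof -
  have "continuous_on UNIV (\<lambda>(t, x). \<phi> t x)" using assms(1) by (simp add: continuous_flow_def)
  from continuous_on_compose2[OF this continuous_on_Pair[OF assms(2,3)]] show ?thesis by auto
qed

lemma opcont_cocycle:
  assumes \<phi>: "continuous_flow \<phi>" and \<Phi>: "symplectic_cocycle \<phi> E \<Phi>" and t: "continuous_on S t"
  shows "opcont E S b (\<lambda>z. \<phi> (t z) (b z)) (\<lambda>z. \<Phi> (t z) (b z))"
  unfolding opcont_def bcont_def
proof (intro allI impI conjI; elim conjE)
  fix f assume f: "continuous_on S b" "continuous_on S f" "\<forall>z\<in>S. f z \<in> fibre E (b z)"
  show "continuous_on S (\<lambda>z. \<phi> (t z) (b z))" by (rule continuous_flow_compose[OF \<phi> t f(1)])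
  have "continuous_on (UNIV \<times> tot E) (\<lambda>(t, v). \<Phi> t (prj E v) v)"
    using \<Phi> by (simp add: symplectic_cocycle_def)
  then have "continuous_on S (\<lambda>z. (\<lambda>(t, v). \<Phi> t (prj E v) v) (t z, f z))"
    by (rule continuous_on_compose2) (use t f in \<open>auto simp: fibre_def intro!: continuous_on_Pair\<close>)
  then show "continuous_on S (\<lambda>z. \<Phi> (t z) (b z) (f z))"
    by (rule continuous_on_eq) (use f in \<open>auto simp: fibre_def\<close>)
  show "\<forall>z\<in>S. \<Phi> (t z) (b z) (f z) \<in> fibre E (\<phi> (t z) (b z))"
    using f \<Phi> by (auto simp: symplectic_cocycle_def fibre_symplectic_iso_def fibre_linear_def)
qed

lemma continuous_on_wedge:
  assumes \<tau>: "unitary_triv_on UNIV E J \<tau>" and f: "\<And>j. bcont E S b (f j)"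
  shows "continuous_on S (\<lambda>z. \<tau> (b z) (wedge E J (b z) (\<lambda>j. f j z)))"
proof -
  have cw: "continuous_on (SIGMA x:UNIV. families E x) (\<lambda>(x, v). \<tau> x (wedge E J x v))"
    using \<tau> by (simp add: unitary_triv_on_def)
  have "continuous_on S (\<lambda>z. (\<lambda>(x, v). \<tau> x (wedge E J x v)) (b z, \<lambda>j. f j z))"
  proof (rule continuous_on_compose2[OF cw])
    show "continuous_on S (\<lambda>z. (b z, \<lambda>j. f j z))"
      using f by (intro continuous_on_Pair continuous_on_coordinatewise_then_product) (auto simp: bcont_def)
    show "(\<lambda>z. (b z, \<lambda>j. f j z)) ` S \<subseteq> (SIGMA x:UNIV. families E x)"
      using f by (auto simp: bcont_def families_def)
  qed
  then show ?thesis by simp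
qed

lemma continuous_on_wedge_path:
  assumes \<tau>: "continuous_on ({0..1} \<times> (SIGMA x:UNIV. families E x)) (\<lambda>(s, x, v). \<tau> s x (wedge E (J s) x v))"
    and s: "continuous_on S s" "s ` S \<subseteq> {0..1::real}" and f: "\<And>j. bcont E S b (f j)"
  shows "continuous_on S (\<lambda>z. \<tau> (s z) (b z) (wedge E (J (s z)) (b z) (\<lambda>j. f j z)))"
proof -
  have "continuous_on S (\<lambda>z. (\<lambda>(s, x, v). \<tau> s x (wedge E (J s) x v)) (s z, b z, \<lambda>j. f j z))"
  proof (rule continuous_on_compose2[OF \<tau>])
    show "continuous_on S (\<lambda>z. (s z, b z, \<lambda>j. f j z))"
      using f s by (intro continuous_on_Pair continuous_on_coordinatewise_then_product) (auto simp: bcont_def)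
    show "(\<lambda>z. (s z, b z, \<lambda>j. f j z)) ` S \<subseteq> {0..1} \<times> (SIGMA x:UNIV. families E x)"
      using f s by (auto simp: bcont_def families_def)
  qed
  then show ?thesis by simp
qed

section \<open>The rotation function\<close>

lemma unitary_triv_at: "triv_pair E (J, \<tau>) \<Longrightarrow> unitary_at E J \<tau> x"
  by (simp add: triv_pair_def unitary_triv_on_def)

lemma triv_pair_frame:
  fixes E :: "('y::topological_space, 'e::topological_space) symp_bundle" and \<tau> :: "('y, 'e, 'k::finite) det_triv"
  assumes "symplectic_vector_bundle TYPE('k) E" "triv_pair E (J, \<tau>)"
  shows "\<exists>g. unitary_frame E J \<tau> x g"
  using exists_unitary_frame[OF assms(1) _ unitary_triv_at[OF assms(2)]] assms(2) by (simp add: triv_pair_def)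

text \<open>By the cocycle identity at time 0 the map is an injective idempotent.\<close>

lemma cocycle_zero:
  assumes "continuous_flow \<phi>" "symplectic_cocycle \<phi> E \<Phi>" "v \<in> fibre E x"
  shows "\<Phi> 0 x v = v"
proof -
  have \<phi>0: "\<phi> 0 x = x" using assms(1) by (simp add: continuous_flow_def)
  have iso: "fibre_symplectic_iso E x E x (\<Phi> 0 x)"
    using assms(2) by (metis \<phi>0 symplectic_cocycle_def)
  have "\<Phi> (0 + 0) x v = \<Phi> 0 (\<phi> 0 x) (\<Phi> 0 x v)"
    using assms(2,3) unfolding symplectic_cocycle_def by blast
  then have "\<Phi> 0 x (\<Phi> 0 x v) = \<Phi> 0 x v" by (simp add: \<phi>0)
  moreover have "inj_on (\<Phi> 0 x) (fibre E x)" "\<Phi> 0 x v \<in> fibre E x"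
    using iso assms(3) by (auto simp: fibre_symplectic_iso_def bij_betw_def)
  ultimately show ?thesis using assms(3) by (meson inj_onD)
qed

text \<open>The polar decomposition is replaced by the complex linear part, whose determinant has the
  same phase; a local section of frames then expresses the phase through continuous functions.\<close>

context
  fixes \<phi> :: "real \<Rightarrow> 'y::topological_space \<Rightarrow> 'y" and E :: "('y, 'e::topological_space) symp_bundle"
    and \<Phi> J and \<tau> :: "('y, 'e, 'k::finite) det_triv"
  assumes \<phi>: "continuous_flow \<phi>" and E: "symplectic_vector_bundle TYPE('k) E"
    and \<Phi>: "symplectic_cocycle \<phi> E \<Phi>" and p: "triv_pair E (J, \<tau>)"
begin

lemma triv_facts: "compatible_cs E J" "unitary_triv_on UNIV E J \<tau>" "vector_bundle TYPE('k) E"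
  using p E by (auto simp: triv_pair_def symplectic_vector_bundle_def)

lemma cocycle_iso_at: "fibre_symplectic_iso E x E (\<phi> t x) (\<Phi> t x)"
  using \<Phi> by (simp add: symplectic_cocycle_def)

lemma rotation_phase_rep:
  assumes "unitary_frame E J \<tau> x g" "unitary_frame E J \<tau> (\<phi> t x) g'"
  shows "\<exists>N. sympl N \<and> (\<forall>v. \<Phi> t x (g v) = g' (N v)) \<and> rotation_phase \<phi> E (J, \<tau>) \<Phi> t x = sgn (cdet (cpart N))"
proof -
  obtain N where N: "sympl N" "\<And>v. \<Phi> t x (g v) = g' (N v)"
    using frame_rep[OF cocycle_iso_at assms] by blast
  then show ?thesis
    using rotation_phase_frame[where N = N and \<Phi> = \<Phi> and \<phi> = \<phi> and t = t and x = x, OF assms unitary_triv_at[OF p] unitary_triv_at[OF p] N] by blast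
qed

text \<open>In unitary frames numerator and denominator carry the same factor
  \<open>col_det v\<close>, so the frames cancel. The right-hand side involves only the vectors
  \<open>e\<close>, which can be chosen to vary continuously with \<open>x\<close>.\<close>

lemma rotation_phase_section:
  assumes "\<And>j. e j \<in> fibre E x" "\<tau> x (wedge E J x e) \<noteq> 0"
  shows "rotation_phase \<phi> E (J, \<tau>) \<Phi> t x =
     sgn (\<tau> (\<phi> t x) (wedge E J (\<phi> t x) (\<lambda>j. bcpart E J J (\<Phi> t x) (e j))) / \<tau> x (wedge E J x e))"
proof -
  obtain g where g: "unitary_frame E J \<tau> x g" using triv_pair_frame[OF E p] by blast
  obtain g' where g': "unitary_frame E J \<tau> (\<phi> t x) g'" using triv_pair_frame[OF E p] by blast
  obtain N where N: "sympl N" "\<And>v. \<Phi> t x (g v) = g' (N v)"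
     and ph: "rotation_phase \<phi> E (J, \<tau>) \<Phi> t x = sgn (cdet (cpart N))"
    using rotation_phase_rep[OF g g'] by blast
  have "e \<in> families E x" using assms(1) by (simp add: families_def)
  then obtain v where e: "e = (\<lambda>j. g (v j))" using families_frame_cases[OF unitary_frame_real[OF g]] by blast
  have d: "\<tau> x (wedge E J x e) = col_det v"
    unfolding e by (rule triv_wedge_unitary_frame[OF g unitary_triv_at[OF p]])
  have "bcpart E J J (\<Phi> t x) (e j) = g' (cpart N (v j))" for j
    unfolding e
    by (rule bcpart_frame(1)[where N = N, OF unitary_frame_complex[OF g] unitary_frame_complex[OF g'] N(2)])
  then have "\<tau> (\<phi> t x) (wedge E J (\<phi> t x) (\<lambda>j. bcpart E J J (\<Phi> t x) (e j))) = cdet (cpart N) * col_det v"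
    using triv_wedge_unitary_frame[OF g' unitary_triv_at[OF p], of "\<lambda>j. cpart N (v j)"]
      col_det_clinear[OF clinear_cpart[OF sympl_linear[OF N(1)]], of v] by simp
  then show ?thesis using assms(2) by (simp add: ph d)
qed

lemma rotation_phase_norm: "norm (rotation_phase \<phi> E (J, \<tau>) \<Phi> t x) = 1"
proof -
  obtain g where g: "unitary_frame E J \<tau> x g" using triv_pair_frame[OF E p] by blast
  obtain g' where g': "unitary_frame E J \<tau> (\<phi> t x) g'" using triv_pair_frame[OF E p] by blast
  obtain N :: "complex ^ 'k \<Rightarrow> complex ^ 'k" where "sympl N" "rotation_phase \<phi> E (J, \<tau>) \<Phi> t x = sgn (cdet (cpart N))"
    using rotation_phase_rep[OF g g'] by blast
  then show ?thesis by (simp add: norm_sgn sympl_cdet_nonzero)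
qed

lemma rotation_phase_zero: "rotation_phase \<phi> E (J, \<tau>) \<Phi> 0 x = 1"
proof -
  have \<phi>0: "\<phi> 0 x = x" using \<phi> by (simp add: continuous_flow_def)
  obtain g where g: "unitary_frame E J \<tau> x g" using triv_pair_frame[OF E p] by blast
  have "\<Phi> 0 x (g v) = g v" for v
    by (rule cocycle_zero[OF \<phi> \<Phi> frame_in[OF unitary_frame_real[OF g]]])
  then show ?thesis
    using rotation_phase_frame[of E J \<tau> x g \<phi> 0 g "\<lambda>v. v" \<Phi>] g unitary_triv_at[OF p] by (simp add: \<phi>0 sympl_id)
qed

lemma continuous_on_rotation_phase: "continuous_on UNIV (\<lambda>(t, x). rotation_phase \<phi> E (J, \<tau>) \<Phi> t x)"
proof (rule continuous_on_locally)
  fix z0 :: "real \<times> 'y"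
  define x0 where "x0 = snd z0"
  obtain g where g: "unitary_frame E J \<tau> x0 g" using triv_pair_frame[OF E p] by blast
  have "g (axis j 1) \<in> fibre E x0" for j by (rule frame_in[OF unitary_frame_real[OF g]])
  then obtain U e where U: "open U" "x0 \<in> U" "\<And>j. bcont E U (\<lambda>y. y) (e j)" "\<And>j. e j x0 = g (axis j 1)"
    using local_sections[OF triv_facts(3), of "\<lambda>j. g (axis j 1)" x0] by blast
  define d where "d x = \<tau> x (wedge E J x (\<lambda>j. e j x))" for x
  have cd: "continuous_on U d" unfolding d_def by (rule continuous_on_wedge[OF triv_facts(2) U(3)])
  have d0: "d x0 = 1" using g by (simp add: d_def U(4) unitary_frame_def)
  \<comment> \<open>The sections form the chosen unitary frame at \<open>x0\<close> only. Where
    \<open>d\<close> is nonzero they are still linearly independent, which suffices for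
    \<open>rotation_phase_section\<close>.\<close>
  define U' where "U' = U \<inter> d -` (- {0})"
  have "open U'" unfolding U'_def using cd U(1) by (rule continuous_open_preimage) auto
  define T where "T = (UNIV :: real set) \<times> U'"
  have U'e: "bcont E T snd (\<lambda>z. e j (snd z))" for j
    using U(3)[of j] unfolding bcont_def T_def U'_def
    by (auto intro!: continuous_on_snd continuous_on_id intro: continuous_on_compose2)
  have ct: "continuous_on T fst" by (intro continuous_on_fst continuous_on_id)
  note op = opcont_parts(1)[OF triv_facts(3) opcont_cs[OF triv_facts(1)] opcont_cocycle[OF \<phi> \<Phi> ct] opcont_cs[OF triv_facts(1)]]
  have "continuous_on T (\<lambda>z. sgn (\<tau> (\<phi> (fst z) (snd z)) (wedge E J (\<phi> (fst z) (snd z))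
      (\<lambda>j. bcpart E J J (\<Phi> (fst z) (snd z)) (e j (snd z)))) / d (snd z)))"
  proof (intro continuous_on_sgn continuous_on_divide)
    show "continuous_on T (\<lambda>z. \<tau> (\<phi> (fst z) (snd z)) (wedge E J (\<phi> (fst z) (snd z))
      (\<lambda>j. bcpart E J J (\<Phi> (fst z) (snd z)) (e j (snd z)))))"
      by (rule continuous_on_wedge[OF triv_facts(2) opcontD[OF op U'e]])
    show "continuous_on T (\<lambda>z. d (snd z))"
      by (rule continuous_on_compose2[OF cd]) (auto simp: T_def U'_def intro!: continuous_on_snd continuous_on_id)
    show d: "\<forall>z\<in>T. d (snd z) \<noteq> 0" by (auto simp: T_def U'_def)
    show "\<forall>z\<in>T. \<tau> (\<phi> (fst z) (snd z)) (wedge E J (\<phi> (fst z) (snd z))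
      (\<lambda>j. bcpart E J J (\<Phi> (fst z) (snd z)) (e j (snd z)))) / d (snd z) \<noteq> 0"
    proof
      fix z assume z: "z \<in> T"
      have "norm (sgn (\<tau> (\<phi> (fst z) (snd z)) (wedge E J (\<phi> (fst z) (snd z))
          (\<lambda>j. bcpart E J J (\<Phi> (fst z) (snd z)) (e j (snd z)))) / d (snd z))) = 1"
        unfolding d_def using U'e d z rotation_phase_norm[of "fst z" "snd z"]
        by (subst rotation_phase_section[symmetric]) (auto simp: bcont_def d_def)
      then show "\<tau> (\<phi> (fst z) (snd z)) (wedge E J (\<phi> (fst z) (snd z))
          (\<lambda>j. bcpart E J J (\<Phi> (fst z) (snd z)) (e j (snd z)))) / d (snd z) \<noteq> 0" by (metis norm_zero sgn_zero zero_neq_one)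
    qed
  qed
  then have "continuous_on T (\<lambda>(t, x). rotation_phase \<phi> E (J, \<tau>) \<Phi> t x)"
  proof (rule continuous_on_eq)
    fix z assume z: "z \<in> T"
    then have "\<tau> (snd z) (wedge E J (snd z) (\<lambda>j. e j (snd z))) \<noteq> 0" by (auto simp: T_def U'_def d_def)
    moreover have "e j (snd z) \<in> fibre E (snd z)" for j using U'e[of j] z by (simp add: bcont_def)
    ultimately show "sgn (\<tau> (\<phi> (fst z) (snd z)) (wedge E J (\<phi> (fst z) (snd z))
      (\<lambda>j. bcpart E J J (\<Phi> (fst z) (snd z)) (e j (snd z)))) / d (snd z)) = (\<lambda>(t, x). rotation_phase \<phi> E (J, \<tau>) \<Phi> t x) z"
      using rotation_phase_section[of "\<lambda>j. e j (snd z)" "snd z" "fst z"] by (simp add: d_def split_beta)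
  qed
  moreover have "openin (top_of_set UNIV) T" using \<open>open U'\<close> by (simp add: T_def open_Times)
  moreover have "z0 \<in> T" using U(2) d0 by (simp add: T_def U'_def x0_def mem_Times_iff)
  ultimately show "\<exists>T. openin (top_of_set UNIV) T \<and> z0 \<in> T \<and> continuous_on T (\<lambda>(t, x). rotation_phase \<phi> E (J, \<tau>) \<Phi> t x)"
    by blast
qed

end

definition rotation_lift ::
    "(real \<Rightarrow> 'y \<Rightarrow> 'y) \<Rightarrow> ('y::topological_space, 'e) symp_bundle \<Rightarrow>
     ('e \<Rightarrow> 'e) \<times> ('y, 'e, 'k::finite) det_triv \<Rightarrow> (real \<Rightarrow> 'y \<Rightarrow> 'e \<Rightarrow> 'e) \<Rightarrow> (real \<Rightarrow> 'y \<Rightarrow> real) \<Rightarrow> bool" where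
  "rotation_lift \<phi> E p \<Phi> u \<longleftrightarrow> continuous_on UNIV (\<lambda>(t, x). u t x) \<and> (\<forall>x. u 0 x = 0) \<and>
        (\<forall>t x. eip (u t x) = rotation_phase \<phi> E p \<Phi> t x)"

text \<open>A lift built along a single orbit and a bounded time interval already computes the
  rotation function there.\<close>

lemma rotation_lift_unique:
  assumes u: "rotation_lift \<phi> E p \<Phi> u"
    and v: "continuous_on {a..b} v" "0 \<in> {a..b}" "v 0 = 0" "\<And>t. t \<in> {a..b} \<Longrightarrow> eip (v t) = rotation_phase \<phi> E p \<Phi> t x"
    and t: "t \<in> {a..b}"
  shows "v t = u t x"
proof -
  have "v t - u t x = v 0 - u 0 x"
  proof (rule eip_lifts_diff[of "{a..b}"])
    show "continuous_on {a..b} (\<lambda>t. u t x)"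
      by (rule continuous_on_sections(2)) (use u in \<open>simp add: rotation_lift_def\<close>)
    show "eip (v t) = eip (u t x)" if "t \<in> {a..b}" for t
      using u v(4)[OF that] by (simp add: rotation_lift_def)
  qed (use v t in auto)
  then show ?thesis using u v by (simp add: rotation_lift_def)
qed

lemma rotation_function_eq:
  assumes u: "rotation_lift \<phi> E p \<Phi> u"
  shows "rotation_function \<phi> E p \<Phi> = u"
proof -
  have "v = u" if v: "rotation_lift \<phi> E p \<Phi> v" for v
  proof (intro ext)
    fix t x
    have "continuous_on {-\<bar>t\<bar>..\<bar>t\<bar>} (\<lambda>t. v t x)"
      by (rule continuous_on_sections(2)) (use v in \<open>simp add: rotation_lift_def\<close>)
    then show "v t x = u t x"
      by (rule rotation_lift_unique[OF u]) (use v in \<open>auto simp: rotation_lift_def\<close>)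
  qed
  then have "(THE v. rotation_lift \<phi> E p \<Phi> v) = u" using u by (intro the_equality)
  then show ?thesis unfolding rotation_function_def rotation_lift_def eip_def .
qed

lemma rotation_lift_exists:
  fixes \<phi> :: "real \<Rightarrow> 'y::t2_space \<Rightarrow> 'y" and E :: "('y, 'e::topological_space) symp_bundle"
    and \<tau> :: "('y, 'e, 'k::finite) det_triv"
  assumes "continuous_flow \<phi>" "symplectic_vector_bundle TYPE('k) E" "symplectic_cocycle \<phi> E \<Phi>" "triv_pair E (J, \<tau>)"
  shows "rotation_lift \<phi> E (J, \<tau>) \<Phi> (rotation_function \<phi> E (J, \<tau>) \<Phi>)"
proof -
  note n = rotation_phase_norm[OF assms]
  have nz: "rotation_phase \<phi> E (J, \<tau>) \<Phi> t x \<noteq> 0" for t x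
    using n[of t x] by auto
  have sg: "sgn (rotation_phase \<phi> E (J, \<tau>) \<Phi> t x) = rotation_phase \<phi> E (J, \<tau>) \<Phi> t x" for t x
    by (simp add: sgn_eq n)
  have "sgn (rotation_phase \<phi> E (J, \<tau>) \<Phi> 0 x) = 1" for x
    by (simp add: rotation_phase_zero[OF assms])
  from joint_lift[OF continuous_on_rotation_phase[OF assms] nz this, unfolded sg]
  have "\<exists>L. rotation_lift \<phi> E (J, \<tau>) \<Phi> L" unfolding rotation_lift_def .
  then show ?thesis using rotation_function_eq by metis
qed

section \<open>The rotation function is a quasi-cocycle\<close>

lemma wedge_bcpart:
  assumes g: "complex_frame E J x g" and g': "unitary_frame E J' \<tau>' y g'" and u: "unitary_at E J' \<tau>' y"
    and A: "\<And>v. A (g v) = g' (N v)" and N: "linear N"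
  shows "\<tau>' y (wedge E J' y (\<lambda>j. bcpart E J J' A (g (v j)))) = cdet (cpart N) * col_det v"
  unfolding bcpart_frame(1)[where N = N, OF g unitary_frame_complex[OF g'] A]
    triv_wedge_unitary_frame[OF g' u] by (rule col_det_clinear[OF clinear_cpart[OF N]])

text \<open>Writes the interpolating determinant as a value of the trivialization on vectors built
  by continuous operations. This yields its continuity although the frames on the right of the
  equation are chosen pointwise.\<close>

lemma wedge_mix:
  assumes g: "complex_frame E J x g" and g2: "complex_frame E J2 y g2"
    and g3: "unitary_frame E J3 \<tau>3 z g3" and u: "unitary_at E J3 \<tau>3 z"
    and A: "\<And>v. A (g v) = g2 (N v)" and B: "\<And>v. B (g2 v) = g3 (M v)"
  shows "\<tau>3 z (wedge E J3 z (\<lambda>j. vadd E (bcpart E J2 J3 B (bcpart E J J2 A (g (axis j 1))))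
      (vscale E r (bdpart E J2 J3 B (bdpart E J J2 A (g (axis j 1)))))))
    = cdet (\<lambda>v. cpart M (cpart N v) + r *\<^sub>R dpart M (dpart N v))"
  unfolding bcpart_frame[where N = N, OF g g2 A] bcpart_frame[where N = M, OF g2 unitary_frame_complex[OF g3] B]
    frame_ops(2,3)[OF unitary_frame_real[OF g3]] triv_wedge_unitary_frame[OF g3 u] cdet_col by (rule refl)

text \<open>Both times are multiplied by \<sigma> in the unit interval. At \<sigma> = 0 the maps are
  identities, so the antilinear product and all three lifts vanish; the variation of the arguments
  up to \<sigma> = 1 is then the defect of additivity.\<close>

lemma rotation_quasi:
  fixes \<phi> :: "real \<Rightarrow> 'y::topological_space \<Rightarrow> 'y" and E :: "('y, 'e::topological_space) symp_bundle"
    and \<tau> :: "('y, 'e, 'k::finite) det_triv"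
  assumes \<phi>: "continuous_flow \<phi>" and E: "symplectic_vector_bundle TYPE('k) E"
    and \<Phi>: "symplectic_cocycle \<phi> E \<Phi>" and p: "triv_pair E (J, \<tau>)" and u: "rotation_lift \<phi> E (J, \<tau>) \<Phi> u"
  shows "\<bar>u (s + t) x - u s x - u t (\<phi> s x)\<bar> \<le> CARD('k) / 2"
proof -
  note tf = triv_facts[OF \<phi> E \<Phi> p]
  have ua: "unitary_at E J \<tau> y" for y by (rule unitary_triv_at[OF p])
  obtain G where G: "\<And>y. unitary_frame E J \<tau> y (G y)" using triv_pair_frame[OF E p] by metis
  obtain N where N: "\<And>r y. sympl (N r y)" "\<And>r y v. \<Phi> r y (G y v) = G (\<phi> r y) (N r y v)"
    using rotation_phase_rep[OF \<phi> E \<Phi> p G G] by metis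
  have ph: "rotation_phase \<phi> E (J, \<tau>) \<Phi> r y = sgn (cdet (cpart (N r y)))" for r y
    by (rule rotation_phase_frame[OF G G ua ua N])
  have \<phi>0: "\<phi> 0 y = y" and \<phi>add: "\<phi> (a + b) y = \<phi> b (\<phi> a y)" for a b y
    using \<phi> by (auto simp: continuous_flow_def)
  have \<Phi>add: "\<Phi> (a + b) y (G y v) = \<Phi> b (\<phi> a y) (\<Phi> a y (G y v))" for a b y v
    using \<Phi> frame_in[OF unitary_frame_real[OF G]] by (auto simp: symplectic_cocycle_def)
  define A where "A \<sigma> = N (\<sigma> * s) x" for \<sigma>
  define B where "B \<sigma> = N (\<sigma> * t) (\<phi> (\<sigma> * s) x)" for \<sigma>
  define S where "S = {0..1::real} \<times> {0..1::real}"
  have cS: "continuous_on S (\<lambda>z. fst z * c)" "continuous_on S snd" "continuous_on S (\<lambda>_. x)" for c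
    by (intro continuous_intros)+
  have cf: "complex_frame E J y (G y)" for y by (rule unitary_frame_complex[OF G])
  note opJ = opcont_cs[OF tf(1)]
  note opA = opcont_parts[OF tf(3) opJ opcont_cocycle[OF \<phi> \<Phi> cS(1)] opJ, where b = "\<lambda>_. x"]
  note opB = opcont_parts[OF tf(3) opJ opcont_cocycle[OF \<phi> \<Phi> cS(1)] opJ, where b = "\<lambda>z. \<phi> (fst z * s) x"]
  have e: "bcont E S (\<lambda>_. x) (\<lambda>_. G x (axis j 1))" for j
    by (rule bcont_const[OF frame_in[OF unitary_frame_real[OF G]]])
  have cu: "continuous_on {0..1} (\<lambda>\<sigma>. u (a \<sigma>) (b \<sigma>))" if "continuous_on {0..1::real} a" "continuous_on {0..1} b" for a b
  proof -
    have "continuous_on UNIV (\<lambda>(t, x). u t x)" using u by (simp add: rotation_lift_def)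
    from continuous_on_compose2[OF this continuous_on_Pair[OF that]] show ?thesis by auto
  qed
  have eu: "eip (u r y) = rotation_phase \<phi> E (J, \<tau>) \<Phi> r y" "u 0 y = 0" for r y
    using u by (auto simp: rotation_lift_def)
  \<comment> \<open>The factors 1 and 0 are the end values of the scaling parameter.\<close>
  have "\<bar>(u (1 * s + 1 * t) x - u (1 * s) x - u (1 * t) (\<phi> (1 * s) x)) -
      (u (0 * s + 0 * t) x - u (0 * s) x - u (0 * t) (\<phi> (0 * s) x))\<bar> \<le> CARD('k) / 2"
  proof (rule composition_argument_variation[where A = A and B = B])
    show "sympl (A \<sigma>)" "sympl (B \<sigma>)" for \<sigma> using N(1) by (simp_all add: A_def B_def)
    have "continuous_on S (\<lambda>z. \<tau> (\<phi> (fst z * t) (\<phi> (fst z * s) x)) (wedge E J (\<phi> (fst z * t) (\<phi> (fst z * s) x))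
       (\<lambda>j. vadd E (bcpart E J J (\<Phi> (fst z * t) (\<phi> (fst z * s) x)) (bcpart E J J (\<Phi> (fst z * s) x) (G x (axis j 1))))
          (vscale E (snd z) (bdpart E J J (\<Phi> (fst z * t) (\<phi> (fst z * s) x)) (bdpart E J J (\<Phi> (fst z * s) x) (G x (axis j 1))))))))"
      by (rule continuous_on_wedge[OF tf(2) bcont_vadd[OF tf(3) opcontD[OF opB(1) opcontD[OF opA(1) e]]
            bcont_vscale[OF tf(3) opcontD[OF opB(2) opcontD[OF opA(2) e]] cS(2)]]])
    then have "continuous_on S (\<lambda>z. cdet (\<lambda>v. cpart (B (fst z)) (cpart (A (fst z)) v) + snd z *\<^sub>R dpart (B (fst z)) (dpart (A (fst z)) v)))"
      unfolding A_def B_def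
      by (rule continuous_on_eq) (rule wedge_mix[OF cf cf G ua], rule N(2), rule N(2))
    then show "continuous_on ({0..1} \<times> {0..1})
      (\<lambda>(\<sigma>, r). cdet (\<lambda>v. cpart (B \<sigma>) (cpart (A \<sigma>) v) + r *\<^sub>R dpart (B \<sigma>) (dpart (A \<sigma>) v)))"
      by (simp add: S_def split_beta)
    show "dpart (B 0) (dpart (A 0) v) = 0" for v
    proof -
      have "G x (N 0 x v) = G x v" for v
        using N(2)[of 0 x v] cocycle_zero[OF \<phi> \<Phi> frame_in[OF unitary_frame_real[OF G]]] by (simp add: \<phi>0)
      then have "A 0 = (\<lambda>v. v)" unfolding A_def using frame_eq_iff[OF unitary_frame_real[OF G]] by auto
      moreover have "linear (B 0)" using N(1) by (simp add: B_def sympl_def)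
      ultimately show ?thesis by (simp add: linear_0 dpart_linear)
    qed
    show "continuous_on {0..1} (\<lambda>\<sigma>. u (\<sigma> * s) x)" "continuous_on {0..1} (\<lambda>\<sigma>. u (\<sigma> * s + \<sigma> * t) x)"
      "continuous_on {0..1} (\<lambda>\<sigma>. u (\<sigma> * t) (\<phi> (\<sigma> * s) x))"
      by (intro cu continuous_flow_compose[OF \<phi>] continuous_intros)+
    show "eip (u (\<sigma> * s) x) = sgn (cdet (cpart (A \<sigma>)))" "eip (u (\<sigma> * t) (\<phi> (\<sigma> * s) x)) = sgn (cdet (cpart (B \<sigma>)))" for \<sigma>
      by (simp_all add: eu ph A_def B_def)
    show "eip (u (\<sigma> * s + \<sigma> * t) x) = sgn (cdet (cpart (\<lambda>v. B \<sigma> (A \<sigma> v))))" for \<sigma>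
      unfolding eu
    proof (rule rotation_phase_frame[OF G G ua ua])
      show "sympl (\<lambda>v. B \<sigma> (A \<sigma> v))" using N(1) by (simp add: A_def B_def sympl_compose)
      show "\<Phi> (\<sigma> * s + \<sigma> * t) x (G x v) = G (\<phi> (\<sigma> * s + \<sigma> * t) x) (B \<sigma> (A \<sigma> v))" for v
        unfolding \<Phi>add by (simp add: N(2) \<phi>add A_def B_def)
    qed
  qed
  then show ?thesis by (simp add: eu \<phi>0)
qed

section \<open>Independence of the complex structure and of the trivialization\<close>

text \<open>Extends a homotopy over the unit interval to all real parameters, as
  \<open>joint_lift\<close> works over the whole line.\<close>

definition clamp :: "real \<Rightarrow> real" where "clamp s = max 0 (min 1 s)"

lemma clamp: "clamp s \<in> {0..1}" "s \<in> {0..1} \<Longrightarrow> clamp s = s"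
  by (auto simp: clamp_def)

lemma continuous_on_clamp: "continuous_on S f \<Longrightarrow> continuous_on S (\<lambda>z. clamp (f z))"
  unfolding clamp_def by (intro continuous_intros)

text \<open>Let R s be the identity of the fibre written from the frame at parameter 0 to the frame
  at \<open>s\<close>, and N s the cocycle at time T in the frames at \<open>s\<close>. Then N s R s
  at x equals R s N 0 with R taken at the end point. Bounding the argument variation of both
  factorizations over \<open>s\<close> compares the rotation functions at s = 1 and s = 0. What
  remains are the arguments of R, bounded by compactness.\<close>

lemma homotopic_rotation_bounded:
  fixes \<phi> :: "real \<Rightarrow> 'y::t2_space \<Rightarrow> 'y" and E :: "('y, 'e::topological_space) symp_bundle"
    and p p' :: "('e \<Rightarrow> 'e) \<times> ('y, 'e, 'k::finite) det_triv"
  assumes cpt: "compact (UNIV :: 'y set)" and \<phi>: "continuous_flow \<phi>" and E: "symplectic_vector_bundle TYPE('k) E"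
    and \<Phi>: "symplectic_cocycle \<phi> E \<Phi>" and hom: "homotopic_triv E p p'"
  shows "\<exists>C. \<forall>T x. \<bar>rotation_function \<phi> E p' \<Phi> T x - rotation_function \<phi> E p \<Phi> T x\<bar> \<le> C"
proof -
  obtain J :: "real \<Rightarrow> 'e \<Rightarrow> 'e" and \<tau> :: "real \<Rightarrow> ('y, 'e, 'k) det_triv" where pp: "(J 0, \<tau> 0) = p" "(J 1, \<tau> 1) = p'"
    and tp: "\<forall>s\<in>{0..1}. triv_pair E (J s, \<tau> s)"
    and cJ: "continuous_on ({0..1} \<times> tot E) (\<lambda>(s, v). J s v)"
    and ct: "continuous_on ({0..1} \<times> (SIGMA x:UNIV. families E x)) (\<lambda>(s, x, v). \<tau> s x (wedge E (J s) x v))"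
    using hom unfolding homotopic_triv_def by (elim exE conjE)
  have tp0: "triv_pair E (J 0, \<tau> 0)" using tp by simp
  note tf0 = triv_facts[OF \<phi> E \<Phi> tp0]
  note vb = tf0(3)
  have cs: "compatible_cs E (J s)" if "s \<in> {0..1}" for s using triv_facts(1)[OF \<phi> E \<Phi>] tp that by blast
  have ua: "unitary_at E (J s) (\<tau> s) y" if "s \<in> {0..1}" for s y using tp that by (blast intro: unitary_triv_at)
  have "\<exists>g. unitary_frame E (J (clamp s)) (\<tau> (clamp s)) y g" for s y
    using triv_pair_frame[OF E] tp clamp(1) by blast
  then obtain G' where "\<And>s y. unitary_frame E (J (clamp s)) (\<tau> (clamp s)) y (G' s y)" by metis
  then obtain G where G: "\<And>s y. s \<in> {0..1} \<Longrightarrow> unitary_frame E (J s) (\<tau> s) y (G s y)"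
    by (metis clamp(2))
  have cf: "complex_frame E (J s) y (G s y)" if "s \<in> {0..1}" for s y by (rule unitary_frame_complex[OF G[OF that]])
  have rf: "real_frame E y (G s y)" if "s \<in> {0..1}" for s y by (rule unitary_frame_real[OF G[OF that]])
  have in01: "(0::real) \<in> {0..1}" "(1::real) \<in> {0..1}" by auto
  note G0 = G[OF in01(1)] and cf0 = cf[OF in01(1)] and rf0 = rf[OF in01(1)] and ua0 = ua[OF in01(1)]
  have "fibre_symplectic_iso E y E y (\<lambda>v. v)" for y
    by (simp add: fibre_symplectic_iso_def fibre_linear_def bij_betw_def)
  then have "\<exists>R. sympl R \<and> (\<forall>v. G 0 y v = G s y (R v))" if "s \<in> {0..1}" for s y
    using frame_rep[OF _ G0 G[OF that], of y y "\<lambda>v. v"] by simp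
  then have "\<forall>s y. \<exists>R. s \<in> {0..1} \<longrightarrow> sympl R \<and> (\<forall>v. G 0 y v = G s y (R v))" by blast
  then obtain R where R: "\<And>s y. s \<in> {0..1} \<Longrightarrow> sympl (R s y)" "\<And>s y v. s \<in> {0..1} \<Longrightarrow> G 0 y v = G s y (R s y v)"
    by metis
  have R0: "R 0 y = (\<lambda>v. v)" for y
    using R(2)[OF in01(1)] frame_eq_iff[OF rf0] by (metis ext)
  have wR: "\<tau> s y (wedge E (J s) y (\<lambda>j. bcpart E (J 0) (J s) (\<lambda>v. v) (G 0 y (v j)))) = cdet (cpart (R s y)) * col_det v"
    if "s \<in> {0..1}" for s y v
    by (rule wedge_bcpart[OF cf0 G[OF that] ua[OF that] R(2)[OF that] sympl_linear[OF R(1)[OF that]]])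
  have opJs: "opcont E S b b (\<lambda>z. J (s z))" if "continuous_on S s" "s ` S \<subseteq> {0..1}"
    for S :: "'x::topological_space set" and s b
    by (rule opcont_cs_path[OF cJ cs that])
  have opJ0: "opcont E S b b (\<lambda>z. J 0)" for S :: "'x::topological_space set" and b
    by (rule opcont_cs[OF tf0(1)])
  note opI = opcont_parts[OF vb opJ0 opcont_id opJs]
  \<comment> \<open>Determinant of the complex linear part of the identity between the structures at
    0 and \<open>s\<close>. It depends on the point only, not on time, so its lift \<rho> will be
    bounded uniformly.\<close>
  define w where "w s y = cdet (cpart (R (clamp s) y))" for s y
  have wnz: "w s y \<noteq> 0" for s y unfolding w_def by (rule sympl_cdet_nonzero[OF R(1)[OF clamp(1)]])
  have cw: "continuous_on UNIV (\<lambda>(s, y). w s y)"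
  proof (rule continuous_on_locally)
    fix z0 :: "real \<times> 'y"
    define x0 where "x0 = snd z0"
    have "G 0 x0 (axis j 1) \<in> fibre E x0" for j by (rule frame_in[OF rf0])
    then obtain U e where U: "open U" "x0 \<in> U" "\<And>j. bcont E U (\<lambda>y. y) (e j)" "\<And>j. e j x0 = G 0 x0 (axis j 1)"
      using local_sections[OF vb, of "\<lambda>j. G 0 x0 (axis j 1)" x0] by blast
    define d where "d y = \<tau> 0 y (wedge E (J 0) y (\<lambda>j. e j y))" for y
    have cd: "continuous_on U d" unfolding d_def by (rule continuous_on_wedge[OF tf0(2) U(3)])
    have d0: "d x0 = 1" using G0[of x0] by (simp add: d_def U(4) unitary_frame_def)
    define U' where "U' = U \<inter> d -` (- {0})"
    have "open U'" unfolding U'_def using cd U(1) by (rule continuous_open_preimage) auto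
    define T where "T = (UNIV :: real set) \<times> U'"
    have U'e: "bcont E T snd (\<lambda>z. e j (snd z))" for j
      using U(3)[of j] unfolding bcont_def T_def U'_def
      by (auto intro!: continuous_on_snd continuous_on_id intro: continuous_on_compose2)
    have cc: "continuous_on T (\<lambda>z. clamp (fst z))" "(\<lambda>z. clamp (fst z)) ` T \<subseteq> {0..1}"
      using clamp(1) by (auto intro!: continuous_on_clamp continuous_on_fst continuous_on_id)
    have "continuous_on T (\<lambda>z. \<tau> (clamp (fst z)) (snd z) (wedge E (J (clamp (fst z))) (snd z)
        (\<lambda>j. bcpart E (J 0) (J (clamp (fst z))) (\<lambda>v. v) (e j (snd z)))) / d (snd z))"
    proof (intro continuous_on_divide continuous_on_wedge_path[OF ct cc] opcontD[OF opI(1)[OF cc] U'e])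
      show "continuous_on T (\<lambda>z. d (snd z))"
        by (rule continuous_on_compose2[OF cd]) (auto simp: T_def U'_def intro!: continuous_on_snd continuous_on_id)
      show "\<forall>z\<in>T. d (snd z) \<noteq> 0" by (auto simp: T_def U'_def)
    qed
    then have "continuous_on T (\<lambda>(s, y). w s y)"
    proof (rule continuous_on_eq)
      fix z assume z: "z \<in> T"
      define y where "y = snd z"
      have "(\<lambda>j. e j y) \<in> families E y"
        using U'e z by (auto simp: bcont_def families_def y_def)
      then obtain v where v: "(\<lambda>j. e j y) = (\<lambda>j. G 0 y (v j))" using families_frame_cases[OF rf0] by blast
      then have ev: "e j y = G 0 y (v j)" for j by metis
      have "d y = col_det v" unfolding d_def v by (rule triv_wedge_unitary_frame[OF G0 ua0])
      moreover have "d y \<noteq> 0" using z by (auto simp: T_def U'_def y_def)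
      ultimately show "\<tau> (clamp (fst z)) (snd z) (wedge E (J (clamp (fst z))) (snd z)
        (\<lambda>j. bcpart E (J 0) (J (clamp (fst z))) (\<lambda>v. v) (e j (snd z)))) / d (snd z) = (\<lambda>(s, y). w s y) z"
        using wR[OF clamp(1), of "fst z" y v] unfolding y_def[symmetric] ev by (simp add: split_beta w_def y_def)
    qed
    moreover have "openin (top_of_set UNIV) T" using \<open>open U'\<close> by (simp add: T_def open_Times)
    moreover have "z0 \<in> T" using U(2) d0 by (simp add: T_def U'_def x0_def mem_Times_iff)
    ultimately show "\<exists>T. openin (top_of_set UNIV) T \<and> z0 \<in> T \<and> continuous_on T (\<lambda>(s, y). w s y)" by blast
  qed
  have "sgn (w 0 y) = 1" for y using clamp(2)[OF in01(1)] by (simp add: w_def R0)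
  from joint_lift[OF cw wnz this] obtain \<rho> where \<rho>: "continuous_on UNIV (\<lambda>(s, y). \<rho> s y)" "\<And>y. \<rho> 0 y = 0"
    "\<And>s y. eip (\<rho> s y) = sgn (w s y)" by blast
  \<comment> \<open>Compactness of the base gives a bound for \<rho> that serves every time and
    every point.\<close>
  have "compact ((\<lambda>(s, y). \<rho> s y) ` ({0..1} \<times> UNIV))"
    by (intro compact_continuous_image continuous_on_subset[OF \<rho>(1)] compact_Times cpt) auto
  then obtain D where "\<forall>z\<in>(\<lambda>(s, y). \<rho> s y) ` ({0..1} \<times> UNIV). norm z \<le> D"
    using compact_imp_bounded bounded_iff by blast
  then have D: "\<bar>\<rho> 1 y\<bar> \<le> D" for y by auto
  have "\<bar>rotation_function \<phi> E p' \<Phi> T x - rotation_function \<phi> E p \<Phi> T x\<bar> \<le> CARD('k) + 2 * D" for T x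
  proof -
    define y where "y = \<phi> T x"
    define e where "e j = G 0 x (axis j 1)" for j
    have eb: "bcont E S (\<lambda>_. x) (\<lambda>_. e j)" for S :: "'x::topological_space set" and j
      unfolding e_def by (rule bcont_const[OF frame_in[OF rf0]])
    have "\<forall>s t. \<exists>N. s \<in> {0..1} \<longrightarrow> sympl N \<and> (\<forall>v. \<Phi> t x (G s x v) = G s (\<phi> t x) (N v))"
      using frame_rep[OF cocycle_iso_at[OF \<phi> E \<Phi> tp0] G G] by blast
    then obtain N where N: "\<And>s t. s \<in> {0..1} \<Longrightarrow> sympl (N s t)"
       "\<And>s t v. s \<in> {0..1} \<Longrightarrow> \<Phi> t x (G s x v) = G s (\<phi> t x) (N s t v)" by metis
    have ph: "rotation_phase \<phi> E (J s, \<tau> s) \<Phi> t x = sgn (cdet (cpart (N s t)))" if "s \<in> {0..1}" for s t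
      by (rule rotation_phase_frame[OF G[OF that] G[OF that] ua[OF that] ua[OF that]], rule N(1)[OF that], rule N(2)[OF that])
    \<comment> \<open>The point \<open>x\<close> is fixed and the homotopy parameter takes the place
      of the space variable in \<open>joint_lift\<close>. The resulting lift is continuous in
      \<open>s\<close> at time \<open>T\<close>, and by uniqueness in time it is the rotation
      function of each pair.\<close>
    define l0 where "l0 t s = cdet (cpart (N (clamp s) t))" for t s
    have "continuous_on UNIV (\<lambda>z. \<tau> (clamp (snd z)) (\<phi> (fst z) x) (wedge E (J (clamp (snd z))) (\<phi> (fst z) x)
        (\<lambda>j. bcpart E (J (clamp (snd z))) (J (clamp (snd z))) (\<Phi> (fst z) x) (bcpart E (J 0) (J (clamp (snd z))) (\<lambda>v. v) (e j))))
        / w (snd z) x)"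
    proof (intro continuous_on_divide)
      have cc: "continuous_on (UNIV :: (real \<times> real) set) (\<lambda>z. clamp (snd z))" "(\<lambda>z. clamp (snd z)) ` (UNIV :: (real \<times> real) set) \<subseteq> {0..1}"
        "continuous_on (UNIV :: (real \<times> real) set) fst"
        using clamp(1) by (auto intro!: continuous_on_clamp continuous_on_snd continuous_on_fst continuous_on_id)
      show "continuous_on UNIV (\<lambda>z. \<tau> (clamp (snd z)) (\<phi> (fst z) x) (wedge E (J (clamp (snd z))) (\<phi> (fst z) x)
        (\<lambda>j. bcpart E (J (clamp (snd z))) (J (clamp (snd z))) (\<Phi> (fst z) x) (bcpart E (J 0) (J (clamp (snd z))) (\<lambda>v. v) (e j)))))"
        by (rule continuous_on_wedge_path[OF ct cc(1,2) opcontD[OF opcont_parts(1)[OF vb opJs[OF cc(1,2)]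
          opcont_cocycle[OF \<phi> \<Phi> cc(3)] opJs[OF cc(1,2)]] opcontD[OF opI(1)[OF cc(1,2)] eb]]])
      show "continuous_on UNIV (\<lambda>z :: real \<times> real. w (snd z) x)"
        by (rule continuous_on_compose2[OF continuous_on_sections(2)[OF cw] continuous_on_snd[OF continuous_on_id]]) (rule subset_UNIV)
    qed (use wnz in auto)
    moreover have "\<tau> s (\<phi> t x) (wedge E (J s) (\<phi> t x) (\<lambda>j. bcpart E (J s) (J s) (\<Phi> t x) (bcpart E (J 0) (J s) (\<lambda>v. v) (e j))))
        = cdet (cpart (N s t)) * cdet (cpart (R s x))" if "s \<in> {0..1}" for s t
    proof -
      have "bcpart E (J 0) (J s) (\<lambda>v. v) (e j) = G s x (cpart (R s x) (axis j 1))" for j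
        unfolding e_def by (rule bcpart_frame(1)[where N = "R s x", OF cf0 cf[OF that] R(2)[OF that]])
      then show ?thesis
        using wedge_bcpart[where A = "\<Phi> t x" and N = "N s t", OF cf[OF that] G[OF that] ua[OF that] N(2)[OF that] sympl_linear[OF N(1)[OF that]],
            of "\<lambda>j. cpart (R s x) (axis j 1)"] by (simp add: cdet_col)
    qed
    ultimately have "continuous_on UNIV (\<lambda>(t, s). l0 t s)"
      using clamp(1) wnz by (simp add: split_beta l0_def w_def)
    moreover have "l0 t s \<noteq> 0" for t s unfolding l0_def by (rule sympl_cdet_nonzero[OF N(1)[OF clamp(1)]])
    moreover have "sgn (l0 0 s) = 1" for s
      using rotation_phase_zero[OF \<phi> E \<Phi>, of "J (clamp s)" "\<tau> (clamp s)" x] tp clamp(1)[of s]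
      by (simp add: l0_def ph)
    ultimately obtain l where l: "continuous_on UNIV (\<lambda>(t, s). l t s)" "\<And>s. l 0 s = 0" "\<And>t s. eip (l t s) = sgn (l0 t s)"
      using joint_lift[of l0] by blast
    have lT: "l T s = rotation_function \<phi> E (J s, \<tau> s) \<Phi> T x" if s: "s \<in> {0..1}" for s
    proof -
      have rl: "rotation_lift \<phi> E (J s, \<tau> s) \<Phi> (rotation_function \<phi> E (J s, \<tau> s) \<Phi>)"
        using rotation_lift_exists[OF \<phi> E \<Phi>] tp s by blast
      have "continuous_on {-\<bar>T\<bar>..\<bar>T\<bar>} (\<lambda>t. l t s)" by (rule continuous_on_sections(2)[OF l(1)])
      then show ?thesis
      proof (rule rotation_lift_unique[OF rl])
      show "eip (l t s) = rotation_phase \<phi> E (J s, \<tau> s) \<Phi> t x" for t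
        using ph[OF s] by (simp add: l(3) l0_def clamp(2)[OF s])
      qed (use l(2) in auto)
    qed
    \<comment> \<open>The two factorizations of the cocycle map from the frame at 0 over
      \<open>x\<close> to the frame at \<open>s\<close> over \<open>y\<close>.\<close>
    have rep_eq: "N s T (R s x v) = R s y (N 0 T v)" if s: "s \<in> {0..1}" for s v
    proof -
      have "G s y (N s T (R s x v)) = G s y (R s y (N 0 T v))"
        using N(2)[OF s, of T "R s x v"] N(2)[OF in01(1), of T v] R(2)[OF s, of x v] R(2)[OF s, of y "N 0 T v"]
        by (simp add: y_def)
      then show ?thesis using frame_eq_iff[OF rf[OF s]] by blast
    qed
    have cid: "continuous_on {0..1::real} (\<lambda>s. s)" "(\<lambda>s. s) ` {0..1::real} \<subseteq> {0..1}"
        "continuous_on {0..1::real} (\<lambda>_. T)" by (auto intro: continuous_intros)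
    have "continuous_on {0..1} (\<lambda>s. \<tau> s y (wedge E (J s) y (\<lambda>j. bcpart E (J 0) (J s) (\<Phi> T x) (e j))))"
      unfolding y_def
      by (rule continuous_on_wedge_path[OF ct cid(1,2) opcontD[OF opcont_parts(1)[OF vb opJ0 opcont_cocycle[OF \<phi> \<Phi> cid(3)] opJs[OF cid(1,2)]] eb]])
    moreover have "\<tau> s y (wedge E (J s) y (\<lambda>j. bcpart E (J 0) (J s) (\<Phi> T x) (e j))) = cdet (cpart (\<lambda>v. N s T (R s x v)))"
      if s: "s \<in> {0..1}" for s
    proof -
      have "\<Phi> T x (G 0 x v) = G s y (N s T (R s x v))" for v
        using N(2)[OF s, of T "R s x v"] R(2)[OF s, of x v] by (simp add: y_def)
      from wedge_bcpart[where A = "\<Phi> T x" and N = "\<lambda>v. N s T (R s x v)", OF cf0 G[OF s] ua[OF s] this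
          sympl_linear[OF sympl_compose[OF R(1)[OF s] N(1)[OF s]]], of "\<lambda>j. axis j 1"]
      show ?thesis by (simp add: e_def)
    qed
    ultimately have cq: "continuous_on {0..1} (\<lambda>s. cdet (cpart (\<lambda>v. N s T (R s x v))))"
      by (rule continuous_on_eq)
    have "contractible {0..1::real}" by (simp add: convex_imp_contractible)
    moreover have "cdet (cpart (\<lambda>v. N s T (R s x v))) \<noteq> 0" if s: "s \<in> {0..1}" for s
      by (rule sympl_cdet_nonzero[OF sympl_compose[OF R(1)[OF s] N(1)[OF s]]])
    ultimately obtain q where q: "continuous_on {0..1} q" "\<And>s. s \<in> {0..1} \<Longrightarrow> cdet (cpart (\<lambda>v. N s T (R s x v))) = exp (q s)"
      using continuous_logarithm_on_contractible[OF cq] by metis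
    \<comment> \<open>An argument of the common composite along the homotopy; it cancels when the
      two estimates are subtracted.\<close>
    define c where "c s = Im (q s) / (2 * pi)" for s
    have cc: "continuous_on {0..1} c" unfolding c_def by (intro continuous_intros q(1)) simp
    have ec: "eip (c s) = sgn (cdet (cpart (\<lambda>v. N s T (R s x v))))" if "s \<in> {0..1}" for s
      unfolding q(2)[OF that] c_def sgn_exp by (rule refl)
    have c\<rho>: "continuous_on {0..1} (\<lambda>s. \<rho> s y)" for y by (rule continuous_on_sections(2)[OF \<rho>(1)])
    have cl: "continuous_on {0..1} (\<lambda>s. l T s)" by (rule continuous_on_sections(1)[OF l(1)])
    have e\<rho>: "eip (\<rho> s y) = sgn (cdet (cpart (R s y)))" if "s \<in> {0..1}" for s y
      by (simp add: \<rho>(3) w_def clamp(2)[OF that])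
    have el: "eip (l T s) = sgn (cdet (cpart (N s T)))" if "s \<in> {0..1}" for s
      by (simp add: l(3) l0_def clamp(2)[OF that])
    define S where "S = {0..1::real} \<times> {0..1::real}"
    have cS: "continuous_on S fst" "fst ` S \<subseteq> {0..1}" "continuous_on S snd" "continuous_on S (\<lambda>_. T)"
      by (auto simp: S_def intro: continuous_intros continuous_on_fst continuous_on_snd)
    note opS = opcont_parts[OF vb opJs[OF cS(1,2)] opcont_cocycle[OF \<phi> \<Phi> cS(4)] opJs[OF cS(1,2)]]
    note opS0 = opcont_parts[OF vb opJ0 opcont_cocycle[OF \<phi> \<Phi> cS(4)] opJ0]
    \<comment> \<open>At s = 0 the map R is the identity, so its antilinear part vanishes. This is
      the starting condition for this factorization and, with the factors in the other order, for
      the second one.\<close>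
    have "\<bar>(c 1 - \<rho> 1 x - l T 1) - (c 0 - \<rho> 0 x - l T 0)\<bar> \<le> CARD('k) / 2"
    proof (rule composition_argument_variation[where A = "\<lambda>s. R s x" and B = "\<lambda>s. N s T"])
      have "continuous_on S (\<lambda>z. \<tau> (fst z) y (wedge E (J (fst z)) y
          (\<lambda>j. vadd E (bcpart E (J (fst z)) (J (fst z)) (\<Phi> T x) (bcpart E (J 0) (J (fst z)) (\<lambda>v. v) (e j)))
            (vscale E (snd z) (bdpart E (J (fst z)) (J (fst z)) (\<Phi> T x) (bdpart E (J 0) (J (fst z)) (\<lambda>v. v) (e j)))))))"
        unfolding y_def
        by (rule continuous_on_wedge_path[OF ct cS(1,2) bcont_vadd[OF vb opcontD[OF opS(1) opcontD[OF opI(1)[OF cS(1,2)] eb]]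
             bcont_vscale[OF vb opcontD[OF opS(2) opcontD[OF opI(2)[OF cS(1,2)] eb]] cS(3)]]])
      then have "continuous_on S (\<lambda>z. cdet (\<lambda>v. cpart (N (fst z) T) (cpart (R (fst z) x) v) + snd z *\<^sub>R dpart (N (fst z) T) (dpart (R (fst z) x) v)))"
      proof (rule continuous_on_eq)
        fix z assume "z \<in> S"
        then have s: "fst z \<in> {0..1}" by (auto simp: S_def)
        show "\<tau> (fst z) y (wedge E (J (fst z)) y
          (\<lambda>j. vadd E (bcpart E (J (fst z)) (J (fst z)) (\<Phi> T x) (bcpart E (J 0) (J (fst z)) (\<lambda>v. v) (e j)))
            (vscale E (snd z) (bdpart E (J (fst z)) (J (fst z)) (\<Phi> T x) (bdpart E (J 0) (J (fst z)) (\<lambda>v. v) (e j)))))) =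
          cdet (\<lambda>v. cpart (N (fst z) T) (cpart (R (fst z) x) v) + snd z *\<^sub>R dpart (N (fst z) T) (dpart (R (fst z) x) v))"
          unfolding e_def y_def by (rule wedge_mix[OF cf0 cf[OF s] G[OF s] ua[OF s]], rule R(2)[OF s], rule N(2)[OF s])
      qed
      then show "continuous_on ({0..1} \<times> {0..1}) (\<lambda>(s, r). cdet (\<lambda>v. cpart (N s T) (cpart (R s x) v) + r *\<^sub>R dpart (N s T) (dpart (R s x) v)))"
        by (simp add: S_def split_beta)
      show "dpart (N 0 T) (dpart (R 0 x) v) = 0" for v
        using dpart_linear[OF sympl_linear[OF N(1)[OF in01(1)]]] by (simp add: R0 linear_0)
    qed (use R(1) N(1) cc c\<rho> cl e\<rho> el ec in auto)
    moreover have "\<bar>(c 1 - l T 0 - \<rho> 1 y) - (c 0 - l T 0 - \<rho> 0 y)\<bar> \<le> CARD('k) / 2"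
    proof (rule composition_argument_variation[where A = "\<lambda>s. N 0 T" and B = "\<lambda>s. R s y"])
      have "continuous_on S (\<lambda>z. \<tau> (fst z) y (wedge E (J (fst z)) y
          (\<lambda>j. vadd E (bcpart E (J 0) (J (fst z)) (\<lambda>v. v) (bcpart E (J 0) (J 0) (\<Phi> T x) (e j)))
            (vscale E (snd z) (bdpart E (J 0) (J (fst z)) (\<lambda>v. v) (bdpart E (J 0) (J 0) (\<Phi> T x) (e j)))))))"
        unfolding y_def
        by (rule continuous_on_wedge_path[OF ct cS(1,2) bcont_vadd[OF vb opcontD[OF opI(1)[OF cS(1,2)] opcontD[OF opS0(1) eb]]
             bcont_vscale[OF vb opcontD[OF opI(2)[OF cS(1,2)] opcontD[OF opS0(2) eb]] cS(3)]]])
      then have "continuous_on S (\<lambda>z. cdet (\<lambda>v. cpart (R (fst z) y) (cpart (N 0 T) v) + snd z *\<^sub>R dpart (R (fst z) y) (dpart (N 0 T) v)))"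
      proof (rule continuous_on_eq)
        fix z assume "z \<in> S"
        then have s: "fst z \<in> {0..1}" by (auto simp: S_def)
        show "\<tau> (fst z) y (wedge E (J (fst z)) y
          (\<lambda>j. vadd E (bcpart E (J 0) (J (fst z)) (\<lambda>v. v) (bcpart E (J 0) (J 0) (\<Phi> T x) (e j)))
            (vscale E (snd z) (bdpart E (J 0) (J (fst z)) (\<lambda>v. v) (bdpart E (J 0) (J 0) (\<Phi> T x) (e j)))))) =
          cdet (\<lambda>v. cpart (R (fst z) y) (cpart (N 0 T) v) + snd z *\<^sub>R dpart (R (fst z) y) (dpart (N 0 T) v))"
          unfolding e_def y_def by (rule wedge_mix[OF cf0 cf0 G[OF s] ua[OF s]], rule N(2)[OF in01(1)], rule R(2)[OF s])
      qed
      then show "continuous_on ({0..1} \<times> {0..1}) (\<lambda>(s, r). cdet (\<lambda>v. cpart (R s y) (cpart (N 0 T) v) + r *\<^sub>R dpart (R s y) (dpart (N 0 T) v)))"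
        by (simp add: S_def split_beta)
      show "dpart (R 0 y) (dpart (N 0 T) v) = 0" for v by (simp add: R0)
      show "eip (c s) = sgn (cdet (cpart (\<lambda>v. R s y (N 0 T v))))" if "s \<in> {0..1}" for s
        using ec[OF that] by (simp add: rep_eq[OF that])
      show "eip (l T 0) = sgn (cdet (cpart (N 0 T)))" by (rule el[OF in01(1)])
    qed (use R(1) N(1)[OF in01(1)] cc c\<rho> e\<rho> in \<open>auto intro: continuous_intros\<close>)
    \<comment> \<open>Subtracting the two estimates costs twice k / 2, and \<rho> at
      \<open>x\<close> and at \<open>y\<close> costs D each; at s = 0 it vanishes.\<close>
    ultimately have "\<bar>l T 1 - l T 0\<bar> \<le> CARD('k) + 2 * D"
      using D[of x] D[of y] by (simp add: \<rho>(2) abs_le_iff) argo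
    then show ?thesis using lT[OF in01(1)] lT[OF in01(2)] pp by simp
  qed
  then show ?thesis by blast
qed

section \<open>Limits in mean\<close>

text \<open>After division by T the perturbation contributes at most C times the total mass over T
  to the distance in mean.\<close>

lemma L1_limit_perturb:
  fixes F G :: "real \<Rightarrow> 'y \<Rightarrow> real"
  assumes "finite_measure \<mu>" and F: "L1_limit \<mu> (\<lambda>T x. F T x / T) f"
    and G: "\<forall>\<^sub>F T in at_top. integrable \<mu> (\<lambda>x. G T x / T)" and C: "\<And>T x. T > 0 \<Longrightarrow> \<bar>G T x - F T x\<bar> \<le> C"
  shows "L1_limit \<mu> (\<lambda>T x. G T x / T) f"
  unfolding L1_limit_def
proof (intro conjI G)
  interpret finite_measure \<mu> by fact
  show f: "integrable \<mu> f" using F by (simp add: L1_limit_def)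
  have iF: "\<forall>\<^sub>F T in at_top. integrable \<mu> (\<lambda>x. F T x / T)" using F by (simp add: L1_limit_def)
  define M where "M = measure \<mu> (space \<mu>)"
  show "((\<lambda>T. \<integral>x. \<bar>G T x / T - f x\<bar> \<partial>\<mu>) \<longlongrightarrow> 0) at_top"
  proof (rule tendsto_sandwich[of "\<lambda>_. 0" _ _ "\<lambda>T. C * M / T + (\<integral>x. \<bar>F T x / T - f x\<bar> \<partial>\<mu>)"])
    have "((\<lambda>T::real. C * M / T) \<longlongrightarrow> 0) at_top"
      by (intro tendsto_divide_0[OF tendsto_const] filterlim_at_top_imp_at_infinity filterlim_ident)
    then show "((\<lambda>T. C * M / T + (\<integral>x. \<bar>F T x / T - f x\<bar> \<partial>\<mu>)) \<longlongrightarrow> 0) at_top"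
      using F by (intro tendsto_add_zero) (simp_all add: L1_limit_def)
    show "\<forall>\<^sub>F T in at_top. (\<integral>x. \<bar>G T x / T - f x\<bar> \<partial>\<mu>) \<le> C * M / T + (\<integral>x. \<bar>F T x / T - f x\<bar> \<partial>\<mu>)"
      using G iF eventually_gt_at_top[of 0]
    proof eventually_elim
      case (elim T)
      have "(\<integral>x. \<bar>G T x / T - f x\<bar> \<partial>\<mu>) \<le> (\<integral>x. C / T + \<bar>F T x / T - f x\<bar> \<partial>\<mu>)"
      proof (rule integral_mono)
        fix x
        have "\<bar>(G T x - F T x) / T\<bar> \<le> C / T"
          unfolding abs_divide using C[OF elim(3), of x] elim(3) by (simp add: divide_right_mono)
        moreover have "(G T x - F T x) / T = G T x / T - F T x / T" by (simp add: diff_divide_distrib)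
        ultimately show "\<bar>G T x / T - f x\<bar> \<le> C / T + \<bar>F T x / T - f x\<bar>" by linarith
      qed (intro integrable_abs Bochner_Integration.integrable_diff Bochner_Integration.integrable_add
          elim f integrable_const)+
      also have "\<dots> = (\<integral>x. C / T \<partial>\<mu>) + (\<integral>x. \<bar>F T x / T - f x\<bar> \<partial>\<mu>)"
        by (intro Bochner_Integration.integral_add integrable_const integrable_abs Bochner_Integration.integrable_diff elim f)
      also have "(\<integral>x. C / T \<partial>\<mu>) = C * M / T" by (simp add: M_def)
      finally show ?case .
    qed
  qed auto
qed

lemma L1_limit_unique:
  assumes F: "L1_limit \<mu> F f" and G: "L1_limit \<mu> F g"
  shows "AE x in \<mu>. f x = g x"
proof -
  have f: "integrable \<mu> f" and g: "integrable \<mu> g" using F G by (auto simp: L1_limit_def)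
  have d: "integrable \<mu> (\<lambda>x. \<bar>f x - g x\<bar>)"
    by (intro integrable_abs Bochner_Integration.integrable_diff f g)
  have "((\<lambda>T. (\<integral>x. \<bar>F T x - f x\<bar> \<partial>\<mu>) + (\<integral>x. \<bar>F T x - g x\<bar> \<partial>\<mu>)) \<longlongrightarrow> 0) at_top"
    using F G by (intro tendsto_add_zero) (auto simp: L1_limit_def)
  moreover have "\<forall>\<^sub>F T in at_top. integrable \<mu> (F T)" using F by (simp add: L1_limit_def)
  then have "\<forall>\<^sub>F T in at_top. (\<integral>x. \<bar>f x - g x\<bar> \<partial>\<mu>) \<le> (\<integral>x. \<bar>F T x - f x\<bar> \<partial>\<mu>) + (\<integral>x. \<bar>F T x - g x\<bar> \<partial>\<mu>)"
  proof eventually_elim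
    case (elim T)
    have "(\<integral>x. \<bar>f x - g x\<bar> \<partial>\<mu>) \<le> (\<integral>x. \<bar>F T x - f x\<bar> + \<bar>F T x - g x\<bar> \<partial>\<mu>)"
      by (intro integral_mono d Bochner_Integration.integrable_add integrable_abs Bochner_Integration.integrable_diff elim f g) auto
    also have "\<dots> = (\<integral>x. \<bar>F T x - f x\<bar> \<partial>\<mu>) + (\<integral>x. \<bar>F T x - g x\<bar> \<partial>\<mu>)"
      by (intro Bochner_Integration.integral_add integrable_abs Bochner_Integration.integrable_diff elim f g)
    finally show ?case .
  qed
  ultimately have "(\<integral>x. \<bar>f x - g x\<bar> \<partial>\<mu>) \<le> 0"
    by (intro tendsto_lowerbound[of _ 0 at_top]) auto
  moreover have "0 \<le> (\<integral>x. \<bar>f x - g x\<bar> \<partial>\<mu>)" by simp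
  ultimately have "(\<integral>x. \<bar>f x - g x\<bar> \<partial>\<mu>) = 0" by linarith
  then have "AE x in \<mu>. \<bar>f x - g x\<bar> = 0"
    using integral_nonneg_eq_0_iff_AE[OF d] by simp
  then show ?thesis by simp
qed

lemma L1_limit_integral:
  assumes F: "L1_limit \<mu> F f"
  shows "((\<lambda>T. \<integral>x. F T x \<partial>\<mu>) \<longlongrightarrow> (\<integral>x. f x \<partial>\<mu>)) at_top"
proof -
  have f: "integrable \<mu> f" and lim: "((\<lambda>T. \<integral>x. \<bar>F T x - f x\<bar> \<partial>\<mu>) \<longlongrightarrow> 0) at_top"
    using F by (auto simp: L1_limit_def)
  have "\<forall>\<^sub>F T in at_top. integrable \<mu> (F T)" using F by (simp add: L1_limit_def)
  then have "\<forall>\<^sub>F T in at_top. norm ((\<integral>x. F T x \<partial>\<mu>) - (\<integral>x. f x \<partial>\<mu>)) \<le> (\<integral>x. \<bar>F T x - f x\<bar> \<partial>\<mu>)"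
  proof eventually_elim
    case (elim T)
    have "(\<integral>x. F T x \<partial>\<mu>) - (\<integral>x. f x \<partial>\<mu>) = (\<integral>x. F T x - f x \<partial>\<mu>)"
      by (rule Bochner_Integration.integral_diff[symmetric, OF elim f])
    then show ?case using integral_abs_bound[of \<mu> "\<lambda>x. F T x - f x"] by simp
  qed
  from Lim_null_comparison[OF this lim] show ?thesis by (simp add: LIM_zero_iff)
qed

section \<open>The Ruelle density\<close>

lemma homotopic_triv_refl:
  assumes "triv_pair E p"
  shows "homotopic_triv E p p"
proof -
  obtain J \<tau> where p: "p = (J, \<tau>)" by (cases p)
  have J: "continuous_on (tot E) J" and \<tau>: "continuous_on (SIGMA x:UNIV. families E x) (\<lambda>(x, v). \<tau> x (wedge E J x v))"
    using assms by (auto simp: p triv_pair_def compatible_cs_def unitary_triv_on_def)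
  have "continuous_on ({0..1::real} \<times> tot E) (\<lambda>z. J (snd z))"
    by (rule continuous_on_compose2[OF J continuous_on_snd[OF continuous_on_id]]) auto
  moreover have "continuous_on ({0..1::real} \<times> (SIGMA x:UNIV. families E x)) (\<lambda>z. (\<lambda>(x, v). \<tau> x (wedge E J x v)) (snd z))"
    by (rule continuous_on_compose2[OF \<tau> continuous_on_snd[OF continuous_on_id]]) auto
  ultimately show ?thesis
    unfolding homotopic_triv_def using assms
    by (intro exI[of _ "\<lambda>_. J"] exI[of _ "\<lambda>_. \<tau>"]) (auto simp: p split_def)
qed

lemma homotopic_triv_pair: "homotopic_triv E p p' \<Longrightarrow> triv_pair E p'"
  unfolding homotopic_triv_def by (metis atLeastAtMost_iff order_refl zero_le_one)

lemma integrable_rotation: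
  fixes \<phi> :: "real \<Rightarrow> 'y::t2_space \<Rightarrow> 'y" and E :: "('y, 'e::topological_space) symp_bundle"
    and p :: "('e \<Rightarrow> 'e) \<times> ('y, 'e, 'k::finite) det_triv"
  assumes "compact (UNIV :: 'y set)" "continuous_flow \<phi>" "invariant_measure \<phi> \<mu>"
    and "symplectic_vector_bundle TYPE('k) E" "symplectic_cocycle \<phi> E \<Phi>" "triv_pair E p"
  shows "integrable \<mu> (\<lambda>x. rotation_function \<phi> E p \<Phi> T x / T)"
proof -
  obtain J \<tau> where p: "p = (J, \<tau>)" by (cases p)
  have "rotation_lift \<phi> E p \<Phi> (rotation_function \<phi> E p \<Phi>)"
    unfolding p by (rule rotation_lift_exists) (use assms p in auto)
  then have "continuous_on UNIV (\<lambda>x. rotation_function \<phi> E p \<Phi> T x)"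
    unfolding rotation_lift_def using continuous_on_sections(1) by blast
  then have "integrable \<mu> (\<lambda>x. rotation_function \<phi> E p \<Phi> T x)"
    using assms(1,3) by (intro integrable_continuous_compact) (auto simp: invariant_measure_def)
  then show ?thesis by (rule integrable_divide_zero)
qed

lemma rotation_L1_limit:
  fixes \<phi> :: "real \<Rightarrow> 'y::t2_space \<Rightarrow> 'y" and E :: "('y, 'e::topological_space) symp_bundle"
    and p :: "('e \<Rightarrow> 'e) \<times> ('y, 'e, 'k::finite) det_triv"
  assumes "compact (UNIV :: 'y set)" "continuous_flow \<phi>" "invariant_measure \<phi> \<mu>"
    and "symplectic_vector_bundle TYPE('k) E" "symplectic_cocycle \<phi> E \<Phi>" "triv_pair E p"
  shows "\<exists>f. L1_limit \<mu> (\<lambda>T x. rotation_function \<phi> E p \<Phi> T x / T) f"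
proof -
  obtain J \<tau> where p: "p = (J, \<tau>)" by (cases p)
  have l: "rotation_lift \<phi> E (J, \<tau>) \<Phi> (rotation_function \<phi> E (J, \<tau>) \<Phi>)"
    by (rule rotation_lift_exists) (use assms p in auto)
  interpret quasi_cocycle \<phi> \<mu> "rotation_function \<phi> E p \<Phi>" "CARD('k) / 2"
  proof
    show "continuous_on UNIV (\<lambda>(t, x). rotation_function \<phi> E p \<Phi> t x)"
      using l by (simp add: p rotation_lift_def)
    show "\<bar>rotation_function \<phi> E p \<Phi> (s + t) x - rotation_function \<phi> E p \<Phi> s x
        - rotation_function \<phi> E p \<Phi> t (\<phi> s x)\<bar> \<le> CARD('k) / 2" for s t x
      unfolding p by (rule rotation_quasi[OF _ _ _ _ l]) (use assms p in auto)
  qed (use assms in auto)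
  show ?thesis by (rule L1_limit_exists)
qed

lemma is_ruelle_density_homotopy_class:
  fixes \<phi> :: "real \<Rightarrow> 'y::t2_space \<Rightarrow> 'y" and E :: "('y, 'e::topological_space) symp_bundle"
    and p :: "('e \<Rightarrow> 'e) \<times> ('y, 'e, 'k::finite) det_triv"
  assumes "compact (UNIV :: 'y set)" "continuous_flow \<phi>" "invariant_measure \<phi> \<mu>"
    and "symplectic_vector_bundle TYPE('k) E" "symplectic_cocycle \<phi> E \<Phi>"
    and f: "L1_limit \<mu> (\<lambda>T x. rotation_function \<phi> E p \<Phi> T x / T) f"
  shows "is_ruelle_density \<phi> E \<Phi> (homotopy_class E p) \<mu> f"
  unfolding is_ruelle_density_def
proof
  fix p' assume "p' \<in> homotopy_class E p"
  then have h: "homotopic_triv E p p'" by (simp add: homotopy_class_def)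
  obtain C where C: "\<And>T x. \<bar>rotation_function \<phi> E p' \<Phi> T x - rotation_function \<phi> E p \<Phi> T x\<bar> \<le> C"
    using homotopic_rotation_bounded[OF assms(1,2,4,5) h] by blast
  show "L1_limit \<mu> (\<lambda>T x. rotation_function \<phi> E p' \<Phi> T x / T) f"
    using integrable_rotation[OF assms(1-5) homotopic_triv_pair[OF h]] assms(3)
    by (intro L1_limit_perturb[OF _ f _ C]) (auto simp: invariant_measure_def)
qed

lemma ruelle_density_exists:
  fixes \<phi> :: "real \<Rightarrow> 'y::t2_space \<Rightarrow> 'y" and E :: "('y, 'e::topological_space) symp_bundle"
    and \<tau> :: "(('e \<Rightarrow> 'e) \<times> ('y, 'e, 'k::finite) det_triv) set"
  assumes "compact (UNIV :: 'y set)" "continuous_flow \<phi>" "invariant_measure \<phi> \<mu>"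
    and "symplectic_vector_bundle TYPE('k) E" "symplectic_cocycle \<phi> E \<Phi>" "triv_class E \<tau>"
  shows "\<exists>f. is_ruelle_density \<phi> E \<Phi> \<tau> \<mu> f"
proof -
  obtain p where p: "triv_pair E p" "\<tau> = homotopy_class E p" using assms(6) by (auto simp: triv_class_def)
  show ?thesis
    using rotation_L1_limit[OF assms(1-5) p(1)] is_ruelle_density_homotopy_class[OF assms(1-5)] p(2) by blast
qed

text \<open>A member of the class is what ties \<open>is_ruelle_density\<close> to an actual limit;
  over an empty set it would hold vacuously and determine nothing.\<close>

lemma triv_class_nonempty: "triv_class E \<tau> \<Longrightarrow> \<exists>p\<in>\<tau>. triv_pair E p"
  unfolding triv_class_def homotopy_class_def using homotopic_triv_refl by blast

lemma triv_class_pair: "triv_class E \<tau> \<Longrightarrow> p \<in> \<tau> \<Longrightarrow> triv_pair E p"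
  unfolding triv_class_def homotopy_class_def using homotopic_triv_pair by blast

lemma ruelle_density_L1:
  assumes "is_ruelle_density \<phi> E \<Phi> \<tau> \<mu> f" "p \<in> \<tau>"
  shows "L1_limit \<mu> (\<lambda>T x. rotation_function \<phi> E p \<Phi> T x / T) (ruelle_density \<phi> E \<Phi> \<tau> \<mu>)"
proof -
  have "is_ruelle_density \<phi> E \<Phi> \<tau> \<mu> (ruelle_density \<phi> E \<Phi> \<tau> \<mu>)"
    unfolding ruelle_density_def by (rule someI[of "is_ruelle_density \<phi> E \<Phi> \<tau> \<mu>", OF assms(1)])
  then show ?thesis using assms(2) by (simp add: is_ruelle_density_def)
qed

lemma L1_limit_integral_eq:
  assumes "AE x in \<mu>. f x = g x" "L1_limit \<mu> F f" "L1_limit \<mu> G g"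
  shows "(\<integral>x. f x \<partial>\<mu>) = (\<integral>x. g x \<partial>\<mu>)"
  using assms by (intro integral_cong_AE) (auto simp: L1_limit_def)

section \<open>Covariance\<close>

text \<open>The pushed complex structure is the conjugate by \<Psi> and the pushed trivialization is
  \<tau> after the determinant of the inverse of \<Psi>, so composing a frame with \<Psi> preserves
  all its properties.\<close>

lemma push_triv_frame:
  fixes E :: "('y::topological_space, 'e::topological_space) symp_bundle" and E' :: "('y, 'f::topological_space) symp_bundle"
    and \<tau> :: "('y, 'e, 'k::finite) det_triv"
  assumes vb': "vector_bundle TYPE('k) E'" and iso: "cocycle_iso \<phi> E \<Phi> E' \<Phi>' \<Psi>"
    and g: "unitary_frame E J \<tau> x g" and push: "push_triv E E' \<Psi> (J, \<tau>) = (J', \<tau>')"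
  shows "unitary_frame E' J' \<tau>' x (\<lambda>v. \<Psi> (g v))"
proof -
  note c = unitary_frame_complex[OF g] and r = unitary_frame_real[OF g]
  note gf = frame_in[OF r]
  define \<Psi>' where "\<Psi>' = inv_into (tot E) \<Psi>"
  have J': "J' = (\<lambda>v. \<Psi> (J (\<Psi>' v)))" and \<tau>': "\<tau>' = (\<lambda>x L. \<tau> x (det_map E' x E J x \<Psi>' L))"
    using push by (auto simp: push_triv_def \<Psi>'_def Let_def)
  have "\<exists>\<Psi>i. homeomorphism (tot E) (tot E') \<Psi> \<Psi>i" using iso unfolding cocycle_iso_def by (rule conjunct1)
  then obtain \<Psi>i where "homeomorphism (tot E) (tot E') \<Psi> \<Psi>i" by (rule exE)
  then have "inj_on \<Psi> (tot E)" by (intro inj_on_inverseI[of _ \<Psi>i]) (simp add: homeomorphism_def)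
  then have inv: "\<Psi>' (\<Psi> (g v)) = g v" for v
    unfolding \<Psi>'_def using gf[of v] by (intro inv_into_f_f) (auto simp: fibre_def)
  have fs: "fibre_symplectic_iso E x E' x \<Psi>" using iso by (simp add: cocycle_iso_def)
  then have lin: "\<Psi> (vadd E (g v) (g w)) = vadd E' (\<Psi> (g v)) (\<Psi> (g w))"
      "\<Psi> (vscale E a (g v)) = vscale E' a (\<Psi> (g v))" "\<Psi> (g v) \<in> fibre E' x" for v w a
    using gf by (auto simp: fibre_symplectic_iso_def fibre_linear_def)
  obtain g' :: "complex ^ 'k \<Rightarrow> 'f" where g': "real_frame E' x g'" using vector_bundle_real_frame[OF vb'] by blast
  have v0: "vscale E' 0 u = vzero E' x" if u: "u \<in> fibre E' x" for u
  proof -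
    obtain a where "u = g' a" using frame_cases[OF g' u] by blast
    then show ?thesis by (simp add: frame_ops[OF g'])
  qed
  \<comment> \<open>\<open>fibre_linear\<close> has no clause about the zero vector; that it is
    preserved comes from scaling by 0.\<close>
  have "\<Psi> (g 0) = \<Psi> (vscale E 0 (g 0))" by (simp add: frame_ops(3)[OF r])
  also have "\<dots> = vzero E' x" by (simp only: lin(2) v0[OF lin(3)])
  finally have z: "\<Psi> (g 0) = vzero E' x" .
  have bij: "bij_betw (\<lambda>v. \<Psi> (g v)) UNIV (fibre E' x)"
    using bij_betw_trans[of g UNIV "fibre E x" \<Psi>] r fs
    by (simp add: real_frame_def fibre_symplectic_iso_def comp_def)
  have rr: "real_frame E' x (\<lambda>v. \<Psi> (g v))"
    unfolding real_frame_def
  proof (intro conjI allI bij z)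
    show "\<Psi> (g (v + w)) = vadd E' (\<Psi> (g v)) (\<Psi> (g w))" for v w
      by (simp only: lin(1)[symmetric] frame_ops(2)[OF r])
    show "\<Psi> (g (a *\<^sub>R v)) = vscale E' a (\<Psi> (g v))" for a v
      by (simp only: lin(2)[symmetric] frame_ops(3)[OF r])
  qed
  have JJ: "J' (\<Psi> (g v)) = \<Psi> (g (\<i> *s v))" for v
    using c by (simp add: J' inv complex_frame_def)
  have cc: "complex_frame E' J' x (\<lambda>v. \<Psi> (g v))"
    using rr by (simp add: complex_frame_def JJ)
  have all: "(\<forall>v\<in>fibre E' x. Q v) \<longleftrightarrow> (\<forall>v. Q (\<Psi> (g v)))" for Q
    using lin(3) frame_cases[OF rr] by metis
  have "fibre_linear E' x E x \<Psi>'"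
    unfolding fibre_linear_def all by (simp add: inv gf frame_ops[OF r] frame_ops[OF rr])
  moreover have "\<Psi>' (J' v) = J (\<Psi>' v)" if v: "v \<in> fibre E' x" for v
  proof -
    obtain a where a: "v = \<Psi> (g a)" using frame_cases[OF rr v] by blast
    have "J (g a) = g (\<i> *s a)" using c by (simp add: complex_frame_def)
    then show ?thesis by (simp add: a JJ inv)
  qed
  ultimately have "det_map E' x E J x \<Psi>' (wedge E' J' x (\<lambda>j. \<Psi> (g (axis j 1)))) = wedge E J x (\<lambda>j. g (axis j 1))"
    using det_map_wedge[OF cc, of E x \<Psi>' J "\<lambda>j. \<Psi> (g (axis j 1))"] by (simp add: inv frame_families[OF rr])
  moreover have "omega E' (\<Psi> (g v)) (\<Psi> (g w)) = std_form v w" for v w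
    using fs gf g by (simp add: fibre_symplectic_iso_def unitary_frame_def)
  ultimately show ?thesis
    using cc g by (simp add: unitary_frame_def \<tau>')
qed

text \<open>In transported frames the two cocycles have the same matrix. The phases, and with them
  the rotation functions, therefore agree exactly and not merely up to a bounded error.\<close>

lemma rotation_function_push:
  fixes E :: "('y::topological_space, 'e::topological_space) symp_bundle" and E' :: "('y, 'f::topological_space) symp_bundle"
    and \<tau> :: "('y, 'e, 'k::finite) det_triv"
  assumes \<phi>: "continuous_flow \<phi>" and E: "symplectic_vector_bundle TYPE('k) E" and E': "symplectic_vector_bundle TYPE('k) E'"
    and \<Phi>: "symplectic_cocycle \<phi> E \<Phi>" and iso: "cocycle_iso \<phi> E \<Phi> E' \<Phi>' \<Psi>"
    and p: "triv_pair E (J, \<tau>)" and p': "triv_pair E' (push_triv E E' \<Psi> (J, \<tau>))"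
  shows "rotation_function \<phi> E' (push_triv E E' \<Psi> (J, \<tau>)) \<Phi>' = rotation_function \<phi> E (J, \<tau>) \<Phi>"
proof -
  obtain J' \<tau>' where push: "push_triv E E' \<Psi> (J, \<tau>) = (J', \<tau>')" by (cases "push_triv E E' \<Psi> (J, \<tau>)")
  have vb': "vector_bundle TYPE('k) E'" using E' by (simp add: symplectic_vector_bundle_def)
  have "rotation_phase \<phi> E' (J', \<tau>') \<Phi>' t x = rotation_phase \<phi> E (J, \<tau>) \<Phi> t x" for t x
  proof -
    obtain g where g: "unitary_frame E J \<tau> x g" using triv_pair_frame[OF E p] by blast
    obtain g' where g': "unitary_frame E J \<tau> (\<phi> t x) g'" using triv_pair_frame[OF E p] by blast
    obtain N where N: "sympl N" "\<And>v. \<Phi> t x (g v) = g' (N v)"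
       and ph: "rotation_phase \<phi> E (J, \<tau>) \<Phi> t x = sgn (cdet (cpart N))"
      using rotation_phase_rep[OF \<phi> E \<Phi> p g g'] by blast
    have "rotation_phase \<phi> E' (J', \<tau>') \<Phi>' t x = sgn (cdet (cpart N))"
    proof (rule rotation_phase_frame[where t = t and x = x and \<phi> = \<phi>, OF push_triv_frame[OF vb' iso g push] push_triv_frame[OF vb' iso g' push]])
      show "sympl N" by (rule N(1))
      show "unitary_at E' J' \<tau>' x" "unitary_at E' J' \<tau>' (\<phi> t x)"
        using p' push by (auto intro: unitary_triv_at)
      show "\<Phi>' t x (\<Psi> (g v)) = \<Psi> (g' (N v))" for v
        using iso frame_in[OF unitary_frame_real[OF g]] N(2) unfolding cocycle_iso_def by metis
    qed
    then show ?thesis by (simp add: ph)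
  qed
  then show ?thesis by (simp add: push rotation_function_def)
qed

section \<open>Combinations of measures\<close>

lemma sets_comb [simp]: "sets (comb_measure a \<mu> b \<nu>) = sets borel"
  and space_comb [simp]: "space (comb_measure a \<mu> b \<nu>) = UNIV"
  using sets.sigma_sets_eq[of borel] by (auto simp: comb_measure_def)

text \<open>\<open>measure_of\<close> returns the intended values once the set function is positive
  and countably additive.\<close>

lemma emeasure_comb:
  assumes "sets \<mu> = sets borel" "sets \<nu> = sets borel" "A \<in> sets borel"
  shows "emeasure (comb_measure a \<mu> b \<nu>) A = ennreal a * emeasure \<mu> A + ennreal b * emeasure \<nu> A"
proof (rule emeasure_measure_of[OF comb_measure_def])
  show "countably_additive (sets (comb_measure a \<mu> b \<nu>)) (\<lambda>A. ennreal a * emeasure \<mu> A + ennreal b * emeasure \<nu> A)"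
    unfolding countably_additive_def
  proof (intro allI impI)
    fix A :: "nat \<Rightarrow> 'a set"
    assume A: "range A \<subseteq> sets (comb_measure a \<mu> b \<nu>)" "disjoint_family A"
    then have "(\<Sum>i. emeasure \<mu> (A i)) = emeasure \<mu> (\<Union>i. A i)" "(\<Sum>i. emeasure \<nu> (A i)) = emeasure \<nu> (\<Union>i. A i)"
      using assms by (auto intro!: suminf_emeasure)
    then show "(\<Sum>i. ennreal a * emeasure \<mu> (A i) + ennreal b * emeasure \<nu> (A i)) =
        ennreal a * emeasure \<mu> (\<Union>i. A i) + ennreal b * emeasure \<nu> (\<Union>i. A i)"
      by (simp add: suminf_add[symmetric])
  qed
qed (use assms in \<open>auto simp: positive_def\<close>)

lemma nn_integral_comb:
  assumes \<mu>: "sets \<mu> = sets borel" and \<nu>: "sets \<nu> = sets borel" and f: "f \<in> borel_measurable borel"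
  shows "(\<integral>\<^sup>+x. f x \<partial>comb_measure a \<mu> b \<nu>) = ennreal a * (\<integral>\<^sup>+x. f x \<partial>\<mu>) + ennreal b * (\<integral>\<^sup>+x. f x \<partial>\<nu>)"
  using f
proof (induction rule: borel_measurable_induct)
  case (cong f g)
  then have "f = g" by auto
  then show ?case using cong by simp
next
  case (set A)
  then show ?case using emeasure_comb[OF \<mu> \<nu>, of A] by (simp add: \<mu> \<nu>)
next
  case (mult u c)
  then have "u \<in> borel_measurable \<mu>" "u \<in> borel_measurable \<nu>" "u \<in> borel_measurable (comb_measure a \<mu> b \<nu>)"
    by (simp_all add: measurable_cong_sets[OF \<mu> refl] measurable_cong_sets[OF \<nu> refl] measurable_cong_sets[OF sets_comb refl])
  then show ?case using mult by (simp add: nn_integral_cmult distrib_left mult_ac)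
next
  case (add u v)
  then have "u \<in> borel_measurable \<mu>" "u \<in> borel_measurable \<nu>" "u \<in> borel_measurable (comb_measure a \<mu> b \<nu>)"
      "v \<in> borel_measurable \<mu>" "v \<in> borel_measurable \<nu>" "v \<in> borel_measurable (comb_measure a \<mu> b \<nu>)"
    by (simp_all add: measurable_cong_sets[OF \<mu> refl] measurable_cong_sets[OF \<nu> refl] measurable_cong_sets[OF sets_comb refl])
  then show ?case using add by (simp add: nn_integral_add distrib_left add_ac)
next
  case (seq U)
  have m: "U i \<in> borel_measurable M" if "sets M = sets borel" for M i
    using seq by (simp add: measurable_cong_sets[OF that refl])
  have sup: "(\<integral>\<^sup>+x. (SUP i. U i) x \<partial>M) = (SUP i. \<integral>\<^sup>+x. U i x \<partial>M)" if "sets M = sets borel" for M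
    using seq m[OF that] by (simp add: image_comp nn_integral_monotone_convergence_SUP)
  have inc: "incseq (\<lambda>i. \<integral>\<^sup>+x. U i x \<partial>M)" for M
    using seq by (auto simp: incseq_def le_fun_def intro!: nn_integral_mono)
  have incc: "incseq (\<lambda>i. ennreal c * (\<integral>\<^sup>+x. U i x \<partial>M))" for c M
    using inc[of M] by (auto simp: incseq_def intro!: mult_left_mono)
  show ?case
    unfolding sup[OF \<mu>] sup[OF \<nu>] sup[OF sets_comb] SUP_mult_left_ennreal
      ennreal_SUP_add[OF incc incc, symmetric]
    by (intro SUP_cong refl) (use seq in auto)
qed

lemma integral_comb:
  fixes f :: "'y::topological_space \<Rightarrow> real"
  assumes \<mu>: "sets \<mu> = sets borel" and \<nu>: "sets \<nu> = sets borel" and ab: "0 \<le> a" "0 \<le> b"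
    and f: "integrable \<mu> f" "integrable \<nu> f"
  shows "integrable (comb_measure a \<mu> b \<nu>) f"
    "(\<integral>x. f x \<partial>comb_measure a \<mu> b \<nu>) = a * (\<integral>x. f x \<partial>\<mu>) + b * (\<integral>x. f x \<partial>\<nu>)"
proof -
  have m: "f \<in> borel_measurable borel"
    using f(1) measurable_cong_sets[OF \<mu> refl, of borel] by (auto dest: borel_measurable_integrable)
  have nn: "(\<integral>\<^sup>+x. ennreal (g x) \<partial>comb_measure a \<mu> b \<nu>) = ennreal a * (\<integral>\<^sup>+x. ennreal (g x) \<partial>\<mu>) + ennreal b * (\<integral>\<^sup>+x. ennreal (g x) \<partial>\<nu>)"
    if "g \<in> borel_measurable borel" for g :: "'y \<Rightarrow> real"
    using that by (intro nn_integral_comb[OF \<mu> \<nu>]) measurable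
  have fin: "(\<integral>\<^sup>+x. ennreal (norm (f x)) \<partial>\<mu>) < \<infinity>" "(\<integral>\<^sup>+x. ennreal (norm (f x)) \<partial>\<nu>) < \<infinity>"
    using f by (simp_all add: integrable_iff_bounded)
  have mc: "f \<in> borel_measurable (comb_measure a \<mu> b \<nu>)"
    using m by (simp add: measurable_cong_sets[OF sets_comb refl])
  have "(\<lambda>x. norm (f x)) \<in> borel_measurable borel" using m by measurable
  from nn[OF this] fin have "(\<integral>\<^sup>+x. ennreal (norm (f x)) \<partial>comb_measure a \<mu> b \<nu>) < \<infinity>"
    by (simp add: ennreal_mult_less_top)
  then show ic: "integrable (comb_measure a \<mu> b \<nu>) f" using mc by (simp add: integrable_iff_bounded)
  have fp: "(\<integral>\<^sup>+x. ennreal (f x) \<partial>M) \<noteq> \<infinity>" "(\<integral>\<^sup>+x. ennreal (- f x) \<partial>M) \<noteq> \<infinity>" if "integrable M f" for M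
    using that by (auto simp: real_integrable_def)
  \<comment> \<open>\<open>enn2real\<close> sends infinity to 0, so additivity needs the finiteness
    that integrability provides.\<close>
  have e: "enn2real (ennreal a * X + ennreal b * Y) = a * enn2real X + b * enn2real Y" 
    if fXY: "X \<noteq> \<infinity>" "Y \<noteq> \<infinity>" for X Y
  proof -
    obtain x where x: "0 \<le> x" "X = ennreal x" using fXY(1) by (cases X) auto
    obtain y where y: "0 \<le> y" "Y = ennreal y" using fXY(2) by (cases Y) auto
    have "ennreal a * X + ennreal b * Y = ennreal (a * x + b * y)"
      using x y ab by (simp add: ennreal_mult ennreal_plus)
    then show ?thesis using x y ab by (simp del: ennreal_plus)
  qed
  have m': "(\<lambda>x. - f x) \<in> borel_measurable borel" using m by measurable
  show "(\<integral>x. f x \<partial>comb_measure a \<mu> b \<nu>) = a * (\<integral>x. f x \<partial>\<mu>) + b * (\<integral>x. f x \<partial>\<nu>)"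
    unfolding real_lebesgue_integral_def[OF ic] real_lebesgue_integral_def[OF f(1)] real_lebesgue_integral_def[OF f(2)]
      nn[OF m] nn[OF m'] e[OF fp(1)[OF f(1)] fp(1)[OF f(2)]] e[OF fp(2)[OF f(1)] fp(2)[OF f(2)]]
    by (simp add: algebra_simps)
qed

lemma invariant_comb:
  fixes \<mu> \<nu> :: "'y::topological_space measure"
  assumes \<phi>: "continuous_flow \<phi>" and \<mu>: "invariant_measure \<phi> \<mu>" and \<nu>: "invariant_measure \<phi> \<nu>" and ab: "0 \<le> a" "0 \<le> b"
  shows "invariant_measure \<phi> (comb_measure a \<mu> b \<nu>)"
proof -
  have s: "sets \<mu> = sets borel" "sets \<nu> = sets borel" and f: "finite_measure \<mu>" "finite_measure \<nu>"
    using \<mu> \<nu> by (auto simp: invariant_measure_def)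
  have sp: "space \<mu> = UNIV" "space \<nu> = UNIV" using s[THEN sets_eq_imp_space_eq] by auto
  have cp: "\<phi> t \<in> borel_measurable borel" for t
    using continuous_flow_compose[OF \<phi> continuous_on_const continuous_on_id, of UNIV t]
    by (intro borel_measurable_continuous_onI) simp
  have m: "\<phi> t \<in> measurable M borel" if "sets M = sets borel" for M t
    using cp measurable_cong_sets[OF that refl] by blast
  have "finite_measure (comb_measure a \<mu> b \<nu>)"
    by (rule finite_measureI)
      (use finite_measure.emeasure_finite[OF f(1)] finite_measure.emeasure_finite[OF f(2)] in
        \<open>auto simp: emeasure_comb[OF s] ennreal_mult_eq_top_iff\<close>)
  moreover have "distr (comb_measure a \<mu> b \<nu>) borel (\<phi> t) = comb_measure a \<mu> b \<nu>" for t
  proof (rule measure_eqI)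
    fix A assume "A \<in> sets (distr (comb_measure a \<mu> b \<nu>) borel (\<phi> t))"
    then have A: "A \<in> sets borel" by simp
    have pre: "\<phi> t -` A \<in> sets borel" using measurable_sets[OF cp A, of t] by simp
    have "emeasure M (\<phi> t -` A) = emeasure M A" if "distr M borel (\<phi> t) = M" "sets M = sets borel" "space M = UNIV" for M
      using emeasure_distr[OF m[OF that(2)] A, of t] that by simp
    then have "emeasure \<mu> (\<phi> t -` A) = emeasure \<mu> A" "emeasure \<nu> (\<phi> t -` A) = emeasure \<nu> A"
      using \<mu> \<nu> s sp by (auto simp: invariant_measure_def)
    then show "emeasure (distr (comb_measure a \<mu> b \<nu>) borel (\<phi> t)) A = emeasure (comb_measure a \<mu> b \<nu>) A"
      by (simp add: emeasure_distr[OF m[OF sets_comb] A] emeasure_comb[OF s] A pre)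
  qed simp
  ultimately show ?thesis by (simp add: invariant_measure_def)
qed

text \<open>The densities for different measures are separate choices, so linearity is taken from
  the limits of integrals. The rotation function of one fixed representative does not depend on the
  measure, and its integral is linear in it at every time.\<close>

lemma ruelle_invariant_comb:
  fixes \<phi> :: "real \<Rightarrow> 'y::t2_space \<Rightarrow> 'y" and E :: "('y, 'e::topological_space) symp_bundle"
    and \<tau> :: "(('e \<Rightarrow> 'e) \<times> ('y, 'e, 'k::finite) det_triv) set"
  assumes c: "compact (UNIV :: 'y set)" "continuous_flow \<phi>" and \<mu>: "invariant_measure \<phi> \<mu>"
    and \<nu>: "invariant_measure \<phi> \<nu>" and ab: "0 \<le> a" "0 \<le> b"
    and E: "symplectic_vector_bundle TYPE('k) E" "symplectic_cocycle \<phi> E \<Phi>" "triv_class E \<tau>"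
  shows "ruelle_invariant \<phi> E \<Phi> \<tau> (comb_measure a \<mu> b \<nu>) =
     a * ruelle_invariant \<phi> E \<Phi> \<tau> \<mu> + b * ruelle_invariant \<phi> E \<Phi> \<tau> \<nu>"
proof -
  obtain p where p: "p \<in> \<tau>" "triv_pair E p" using triv_class_nonempty[OF E(3)] by blast
  define F where "F T x = rotation_function \<phi> E p \<Phi> T x / T" for T x
  have lim: "((\<lambda>T. \<integral>x. F T x \<partial>M) \<longlongrightarrow> ruelle_invariant \<phi> E \<Phi> \<tau> M) at_top" if M: "invariant_measure \<phi> M" for M
  proof -
    obtain f where "is_ruelle_density \<phi> E \<Phi> \<tau> M f" using ruelle_density_exists[OF c M E] by blast
    from L1_limit_integral[OF ruelle_density_L1[OF this p(1)]]
    show ?thesis unfolding F_def ruelle_invariant_def .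
  qed
  have s: "sets \<mu> = sets borel" "sets \<nu> = sets borel" using \<mu> \<nu> by (auto simp: invariant_measure_def)
  have "(\<integral>x. F T x \<partial>comb_measure a \<mu> b \<nu>) = a * (\<integral>x. F T x \<partial>\<mu>) + b * (\<integral>x. F T x \<partial>\<nu>)" for T
    unfolding F_def by (rule integral_comb(2)[OF s ab integrable_rotation[OF c \<mu> E(1,2) p(2)] integrable_rotation[OF c \<nu> E(1,2) p(2)]])
  then have "((\<lambda>T. \<integral>x. F T x \<partial>comb_measure a \<mu> b \<nu>) \<longlongrightarrow>
      a * ruelle_invariant \<phi> E \<Phi> \<tau> \<mu> + b * ruelle_invariant \<phi> E \<Phi> \<tau> \<nu>) at_top"
    using lim[OF \<mu>] lim[OF \<nu>] by (simp add: tendsto_add tendsto_mult_left)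
  with lim[OF invariant_comb[OF c(2) \<mu> \<nu> ab]] show ?thesis
    by (rule tendsto_unique[OF trivial_limit_at_top_linorder])
qed

section \<open>Direct sums\<close>

definition fstv :: "complex ^ ('k::finite + 'l::finite) \<Rightarrow> complex ^ 'k" where "fstv z = (\<chi> i. z $ Inl i)"
definition sndv :: "complex ^ ('k::finite + 'l::finite) \<Rightarrow> complex ^ 'l" where "sndv z = (\<chi> j. z $ Inr j)"
definition joinv :: "complex ^ 'k::finite \<Rightarrow> complex ^ 'l::finite \<Rightarrow> complex ^ ('k + 'l)" where
  "joinv a b = (\<chi> s. case s of Inl i \<Rightarrow> a $ i | Inr j \<Rightarrow> b $ j)"

lemma joinv_simps [simp]: "fstv (joinv a b) = a" "sndv (joinv a b) = b" "joinv (fstv z) (sndv z) = z"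
  by (auto simp: fstv_def sndv_def joinv_def vec_eq_iff split: sum.split)

lemma joinv_linear: "joinv (a + a') (b + b') = joinv a b + joinv a' b'"
    "joinv (r *\<^sub>R a) (r *\<^sub>R b) = r *\<^sub>R joinv a b" "joinv (c *s a) (c *s b) = c *s joinv a b"
    "joinv (a - a') (b - b') = joinv a b - joinv a' b'" "joinv 0 0 = 0"
  by (auto simp: joinv_def vec_eq_iff split: sum.split)

lemma fstv_linear: "fstv (z + w) = fstv z + fstv w" "fstv (r *\<^sub>R z) = r *\<^sub>R fstv z" "fstv (c *s z) = c *s fstv z"
    "fstv (0 :: complex ^ ('k::finite + 'l::finite)) = 0"
  and sndv_linear: "sndv (z + w) = sndv z + sndv w" "sndv (r *\<^sub>R z) = r *\<^sub>R sndv z" "sndv (c *s z) = c *s sndv z"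
    "sndv (0 :: complex ^ ('k::finite + 'l::finite)) = 0"
  by (auto simp: fstv_def sndv_def vec_eq_iff)

lemma joinv_axis: "joinv (axis i c) 0 = axis (Inl i) c" "joinv 0 (axis j c) = axis (Inr j) c"
  by (auto simp: joinv_def axis_def vec_eq_iff split: sum.split)

lemma continuous_on_fstv [continuous_intros]: "continuous_on S f \<Longrightarrow> continuous_on S (\<lambda>x. fstv (f x))"
  and continuous_on_sndv [continuous_intros]: "continuous_on S f \<Longrightarrow> continuous_on S (\<lambda>x. sndv (f x))"
  unfolding fstv_def sndv_def by (intro continuous_intros; assumption)+

lemma continuous_on_joinv [continuous_intros]:
  assumes "continuous_on S f" "continuous_on S g" shows "continuous_on S (\<lambda>x. joinv (f x) (g x))"
  unfolding joinv_def
proof (intro continuous_on_vec_lambda)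
  fix s show "continuous_on S (\<lambda>x. case s of Inl i \<Rightarrow> f x $ i | Inr j \<Rightarrow> g x $ j)"
    using assms by (cases s) (auto intro!: continuous_intros)
qed

lemma std_form_sum: "std_form z w = std_form (fstv z) (fstv w) + std_form (sndv z) (sndv w)"
proof -
  have "(\<Sum>s\<in>(UNIV :: ('a + 'b) set). f s) = (\<Sum>i\<in>UNIV. f (Inl i)) + (\<Sum>j\<in>UNIV. f (Inr j))" for f :: "'a + 'b \<Rightarrow> real"
    unfolding UNIV_Plus_UNIV[symmetric] by (subst sum.Plus) auto
  then show ?thesis by (simp add: std_form_def fstv_def sndv_def)
qed

text \<open>The left-hand side is alternating in the first block of vectors for any fixed second
  block, and conversely. Applying \<open>alternating_eq_det\<close> once to each block reduces to
  standard basis vectors.\<close>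

lemma col_det_block:
  "col_det (case_sum (\<lambda>i. joinv (a i) 0) (\<lambda>j. joinv 0 (b j))) = col_det a * col_det b"
proof -
  have u1: "case_sum (\<lambda>i. joinv ((a(m := u)) i) 0) g = (case_sum (\<lambda>i. joinv (a i) 0) g)(Inl m := joinv u 0)" for a m u g
    by (auto simp: fun_eq_iff split: sum.split)
  have u2: "case_sum f (\<lambda>j. joinv 0 ((b(m := u)) j)) = (case_sum f (\<lambda>j. joinv 0 (b j)))(Inr m := joinv 0 u)" for b m u f
    by (auto simp: fun_eq_iff split: sum.split)
  have j: "joinv (u + v) 0 = joinv u 0 + joinv v 0" "joinv (c *s u) 0 = c *s joinv u 0"
      "joinv 0 (x + y) = joinv 0 x + joinv 0 y" "joinv 0 (c *s x) = c *s joinv 0 x" for u v c x y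
    using joinv_linear(1)[of u v 0 0] joinv_linear(3)[of c u 0] joinv_linear(1)[of 0 0 x y] joinv_linear(3)[of c 0 x]
    by simp_all
  have 1: "col_det (case_sum (\<lambda>i. joinv (a i) 0) g) = col_det a * col_det (case_sum (\<lambda>i. joinv (axis i 1) 0) g)" for g
  proof (rule alternating_eq_det)
    show "col_det (case_sum (\<lambda>i. joinv (v i) 0) g) = 0" if "i \<noteq> j" "v i = v j" for v i j
      by (rule col_det_alt[of "Inl i" "Inl j"]) (use that in auto)
  qed (simp_all only: u1 j col_det_add col_det_scale)
  have 2: "col_det (case_sum f (\<lambda>j. joinv 0 (b j))) = col_det b * col_det (case_sum f (\<lambda>j. joinv 0 (axis j 1)))" for f
  proof (rule alternating_eq_det)
    show "col_det (case_sum f (\<lambda>j. joinv 0 (v j))) = 0" if "i \<noteq> j" "v i = v j" for v i j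
      by (rule col_det_alt[of "Inr i" "Inr j"]) (use that in auto)
  qed (simp_all only: u2 j col_det_add col_det_scale)
  have 3: "case_sum (\<lambda>i. joinv (axis i 1) 0) (\<lambda>j. joinv 0 (axis j 1)) = (\<lambda>s. axis s 1)"
    by (auto simp: fun_eq_iff joinv_axis split: sum.split)
  show ?thesis by (simp add: 1[of "\<lambda>j. joinv 0 (b j)"] 2[of "\<lambda>i. joinv (axis i 1) 0"] 3)
qed

lemma cdet_block:
  assumes "M 0 = 0" "N 0 = 0"
  shows "cdet (\<lambda>z. joinv (M (fstv z)) (N (sndv z))) = cdet M * cdet N"
proof -
  have "(\<lambda>s. joinv (M (fstv (axis s 1))) (N (sndv (axis s 1)))) =
      case_sum (\<lambda>i. joinv (M (axis i 1)) 0) (\<lambda>j. joinv 0 (N (axis j 1)))"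
    using assms by (auto simp: fun_eq_iff simp flip: joinv_axis split: sum.split)
  then show ?thesis unfolding cdet_col by (simp add: col_det_block)
qed

section \<open>Direct sums of symplectic bundles and cocycles\<close>

lemma tot_sum: "tot (sum_bundle E F) = {(v, w). v \<in> tot E \<and> w \<in> tot F \<and> prj E v = prj F w}"
  and prj_sum: "prj (sum_bundle E F) = (\<lambda>(v, w). prj E v)"
  and vadd_sum: "vadd (sum_bundle E F) (v, w) (v', w') = (vadd E v v', vadd F w w')"
  and vscale_sum: "vscale (sum_bundle E F) r (v, w) = (vscale E r v, vscale F r w)"
  and vzero_sum: "vzero (sum_bundle E F) x = (vzero E x, vzero F x)"
  and omega_sum: "omega (sum_bundle E F) (v, w) (v', w') = omega E v v' + omega F w w'"
  by (simp_all add: sum_bundle_def)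

lemma fibre_sum: "fibre (sum_bundle E F) x = fibre E x \<times> fibre F x"
  by (auto simp: fibre_def tot_sum prj_sum)

lemma real_frame_sum:
  assumes g: "real_frame E x g" and h: "real_frame F x h"
  shows "real_frame (sum_bundle E F) x (\<lambda>z. (g (fstv z), h (sndv z)))"
  unfolding real_frame_def
proof (intro conjI allI)
  show "bij_betw (\<lambda>z. (g (fstv z), h (sndv z))) UNIV (fibre (sum_bundle E F) x)"
  proof (rule bij_betw_byWitness[where f' = "\<lambda>(v, w). joinv (inv_into UNIV g v) (inv_into UNIV h w)"])
    show "\<forall>z\<in>UNIV. (\<lambda>(v, w). joinv (inv_into UNIV g v) (inv_into UNIV h w)) (g (fstv z), h (sndv z)) = z"
      by (simp add: frame_inv(1)[OF g] frame_inv(1)[OF h])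
    show "\<forall>p\<in>fibre (sum_bundle E F) x. (\<lambda>z. (g (fstv z), h (sndv z)))
        ((\<lambda>(v, w). joinv (inv_into UNIV g v) (inv_into UNIV h w)) p) = p"
      by (auto simp: fibre_sum frame_inv(2)[OF g] frame_inv(2)[OF h])
  qed (auto simp: fibre_sum frame_in[OF g] frame_in[OF h])
qed (simp_all add: fstv_linear sndv_linear vadd_sum vscale_sum vzero_sum frame_ops[OF g] frame_ops[OF h])

text \<open>The inverse reads the base point from the first summand; points of the sum have equal
  projections, so the second summand agrees.\<close>

lemma bundle_chart_sum:
  assumes h: "bundle_chart E U h h'" and k: "bundle_chart F W k k'"
  shows "bundle_chart (sum_bundle E F) (U \<inter> W) (\<lambda>(y, z). (h (y, fstv z), k (y, sndv z)))
     (\<lambda>(v, w). (fst (h' v), joinv (snd (h' v)) (snd (k' w))))"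
proof -
  note H = chart_homeo[OF h] and K = chart_homeo[OF k]
  have p: "prj E (h (y, z)) = y" if "y \<in> U" for y z using h that by (simp add: bundle_chart_def)
  have q: "prj F (k (y, z)) = y" if "y \<in> W" for y z using k that by (simp add: bundle_chart_def)
  have ih: "h' (h (y, z)) = (y, z)" if "y \<in> U" for y z using H that by (simp add: homeomorphism_def)
  have ik: "k' (k (y, z)) = (y, z)" if "y \<in> W" for y z using K that by (simp add: homeomorphism_def)
  have th: "h (y, z) \<in> tot E" if "y \<in> U" for y z using H that by (auto simp: homeomorphism_def)
  have tk: "k (y, z) \<in> tot F" if "y \<in> W" for y z using K that by (auto simp: homeomorphism_def)
  have "homeomorphism ((U \<inter> W) \<times> UNIV) {p \<in> tot (sum_bundle E F). prj (sum_bundle E F) p \<in> U \<inter> W}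
     (\<lambda>(y, z). (h (y, fstv z), k (y, sndv z))) (\<lambda>(v, w). (fst (h' v), joinv (snd (h' v)) (snd (k' w))))"
  proof (rule homeomorphismI)
    show "continuous_on ((U \<inter> W) \<times> UNIV) (\<lambda>(y, z). (h (y, fstv z), k (y, sndv z)))"
      unfolding split_def
      by (intro continuous_on_Pair continuous_chart[OF h] continuous_chart[OF k] continuous_intros) auto
    have "continuous_on {p \<in> tot (sum_bundle E F). prj (sum_bundle E F) p \<in> U \<inter> W} (\<lambda>p. h' (fst p))"
      by (rule continuous_on_compose2[of "{v \<in> tot E. prj E v \<in> U}" h'])
        (use H in \<open>auto simp: homeomorphism_def tot_sum prj_sum intro!: continuous_intros\<close>)
    moreover have "continuous_on {p \<in> tot (sum_bundle E F). prj (sum_bundle E F) p \<in> U \<inter> W} (\<lambda>p. k' (snd p))"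
      by (rule continuous_on_compose2[of "{v \<in> tot F. prj F v \<in> W}" k'])
        (use K in \<open>auto simp: homeomorphism_def tot_sum prj_sum intro!: continuous_intros\<close>)
    ultimately show "continuous_on {p \<in> tot (sum_bundle E F). prj (sum_bundle E F) p \<in> U \<inter> W}
        (\<lambda>(v, w). (fst (h' v), joinv (snd (h' v)) (snd (k' w))))"
      unfolding split_def by (intro continuous_intros)
    show "(\<lambda>(y, z). (h (y, fstv z), k (y, sndv z))) ` ((U \<inter> W) \<times> UNIV) \<subseteq> {p \<in> tot (sum_bundle E F). prj (sum_bundle E F) p \<in> U \<inter> W}"
      by (auto simp: tot_sum prj_sum p q th tk)
    have inv: "\<exists>y z. y \<in> U \<inter> W \<and> v = (h (y, fstv z), k (y, sndv z))"
      if "v \<in> {p \<in> tot (sum_bundle E F). prj (sum_bundle E F) p \<in> U \<inter> W}" for v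
    proof -
      define y where "y = prj E (fst v)"
      have y: "y \<in> U" "y \<in> W" "fst v \<in> fibre E y" "snd v \<in> fibre F y"
        using that by (auto simp: tot_sum prj_sum fibre_def y_def)
      then have "v = (h (y, fstv (joinv (snd (h' (fst v))) (snd (k' (snd v))))), k (y, sndv (joinv (snd (h' (fst v))) (snd (k' (snd v))))))"
        by (simp add: chart_coords[OF h] chart_coords[OF k])
      then show ?thesis using y by blast
    qed
    show "(\<lambda>(v, w). (fst (h' v), joinv (snd (h' v)) (snd (k' w)))) ` {p \<in> tot (sum_bundle E F). prj (sum_bundle E F) p \<in> U \<inter> W} \<subseteq> (U \<inter> W) \<times> UNIV"
      using inv by (fastforce simp: ih ik)
    show "(\<lambda>(v, w). (fst (h' v), joinv (snd (h' v)) (snd (k' w)))) ((\<lambda>(y, z). (h (y, fstv z), k (y, sndv z))) q) = q"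
      if "q \<in> (U \<inter> W) \<times> UNIV" for q using that by (auto simp: ih ik)
    show "(\<lambda>(y, z). (h (y, fstv z), k (y, sndv z))) ((\<lambda>(v, w). (fst (h' v), joinv (snd (h' v)) (snd (k' w)))) v) = v"
      if v: "v \<in> {p \<in> tot (sum_bundle E F). prj (sum_bundle E F) p \<in> U \<inter> W}" for v
      using inv[OF v] by (auto simp: ih ik)
  qed
  then show ?thesis
    using h k unfolding bundle_chart_def
    by (auto simp: vadd_sum vscale_sum vzero_sum prj_sum fstv_linear sndv_linear)
qed

lemma omega_vzero:
  fixes E :: "('y::topological_space, 'e::topological_space) symp_bundle"
  assumes E: "symplectic_vector_bundle TYPE('k::finite) E" and v: "v \<in> fibre E x"
  shows "vzero E x \<in> fibre E x" "omega E (vzero E x) v = 0" "omega E v (vzero E x) = 0"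
proof -
  have om: "omega E (vscale E r v) w = r * omega E v w" "omega E v w = - omega E w v"
    if "v \<in> fibre E x" "w \<in> fibre E x" for v w r
    using E that unfolding symplectic_vector_bundle_def by blast+
  have "vector_bundle TYPE('k) E" using E by (simp add: symplectic_vector_bundle_def)
  then obtain g :: "complex ^ 'k \<Rightarrow> 'e" where g: "real_frame E x g" using vector_bundle_real_frame by blast
  show z: "vzero E x \<in> fibre E x" using frame_in[OF g, of 0] by (simp add: frame_ops[OF g])
  have "vscale E 0 v = vzero E x"
  proof -
    obtain a where "v = g a" using frame_cases[OF g v] by blast
    then show ?thesis by (simp add: frame_ops[OF g])
  qed
  then show "omega E (vzero E x) v = 0" using om(1)[OF v v, of 0] by simp
  then show "omega E v (vzero E x) = 0" using om(2)[OF v z] by simp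
qed

lemma symplectic_bundle_sum:
  fixes E :: "('y::topological_space, 'e::topological_space) symp_bundle" and F :: "('y, 'f::topological_space) symp_bundle"
  assumes E: "symplectic_vector_bundle TYPE('k::finite) E" and F: "symplectic_vector_bundle TYPE('l::finite) F"
  shows "symplectic_vector_bundle TYPE('k + 'l) (sum_bundle E F)"
  unfolding symplectic_vector_bundle_def
proof (intro conjI)
  have vE: "vector_bundle TYPE('k) E" and vF: "vector_bundle TYPE('l) F"
    using E F by (auto simp: symplectic_vector_bundle_def)
  show "vector_bundle TYPE('k + 'l) (sum_bundle E F)"
    unfolding vector_bundle_chart
  proof
    fix x
    obtain U h h' where 1: "x \<in> U" "bundle_chart E U (h :: 'y \<times> (complex ^ 'k) \<Rightarrow> 'e) h'"
      using vE unfolding vector_bundle_chart by blast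
    obtain W k k' where 2: "x \<in> W" "bundle_chart F W (k :: 'y \<times> (complex ^ 'l) \<Rightarrow> 'f) k'"
      using vF unfolding vector_bundle_chart by blast
    show "\<exists>U (h :: 'y \<times> (complex ^ ('k + 'l)) \<Rightarrow> 'e \<times> 'f) h'. x \<in> U \<and> bundle_chart (sum_bundle E F) U h h'"
      using bundle_chart_sum[OF 1(2) 2(2)] 1(1) 2(1) by blast
  qed
  have oE: "continuous_on {(v, w). v \<in> tot E \<and> w \<in> tot E \<and> prj E v = prj E w} (\<lambda>(v, w). omega E v w)"
    and oF: "continuous_on {(v, w). v \<in> tot F \<and> w \<in> tot F \<and> prj F v = prj F w} (\<lambda>(v, w). omega F v w)"
    using E F by (auto simp: symplectic_vector_bundle_def)
  define D where "D = {(v, w). v \<in> tot (sum_bundle E F) \<and> w \<in> tot (sum_bundle E F) \<and> prj (sum_bundle E F) v = prj (sum_bundle E F) w}"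
  have c: "continuous_on D (\<lambda>z. (fst (fst z), fst (snd z)))" "continuous_on D (\<lambda>z. (snd (fst z), snd (snd z)))"
    by (intro continuous_intros)+
  have "continuous_on D (\<lambda>z. (\<lambda>(v, w). omega E v w) (fst (fst z), fst (snd z)) + (\<lambda>(v, w). omega F v w) (snd (fst z), snd (snd z)))"
    by (intro continuous_on_add continuous_on_compose2[OF oE c(1)] continuous_on_compose2[OF oF c(2)])
      (auto simp: D_def tot_sum prj_sum)
  moreover have "(\<lambda>z. (\<lambda>(v, w). omega E v w) (fst (fst z), fst (snd z)) + (\<lambda>(v, w). omega F v w) (snd (fst z), snd (snd z)))
      = (\<lambda>(v, w). omega (sum_bundle E F) v w)"
    by (auto simp: fun_eq_iff omega_sum)
  ultimately show "continuous_on {(v, w). v \<in> tot (sum_bundle E F) \<and> w \<in> tot (sum_bundle E F) \<and>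
      prj (sum_bundle E F) v = prj (sum_bundle E F) w} (\<lambda>(v, w). omega (sum_bundle E F) v w)"
    unfolding D_def[symmetric] by (simp only:)
  have omE: "omega E (vadd E u v) w = omega E u w + omega E v w" "omega E (vscale E r v) w = r * omega E v w"
     "omega E v w = - omega E w v" if "u \<in> fibre E x" "v \<in> fibre E x" "w \<in> fibre E x" for u v w r x
    using E that unfolding symplectic_vector_bundle_def by blast+
  have omF: "omega F (vadd F u v) w = omega F u w + omega F v w" "omega F (vscale F r v) w = r * omega F v w"
     "omega F v w = - omega F w v" if "u \<in> fibre F x" "v \<in> fibre F x" "w \<in> fibre F x" for u v w r x
    using F that unfolding symplectic_vector_bundle_def by blast+
  show "\<forall>x. \<forall>u\<in>fibre (sum_bundle E F) x. \<forall>v\<in>fibre (sum_bundle E F) x. \<forall>w\<in>fibre (sum_bundle E F) x. \<forall>r.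
      omega (sum_bundle E F) (vadd (sum_bundle E F) u v) w = omega (sum_bundle E F) u w + omega (sum_bundle E F) v w \<and>
      omega (sum_bundle E F) (vscale (sum_bundle E F) r v) w = r * omega (sum_bundle E F) v w \<and>
      omega (sum_bundle E F) v w = - omega (sum_bundle E F) w v"
  proof (intro allI ballI)
    fix x u v w r
    assume "u \<in> fibre (sum_bundle E F) x" "v \<in> fibre (sum_bundle E F) x" "w \<in> fibre (sum_bundle E F) x"
    then obtain u1 u2 v1 v2 w1 w2 where uvw: "u = (u1, u2)" "v = (v1, v2)" "w = (w1, w2)"
      and f: "u1 \<in> fibre E x" "v1 \<in> fibre E x" "w1 \<in> fibre E x" "u2 \<in> fibre F x" "v2 \<in> fibre F x" "w2 \<in> fibre F x"
      by (auto simp: fibre_sum)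
    show "omega (sum_bundle E F) (vadd (sum_bundle E F) u v) w = omega (sum_bundle E F) u w + omega (sum_bundle E F) v w \<and>
      omega (sum_bundle E F) (vscale (sum_bundle E F) r v) w = r * omega (sum_bundle E F) v w \<and>
      omega (sum_bundle E F) v w = - omega (sum_bundle E F) w v"
      unfolding uvw omega_sum vadd_sum vscale_sum
      using omE(1,2)[OF f(1-3)] omF(1,2)[OF f(4-6)] omE(3)[OF f(1-3)] omF(3)[OF f(4-6)] by (simp add: algebra_simps)
  qed
  show "\<forall>x. \<forall>v\<in>fibre (sum_bundle E F) x. v \<noteq> vzero (sum_bundle E F) x \<longrightarrow>
      (\<exists>w\<in>fibre (sum_bundle E F) x. omega (sum_bundle E F) v w \<noteq> 0)"
  proof (intro allI ballI impI)
    fix x v assume v: "v \<in> fibre (sum_bundle E F) x" "v \<noteq> vzero (sum_bundle E F) x"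
    obtain v1 v2 where v12: "v = (v1, v2)" "v1 \<in> fibre E x" "v2 \<in> fibre F x" using v(1) by (auto simp: fibre_sum)
    note zE = omega_vzero(1)[OF E v12(2)] and zF = omega_vzero(1)[OF F v12(3)]
    note oz = omega_vzero(3)[OF E v12(2)] omega_vzero(3)[OF F v12(3)]
    show "\<exists>w\<in>fibre (sum_bundle E F) x. omega (sum_bundle E F) v w \<noteq> 0"
    proof (cases "v1 = vzero E x")
      case False
      then obtain w where "w \<in> fibre E x" "omega E v1 w \<noteq> 0"
        using E v12(2) unfolding symplectic_vector_bundle_def by blast
      then show ?thesis using zF oz by (intro bexI[of _ "(w, vzero F x)"]) (auto simp: v12(1) omega_sum fibre_sum)
    next
      case True
      then have "v2 \<noteq> vzero F x" using v(2) by (simp add: v12(1) vzero_sum)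
      then obtain w where "w \<in> fibre F x" "omega F v2 w \<noteq> 0"
        using F v12(3) unfolding symplectic_vector_bundle_def by blast
      then show ?thesis using zE oz by (intro bexI[of _ "(vzero E x, w)"]) (auto simp: v12(1) omega_sum fibre_sum)
    qed
  qed
qed

lemma symplectic_cocycle_sum:
  assumes \<Phi>: "symplectic_cocycle \<phi> E \<Phi>" and \<Psi>: "symplectic_cocycle \<phi> F \<Psi>"
  shows "symplectic_cocycle \<phi> (sum_bundle E F) (sum_cocycle \<Phi> \<Psi>)"
  unfolding symplectic_cocycle_def
proof (intro conjI allI ballI)
  have c1: "continuous_on (UNIV \<times> tot E) (\<lambda>(t, v). \<Phi> t (prj E v) v)"
    and c2: "continuous_on (UNIV \<times> tot F) (\<lambda>(t, v). \<Psi> t (prj F v) v)"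
    using \<Phi> \<Psi> by (auto simp: symplectic_cocycle_def)
  define D where "D = (UNIV :: real set) \<times> tot (sum_bundle E F)"
  have c: "continuous_on D (\<lambda>z. (fst z, fst (snd z)))" "continuous_on D (\<lambda>z. (fst z, snd (snd z)))"
    by (intro continuous_intros)+
  have "continuous_on D (\<lambda>z. ((\<lambda>(t, v). \<Phi> t (prj E v) v) (fst z, fst (snd z)), (\<lambda>(t, v). \<Psi> t (prj F v) v) (fst z, snd (snd z))))"
    by (intro continuous_on_Pair continuous_on_compose2[OF c1 c(1)] continuous_on_compose2[OF c2 c(2)])
      (auto simp: D_def tot_sum)
  then show "continuous_on (UNIV \<times> tot (sum_bundle E F)) (\<lambda>(t, v). sum_cocycle \<Phi> \<Psi> t (prj (sum_bundle E F) v) v)"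
    unfolding D_def[symmetric]
    by (rule continuous_on_eq) (auto simp: D_def tot_sum prj_sum sum_cocycle_def)
  have i: "fibre_symplectic_iso E x E (\<phi> t x) (\<Phi> t x)" "fibre_symplectic_iso F x F (\<phi> t x) (\<Psi> t x)" for t x
    using \<Phi> \<Psi> by (auto simp: symplectic_cocycle_def)
  show "fibre_symplectic_iso (sum_bundle E F) x (sum_bundle E F) (\<phi> t x) (sum_cocycle \<Phi> \<Psi> t x)" for t x
  proof -
    have "bij_betw (map_prod (\<Phi> t x) (\<Psi> t x)) (fibre E x \<times> fibre F x) (fibre E (\<phi> t x) \<times> fibre F (\<phi> t x))"
      by (rule bij_betw_map_prod) (use i[of x t] in \<open>auto simp: fibre_symplectic_iso_def\<close>)
    then show ?thesis
      using i[of x t] unfolding fibre_symplectic_iso_def fibre_linear_def fibre_sum sum_cocycle_def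
      by (auto simp: vadd_sum vscale_sum omega_sum)
  qed
  show "sum_cocycle \<Phi> \<Psi> (s + t) x v = sum_cocycle \<Phi> \<Psi> t (\<phi> s x) (sum_cocycle \<Phi> \<Psi> s x v)"
    if "v \<in> fibre (sum_bundle E F) x" for s t x v
    using \<Phi> \<Psi> that by (auto simp: symplectic_cocycle_def sum_cocycle_def fibre_sum)
qed

lemma compatible_cs_sum:
  assumes E: "symplectic_vector_bundle TYPE('k::finite) E" and F: "symplectic_vector_bundle TYPE('l::finite) F"
    and J: "compatible_cs E J" and K: "compatible_cs F K"
  shows "compatible_cs (sum_bundle E F) (map_prod J K)"
  unfolding compatible_cs_def
proof (intro conjI allI)
  have c: "continuous_on (tot E) J" "continuous_on (tot F) K" using J K by (auto simp: compatible_cs_def)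
  have "continuous_on (tot (sum_bundle E F)) (\<lambda>p. (J (fst p), K (snd p)))"
    by (intro continuous_on_Pair continuous_on_compose2[OF c(1) continuous_on_fst[OF continuous_on_id]]
       continuous_on_compose2[OF c(2) continuous_on_snd[OF continuous_on_id]]) (auto simp: tot_sum)
  then show "continuous_on (tot (sum_bundle E F)) (map_prod J K)" by (simp add: map_prod_def split_def)
  fix x
  have lin: "fibre_linear E x E x J" "fibre_linear F x F x K"
    and p: "\<And>v. v \<in> fibre E x \<Longrightarrow> v \<noteq> vzero E x \<Longrightarrow> omega E v (J v) > 0"
      "\<And>v. v \<in> fibre F x \<Longrightarrow> v \<noteq> vzero F x \<Longrightarrow> omega F v (K v) > 0"
    and s: "\<And>v w. v \<in> fibre E x \<Longrightarrow> w \<in> fibre E x \<Longrightarrow> omega E v (J w) = omega E w (J v)"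
      "\<And>v w. v \<in> fibre F x \<Longrightarrow> w \<in> fibre F x \<Longrightarrow> omega F v (K w) = omega F w (K v)"
    and q: "\<And>v. v \<in> fibre E x \<Longrightarrow> J (J v) = vscale E (-1) v" "\<And>v. v \<in> fibre F x \<Longrightarrow> K (K v) = vscale F (-1) v"
    using J K by (auto simp: compatible_cs_def)
  show "fibre_linear (sum_bundle E F) x (sum_bundle E F) x (map_prod J K)"
    using lin by (auto simp: fibre_linear_def fibre_sum vadd_sum vscale_sum)
  show "\<forall>v\<in>fibre (sum_bundle E F) x. map_prod J K (map_prod J K v) = vscale (sum_bundle E F) (-1) v"
    using q by (auto simp: fibre_sum vscale_sum)
  show "\<forall>v\<in>fibre (sum_bundle E F) x. \<forall>w\<in>fibre (sum_bundle E F) x.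
      omega (sum_bundle E F) v (map_prod J K w) = omega (sum_bundle E F) w (map_prod J K v)"
    unfolding fibre_sum by (clarsimp simp: omega_sum) (metis s)
  show "\<forall>v\<in>fibre (sum_bundle E F) x. v \<noteq> vzero (sum_bundle E F) x \<longrightarrow> 0 < omega (sum_bundle E F) v (map_prod J K v)"
  proof (intro ballI impI)
    fix v assume v: "v \<in> fibre (sum_bundle E F) x" "v \<noteq> vzero (sum_bundle E F) x"
    obtain v1 v2 where v12: "v = (v1, v2)" "v1 \<in> fibre E x" "v2 \<in> fibre F x" using v(1) by (auto simp: fibre_sum)
    have Jf: "J v1 \<in> fibre E x" "K v2 \<in> fibre F x" using lin v12 by (auto simp: fibre_linear_def)
    have "0 \<le> omega E v1 (J v1)" "0 \<le> omega F v2 (K v2)"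
      using p(1)[OF v12(2)] p(2)[OF v12(3)] omega_vzero(2)[OF E Jf(1)] omega_vzero(2)[OF F Jf(2)] by fastforce+
    moreover have "v1 \<noteq> vzero E x \<or> v2 \<noteq> vzero F x" using v(2) by (auto simp: v12(1) vzero_sum)
    ultimately show "0 < omega (sum_bundle E F) v (map_prod J K v)"
      using p(1)[OF v12(2)] p(2)[OF v12(3)] by (auto simp: v12(1) omega_sum intro: add_pos_nonneg add_nonneg_pos)
  qed
qed

section \<open>Tensor products of trivializations\<close>

text \<open>The matrix of Hermitian products is the product of the matrix with rows
  \<open>v i\<close> and its conjugate transpose, so its determinant is the squared modulus.\<close>

lemma col_det_gram:
  "det (\<chi> i j. Complex (v i \<bullet> v j) (- std_form (v i) (v j))) = complex_of_real ((cmod (col_det v))\<^sup>2)"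
proof -
  have e: "Complex (a \<bullet> b) (- std_form a b) = (\<Sum>m\<in>UNIV. a $ m * cnj (b $ m))" for a b :: "complex ^ 'a"
    by (simp add: complex_eq_iff inner_vec_def inner_complex_def std_form_def sum_negf[symmetric])
  have "(\<chi> i j. Complex (v i \<bullet> v j) (- std_form (v i) (v j))) = (\<chi> i. v i) ** (\<chi> m j. cnj (v j $ m))"
    by (simp add: vec_eq_iff matrix_matrix_mult_def e)
  moreover have "det (\<chi> m j. cnj (v j $ m)) = cnj (col_det v)"
    by (simp add: det_def col_det_def)
  ultimately show ?thesis
    by (simp only: det_mul complex_norm_square col_det_row)
qed

text \<open>By Cramer's rule the coordinates of a vector in a moving frame are quotients of values of the
  trivialization, hence continuous.\<close>

lemma col_det_cramer:
  assumes a: "col_det a \<noteq> 0" and b: "col_det b \<noteq> 0"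
  shows "col_det z = col_det (\<lambda>m. joinv (\<chi> i. col_det (a(i := fstv (z m))) / col_det a)
      (\<chi> j. col_det (b(j := sndv (z m))) / col_det b)) * col_det a * col_det b"
proof -
  define A where "A = (\<chi> i j. a j $ i)"
  define B where "B = (\<chi> i j. b j $ i)"
  have cA: "A *v (\<chi> i. col_det (a(i := u)) / col_det a) = u" for u
  proof -
    have "det (\<chi> i j. if j = k then u $ i else A $ i $ j) = col_det (a(k := u))" for k
      unfolding col_det_def A_def by (intro arg_cong[of _ _ det]) (simp add: vec_eq_iff)
    moreover have "det A = col_det a" by (simp add: A_def col_det_def)
    ultimately show ?thesis using cramer[of A _ u] a by simp
  qed
  have cB: "B *v (\<chi> i. col_det (b(i := u)) / col_det b) = u" for u
  proof -
    have "det (\<chi> i j. if j = k then u $ i else B $ i $ j) = col_det (b(k := u))" for k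
      unfolding col_det_def B_def by (intro arg_cong[of _ _ det]) (simp add: vec_eq_iff)
    moreover have "det B = col_det b" by (simp add: B_def col_det_def)
    ultimately show ?thesis using cramer[of B _ u] b by simp
  qed
  \<comment> \<open>The block diagonal change from coordinates in the moving frames to standard
    coordinates, with determinant \<open>col_det a * col_det b\<close>.\<close>
  define Q where "Q y = joinv (A *v fstv y) (B *v sndv y)" for y
  have cl: "clinear Q"
    by (rule clinearI) (simp_all add: Q_def fstv_linear sndv_linear matrix_vector_right_distrib
      joinv_linear vector_scalar_commute scaleR_eq_cmult matrix_vector_mult_scaleR)
  have "cdet Q = cdet ((*v) A) * cdet ((*v) B)"
    unfolding Q_def by (rule cdet_block) simp_all
  also have "\<dots> = col_det a * col_det b"
    by (simp add: cdet_def A_def B_def col_det_def)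
  finally have "cdet Q = col_det a * col_det b" .
  moreover have "z m = Q (joinv (\<chi> i. col_det (a(i := fstv (z m))) / col_det a)
      (\<chi> j. col_det (b(j := sndv (z m))) / col_det b))" for m
    by (simp add: Q_def cA cB)
  then have "col_det z = col_det (\<lambda>m. Q (joinv (\<chi> i. col_det (a(i := fstv (z m))) / col_det a)
      (\<chi> j. col_det (b(j := sndv (z m))) / col_det b)))" by presburger
  ultimately show ?thesis using col_det_clinear[OF cl] by simp
qed

lemma continuous_on_col_det:
  "(\<And>m s. continuous_on S (\<lambda>z. c z m $ s)) \<Longrightarrow> continuous_on S (\<lambda>z. col_det (c z))"
  unfolding col_det_def det_def
  by (simp, intro continuous_on_sum continuous_on_mult continuous_on_const continuous_on_prod) simp

lemma complex_frame_sum: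
  assumes "complex_frame E J x g" "complex_frame F K x h"
  shows "complex_frame (sum_bundle E F) (map_prod J K) x (\<lambda>z. (g (fstv z), h (sndv z)))"
  using assms real_frame_sum[of E x g F h] by (simp add: complex_frame_def fstv_linear sndv_linear)

lemma sum_frame_axis:
  assumes "real_frame E x g" "real_frame F x h"
  shows "(\<lambda>s. (g (fstv (case_sum (\<lambda>i. joinv (a i) 0) (\<lambda>j. joinv 0 (b j)) s)),
             h (sndv (case_sum (\<lambda>i. joinv (a i) 0) (\<lambda>j. joinv 0 (b j)) s)))) =
    case_sum (\<lambda>i. (g (a i), vzero F x)) (\<lambda>j. (vzero E x, h (b j)))"
  by (auto simp: fun_eq_iff frame_ops[OF assms(1), symmetric] frame_ops[OF assms(2), symmetric] split: sum.split)

lemma sum_axis: "(\<lambda>s. axis s 1) = case_sum (\<lambda>i. joinv (axis i 1) 0) (\<lambda>j. joinv 0 (axis j 1))"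
  by (auto simp: fun_eq_iff joinv_axis split: sum.split)

lemma unitary_frame_sum:
  assumes g: "unitary_frame E J \<tau> x g" and h: "unitary_frame F K \<sigma> x h"
    and t: "is_tensor_triv E (J, \<tau>) F (K, \<sigma>) (L, \<rho>)"
  shows "unitary_frame (sum_bundle E F) L \<rho> x (\<lambda>z. (g (fstv z), h (sndv z)))"
proof -
  note r = unitary_frame_real[OF g] unitary_frame_real[OF h]
  have L: "L = map_prod J K" and \<rho>: "\<And>v w. v \<in> families E x \<Longrightarrow> w \<in> families F x \<Longrightarrow>
     \<rho> x (wedge (sum_bundle E F) L x (case_sum (\<lambda>i. (v i, vzero F x)) (\<lambda>j. (vzero E x, w j)))) =
     \<tau> x (wedge E J x v) * \<sigma> x (wedge F K x w)"
    using t by (auto simp: is_tensor_triv_def)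
  have "\<rho> x (wedge (sum_bundle E F) L x (\<lambda>s. (g (fstv (axis s 1)), h (sndv (axis s 1))))) = 1"
  proof -
    have ax: "axis s 1 = case_sum (\<lambda>i. joinv (axis i 1) 0) (\<lambda>j. joinv 0 (axis j 1)) s" for s
      by (rule fun_cong[OF sum_axis])
    have "(\<lambda>s. (g (fstv (axis s 1)), h (sndv (axis s 1)))) =
        case_sum (\<lambda>i. (g (axis i 1), vzero F x)) (\<lambda>j. (vzero E x, h (axis j 1)))"
      unfolding sum_frame_axis[OF r, symmetric] by (simp only: ax[symmetric])
    then show ?thesis
      using \<rho>[OF frame_families[OF r(1)] frame_families[OF r(2)], of "\<lambda>i. axis i 1" "\<lambda>j. axis j 1"] g h
      by (simp add: unitary_frame_def)
  qed
  then show ?thesis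
    using g h complex_frame_sum[of E J x g F K h] by (simp add: unitary_frame_def L omega_sum std_form_sum)
qed

context
  fixes E :: "('y::topological_space, 'e::topological_space) symp_bundle"
    and F :: "('y, 'f::topological_space) symp_bundle"
    and J \<tau> K \<sigma> and K' :: "'k::finite itself" and L' :: "'l::finite itself"
  assumes E: "symplectic_vector_bundle TYPE('k) E" and F: "symplectic_vector_bundle TYPE('l) F"
    and p: "triv_pair E (J, \<tau> :: ('y, 'e, 'k) det_triv)" and q: "triv_pair F (K, \<sigma> :: ('y, 'f, 'l) det_triv)"
begin

text \<open>At each point \<rho> is evaluation on the determinant form of a sum of unitary frames,
  which settles unitarity and the tensor relation. These frames vary arbitrarily with the point, so
  the work lies in continuity: locally \<rho> is rewritten through continuous sections of the
  summands and the given trivializations.\<close>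

lemma tensor_triv_exists:
  "\<exists>\<rho> :: ('y, 'e \<times> 'f, 'k + 'l) det_triv. triv_pair (sum_bundle E F) (map_prod J K, \<rho>) \<and>
      is_tensor_triv E (J, \<tau>) F (K, \<sigma>) (map_prod J K, \<rho>)"
proof -
  obtain g where g: "\<And>x. unitary_frame E J \<tau> x (g x)" using triv_pair_frame[OF E p] by metis
  obtain h where h: "\<And>x. unitary_frame F K \<sigma> x (h x)" using triv_pair_frame[OF F q] by metis
  define G where "G x z = (g x (fstv z), h x (sndv z))" for x z
  define S where "S = sum_bundle E F"
  note rg = unitary_frame_real[OF g] and rh = unitary_frame_real[OF h]
  have ua: "unitary_at E J \<tau> x" "unitary_at F K \<sigma> x" for x using p q by (auto intro: unitary_triv_at)
  have tE: "compatible_cs E J" "unitary_triv_on UNIV E J \<tau>" and tF: "compatible_cs F K" "unitary_triv_on UNIV F K \<sigma>"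
    using p q by (auto simp: triv_pair_def)
  have vE: "vector_bundle TYPE('k) E" and vF: "vector_bundle TYPE('l) F"
    using E F by (auto simp: symplectic_vector_bundle_def)
  have cG: "complex_frame S (map_prod J K) x (G x)" for x
    unfolding G_def[abs_def] S_def by (rule complex_frame_sum[OF unitary_frame_complex[OF g] unitary_frame_complex[OF h]])
  note rG = complex_frame_real[OF cG]
  define \<rho> :: "('y, 'e \<times> 'f, 'k + 'l) det_triv" where "\<rho> x L = L (frame_form S x (G x))" for x L
  note al = frame_form_alt[OF cG]
  have wv: "\<rho> x (wedge S (map_prod J K) x (\<lambda>s. G x (z s))) = col_det z" for x z
    unfolding \<rho>_def wedge_def using al frame_form_frame[OF cG] by simp
  have oG: "omega S (G x v) (G x w) = std_form v w" for x v w
    using g[of x] h[of x] by (simp add: G_def S_def omega_sum std_form_sum unitary_frame_def)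
  have her: "hermitian S (map_prod J K) (G x v) (G x w) = Complex (v \<bullet> w) (- std_form v w)" for x v w
  proof -
    have "map_prod J K (G x w) = G x (\<i> *s w)" using cG by (simp add: complex_frame_def)
    then show ?thesis by (simp add: hermitian_def oG std_form_i)
  qed
  have "unitary_at S (map_prod J K) \<rho> x" for x
    unfolding unitary_at_def
  proof (intro conjI ballI allI)
    fix v :: "'k + 'l \<Rightarrow> 'e \<times> 'f" assume "v \<in> families S x"
    then obtain z where v: "v = (\<lambda>s. G x (z s))" using families_frame_cases[OF rG] by blast
    show "complex_of_real ((cmod (\<rho> x (wedge S (map_prod J K) x v)))\<^sup>2) =
          det (\<chi> i j. hermitian S (map_prod J K) (v i) (v j))"
      unfolding v wv her col_det_gram by (rule refl)
  qed (use al in \<open>simp_all add: \<rho>_def\<close>)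
  moreover have "continuous_on (SIGMA x:UNIV. families S x) (\<lambda>(x, v). \<rho> x (wedge S (map_prod J K) x v))"
  proof (rule continuous_on_locally)
    define D where "D = (SIGMA x:UNIV. (families S x :: ('k + 'l \<Rightarrow> 'e \<times> 'f) set))"
    fix z0 assume z0: "z0 \<in> (SIGMA x:UNIV. (families S x :: ('k + 'l \<Rightarrow> 'e \<times> 'f) set))"
    define x0 where "x0 = fst z0"
    obtain U1 e where U1: "open U1" "x0 \<in> U1" "\<And>j. bcont E U1 (\<lambda>y. y) (e j)" "\<And>j. e j x0 = g x0 (axis j 1)"
    proof -
      have "\<exists>U f. open U \<and> x0 \<in> U \<and> (\<forall>j. bcont E U (\<lambda>y. y) (f j) \<and> f j x0 = g x0 (axis j 1))"
        by (rule local_sections[OF vE]) (rule frame_in[OF rg])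
      then obtain U f where U: "open U" "x0 \<in> U" "\<forall>j. bcont E U (\<lambda>y. y) (f j) \<and> f j x0 = g x0 (axis j 1)"
        by (elim exE conjE)
      show ?thesis by (rule that[of U f]) (use U in auto)
    qed
    obtain U2 f where U2: "open U2" "x0 \<in> U2" "\<And>j. bcont F U2 (\<lambda>y. y) (f j)" "\<And>j. f j x0 = h x0 (axis j 1)"
    proof -
      have "\<exists>U f. open U \<and> x0 \<in> U \<and> (\<forall>j. bcont F U (\<lambda>y. y) (f j) \<and> f j x0 = h x0 (axis j 1))"
        by (rule local_sections[OF vF]) (rule frame_in[OF rh])
      then obtain U f where U: "open U" "x0 \<in> U" "\<forall>j. bcont F U (\<lambda>y. y) (f j) \<and> f j x0 = h x0 (axis j 1)"
        by (elim exE conjE)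
      show ?thesis by (rule that[of U f]) (use U in auto)
    qed
    define d1 where "d1 x = \<tau> x (wedge E J x (\<lambda>j. e j x))" for x
    define d2 where "d2 x = \<sigma> x (wedge F K x (\<lambda>j. f j x))" for x
    have cd: "continuous_on U1 d1" "continuous_on U2 d2"
      unfolding d1_def d2_def by (rule continuous_on_wedge[OF tE(2) U1(3)], rule continuous_on_wedge[OF tF(2) U2(3)])
    have d0: "d1 x0 = 1" "d2 x0 = 1" using g[of x0] h[of x0] by (simp_all add: d1_def d2_def U1(4) U2(4) unitary_frame_def)
    define U where "U = (U1 \<inter> d1 -` (- {0})) \<inter> (U2 \<inter> d2 -` (- {0}))"
    have "open (U1 \<inter> d1 -` (- {0}))" "open (U2 \<inter> d2 -` (- {0}))"
      using continuous_open_preimage[OF cd(1) U1(1), of "- {0}"] continuous_open_preimage[OF cd(2) U2(1), of "- {0}"] by auto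
    then have "open U" unfolding U_def by (rule open_Int)
    define T where "T = D \<inter> fst -` U"
    have opT: "openin (top_of_set D) T"
      unfolding T_def by (rule continuous_openin_preimage_gen[OF continuous_on_fst[OF continuous_on_id] \<open>open U\<close>])
    have cfst: "continuous_on T fst" by (intro continuous_intros)
    have csm: "continuous_on T (\<lambda>z. snd z m)" for m
      using continuous_on_compose2[OF continuous_on_product_coordinates[of m] continuous_on_snd[OF continuous_on_id], of T] by simp
    have fT: "fst (snd z m) \<in> fibre E (fst z)" "snd (snd z m) \<in> fibre F (fst z)" if "z \<in> T" for z and m :: "'k + 'l"
      using that by (auto simp: T_def D_def families_def S_def fibre_sum mem_Times_iff)
    \<comment> \<open>A numerator in Cramer's rule: the i-th vector of the moving frame is replaced
      by a component of the m-th given vector.\<close>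
    have be: "bcont E T fst (\<lambda>z. if j = i then fst (snd z m) else e j (fst z))" for i j m
    proof (cases "j = i")
      case True then show ?thesis using cfst fT by (auto simp: bcont_def intro!: continuous_on_fst csm)
    next
      case False
      then show ?thesis using cfst U1(3)[of j] by (auto simp: bcont_def T_def U_def intro!: continuous_on_compose2[of U1 "e j"])
    qed
    have bf: "bcont F T fst (\<lambda>z. if j = i then snd (snd z m) else f j (fst z))" for i j m
    proof (cases "j = i")
      case True then show ?thesis using cfst fT by (auto simp: bcont_def intro!: continuous_on_snd csm)
    next
      case False
      then show ?thesis using cfst U2(3)[of j] by (auto simp: bcont_def T_def U_def intro!: continuous_on_compose2[of U2 "f j"])
    qed
    have cdT: "continuous_on T (\<lambda>z. d1 (fst z))" "continuous_on T (\<lambda>z. d2 (fst z))"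
      using continuous_on_compose2[OF cd(1) cfst] continuous_on_compose2[OF cd(2) cfst] by (auto simp: T_def U_def)
    have dT: "d1 (fst z) \<noteq> 0" "d2 (fst z) \<noteq> 0" if "z \<in> T" for z using that by (auto simp: T_def U_def)
    \<comment> \<open>The coordinates of the m-th vector in the moving frames \<open>e\<close> and
      \<open>f\<close>, written only through \<tau>, \<sigma> and the sections.\<close>
    define c where "c z m = joinv
        (\<chi> i. \<tau> (fst z) (wedge E J (fst z) (\<lambda>j. if j = i then fst (snd z m) else e j (fst z))) / d1 (fst z))
        (\<chi> i. \<sigma> (fst z) (wedge F K (fst z) (\<lambda>j. if j = i then snd (snd z m) else f j (fst z))) / d2 (fst z))"
      for z :: "'y \<times> ('k + 'l \<Rightarrow> 'e \<times> 'f)" and m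
    have "continuous_on T (\<lambda>z. c z m)" for m
      unfolding c_def using dT
      by (intro continuous_on_joinv continuous_on_vec_lambda continuous_on_divide cdT
          continuous_on_wedge[OF tE(2) be] continuous_on_wedge[OF tF(2) bf]) auto
    then have "continuous_on T (\<lambda>z. col_det (c z) * d1 (fst z) * d2 (fst z))"
      by (intro continuous_on_mult cdT continuous_on_col_det continuous_on_component)
    then have "continuous_on T (\<lambda>(x, v). \<rho> x (wedge S (map_prod J K) x v))"
    proof (rule continuous_on_eq)
      fix z assume z: "z \<in> T"
      define x where "x = fst z"
      have "snd z \<in> families S x" using z by (auto simp: T_def D_def x_def)
      then obtain y where y: "snd z = (\<lambda>s. G x (y s))" using families_frame_cases[OF rG] by blast
      have "(\<lambda>j. e j x) \<in> families E x" "(\<lambda>j. f j x) \<in> families F x"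
        using U1(3) U2(3) z by (auto simp: bcont_def families_def x_def T_def U_def)
      then obtain a b where a: "(\<lambda>j. e j x) = (\<lambda>j. g x (a j))" and b: "(\<lambda>j. f j x) = (\<lambda>j. h x (b j))"
        by (metis families_frame_cases[OF rg] families_frame_cases[OF rh])
      have ab: "e j x = g x (a j)" "f i x = h x (b i)" for i j using a b by metis+
      have D1: "d1 x = col_det a" "d2 x = col_det b"
        unfolding d1_def d2_def a b
          triv_wedge_unitary_frame[OF g ua(1)] triv_wedge_unitary_frame[OF h ua(2)] by (rule refl)+
      have u1: "(\<lambda>j. if j = i then g x u else g x (a j)) = (\<lambda>j. g x ((a(i := u)) j))" for i u by auto
      have u2: "(\<lambda>j. if j = i then h x u else h x (b j)) = (\<lambda>j. h x ((b(i := u)) j))" for i u by auto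
      have fs: "fst (snd z m) = g x (fstv (y m))" "snd (snd z m) = h x (sndv (y m))" for m
        by (simp_all add: y G_def)
      have cz: "c z m = joinv (\<chi> i. col_det (a(i := fstv (y m))) / col_det a)
          (\<chi> i. col_det (b(i := sndv (y m))) / col_det b)" for m
        unfolding c_def x_def[symmetric] fs ab u1 u2 D1
          triv_wedge_unitary_frame[OF g ua(1)] triv_wedge_unitary_frame[OF h ua(2)] by (rule refl)
      have "col_det a \<noteq> 0" "col_det b \<noteq> 0" using dT[OF z] by (simp_all add: x_def[symmetric] D1)
      from col_det_cramer[OF this, of y]
      show "col_det (c z) * d1 (fst z) * d2 (fst z) = (\<lambda>(x, v). \<rho> x (wedge S (map_prod J K) x v)) z"
        unfolding split_beta x_def[symmetric] y wv D1 cz[abs_def] by (rule sym)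
    qed
    moreover have "z0 \<in> T" using z0 U1(2) U2(2) d0 by (auto simp: T_def D_def U_def x0_def)
    ultimately show "\<exists>T. openin (top_of_set (SIGMA x:UNIV. families S x)) T \<and> z0 \<in> T \<and>
        continuous_on T (\<lambda>(x, v). \<rho> x (wedge S (map_prod J K) x v))"
      using opT unfolding D_def by blast
  qed
  ultimately have "triv_pair S (map_prod J K, \<rho>)"
    using compatible_cs_sum[OF E F tE(1) tF(1)] by (auto simp: triv_pair_def unitary_triv_on_def S_def)
  moreover have "is_tensor_triv E (J, \<tau>) F (K, \<sigma>) (map_prod J K, \<rho>)"
    unfolding is_tensor_triv_def prod.case
  proof (intro conjI refl allI ballI)
    fix x and v :: "'k \<Rightarrow> 'e" and w :: "'l \<Rightarrow> 'f"
    assume v: "v \<in> families E x" and w: "w \<in> families F x"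
    obtain a where a: "v = (\<lambda>i. g x (a i))" using families_frame_cases[OF rg v] by blast
    obtain b where b: "w = (\<lambda>i. h x (b i))" using families_frame_cases[OF rh w] by blast
    have "case_sum (\<lambda>i. (v i, vzero F x)) (\<lambda>j. (vzero E x, w j)) =
       (\<lambda>s. G x (case_sum (\<lambda>i. joinv (a i) 0) (\<lambda>j. joinv 0 (b j)) s))"
      unfolding G_def a b by (rule sum_frame_axis[OF rg rh, symmetric])
    then show "\<rho> x (wedge (sum_bundle E F) (map_prod J K) x (case_sum (\<lambda>i. (v i, vzero F x)) (\<lambda>j. (vzero E x, w j)))) =
        \<tau> x (wedge E J x v) * \<sigma> x (wedge F K x w)"
      using wv[of x "case_sum (\<lambda>i. joinv (a i) 0) (\<lambda>j. joinv 0 (b j))"]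
      unfolding S_def a b triv_wedge_unitary_frame[OF g ua(1)] triv_wedge_unitary_frame[OF h ua(2)]
      by (simp add: col_det_block)
  qed
  ultimately show ?thesis unfolding S_def by blast
qed

end

text \<open>In sums of unitary frames the cocycle is block diagonal. The phases multiply, so the sum
  of the two rotation functions is a lift of the product and is the rotation function by
  uniqueness.\<close>

lemma rotation_function_sum:
  fixes \<phi> :: "real \<Rightarrow> 'y::t2_space \<Rightarrow> 'y" and E :: "('y, 'e::topological_space) symp_bundle"
    and F :: "('y, 'f::topological_space) symp_bundle"
    and \<tau> :: "('y, 'e, 'k::finite) det_triv" and \<sigma> :: "('y, 'f, 'l::finite) det_triv"
    and \<rho> :: "('y, 'e \<times> 'f, 'k + 'l) det_triv"
  assumes \<phi>: "continuous_flow \<phi>" and E: "symplectic_vector_bundle TYPE('k) E" and F: "symplectic_vector_bundle TYPE('l) F"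
    and \<Phi>: "symplectic_cocycle \<phi> E \<Phi>" and \<Psi>: "symplectic_cocycle \<phi> F \<Psi>"
    and p: "triv_pair E (J, \<tau>)" and q: "triv_pair F (K, \<sigma>)" and pq: "triv_pair (sum_bundle E F) (L, \<rho>)"
    and t: "is_tensor_triv E (J, \<tau>) F (K, \<sigma>) (L, \<rho>)"
  shows "rotation_function \<phi> (sum_bundle E F) (L, \<rho>) (sum_cocycle \<Phi> \<Psi>) =
     (\<lambda>T x. rotation_function \<phi> E (J, \<tau>) \<Phi> T x + rotation_function \<phi> F (K, \<sigma>) \<Psi> T x)"
proof (rule rotation_function_eq)
  let ?u = "rotation_function \<phi> E (J, \<tau>) \<Phi>" and ?v = "rotation_function \<phi> F (K, \<sigma>) \<Psi>"
  have u: "rotation_lift \<phi> E (J, \<tau>) \<Phi> ?u" by (rule rotation_lift_exists[OF \<phi> E \<Phi> p])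
  have v: "rotation_lift \<phi> F (K, \<sigma>) \<Psi> ?v" by (rule rotation_lift_exists[OF \<phi> F \<Psi> q])
  have "rotation_phase \<phi> (sum_bundle E F) (L, \<rho>) (sum_cocycle \<Phi> \<Psi>) s x =
      rotation_phase \<phi> E (J, \<tau>) \<Phi> s x * rotation_phase \<phi> F (K, \<sigma>) \<Psi> s x" for s x
  proof -
    obtain g where g: "unitary_frame E J \<tau> x g" using triv_pair_frame[OF E p] by blast
    obtain g' where g': "unitary_frame E J \<tau> (\<phi> s x) g'" using triv_pair_frame[OF E p] by blast
    obtain h where h: "unitary_frame F K \<sigma> x h" using triv_pair_frame[OF F q] by blast
    obtain h' where h': "unitary_frame F K \<sigma> (\<phi> s x) h'" using triv_pair_frame[OF F q] by blast
    obtain N where N: "sympl N" "\<And>v. \<Phi> s x (g v) = g' (N v)"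
       and ph: "rotation_phase \<phi> E (J, \<tau>) \<Phi> s x = sgn (cdet (cpart N))"
      using rotation_phase_rep[OF \<phi> E \<Phi> p g g'] by blast
    obtain M where M: "sympl M" "\<And>v. \<Psi> s x (h v) = h' (M v)"
       and ph': "rotation_phase \<phi> F (K, \<sigma>) \<Psi> s x = sgn (cdet (cpart M))"
      using rotation_phase_rep[OF \<phi> F \<Psi> q h h'] by blast
    have lN: "linear N" and lM: "linear M" using N(1) M(1) by (auto simp: sympl_def)
    define Q where "Q z = joinv (N (fstv z)) (M (sndv z))" for z
    have "linear Q"
      by (rule linearI) (simp_all add: Q_def fstv_linear sndv_linear linear_add[OF lN] linear_add[OF lM]
          linear_scale[OF lN] linear_scale[OF lM] joinv_linear)
    then have "sympl Q" using N(1) M(1) by (simp add: sympl_def Q_def std_form_sum)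
    moreover have "sum_cocycle \<Phi> \<Psi> s x (g (fstv z), h (sndv z)) = (g' (fstv (Q z)), h' (sndv (Q z)))" for z
      by (simp add: sum_cocycle_def N(2) M(2) Q_def)
    ultimately have "rotation_phase \<phi> (sum_bundle E F) (L, \<rho>) (sum_cocycle \<Phi> \<Psi>) s x = sgn (cdet (cpart Q))"
      by (intro rotation_phase_frame[where t = s and x = x and \<phi> = \<phi>, OF unitary_frame_sum[OF g h t] unitary_frame_sum[OF g' h' t]]
          unitary_triv_at[OF pq]) auto
    also have "cpart Q = (\<lambda>z. joinv (cpart N (fstv z)) (cpart M (sndv z)))"
      by (rule ext) (simp add: cpart_def Q_def fstv_linear sndv_linear joinv_linear flip: joinv_linear)
    also have "cdet \<dots> = cdet (cpart N) * cdet (cpart M)"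
      by (rule cdet_block) (use clinear_cpart[OF lN] clinear_cpart[OF lM] in \<open>auto simp: clinear_def linear_0\<close>)
    finally show ?thesis by (simp add: sgn_mult ph ph')
  qed
  then show "rotation_lift \<phi> (sum_bundle E F) (L, \<rho>) (sum_cocycle \<Phi> \<Psi>) (\<lambda>T x. ?u T x + ?v T x)"
    using u v unfolding rotation_lift_def split_def by (auto simp: eip_add intro: continuous_on_add)
qed

lemma L1_limit_add:
  assumes F: "L1_limit \<mu> F f" and G: "L1_limit \<mu> G g"
  shows "L1_limit \<mu> (\<lambda>T x. F T x + G T x) (\<lambda>x. f x + g x)"
  unfolding L1_limit_def
proof (intro conjI)
  have f: "integrable \<mu> f" and g: "integrable \<mu> g" using F G by (auto simp: L1_limit_def)
  then show "integrable \<mu> (\<lambda>x. f x + g x)" by (rule Bochner_Integration.integrable_add)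
  have i: "\<forall>\<^sub>F T in at_top. integrable \<mu> (F T)" "\<forall>\<^sub>F T in at_top. integrable \<mu> (G T)"
    using F G by (auto simp: L1_limit_def)
  then show "\<forall>\<^sub>F T in at_top. integrable \<mu> (\<lambda>x. F T x + G T x)"
    by eventually_elim (rule Bochner_Integration.integrable_add)
  show "((\<lambda>T. \<integral>x. \<bar>F T x + G T x - (f x + g x)\<bar> \<partial>\<mu>) \<longlongrightarrow> 0) at_top"
  proof (rule tendsto_sandwich[of "\<lambda>_. 0" _ _ "\<lambda>T. (\<integral>x. \<bar>F T x - f x\<bar> \<partial>\<mu>) + (\<integral>x. \<bar>G T x - g x\<bar> \<partial>\<mu>)"])
    show "((\<lambda>T. (\<integral>x. \<bar>F T x - f x\<bar> \<partial>\<mu>) + (\<integral>x. \<bar>G T x - g x\<bar> \<partial>\<mu>)) \<longlongrightarrow> 0) at_top"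
      using F G by (intro tendsto_add_zero) (auto simp: L1_limit_def)
    show "\<forall>\<^sub>F T in at_top. (\<integral>x. \<bar>F T x + G T x - (f x + g x)\<bar> \<partial>\<mu>) \<le> (\<integral>x. \<bar>F T x - f x\<bar> \<partial>\<mu>) + (\<integral>x. \<bar>G T x - g x\<bar> \<partial>\<mu>)"
      using i
    proof eventually_elim
      case (elim T)
      have "(\<integral>x. \<bar>F T x + G T x - (f x + g x)\<bar> \<partial>\<mu>) \<le> (\<integral>x. \<bar>F T x - f x\<bar> + \<bar>G T x - g x\<bar> \<partial>\<mu>)"
        by (intro integral_mono integrable_abs Bochner_Integration.integrable_diff Bochner_Integration.integrable_add elim f g) auto
      also have "\<dots> = (\<integral>x. \<bar>F T x - f x\<bar> \<partial>\<mu>) + (\<integral>x. \<bar>G T x - g x\<bar> \<partial>\<mu>)"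
        by (intro Bochner_Integration.integral_add integrable_abs Bochner_Integration.integrable_diff elim f g)
      finally show ?case .
    qed
  qed auto
qed

lemma ruelle_density_sum:
  fixes \<phi> :: "real \<Rightarrow> 'y::t2_space \<Rightarrow> 'y" and E :: "('y, 'e::topological_space) symp_bundle"
    and F :: "('y, 'f::topological_space) symp_bundle"
    and T1 :: "(('e \<Rightarrow> 'e) \<times> ('y, 'e, 'k::finite) det_triv) set" and T2 :: "(('f \<Rightarrow> 'f) \<times> ('y, 'f, 'l::finite) det_triv) set"
  assumes c: "compact (UNIV :: 'y set)" "continuous_flow \<phi>" "invariant_measure \<phi> \<mu>"
    and E: "symplectic_vector_bundle TYPE('k) E" "symplectic_cocycle \<phi> E \<Phi>" "triv_class E T1"
    and F: "symplectic_vector_bundle TYPE('l) F" "symplectic_cocycle \<phi> F \<Psi>" "triv_class F T2"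
  shows "AE x in \<mu>. ruelle_density \<phi> (sum_bundle E F) (sum_cocycle \<Phi> \<Psi>) (tensor_class E T1 F T2) \<mu> x =
     ruelle_density \<phi> E \<Phi> T1 \<mu> x + ruelle_density \<phi> F \<Psi> T2 \<mu> x"
proof -
  define f where "f = ruelle_density \<phi> E \<Phi> T1 \<mu>"
  define g where "g = ruelle_density \<phi> F \<Psi> T2 \<mu>"
  note sb = symplectic_bundle_sum[OF E(1) F(1)] and sc = symplectic_cocycle_sum[OF E(2) F(2)]
  have f: "L1_limit \<mu> (\<lambda>T x. rotation_function \<phi> E p \<Phi> T x / T) f" if "p \<in> T1" for p
    using ruelle_density_L1[OF _ that] ruelle_density_exists[OF c E] unfolding f_def by blast
  have g: "L1_limit \<mu> (\<lambda>T x. rotation_function \<phi> F p \<Psi> T x / T) g" if "p \<in> T2" for p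
    using ruelle_density_L1[OF _ that] ruelle_density_exists[OF c F] unfolding g_def by blast
  have lim: "L1_limit \<mu> (\<lambda>T x. rotation_function \<phi> (sum_bundle E F) p (sum_cocycle \<Phi> \<Psi>) T x / T) (\<lambda>x. f x + g x)"
    if "p1 \<in> T1" "p2 \<in> T2" "triv_pair (sum_bundle E F) p" "is_tensor_triv E p1 F p2 p" for p1 p2 p
  proof -
    obtain J \<tau> K \<sigma> L \<rho> where e: "p1 = (J, \<tau>)" "p2 = (K, \<sigma>)" "p = (L, \<rho>)" by (metis surj_pair)
    show ?thesis
      using L1_limit_add[OF f[OF that(1)] g[OF that(2)]] that triv_class_pair[OF E(3) that(1)] triv_class_pair[OF F(3) that(2)]
      unfolding e by (simp add: rotation_function_sum[OF c(2) E(1) F(1) E(2) F(2)] add_divide_distrib)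
  qed
  have d: "is_ruelle_density \<phi> (sum_bundle E F) (sum_cocycle \<Phi> \<Psi>) (tensor_class E T1 F T2) \<mu> (\<lambda>x. f x + g x)"
    unfolding is_ruelle_density_def
  proof
    fix p' assume "p' \<in> tensor_class E T1 F T2"
    then obtain p1 p2 p where p: "p1 \<in> T1" "p2 \<in> T2" "triv_pair (sum_bundle E F) p" "is_tensor_triv E p1 F p2 p"
      "p' \<in> homotopy_class (sum_bundle E F) p" by (auto simp: tensor_class_def)
    show "L1_limit \<mu> (\<lambda>T x. rotation_function \<phi> (sum_bundle E F) p' (sum_cocycle \<Phi> \<Psi>) T x / T) (\<lambda>x. f x + g x)"
      using is_ruelle_density_homotopy_class[OF c sb sc lim[OF p(1-4)]] p(5) unfolding is_ruelle_density_def by blast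
  qed
  \<comment> \<open>A member of \<open>tensor_class\<close> is exhibited, so that the density
    selected for the sum is tied to a limit and can be compared.\<close>
  obtain p1 p2 where p12: "p1 \<in> T1" "triv_pair E p1" "p2 \<in> T2" "triv_pair F p2"
    using triv_class_nonempty[OF E(3)] triv_class_nonempty[OF F(3)] by blast
  obtain J \<tau> K \<sigma> where e: "p1 = (J, \<tau>)" "p2 = (K, \<sigma>)" by (metis surj_pair)
  obtain \<rho> where \<rho>: "triv_pair (sum_bundle E F) (map_prod J K, \<rho>)" "is_tensor_triv E p1 F p2 (map_prod J K, \<rho>)"
    using tensor_triv_exists[OF E(1) F(1)] p12 unfolding e by blast
  have mem: "(map_prod J K, \<rho>) \<in> tensor_class E T1 F T2"
    unfolding tensor_class_def using p12 \<rho> homotopic_triv_refl[OF \<rho>(1)] by (auto simp: homotopy_class_def)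
  show ?thesis
    using L1_limit_unique[OF ruelle_density_L1[OF d mem] lim[OF p12(1,3) \<rho>]] unfolding f_def g_def .
qed

section \<open>Trivial bundles\<close>

lemma trivial_simps:
  "tot trivial_bundle = UNIV" "prj trivial_bundle = fst" "vadd trivial_bundle (x, v) (y, w) = (x, v + w)"
  "vscale trivial_bundle r (x, v) = (x, r *\<^sub>R v)" "vzero trivial_bundle x = (x, 0)"
  "omega trivial_bundle (x, v) (y, w) = std_form v w" "fibre trivial_bundle x = Pair x ` UNIV"
  by (auto simp: trivial_bundle_def fibre_def)

lemma trivial_complex_frame: "complex_frame trivial_bundle std_cs x (Pair x)"
  by (auto simp: complex_frame_def real_frame_def trivial_simps std_cs_def bij_betw_def inj_on_def)

lemma std_form_linear:
  "std_form (u + v) w = std_form u w + std_form v w" "std_form (r *\<^sub>R v) w = r * std_form v w"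
  "std_form v w = - std_form w v"
  by (simp_all add: std_form_def sum_distrib_left sum_negf[symmetric] sum.distrib[symmetric] algebra_simps)

lemma symplectic_bundle_trivial:
  "symplectic_vector_bundle TYPE('n::finite) (trivial_bundle :: ('y::topological_space, 'y \<times> (complex ^ 'n)) symp_bundle)"
  unfolding symplectic_vector_bundle_def
proof (intro conjI)
  show "vector_bundle TYPE('n) (trivial_bundle :: ('y, 'y \<times> (complex ^ 'n)) symp_bundle)"
    unfolding vector_bundle_def
  proof
    fix x :: 'y
    have "open (UNIV :: 'y set) \<and> x \<in> UNIV \<and>
        homeomorphism (UNIV \<times> UNIV) {v \<in> tot trivial_bundle. prj trivial_bundle v \<in> (UNIV :: 'y set)} id
          (id :: 'y \<times> (complex ^ 'n) \<Rightarrow> 'y \<times> (complex ^ 'n)) \<and>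
        (\<forall>y\<in>UNIV. id (y, 0) = vzero (trivial_bundle :: ('y, 'y \<times> (complex ^ 'n)) symp_bundle) y \<and>
           (\<forall>z. prj trivial_bundle (id (y, z :: complex ^ 'n)) = y) \<and>
           (\<forall>z w. id (y, z + w :: complex ^ 'n) = vadd trivial_bundle (id (y, z)) (id (y, w))) \<and>
           (\<forall>r z. id (y, r *\<^sub>R z :: complex ^ 'n) = vscale trivial_bundle r (id (y, z))))"
      by (simp add: trivial_simps homeomorphism_def)
    then show "\<exists>U (h :: 'y \<times> (complex ^ 'n) \<Rightarrow> 'y \<times> (complex ^ 'n)) h'.
        open U \<and> x \<in> U \<and>
        homeomorphism (U \<times> UNIV) {v \<in> tot trivial_bundle. prj trivial_bundle v \<in> U} h h' \<and>
        (\<forall>y\<in>U. h (y, 0) = vzero trivial_bundle y \<and>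
           (\<forall>z. prj trivial_bundle (h (y, z)) = y) \<and>
           (\<forall>z w. h (y, z + w) = vadd trivial_bundle (h (y, z)) (h (y, w))) \<and>
           (\<forall>r z. h (y, r *\<^sub>R z) = vscale trivial_bundle r (h (y, z))))" by blast
  qed
  show "continuous_on {(v, w). v \<in> tot trivial_bundle \<and> w \<in> tot trivial_bundle \<and> prj trivial_bundle v = prj trivial_bundle w}
      (\<lambda>(v :: 'y \<times> (complex ^ 'n), w). omega trivial_bundle v w)"
    unfolding trivial_bundle_def std_form_inner case_prod_beta
    by simp (intro continuous_intros)
  show "\<forall>x :: 'y. \<forall>u\<in>fibre trivial_bundle x. \<forall>v\<in>fibre trivial_bundle x. \<forall>w :: 'y \<times> (complex ^ 'n)\<in>fibre trivial_bundle x. \<forall>r.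
        omega trivial_bundle (vadd trivial_bundle u v) w = omega trivial_bundle u w + omega trivial_bundle v w \<and>
        omega trivial_bundle (vscale trivial_bundle r v) w = r * omega trivial_bundle v w \<and>
        omega trivial_bundle v w = - omega trivial_bundle w v"
    using std_form_linear by (auto simp: trivial_simps)
  show "\<forall>x :: 'y. \<forall>v :: 'y \<times> (complex ^ 'n)\<in>fibre trivial_bundle x. v \<noteq> vzero trivial_bundle x \<longrightarrow>
      (\<exists>w\<in>fibre trivial_bundle x. omega trivial_bundle v w \<noteq> 0)"
  proof (intro allI ballI impI)
    fix x :: 'y and v :: "'y \<times> (complex ^ 'n)" assume "v \<in> fibre trivial_bundle x" "v \<noteq> vzero trivial_bundle x"
    then obtain a where "v = (x, a)" "a \<noteq> 0" by (auto simp: trivial_simps)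
    then show "\<exists>w\<in>fibre trivial_bundle x. omega trivial_bundle v w \<noteq> 0"
      by (intro bexI[of _ "(x, \<i> *s a)"]) (simp_all add: trivial_simps std_form_i)
  qed
qed

text \<open>The determinant of second components is the form dual to the tautological frame, which
  puts the standard trivialization under the general calculus of frames.\<close>

lemma std_triv_frame_form: "std_triv x L = L (frame_form trivial_bundle x (Pair x))"
proof -
  have "inv_into UNIV (Pair x) (v j) = snd (v j)" if "v \<in> families trivial_bundle x" for v :: "'b \<Rightarrow> 'a \<times> (complex ^ 'b)" and j
  proof -
    have "v j = Pair x (snd (v j))" using that by (auto simp: families_def trivial_simps dest: spec[of _ j])
    then show ?thesis by (metis frame_inv(1)[OF complex_frame_real[OF trivial_complex_frame]])
  qed
  then have "(\<lambda>v\<in>families trivial_bundle x. det (\<chi> i j. snd (v j) $ i)) =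
      frame_form trivial_bundle x (Pair x :: complex ^ 'b \<Rightarrow> 'a \<times> (complex ^ 'b))"
    by (auto simp: frame_form_def[OF trivial_complex_frame] fun_eq_iff col_det_def)
  then show ?thesis by (simp add: std_triv_def)
qed

lemma std_triv_wedge: "std_triv x (wedge trivial_bundle std_cs x (\<lambda>j. (x, v j))) = col_det v"
  unfolding std_triv_frame_form wedge_def
  by (simp add: frame_form_alt[OF trivial_complex_frame] frame_form_frame[OF trivial_complex_frame])

lemma trivial_unitary_frame: "unitary_frame trivial_bundle std_cs std_triv x (Pair x)"
  by (simp add: unitary_frame_def trivial_complex_frame trivial_simps std_triv_wedge)

lemma std_triv_pair: "triv_pair trivial_bundle (std_cs :: 'y \<times> (complex ^ 'n) \<Rightarrow> 'y::topological_space \<times> (complex ^ 'n::finite), std_triv)"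
  unfolding triv_pair_def prod.case
proof
  show "compatible_cs trivial_bundle (std_cs :: 'y \<times> (complex ^ 'n) \<Rightarrow> _)"
    unfolding compatible_cs_def
  proof (intro conjI allI)
    show "continuous_on (tot trivial_bundle) (std_cs :: 'y \<times> (complex ^ 'n) \<Rightarrow> _)"
      unfolding std_cs_def case_prod_beta by (intro continuous_intros)
    fix x :: 'y
    show "fibre_linear trivial_bundle x trivial_bundle x (std_cs :: 'y \<times> (complex ^ 'n) \<Rightarrow> _)"
      by (simp only: fibre_linear_def trivial_simps std_cs_def i_cmult_linear ball_simps prod.case) blast
    show "\<forall>v\<in>fibre trivial_bundle x. std_cs (std_cs v) = vscale trivial_bundle (-1) (v :: 'y \<times> (complex ^ 'n))"
      by (simp add: trivial_simps std_cs_def)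
    show "\<forall>v\<in>fibre trivial_bundle x. \<forall>w\<in>fibre trivial_bundle x.
        omega trivial_bundle v (std_cs w) = omega trivial_bundle w (std_cs (v :: 'y \<times> (complex ^ 'n)))"
      by (simp add: trivial_simps std_cs_def std_form_i inner_commute)
    show "\<forall>v\<in>fibre trivial_bundle x. v \<noteq> vzero trivial_bundle x \<longrightarrow>
        0 < omega trivial_bundle v (std_cs (v :: 'y \<times> (complex ^ 'n)))"
      by (simp add: trivial_simps std_cs_def std_form_i)
  qed
  have "unitary_at trivial_bundle std_cs (std_triv :: ('y, 'y \<times> (complex ^ 'n), 'n) det_triv) x" for x
    unfolding unitary_at_def
  proof (intro conjI ballI allI)
    fix v :: "'n \<Rightarrow> 'y \<times> (complex ^ 'n)" assume "v \<in> families trivial_bundle x"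
    then obtain a where a: "v = (\<lambda>j. (x, a j))"
      by (rule families_frame_cases[OF unitary_frame_real[OF trivial_unitary_frame]])
    show "complex_of_real ((cmod (std_triv x (wedge trivial_bundle std_cs x v)))\<^sup>2) =
          det (\<chi> i j. hermitian trivial_bundle std_cs (v i) (v j))"
    proof -
      have h: "hermitian trivial_bundle std_cs (v i) (v j) = Complex (a i \<bullet> a j) (- std_form (a i) (a j))" for i j
        using unitary_frame_hermitian[OF trivial_unitary_frame, of x "a i" "a j"] by (simp only: a)
      have t: "std_triv x (wedge trivial_bundle std_cs x v) = col_det a"
        using std_triv_wedge[of x a] by (simp only: a)
      show ?thesis unfolding h t by (simp only: col_det_gram)
    qed
  qed (simp_all add: std_triv_frame_form frame_form_alt[OF trivial_complex_frame])
  moreover have "continuous_on (SIGMA x:UNIV. families trivial_bundle x)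
     (\<lambda>(x, v). std_triv x (wedge trivial_bundle (std_cs :: 'y \<times> (complex ^ 'n) \<Rightarrow> _) x v))"
  proof -
    have "continuous_on (SIGMA x:UNIV. families trivial_bundle x)
       (\<lambda>z :: 'y \<times> ('n \<Rightarrow> 'y \<times> (complex ^ 'n)). col_det (\<lambda>j. snd (snd z j)))"
    proof (intro continuous_on_col_det continuous_on_component continuous_on_snd)
      fix m :: 'n
      show "continuous_on (SIGMA x:UNIV. families trivial_bundle x) (\<lambda>z :: 'y \<times> ('n \<Rightarrow> 'y \<times> (complex ^ 'n)). snd z m)"
        by (rule continuous_on_compose2[OF continuous_on_product_coordinates]) (auto intro: continuous_intros)
    qed
    then show ?thesis
    proof (rule continuous_on_eq)
      fix z :: "'y \<times> ('n \<Rightarrow> 'y \<times> (complex ^ 'n))" assume "z \<in> (SIGMA x:UNIV. families trivial_bundle x)"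
      then have "snd z \<in> families trivial_bundle (fst z)" by auto
      then obtain a where "snd z = (\<lambda>j. (fst z, a j))"
        by (rule families_frame_cases[OF unitary_frame_real[OF trivial_unitary_frame]])
      then show "col_det (\<lambda>j. snd (snd z j)) = (\<lambda>(x, v). std_triv x (wedge trivial_bundle std_cs x v)) z"
        by (simp add: std_triv_wedge case_prod_beta)
    qed
  qed
  ultimately show "unitary_triv_on UNIV trivial_bundle (std_cs :: 'y \<times> (complex ^ 'n) \<Rightarrow> _) std_triv"
    by (simp add: unitary_triv_on_def)
qed

lemma Sp_group_sympl: "A \<in> Sp_group \<longleftrightarrow> sympl (blinfun_apply A)"
  by (simp add: Sp_group_def sympl_def linear_blinfun)

section \<open>Cocycles on the trivial bundle as paths of symplectic matrices\<close>

context
  fixes \<phi> :: "real \<Rightarrow> 'y::topological_space \<Rightarrow> 'y"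
    and \<Phi> :: "real \<Rightarrow> 'y \<Rightarrow> 'y \<times> (complex ^ 'n::finite) \<Rightarrow> 'y \<times> (complex ^ 'n)"
  assumes \<phi>: "continuous_flow \<phi>" and \<Phi>: "symplectic_cocycle \<phi> trivial_bundle \<Phi>"
begin

lemma cocycle_matrix: "\<Phi> t x (x, v) = (\<phi> t x, cocycle_matrix \<Phi> t x v)"
proof -
  have iso: "fibre_linear trivial_bundle x trivial_bundle (\<phi> t x) (\<Phi> t x)"
    using \<Phi> by (simp add: symplectic_cocycle_def fibre_symplectic_iso_def)
  then have m: "\<Phi> t x (x, v) = (\<phi> t x, snd (\<Phi> t x (x, v)))" for v
    by (auto simp: fibre_linear_def trivial_simps prod_eq_iff)
  have "linear (\<lambda>v. snd (\<Phi> t x (x, v)))"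
  proof (rule linearI)
    fix v w :: "complex ^ 'n" and r :: real
    have "\<Phi> t x (vadd trivial_bundle (x, v) (x, w)) = vadd trivial_bundle (\<Phi> t x (x, v)) (\<Phi> t x (x, w))"
      using iso unfolding fibre_linear_def by (simp add: trivial_simps)
    then show "snd (\<Phi> t x (x, v + w)) = snd (\<Phi> t x (x, v)) + snd (\<Phi> t x (x, w))"
      by (metis m snd_conv trivial_simps(3))
    have "\<Phi> t x (vscale trivial_bundle r (x, v)) = vscale trivial_bundle r (\<Phi> t x (x, v))"
      using iso unfolding fibre_linear_def by (simp add: trivial_simps)
    then show "snd (\<Phi> t x (x, r *\<^sub>R v)) = r *\<^sub>R snd (\<Phi> t x (x, v))"
      by (metis m snd_conv trivial_simps(4))
  qed
  then have "cocycle_matrix \<Phi> t x v = snd (\<Phi> t x (x, v))"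
    by (simp add: cocycle_matrix_def bounded_linear_Blinfun_apply linear_conv_bounded_linear)
  then show ?thesis using m by simp
qed

lemma cocycle_matrix_Sp: "cocycle_matrix \<Phi> t x \<in> Sp_group"
proof -
  have "omega trivial_bundle (\<Phi> t x (x, v)) (\<Phi> t x (x, w)) = omega trivial_bundle (x, v) (x, w)" for v w
    using \<Phi> unfolding symplectic_cocycle_def fibre_symplectic_iso_def by (simp add: trivial_simps)
  then show ?thesis by (simp add: Sp_group_def cocycle_matrix trivial_simps)
qed

lemma trivial_rotation_phase:
  "rotation_phase \<phi> trivial_bundle (std_cs, std_triv) \<Phi> t x = sgn (cdet (cpart (cocycle_matrix \<Phi> t x)))"
  by (rule rotation_phase_frame[where t = t and x = x and \<phi> = \<phi> and \<Phi> = \<Phi> and N = "cocycle_matrix \<Phi> t x",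
        OF trivial_unitary_frame trivial_unitary_frame unitary_triv_at[OF std_triv_pair] unitary_triv_at[OF std_triv_pair]
        _ cocycle_matrix])
    (use cocycle_matrix_Sp Sp_group_sympl in blast)

end

section \<open>The universal cover of the symplectic group\<close>

text \<open>One bound \<open>B\<close> for the whole family places all operators N^T N in a set on
  which a single instance of the square root is continuous.\<close>

lemma polar_pos_continuous:
  fixes A :: "real \<Rightarrow> (complex ^ 'n::finite) \<Rightarrow>\<^sub>L (complex ^ 'n)"
  assumes A: "continuous_on S A" "\<And>t. t \<in> S \<Longrightarrow> sympl (A t)" and B: "\<And>t. t \<in> S \<Longrightarrow> norm (A t) \<le> B" "1 \<le> B"
  shows "continuous_on S (\<lambda>t. polar_pos B (A t))"
  unfolding polar_pos_def
proof (rule continuous_on_compose2[OF continuous_on_possqrt[OF polar_bounds[OF B(2)]]])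
  show "continuous_on S (\<lambda>t. gram_op (A t))"
  proof (rule continuous_on_blinfun_componentwise)
    fix i :: "complex ^ 'n"
    show "continuous_on S (\<lambda>t. gram_op (A t) i)"
      unfolding continuous_on_componentwise[where f = "\<lambda>t. gram_op (A t) i"] gram_op(2)[OF linear_blinfun]
      by (intro ballI continuous_intros A)
  qed
  show "(\<lambda>t. gram_op (A t)) ` S \<subseteq> {S. bounded_positive (1 / B\<^sup>2) (B\<^sup>2) S}"
  proof clarify
    fix t assume t: "t \<in> S"
    have "norm (A t v) \<le> B * norm v" for v
      by (rule order_trans[OF norm_blinfun mult_right_mono[OF B(1)[OF t]]]) simp
    then show "bounded_positive (1 / B\<^sup>2) (B\<^sup>2) (gram_op (A t))"
      by (rule gram_op_bounded_positive[OF A(2)[OF t] _ B(2)])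
  qed
qed

text \<open>The positive part P squares to the identity, so v - P v is an eigenvector for -1 unless
  it vanishes, and positivity excludes the former.\<close>

lemma polar_pos_id:
  assumes "1 \<le> B" shows "polar_pos B (blinfun_apply id_blinfun) = (id_blinfun :: (complex ^ 'n::finite) \<Rightarrow>\<^sub>L _)"
proof (rule blinfun_eqI)
  fix v :: "complex ^ 'n"
  define P where "P = blinfun_apply (polar_pos B (blinfun_apply (id_blinfun :: (complex ^ 'n) \<Rightarrow>\<^sub>L _)))"
  have N: "sympl (blinfun_apply (id_blinfun :: (complex ^ 'n) \<Rightarrow>\<^sub>L _))"
    using sympl_id by (simp add: id_def)
  have bd: "norm (blinfun_apply id_blinfun w) \<le> B * norm w" for w :: "complex ^ 'n"
    using mult_right_mono[OF assms norm_ge_zero] by simp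
  note pp = polar_props[OF N bd assms, folded P_def]
  have "gram_op (blinfun_apply id_blinfun) v = v"
    using gram_op(2)[OF linear_blinfun, of id_blinfun v] by (intro iffD1[OF vector_eq_rdot]) simp
  then have PP: "P (P v) = v" by (simp add: pp(1))
  have l: "linear P" unfolding P_def by (rule linear_blinfun)
  have "P (v - P v) = - (v - P v)" by (simp add: linear_diff[OF l] PP)
  then have "P (v - P v) \<bullet> (v - P v) = - ((v - P v) \<bullet> (v - P v))" by (simp only: inner_minus_left)
  then have "\<not> 0 < P (v - P v) \<bullet> (v - P v)" using inner_ge_zero[of "v - P v"] by linarith
  then have "v - P v = 0" using pp(3) by blast
  then show "polar_pos B (blinfun_apply id_blinfun) v = id_blinfun v" by (simp add: P_def)
qed

definition i_blinfun :: "(complex ^ 'n::finite) \<Rightarrow>\<^sub>L (complex ^ 'n)" where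
  "i_blinfun = Blinfun (\<lambda>v. \<i> *s v)"

lemma i_blinfun [simp]: "i_blinfun v = \<i> *s (v :: complex ^ 'n::finite)"
proof -
  have "linear (\<lambda>v :: complex ^ 'n. \<i> *s v)" by (rule linearI) (simp_all add: i_cmult_linear)
  then have "bounded_linear (\<lambda>v :: complex ^ 'n. \<i> *s v)" by (simp add: linear_conv_bounded_linear)
  from bounded_linear_Blinfun_apply[OF this] show ?thesis by (simp add: i_blinfun_def)
qed

lemma i_blinfun_Sp: "i_blinfun \<in> Sp_group"
  by (simp add: Sp_group_def std_form_inner inner_i_i)
    (simp add: inner_i_skew)

section \<open>Discrete kernel and lifting of paths in the covering group\<close>

locale Sp_cover =
  fixes G :: "'g::topological_space monoid" and \<pi> :: "'g \<Rightarrow> ((complex ^ 'n::finite) \<Rightarrow>\<^sub>L (complex ^ 'n))"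
  assumes cover: "universal_cover_Sp G \<pi>"

sublocale Sp_cover \<subseteq> group G
  using cover by (simp add: universal_cover_Sp_def)

context Sp_cover
begin

lemma cont_mult:
  assumes "continuous_on S f" "continuous_on S g" "f ` S \<subseteq> carrier G" "g ` S \<subseteq> carrier G"
  shows "continuous_on S (\<lambda>t. f t \<otimes>\<^bsub>G\<^esub> g t)"
proof -
  have "continuous_on (carrier G \<times> carrier G) (\<lambda>(g, h). g \<otimes>\<^bsub>G\<^esub> h)"
    using cover by (simp add: universal_cover_Sp_def)
  from continuous_on_compose2[OF this continuous_on_Pair[OF assms(1,2)]] assms(3,4)
  show ?thesis by auto
qed

lemma cont_inv:
  assumes "continuous_on S f" "f ` S \<subseteq> carrier G"
  shows "continuous_on S (\<lambda>t. m_inv G (f t))"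
  using cover assms unfolding universal_cover_Sp_def by (metis continuous_on_compose2)

lemma proj_mult: "g \<in> carrier G \<Longrightarrow> h \<in> carrier G \<Longrightarrow> \<pi> (g \<otimes>\<^bsub>G\<^esub> h) = \<pi> g o\<^sub>L \<pi> h"
  using cover by (simp add: universal_cover_Sp_def)

lemma proj_image: "\<pi> ` carrier G = Sp_group"
  using cover by (simp add: universal_cover_Sp_def covering_space_def)

lemma proj_cont: "continuous_on (carrier G) \<pi>"
  using cover by (simp add: universal_cover_Sp_def covering_space_def)

lemma proj_sympl: "g \<in> carrier G \<Longrightarrow> sympl (\<pi> g)"
  using proj_image Sp_group_sympl by blast

lemma proj_one: "\<pi> \<one>\<^bsub>G\<^esub> = id_blinfun"
proof (rule blinfun_eqI)
  fix v
  have "\<pi> \<one>\<^bsub>G\<^esub> (\<pi> \<one>\<^bsub>G\<^esub> v) = \<pi> \<one>\<^bsub>G\<^esub> v" by (metis blinfun_apply_blinfun_compose one_closed proj_mult r_one)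
  then show "\<pi> \<one>\<^bsub>G\<^esub> v = id_blinfun v" using injD[OF sympl_inj[OF proj_sympl[OF one_closed]]] by simp
qed

lemma proj_inv: "g \<in> carrier G \<Longrightarrow> \<pi> (m_inv G g) (\<pi> g v) = v"
  by (metis blinfun_apply_blinfun_compose blinfun_apply_id_blinfun id_apply inv_closed l_inv proj_mult proj_one)

text \<open>The sheet \<open>u\<close> through the unit makes the kernel of the covering map
  discrete, and the section \<sigma> lifts matrices close to the identity continuously.\<close>

lemma section_at_one:
  obtains u \<sigma> e where "openin (top_of_set (carrier G)) u" "\<one>\<^bsub>G\<^esub> \<in> u" "inj_on \<pi> u"
    "0 < e" "continuous_on {A \<in> Sp_group. norm (A - id_blinfun) < e} \<sigma>" "\<sigma> id_blinfun = \<one>\<^bsub>G\<^esub>"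
    "\<And>A. A \<in> Sp_group \<Longrightarrow> norm (A - id_blinfun) < e \<Longrightarrow> \<sigma> A \<in> carrier G \<and> \<pi> (\<sigma> A) = A"
proof -
  have idS: "(id_blinfun :: (complex ^ 'n) \<Rightarrow>\<^sub>L _) \<in> Sp_group" using imageI[OF one_closed, of \<pi>] by (simp add: proj_image proj_one)
  have "covering_space (carrier G) \<pi> Sp_group" using cover by (simp add: universal_cover_Sp_def)
  then have "\<exists>T. id_blinfun \<in> T \<and> openin (top_of_set Sp_group) T \<and>
      (\<exists>\<V>. \<Union>\<V> = carrier G \<inter> \<pi> -` T \<and> (\<forall>u\<in>\<V>. openin (top_of_set (carrier G)) u) \<and>
         pairwise disjnt \<V> \<and> (\<forall>u\<in>\<V>. \<exists>q. homeomorphism u T \<pi> q))"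
    unfolding covering_space_def using idS by (elim conjE) (rule bspec)
  then obtain T \<V> where T: "id_blinfun \<in> T" "openin (top_of_set Sp_group) T"
    and V: "\<Union>\<V> = carrier G \<inter> \<pi> -` T" "\<forall>u\<in>\<V>. openin (top_of_set (carrier G)) u"
      "\<forall>u\<in>\<V>. \<exists>q. homeomorphism u T \<pi> q"
    by (elim exE conjE) (rule that)
  have "\<one>\<^bsub>G\<^esub> \<in> \<Union>\<V>" using V(1) T(1) proj_one by simp
  then obtain u where u: "u \<in> \<V>" "\<one>\<^bsub>G\<^esub> \<in> u" by blast
  obtain \<sigma> where \<sigma>: "homeomorphism u T \<pi> \<sigma>" using V(3) u(1) by blast
  obtain e where e: "0 < e" "ball id_blinfun e \<inter> Sp_group \<subseteq> T"
    using T unfolding openin_contains_ball by blast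
  have sub: "{A \<in> Sp_group. norm (A - id_blinfun) < e} \<subseteq> T"
    using e(2) by (auto simp: dist_norm norm_minus_commute)
  show ?thesis
  proof (rule that[OF bspec[OF V(2) u(1)] u(2) _ e(1)])
    show "inj_on \<pi> u" using \<sigma> by (metis homeomorphism_def inj_on_inverseI)
    show "continuous_on {A \<in> Sp_group. norm (A - id_blinfun) < e} \<sigma>"
      using \<sigma> sub by (meson continuous_on_subset homeomorphism_def)
    show "\<sigma> id_blinfun = \<one>\<^bsub>G\<^esub>" using \<sigma> u(2) proj_one by (metis homeomorphism_apply1)
    fix A :: "(complex ^ 'n) \<Rightarrow>\<^sub>L (complex ^ 'n)" assume "A \<in> Sp_group" "norm (A - id_blinfun) < e"
    then have "A \<in> T" using sub by blast
    then have "\<sigma> A \<in> u" "\<pi> (\<sigma> A) = A" using \<sigma> by (auto simp: homeomorphism_def)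
    then show "\<sigma> A \<in> carrier G \<and> \<pi> (\<sigma> A) = A" using V(1) u(1) by blast
  qed
qed

text \<open>Near a time \<open>r\<close> the quotient of \<open>d t\<close> by \<open>d r\<close>
  lies in the sheet through the unit and over the identity, hence is the unit. So \<open>d\<close>
  is locally constant.\<close>

lemma kernel_path_constant:
  fixes d :: "real \<Rightarrow> 'g"
  assumes d: "continuous_on {a..b} d" "d ` {a..b} \<subseteq> carrier G" "\<And>t. t \<in> {a..b} \<Longrightarrow> \<pi> (d t) = id_blinfun"
    and s: "s \<in> {a..b}" "t \<in> {a..b}"
  shows "d s = d t"
proof -
  obtain u \<sigma> e where u: "openin (top_of_set (carrier G)) u" "\<one>\<^bsub>G\<^esub> \<in> u" "inj_on \<pi> u"
    by (rule section_at_one)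
  have dc: "d t \<in> carrier G" if "t \<in> {a..b}" for t using d(2) that by blast
  have "d constant_on {a..b}"
  proof (rule locally_constant_imp_constant)
    show "connected {a..b}" by simp
    fix r assume r: "r \<in> {a..b}"
    define c where "c t = d t \<otimes>\<^bsub>G\<^esub> m_inv G (d r)" for t
    have cc: "c ` {a..b} \<subseteq> carrier G" using dc r by (auto simp: c_def)
    have "continuous_on {a..b} c"
      unfolding c_def by (intro cont_mult d continuous_on_const) (use dc r in auto)
    then have "openin (top_of_set {a..b}) ({a..b} \<inter> c -` u)"
      by (rule continuous_openin_preimage[OF _ _ u(1)]) (use cc in auto)
    moreover have "r \<in> {a..b} \<inter> c -` u" using r dc u(2) by (simp add: c_def)
    moreover have "d t = d r" if t: "t \<in> {a..b} \<inter> c -` u" for t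
    proof -
      have td: "t \<in> {a..b}" "c t \<in> u" using t by auto
      have "\<pi> (m_inv G (d r)) v = v" for v using proj_inv[OF dc[OF r], of v] d(3)[OF r] by simp
      then have "\<pi> (c t) = id_blinfun"
        using proj_mult[OF dc[OF td(1)] inv_closed[OF dc[OF r]]] d(3)[OF td(1)]
        by (intro blinfun_eqI) (simp add: c_def)
      then have "c t = \<one>\<^bsub>G\<^esub>" using u(2,3) td(2) proj_one by (metis inj_onD)
      then show ?thesis unfolding c_def using dc[OF td(1)] dc[OF r]
        by (metis inv_equality inv_inv inv_closed)
    qed
    ultimately show "\<exists>U. openin (top_of_set {a..b}) U \<and> r \<in> U \<and> (\<forall>x\<in>U. d x = d r)" by blast
  qed
  then show ?thesis using s by (auto simp: constant_on_def)
qed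

text \<open>With \<open>Q\<close> the inverse of \<open>P\<close>, the path \<open>P\<close> is the telescoping product of the near-identity
  factors \<open>Q (i t / n) P ((i + 1) t / n)\<close>, which lift through the local section at the identity.\<close>

lemma path_lift:
  fixes P Q :: "real \<Rightarrow> (complex ^ 'n) \<Rightarrow>\<^sub>L (complex ^ 'n)"
  assumes P: "continuous_on {0..T} P" "\<And>t. t \<in> {0..T} \<Longrightarrow> P t \<in> Sp_group" "P 0 = id_blinfun"
    and Q: "continuous_on {0..T} Q" "\<And>t. t \<in> {0..T} \<Longrightarrow> Q t \<in> Sp_group"
      "\<And>t. t \<in> {0..T} \<Longrightarrow> Q t o\<^sub>L P t = id_blinfun" "\<And>t. t \<in> {0..T} \<Longrightarrow> P t o\<^sub>L Q t = id_blinfun"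
  shows "\<exists>\<beta>. continuous_on {0..T} \<beta> \<and> \<beta> ` {0..T} \<subseteq> carrier G \<and> \<beta> 0 = \<one>\<^bsub>G\<^esub> \<and> (\<forall>t\<in>{0..T}. \<pi> (\<beta> t) = P t)"
proof (cases "0 \<le> T")
  case T: True
  obtain u \<sigma> e where e: "0 < e" "continuous_on {A \<in> Sp_group. norm (A - id_blinfun) < e} \<sigma>" "\<sigma> id_blinfun = \<one>\<^bsub>G\<^esub>"
    "\<And>A. A \<in> Sp_group \<Longrightarrow> norm (A - id_blinfun) < e \<Longrightarrow> \<sigma> A \<in> carrier G \<and> \<pi> (\<sigma> A) = A"
    by (rule section_at_one) blast
  define R where "R = (\<lambda>(s, t). Q s o\<^sub>L P t)"
  have Rc: "continuous_on ({0..T} \<times> {0..T}) R"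
    unfolding R_def case_prod_beta
    by (intro continuous_intros continuous_on_compose2[OF P(1)] continuous_on_compose2[OF Q(1)]) auto
  \<comment> \<open>\<open>R\<close> is the identity on the diagonal, so uniform continuity keeps
    its values at nearby times within reach of the local section.\<close>
  then have "uniformly_continuous_on ({0..T} \<times> {0..T}) R"
    by (rule compact_uniformly_continuous) (intro compact_Times compact_Icc)
  then obtain d where d: "0 < d" "\<And>z w. z \<in> {0..T} \<times> {0..T} \<Longrightarrow> w \<in> {0..T} \<times> {0..T} \<Longrightarrow> dist w z < d \<Longrightarrow> dist (R w) (R z) < e"
    unfolding uniformly_continuous_on_def using e(1) by metis
  obtain n where n: "T / d < real n" using reals_Archimedean2 by blast
  have n0: "0 < n" using n T d(1) by (metis divide_nonneg_pos gr0I leD of_nat_0)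
  have Td: "T / real n < d" using n n0 d(1) by (simp add: field_simps)
  \<comment> \<open>The subdivision shrinks with \<open>t\<close>: at t = 0 every factor is the
    identity, and after \<open>n\<close> steps the product has reached \<open>P t\<close>.\<close>
  define f where "f i t = real i * t / real n" for i t
  have f_in: "f i t \<in> {0..T}" if "i \<le> n" "t \<in> {0..T}" for i t
  proof -
    have "real i * t \<le> real n * T" using that by (intro mult_mono) auto
    then show ?thesis using that n0 by (simp add: f_def field_simps)
  qed
  have f_cont: "continuous_on {0..T} (f i)" for i
    unfolding f_def by (intro continuous_intros) (use n0 in auto)
  define S where "S i t = R (f i t, f (Suc i) t)" for i t
  have S: "S i t \<in> Sp_group" "norm (S i t - id_blinfun) < e" if "i < n" "t \<in> {0..T}" for i t
  proof -
    have i: "f i t \<in> {0..T}" "f (Suc i) t \<in> {0..T}" using f_in that by auto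
    show "S i t \<in> Sp_group"
      using P(2)[OF i(2)] Q(2)[OF i(1)] by (simp add: Sp_group_def S_def R_def)
    have "dist (f i t, f (Suc i) t) (f i t, f i t) = t / real n"
      using that n0 by (simp add: dist_Pair_Pair dist_real_def f_def diff_divide_distrib[symmetric] algebra_simps)
    also have "\<dots> < d" using Td that divide_right_mono[of t T "real n"] by auto
    finally have "dist (R (f i t, f (Suc i) t)) (R (f i t, f i t)) < e" using d(2) i by simp
    then show "norm (S i t - id_blinfun) < e" using Q(3)[OF i(1)] by (simp add: dist_norm S_def R_def)
  qed
  have S_cont: "continuous_on {0..T} (S i)" if "i < n" for i
    unfolding S_def using f_in[of i] f_in[of "Suc i"] that
    by (intro continuous_on_compose2[OF Rc] continuous_on_Pair f_cont) auto
  define \<gamma> where "\<gamma> = rec_nat (\<lambda>t. \<one>\<^bsub>G\<^esub>) (\<lambda>i g t. g t \<otimes>\<^bsub>G\<^esub> \<sigma> (S i t))"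
  have \<gamma>: "\<gamma> 0 = (\<lambda>t. \<one>\<^bsub>G\<^esub>)" "\<gamma> (Suc i) = (\<lambda>t. \<gamma> i t \<otimes>\<^bsub>G\<^esub> \<sigma> (S i t))" for i
    by (simp_all add: \<gamma>_def)
  have "continuous_on {0..T} (\<gamma> i) \<and> \<gamma> i ` {0..T} \<subseteq> carrier G \<and> \<gamma> i 0 = \<one>\<^bsub>G\<^esub> \<and> (\<forall>t\<in>{0..T}. \<pi> (\<gamma> i t) = P (f i t))"
    if "i \<le> n" for i
    using that
  proof (induction i)
    case 0
    show ?case by (simp add: \<gamma> proj_one f_def P(3) image_subset_iff)
  next
    case (Suc i)
    then have i: "i < n" and IH: "continuous_on {0..T} (\<gamma> i)" "\<gamma> i ` {0..T} \<subseteq> carrier G" "\<gamma> i 0 = \<one>\<^bsub>G\<^esub>"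
      "\<And>t. t \<in> {0..T} \<Longrightarrow> \<pi> (\<gamma> i t) = P (f i t)" by auto
    have c: "\<sigma> (S i t) \<in> carrier G" "\<pi> (\<sigma> (S i t)) = S i t" if "t \<in> {0..T}" for t
      using e(4)[OF S[OF i that]] by auto
    have sc: "continuous_on {0..T} (\<lambda>t. \<sigma> (S i t))"
      by (rule continuous_on_compose2[OF e(2) S_cont[OF i]]) (use S[OF i] in auto)
    show ?case unfolding \<gamma>
    proof (intro conjI ballI)
      show "continuous_on {0..T} (\<lambda>t. \<gamma> i t \<otimes>\<^bsub>G\<^esub> \<sigma> (S i t))"
        by (rule cont_mult[OF IH(1) sc IH(2)]) (use c in auto)
      show "(\<lambda>t. \<gamma> i t \<otimes>\<^bsub>G\<^esub> \<sigma> (S i t)) ` {0..T} \<subseteq> carrier G" using IH(2) c by auto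
      have "S i 0 = id_blinfun" using Q(3)[of 0] T by (simp add: S_def R_def f_def)
      then show "\<gamma> i 0 \<otimes>\<^bsub>G\<^esub> \<sigma> (S i 0) = \<one>\<^bsub>G\<^esub>" by (simp add: IH(3) e(3))
      fix t assume t: "t \<in> {0..T}"
      have "\<pi> (\<gamma> i t \<otimes>\<^bsub>G\<^esub> \<sigma> (S i t)) = P (f i t) o\<^sub>L S i t"
        using IH(2) t by (subst proj_mult) (auto simp: c[OF t] IH(4)[OF t])
      also have "\<dots> = (P (f i t) o\<^sub>L Q (f i t)) o\<^sub>L P (f (Suc i) t)"
        by (rule blinfun_eqI) (simp add: S_def R_def)
      also have "\<dots> = P (f (Suc i) t)" using Q(4)[OF f_in[of i t]] i t by (intro blinfun_eqI) simp
      finally show "\<pi> (\<gamma> i t \<otimes>\<^bsub>G\<^esub> \<sigma> (S i t)) = P (f (Suc i) t)" .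
    qed
  qed
  from this[of n] show ?thesis using n0 by (intro exI[of _ "\<gamma> n"]) (auto simp: f_def)
qed auto

text \<open>Writing the path as \<open>\<gamma> \<beta>\<close> with \<open>\<beta>\<close> lifting the positive parts \<open>P\<close> and \<open>\<gamma>\<close> the unitary
  parts, the lift \<open>\<rho> \<gamma>\<close> of the phase is off by \<open>\<rho> \<beta>\<close>.  As \<open>P\<close> is conjugate to its
  inverse by \<open>i\<close>, so is \<open>\<beta>\<close> by a lift of \<open>i\<close>, which bounds \<open>\<rho> \<beta>\<close>.\<close>

lemma rho_phase_lift:
  fixes A :: "real \<Rightarrow> (complex ^ 'n) \<Rightarrow>\<^sub>L (complex ^ 'n)"
  assumes \<rho>: "is_rotation_rho G \<pi> \<rho>"
    and D: "\<And>g h. g \<in> carrier G \<Longrightarrow> h \<in> carrier G \<Longrightarrow> \<bar>\<rho> (g \<otimes>\<^bsub>G\<^esub> h) - \<rho> g - \<rho> h\<bar> \<le> D"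
    and T: "0 \<le> T" and a: "continuous_on {0..T} a" "a ` {0..T} \<subseteq> carrier G" "a 0 = \<one>\<^bsub>G\<^esub>"
    and A: "\<And>t. t \<in> {0..T} \<Longrightarrow> \<pi> (a t) = A t"
  shows "\<exists>r. continuous_on {0..T} r \<and> r 0 = 0 \<and> (\<forall>t\<in>{0..T}. eip (r t) = sgn (cdet (cpart (A t)))) \<and>
     \<bar>\<rho> (a T) - r T\<bar> \<le> 3 * D"
proof -
  have ac: "a t \<in> carrier G" if "t \<in> {0..T}" for t using a(2) that by blast
  have As: "sympl (A t)" if "t \<in> {0..T}" for t using proj_sympl[OF ac[OF that]] A[OF that] by simp
  have Ac: "continuous_on {0..T} A"
    by (rule continuous_on_eq[OF continuous_on_compose2[OF proj_cont a(1,2)]]) (simp add: A)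
  have "bounded (A ` {0..T})" by (rule compact_imp_bounded[OF compact_continuous_image[OF Ac compact_Icc]])
  then obtain B0 where "\<forall>z\<in>A ` {0..T}. norm z \<le> B0" unfolding bounded_iff by blast
  then have B0: "norm (A t) \<le> B0" if "t \<in> {0..T}" for t using that by blast
  define B where "B = max 1 B0"
  have B1: "1 \<le> B" and BA: "\<And>t. t \<in> {0..T} \<Longrightarrow> norm (A t) \<le> B"
    using B0 by (auto simp: B_def intro: le_max_iff_disj[THEN iffD2])
  have BN: "norm (A t v) \<le> B * norm v" if "t \<in> {0..T}" for t v
    by (rule order_trans[OF norm_blinfun mult_right_mono[OF BA[OF that]]]) simp
  define P where "P t = polar_pos B (A t)" for t
  define Q where "Q t = - (i_blinfun o\<^sub>L P t o\<^sub>L i_blinfun)" for t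
  have Pc: "continuous_on {0..T} P"
    unfolding P_def by (rule polar_pos_continuous[OF Ac As BA B1])
  have PiP: "P t (\<i> *s P t v) = \<i> *s v" if "t \<in> {0..T}" for t v
    unfolding P_def by (rule polar_pos_i[OF As[OF that] BN[OF that] B1])
  have Psym: "sympl (P t)" if "t \<in> {0..T}" for t
    unfolding P_def by (rule polar_pos_sympl[OF As[OF that] BN[OF that] B1])
  have Psurj: "\<exists>w. v = P t w" if "t \<in> {0..T}" for t v
    using sympl_surj[OF Psym[OF that]] by (metis surjD)
  have QP: "Q t o\<^sub>L P t = id_blinfun" if "t \<in> {0..T}" for t
    by (rule blinfun_eqI) (simp add: Q_def blinfun.minus_left PiP[OF that])
  have PQ: "P t o\<^sub>L Q t = id_blinfun" if "t \<in> {0..T}" for t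
  proof (rule blinfun_eqI)
    fix v
    obtain w where w: "v = P t w" using Psurj[OF \<open>t \<in> {0..T}\<close>] by blast
    have "Q t (P t w) = w" using QP[OF that] by (metis blinfun_apply_blinfun_compose blinfun_apply_id_blinfun id_apply)
    then show "(P t o\<^sub>L Q t) v = id_blinfun v" by (simp add: w)
  qed
  have "\<pi> (a 0) = A 0" using A T by simp
  then have P0: "P 0 = id_blinfun" using polar_pos_id[OF B1] by (simp add: P_def a(3) proj_one)
  have QS: "Q t \<in> Sp_group" if "t \<in> {0..T}" for t
    using Psym[OF that] by (simp add: Sp_group_def sympl_def Q_def blinfun.minus_left std_form_inner i_cmult_linear inner_i_i inner_i_skew)
  have Qc: "continuous_on {0..T} Q" unfolding Q_def by (intro continuous_intros Pc)
  have "\<exists>\<beta>. continuous_on {0..T} \<beta> \<and> \<beta> ` {0..T} \<subseteq> carrier G \<and> \<beta> 0 = \<one>\<^bsub>G\<^esub> \<and> (\<forall>t\<in>{0..T}. \<pi> (\<beta> t) = P t)"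
    by (rule path_lift[OF Pc _ P0 Qc QS QP PQ]) (simp_all add: Sp_group_sympl Psym)
  then obtain \<beta> where \<beta>: "continuous_on {0..T} \<beta>" "\<beta> ` {0..T} \<subseteq> carrier G" "\<beta> 0 = \<one>\<^bsub>G\<^esub>"
    "\<And>t. t \<in> {0..T} \<Longrightarrow> \<pi> (\<beta> t) = P t" by blast
  have bc: "\<beta> t \<in> carrier G" if "t \<in> {0..T}" for t using \<beta>(2) that by blast
  obtain j where j: "j \<in> carrier G" "\<pi> j = i_blinfun" using i_blinfun_Sp proj_image by (metis imageE)
  define k where "k = m_inv G j"
  have k: "k \<in> carrier G" using j by (simp add: k_def)
  have kj: "k \<otimes>\<^bsub>G\<^esub> j = \<one>\<^bsub>G\<^esub>" using j by (simp add: k_def)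
  have \<rho>1: "\<rho> \<one>\<^bsub>G\<^esub> = 0"
  proof -
    have "\<forall>k::int. \<rho> (\<one>\<^bsub>G\<^esub> [^]\<^bsub>G\<^esub> k) = of_int k * \<rho> \<one>\<^bsub>G\<^esub>"
      using \<rho> one_closed unfolding is_rotation_rho_def homogeneous_def by blast
    from spec[OF this, of 0] show ?thesis by simp
  qed
  have Tt: "T \<in> {0..T}" "0 \<in> {0..T}" using T by auto
  \<comment> \<open>\<open>d\<close> lies over the inverse of i times P i P, which is the identity,
    so it is constant. At time 0 it is \<open>k\<close> times \<open>j\<close>, the unit.\<close>
  define d where "d t = k \<otimes>\<^bsub>G\<^esub> (\<beta> t \<otimes>\<^bsub>G\<^esub> (j \<otimes>\<^bsub>G\<^esub> \<beta> t))" for t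
  have "d T = d 0"
  proof (rule kernel_path_constant[of 0 T])
    show "continuous_on {0..T} d"
      unfolding d_def by (intro cont_mult continuous_on_const \<beta>) (use j k bc in auto)
    show "d ` {0..T} \<subseteq> carrier G" using j k bc by (auto simp: d_def)
    show "\<pi> (d t) = id_blinfun" if t: "t \<in> {0..T}" for t
    proof (rule blinfun_eqI)
      fix v
      have "\<pi> (d t) v = \<pi> k (P t (\<i> *s P t v))"
        using j k bc[OF t] by (simp add: d_def proj_mult \<beta>(4)[OF t])
      also have "\<dots> = v" using proj_inv[OF j(1), of v] by (simp add: PiP[OF t] j(2) k_def)
      finally show "\<pi> (d t) v = id_blinfun v" by simp
    qed
  qed (use T in auto)
  then have dT: "d T = \<one>\<^bsub>G\<^esub>" using j k kj by (simp add: d_def \<beta>(3))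
  \<comment> \<open>Three uses of quasi-additivity expand \<rho> (d T) = 0 into \<rho> k + \<rho> j
    + 2 \<rho> (\<beta> T), and a fourth shows that \<rho> k + \<rho> j is within D of \<rho> at the
    unit, which is 0. So 2 \<rho> (\<beta> T) is at most 4 D in absolute value.\<close>
  have \<rho>\<beta>: "\<bar>\<rho> (\<beta> T)\<bar> \<le> 2 * D"
  proof -
    have b: "\<beta> T \<in> carrier G" using bc T by simp
    have "\<bar>\<rho> (d T) - \<rho> k - \<rho> (\<beta> T \<otimes>\<^bsub>G\<^esub> (j \<otimes>\<^bsub>G\<^esub> \<beta> T))\<bar> \<le> D"
      unfolding d_def using j k b by (intro D) auto
    moreover have "\<bar>\<rho> (\<beta> T \<otimes>\<^bsub>G\<^esub> (j \<otimes>\<^bsub>G\<^esub> \<beta> T)) - \<rho> (\<beta> T) - \<rho> (j \<otimes>\<^bsub>G\<^esub> \<beta> T)\<bar> \<le> D"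
      using j b by (intro D) auto
    moreover have "\<bar>\<rho> (j \<otimes>\<^bsub>G\<^esub> \<beta> T) - \<rho> j - \<rho> (\<beta> T)\<bar> \<le> D" using j b by (intro D) auto
    moreover have "\<bar>\<rho> (k \<otimes>\<^bsub>G\<^esub> j) - \<rho> k - \<rho> j\<bar> \<le> D" using j k by (intro D) auto
    ultimately show ?thesis by (simp add: dT kj \<rho>1)
  qed
  \<comment> \<open>This lies over the unitary part of \<open>A t\<close>, where \<rho> is a
    continuous lift of the complex determinant.\<close>
  define c where "c t = a t \<otimes>\<^bsub>G\<^esub> m_inv G (\<beta> t)" for t
  have cc: "c t \<in> carrier G" if "t \<in> {0..T}" for t using ac[OF that] bc[OF that] by (simp add: c_def)
  have cU: "\<pi> (c t) v = polar_unit (A t) B v" if t: "t \<in> {0..T}" for t v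
  proof -
    obtain w where w: "v = P t w" using Psurj[OF t] by blast
    have "\<pi> (m_inv G (\<beta> t)) (P t w) = w" using proj_inv[OF bc[OF t], of w] by (simp add: \<beta>(4)[OF t])
    then have "\<pi> (c t) v = A t w"
      using ac[OF t] bc[OF t] by (simp add: c_def proj_mult A[OF t] w)
    then show ?thesis
      unfolding w P_def by (simp add: polar_unit_pos[OF As[OF t] BN[OF t] B1])
  qed
  have cUg: "\<pi> (c t) \<in> U_group" if t: "t \<in> {0..T}" for t
    using proj_sympl[OF cc[OF t]] cU[OF t] polar_unit_inner[OF As[OF t] BN[OF t] B1]
    by (simp add: U_group_def Sp_group_sympl norm_eq_sqrt_inner)
  show ?thesis
  proof (intro exI[of _ "\<lambda>t. \<rho> (c t)"] conjI ballI)
    have cont: "continuous_on {g \<in> carrier G. \<pi> g \<in> U_group} \<rho>" using \<rho> by (simp add: is_rotation_rho_def)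
    show "continuous_on {0..T} (\<lambda>t. \<rho> (c t))"
    proof (rule continuous_on_compose2[OF cont])
      show "continuous_on {0..T} c"
        unfolding c_def by (intro cont_mult cont_inv a \<beta>) (use bc in auto)
    qed (use cc cUg in auto)
    show "\<rho> (c 0) = 0" by (simp add: c_def a(3) \<beta>(3) \<rho>1)
    fix t assume t: "t \<in> {0..T}"
    have "eip (\<rho> (c t)) = cdet (\<pi> (c t))"
      using \<rho> cc[OF t] cUg[OF t] unfolding is_rotation_rho_def eip_def cdet_def by blast
    also have "\<dots> = cdet (polar_unit (A t) B)" using cU[OF t] by (intro arg_cong[of _ _ cdet] ext)
    finally have e: "eip (\<rho> (c t)) = cdet (polar_unit (A t) B)" .
    then have "sgn (cdet (polar_unit (A t) B)) = cdet (polar_unit (A t) B)" by (simp add: sgn_eq flip: e)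
    moreover have "sgn (cdet (cpart (A t))) = sgn (cdet (polar_unit (A t) B))"
      by (rule polar_phase[OF polar_unit_pos[OF As[OF t] BN[OF t] B1, symmetric] polar_unit_clinear[OF As[OF t] BN[OF t] B1]
        linear_blinfun polar_props(2)[OF As[OF t] BN[OF t] B1] polar_props(3)[OF As[OF t] BN[OF t] B1]])
    ultimately show "eip (\<rho> (c t)) = sgn (cdet (cpart (A t)))" using e by simp
  next
    \<comment> \<open>One more use of quasi-additivity, on the factors \<open>c T\<close> and
      \<open>\<beta> T\<close>, raises the error from 2 D to 3 D.\<close>
    have "c T \<otimes>\<^bsub>G\<^esub> \<beta> T = a T" using ac[OF Tt(1)] bc[OF Tt(1)] by (simp add: c_def m_assoc)
    then have "\<bar>\<rho> (a T) - \<rho> (c T) - \<rho> (\<beta> T)\<bar> \<le> D" using D[OF cc[OF Tt(1)] bc[OF Tt(1)]] by simp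
    then show "\<bar>\<rho> (a T) - \<rho> (c T)\<bar> \<le> 3 * D" using \<rho>\<beta> by linarith
  qed
qed

end

text \<open>The path of matrices over each single orbit has a phase lift that is the rotation
  function by uniqueness, and \<rho> differs from it by at most 3 D. Adding the distance C between
  \<open>q\<close> and \<rho> makes \<open>q\<close> along the lift a bounded perturbation of the
  rotation function, uniformly in time and space.\<close>

lemma ruelle_density_trivial:
  fixes \<phi> :: "real \<Rightarrow> 'y::t2_space \<Rightarrow> 'y"
    and \<Phi> :: "real \<Rightarrow> 'y \<Rightarrow> 'y \<times> (complex ^ 'n::finite) \<Rightarrow> 'y \<times> (complex ^ 'n)"
    and G :: "'g::topological_space monoid"
  assumes c: "compact (UNIV :: 'y set)" "continuous_flow \<phi>" "invariant_measure \<phi> \<mu>"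
    and \<Phi>: "symplectic_cocycle \<phi> trivial_bundle \<Phi>"
    and cover: "universal_cover_Sp G \<pi>" and q: "rotation_quasimorphism G \<pi> q" and lift: "is_cocycle_lift G \<pi> \<Phi> \<Phi>'"
    and meas: "\<forall>\<^sub>F T in at_top. (\<lambda>x. q (\<Phi>' T x)) \<in> borel_measurable \<mu>"
  shows "L1_limit \<mu> (\<lambda>T x. q (\<Phi>' T x) / T) (ruelle_density \<phi> trivial_bundle \<Phi> std_class \<mu>)"
    and "((\<lambda>T. (1 / T) * (\<integral>x. q (\<Phi>' T x) \<partial>\<mu>)) \<longlongrightarrow> ruelle_invariant \<phi> trivial_bundle \<Phi> std_class \<mu>) at_top"
proof -
  interpret Sp_cover G \<pi> by standard (rule cover)
  define u where "u = rotation_function \<phi> trivial_bundle (std_cs, std_triv) \<Phi>"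
  have ul: "rotation_lift \<phi> trivial_bundle (std_cs, std_triv) \<Phi> u"
    unfolding u_def by (rule rotation_lift_exists[OF c(2) symplectic_bundle_trivial \<Phi> std_triv_pair])
  have cl: "triv_class trivial_bundle (std_class :: (('y \<times> (complex ^ 'n) \<Rightarrow> _) \<times> _) set)"
    unfolding triv_class_def std_class_def using std_triv_pair by blast
  have mem: "(std_cs, std_triv) \<in> (std_class :: (('y \<times> (complex ^ 'n) \<Rightarrow> _) \<times> _) set)"
    unfolding std_class_def homotopy_class_def using homotopic_triv_refl[OF std_triv_pair] by simp
  obtain f where f: "is_ruelle_density \<phi> trivial_bundle \<Phi> std_class \<mu> f"
    using ruelle_density_exists[OF c symplectic_bundle_trivial \<Phi> cl] by blast
  have ulim: "L1_limit \<mu> (\<lambda>T x. u T x / T) (ruelle_density \<phi> trivial_bundle \<Phi> std_class \<mu>)"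
    unfolding u_def by (rule ruelle_density_L1[OF f mem])
  obtain \<rho> C where \<rho>: "is_rotation_rho G \<pi> \<rho>" and C: "\<And>g. g \<in> carrier G \<Longrightarrow> \<bar>q g - \<rho> g\<bar> \<le> C"
    using q unfolding rotation_quasimorphism_def by blast
  obtain D where D: "\<And>g h. g \<in> carrier G \<Longrightarrow> h \<in> carrier G \<Longrightarrow> \<bar>\<rho> (g \<otimes>\<^bsub>G\<^esub> h) - \<rho> g - \<rho> h\<bar> \<le> D"
    using \<rho> unfolding is_rotation_rho_def quasimorphism_def by blast
  have bound: "\<bar>q (\<Phi>' T x) - u T x\<bar> \<le> C + 3 * D" if T: "0 < T" for T x
  proof -
    have l: "\<And>t. \<Phi>' t x \<in> carrier G" "\<And>t. \<pi> (\<Phi>' t x) = cocycle_matrix \<Phi> t x" "\<Phi>' 0 x = \<one>\<^bsub>G\<^esub>"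
      using lift by (auto simp: is_cocycle_lift_def)
    have lc: "continuous_on {0..T} (\<lambda>t. \<Phi>' t x)"
      by (rule continuous_on_sections(2)) (use lift in \<open>simp add: is_cocycle_lift_def\<close>)
    obtain r where r: "continuous_on {0..T} r" "r 0 = 0"
      "\<And>t. t \<in> {0..T} \<Longrightarrow> eip (r t) = sgn (cdet (cpart (cocycle_matrix \<Phi> t x)))" "\<bar>\<rho> (\<Phi>' T x) - r T\<bar> \<le> 3 * D"
      using rho_phase_lift[OF \<rho> D less_imp_le[OF T] lc _ l(3) l(2)] l(1) by blast
    have "r T = u T x"
      by (rule rotation_lift_unique[OF ul r(1) _ r(2)]) (use T r(3) in \<open>simp_all add: trivial_rotation_phase[OF c(2) \<Phi>]\<close>)
    then show ?thesis using r(4) C[OF l(1), of T] by linarith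
  qed
  \<comment> \<open>Along the lift \<open>q\<close> is only measurable, for large times; domination
    by the rotation function plus a constant makes it integrable.\<close>
  have int: "\<forall>\<^sub>F T in at_top. integrable \<mu> (\<lambda>x. q (\<Phi>' T x) / T)"
    using meas eventually_gt_at_top[of 0]
  proof eventually_elim
    case (elim T)
    interpret finite_measure \<mu> using c(3) by (simp add: invariant_measure_def)
    have iu: "integrable \<mu> (\<lambda>x. u T x / T)"
      unfolding u_def by (rule integrable_rotation[OF c symplectic_bundle_trivial \<Phi> std_triv_pair])
    show ?case
    proof (rule Bochner_Integration.integrable_bound)
      show "integrable \<mu> (\<lambda>x. \<bar>u T x / T\<bar> + (C + 3 * D) / T)"
        by (intro Bochner_Integration.integrable_add integrable_abs iu integrable_const)
      show "(\<lambda>x. q (\<Phi>' T x) / T) \<in> borel_measurable \<mu>" using elim(1) by measurable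
      show "AE x in \<mu>. norm (q (\<Phi>' T x) / T) \<le> norm (\<bar>u T x / T\<bar> + (C + 3 * D) / T)"
      proof (rule AE_I2)
        fix x
        have "\<bar>q (\<Phi>' T x)\<bar> / T \<le> (\<bar>u T x\<bar> + (C + 3 * D)) / T"
          using bound[OF elim(2), of x] elim(2) by (intro divide_right_mono) auto
        then show "norm (q (\<Phi>' T x) / T) \<le> norm (\<bar>u T x / T\<bar> + (C + 3 * D) / T)"
          using elim(2) by (simp add: add_divide_distrib abs_divide)
      qed
    qed
  qed
  show lim: "L1_limit \<mu> (\<lambda>T x. q (\<Phi>' T x) / T) (ruelle_density \<phi> trivial_bundle \<Phi> std_class \<mu>)"
    by (rule L1_limit_perturb[OF _ ulim int bound]) (use c(3) in \<open>simp_all add: invariant_measure_def\<close>)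
  show "((\<lambda>T. (1 / T) * (\<integral>x. q (\<Phi>' T x) \<partial>\<mu>)) \<longlongrightarrow> ruelle_invariant \<phi> trivial_bundle \<Phi> std_class \<mu>) at_top"
    using L1_limit_integral[OF lim] by (simp add: ruelle_invariant_def)
qed

theorem theorem1p2:
  fixes \<phi> :: "real \<Rightarrow> 'y::{t2_space,second_countable_topology} \<Rightarrow> 'y"
    and \<mu> :: "'y measure"
  assumes "compact_manifold (UNIV :: 'y set)"
    and "continuous_flow \<phi>"
    and "invariant_measure \<phi> \<mu>"
  shows
    "(\<forall>(E :: ('y, 'e::topological_space) symp_bundle) \<Phi>
        (\<tau> :: (('e \<Rightarrow> 'e) \<times> ('y, 'e, 'k::finite) det_triv) set).
      ruelle_data \<phi> E \<Phi> \<tau> \<longrightarrow>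
        (\<exists>f. is_ruelle_density \<phi> E \<Phi> \<tau> \<mu> f) \<and>
        (\<forall>f g. is_ruelle_density \<phi> E \<Phi> \<tau> \<mu> f \<and> is_ruelle_density \<phi> E \<Phi> \<tau> \<mu> g \<longrightarrow>
           (AE x in \<mu>. f x = g x))) \<and>
     (\<forall>(E :: ('y, 'e) symp_bundle) \<Phi>
        (\<tau> :: (('e \<Rightarrow> 'e) \<times> ('y, 'e, 'k) det_triv) set)
        (E' :: ('y, 'f::topological_space) symp_bundle) \<Phi>'
        (\<tau>' :: (('f \<Rightarrow> 'f) \<times> ('y, 'f, 'k) det_triv) set) \<Psi>.
      ruelle_data \<phi> E \<Phi> \<tau> \<and> ruelle_data \<phi> E' \<Phi>' \<tau>' \<and>
      cocycle_iso \<phi> E \<Phi> E' \<Phi>' \<Psi> \<and> (\<forall>p\<in>\<tau>. push_triv E E' \<Psi> p \<in> \<tau>') \<longrightarrow>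
        (AE x in \<mu>. ruelle_density \<phi> E \<Phi> \<tau> \<mu> x = ruelle_density \<phi> E' \<Phi>' \<tau>' \<mu> x) \<and>
        ruelle_invariant \<phi> E \<Phi> \<tau> \<mu> = ruelle_invariant \<phi> E' \<Phi>' \<tau>' \<mu>) \<and>
     (\<forall>(E\<^sub>1 :: ('y, 'e) symp_bundle) \<Phi>\<^sub>1
        (\<tau>\<^sub>1 :: (('e \<Rightarrow> 'e) \<times> ('y, 'e, 'k) det_triv) set)
        (E\<^sub>2 :: ('y, 'f) symp_bundle) \<Phi>\<^sub>2
        (\<tau>\<^sub>2 :: (('f \<Rightarrow> 'f) \<times> ('y, 'f, 'l::finite) det_triv) set).
      ruelle_data \<phi> E\<^sub>1 \<Phi>\<^sub>1 \<tau>\<^sub>1 \<and> ruelle_data \<phi> E\<^sub>2 \<Phi>\<^sub>2 \<tau>\<^sub>2 \<longrightarrow>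
        (AE x in \<mu>.
           ruelle_density \<phi> (sum_bundle E\<^sub>1 E\<^sub>2) (sum_cocycle \<Phi>\<^sub>1 \<Phi>\<^sub>2)
             (tensor_class E\<^sub>1 \<tau>\<^sub>1 E\<^sub>2 \<tau>\<^sub>2) \<mu> x =
           ruelle_density \<phi> E\<^sub>1 \<Phi>\<^sub>1 \<tau>\<^sub>1 \<mu> x + ruelle_density \<phi> E\<^sub>2 \<Phi>\<^sub>2 \<tau>\<^sub>2 \<mu> x)) \<and>
     (\<forall>(E :: ('y, 'e) symp_bundle) \<Phi>
        (\<tau> :: (('e \<Rightarrow> 'e) \<times> ('y, 'e, 'k) det_triv) set) \<nu> a b.
      ruelle_data \<phi> E \<Phi> \<tau> \<and> invariant_measure \<phi> \<nu> \<and> 0 \<le> a \<and> 0 \<le> b \<longrightarrow>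
        ruelle_invariant \<phi> E \<Phi> \<tau> (comb_measure a \<mu> b \<nu>) =
          a * ruelle_invariant \<phi> E \<Phi> \<tau> \<mu> + b * ruelle_invariant \<phi> E \<Phi> \<tau> \<nu>) \<and>
     (\<forall>\<Phi> (G :: 'g::topological_space monoid)
        (\<pi> :: 'g \<Rightarrow> ((complex ^ 'n::finite) \<Rightarrow>\<^sub>L (complex ^ 'n))) q \<Phi>'.
      symplectic_cocycle \<phi> (trivial_bundle :: ('y, 'y \<times> (complex ^ 'n)) symp_bundle) \<Phi> \<and>
      universal_cover_Sp G \<pi> \<and> rotation_quasimorphism G \<pi> q \<and> is_cocycle_lift G \<pi> \<Phi> \<Phi>' \<and>
      (\<forall>\<^sub>F T in at_top. (\<lambda>x. q (\<Phi>' T x)) \<in> borel_measurable \<mu>) \<longrightarrow>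
        L1_limit \<mu> (\<lambda>T x. q (\<Phi>' T x) / T) (ruelle_density \<phi> trivial_bundle \<Phi> std_class \<mu>) \<and>
        ((\<lambda>T. (1 / T) * (\<integral>x. q (\<Phi>' T x) \<partial>\<mu>))
           \<longlongrightarrow> ruelle_invariant \<phi> trivial_bundle \<Phi> std_class \<mu>) at_top)"
proof -
  have c: "compact (UNIV :: 'y set)" "continuous_flow \<phi>" "invariant_measure \<phi> \<mu>"
    using assms by (auto simp: compact_manifold_def)
  have exist: "(\<exists>f. is_ruelle_density \<phi> E \<Phi> \<tau> \<mu> f) \<and>
        (\<forall>f g. is_ruelle_density \<phi> E \<Phi> \<tau> \<mu> f \<and> is_ruelle_density \<phi> E \<Phi> \<tau> \<mu> g \<longrightarrow> (AE x in \<mu>. f x = g x))"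
    if r: "ruelle_data \<phi> E \<Phi> \<tau>"
    for E :: "('y, 'e) symp_bundle" and \<Phi> and \<tau> :: "(('e \<Rightarrow> 'e) \<times> ('y, 'e, 'k) det_triv) set"
  proof (intro conjI allI impI)
    have d: "symplectic_vector_bundle TYPE('k) E" "symplectic_cocycle \<phi> E \<Phi>" "triv_class E \<tau>"
      using r by (auto simp: ruelle_data_def)
    show "\<exists>f. is_ruelle_density \<phi> E \<Phi> \<tau> \<mu> f" by (rule ruelle_density_exists[OF c d])
    obtain p where p: "p \<in> \<tau>" using triv_class_nonempty[OF d(3)] by blast
    fix f g assume "is_ruelle_density \<phi> E \<Phi> \<tau> \<mu> f \<and> is_ruelle_density \<phi> E \<Phi> \<tau> \<mu> g"
    then show "AE x in \<mu>. f x = g x"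
      using p unfolding is_ruelle_density_def by (elim conjE) (rule L1_limit_unique; erule bspec)
  qed
  have covariance: "(AE x in \<mu>. ruelle_density \<phi> E \<Phi> \<tau> \<mu> x = ruelle_density \<phi> E' \<Phi>' \<tau>' \<mu> x) \<and>
        ruelle_invariant \<phi> E \<Phi> \<tau> \<mu> = ruelle_invariant \<phi> E' \<Phi>' \<tau>' \<mu>"
    if r: "ruelle_data \<phi> E \<Phi> \<tau>" "ruelle_data \<phi> E' \<Phi>' \<tau>'"
      and iso: "cocycle_iso \<phi> E \<Phi> E' \<Phi>' \<Psi>" and push: "\<forall>p\<in>\<tau>. push_triv E E' \<Psi> p \<in> \<tau>'"
    for E :: "('y, 'e) symp_bundle" and \<Phi> and \<tau> :: "(('e \<Rightarrow> 'e) \<times> ('y, 'e, 'k) det_triv) set"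
      and E' :: "('y, 'f) symp_bundle" and \<Phi>' and \<tau>' :: "(('f \<Rightarrow> 'f) \<times> ('y, 'f, 'k) det_triv) set" and \<Psi>
  proof -
    have d: "symplectic_vector_bundle TYPE('k) E" "symplectic_cocycle \<phi> E \<Phi>" "triv_class E \<tau>"
      and d': "symplectic_vector_bundle TYPE('k) E'" "symplectic_cocycle \<phi> E' \<Phi>'" "triv_class E' \<tau>'"
      using r by (auto simp: ruelle_data_def)
    obtain p where p: "p \<in> \<tau>" "triv_pair E p" using triv_class_nonempty[OF d(3)] by blast
    obtain J \<sigma> where Js: "p = (J, \<sigma>)" by (cases p)
    have p': "push_triv E E' \<Psi> p \<in> \<tau>'" using push p(1) by blast
    obtain f where f: "is_ruelle_density \<phi> E \<Phi> \<tau> \<mu> f" using ruelle_density_exists[OF c d] by blast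
    obtain f' where f': "is_ruelle_density \<phi> E' \<Phi>' \<tau>' \<mu> f'" using ruelle_density_exists[OF c d'] by blast
    have eq: "rotation_function \<phi> E' (push_triv E E' \<Psi> p) \<Phi>' = rotation_function \<phi> E p \<Phi>"
      using rotation_function_push[OF c(2) d(1) d'(1) d(2) iso] p(2) triv_class_pair[OF d'(3) p'] unfolding Js by blast
    note l = ruelle_density_L1[OF f p(1)] and l' = ruelle_density_L1[OF f' p', unfolded eq]
    show ?thesis
      using L1_limit_unique[OF l l'] L1_limit_integral_eq[OF L1_limit_unique[OF l l'] l l']
      by (simp add: ruelle_invariant_def)
  qed
  have direct_sum: "AE x in \<mu>. ruelle_density \<phi> (sum_bundle E\<^sub>1 E\<^sub>2) (sum_cocycle \<Phi>\<^sub>1 \<Phi>\<^sub>2)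
             (tensor_class E\<^sub>1 \<tau>\<^sub>1 E\<^sub>2 \<tau>\<^sub>2) \<mu> x =
           ruelle_density \<phi> E\<^sub>1 \<Phi>\<^sub>1 \<tau>\<^sub>1 \<mu> x + ruelle_density \<phi> E\<^sub>2 \<Phi>\<^sub>2 \<tau>\<^sub>2 \<mu> x"
    if "ruelle_data \<phi> E\<^sub>1 \<Phi>\<^sub>1 \<tau>\<^sub>1" "ruelle_data \<phi> E\<^sub>2 \<Phi>\<^sub>2 \<tau>\<^sub>2"
    for E\<^sub>1 :: "('y, 'e) symp_bundle" and \<Phi>\<^sub>1 and \<tau>\<^sub>1 :: "(('e \<Rightarrow> 'e) \<times> ('y, 'e, 'k) det_triv) set"
      and E\<^sub>2 :: "('y, 'f) symp_bundle" and \<Phi>\<^sub>2 and \<tau>\<^sub>2 :: "(('f \<Rightarrow> 'f) \<times> ('y, 'f, 'l) det_triv) set"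
    by (rule ruelle_density_sum[OF c]) (use that in \<open>simp_all add: ruelle_data_def\<close>)
  have linearity: "ruelle_invariant \<phi> E \<Phi> \<tau> (comb_measure a \<mu> b \<nu>) =
          a * ruelle_invariant \<phi> E \<Phi> \<tau> \<mu> + b * ruelle_invariant \<phi> E \<Phi> \<tau> \<nu>"
    if "ruelle_data \<phi> E \<Phi> \<tau>" "invariant_measure \<phi> \<nu>" "0 \<le> a" "0 \<le> b"
    for E :: "('y, 'e) symp_bundle" and \<Phi> and \<tau> :: "(('e \<Rightarrow> 'e) \<times> ('y, 'e, 'k) det_triv) set" and \<nu> a b
    by (rule ruelle_invariant_comb[OF c(1,2,3)]) (use that in \<open>simp_all add: ruelle_data_def\<close>)
  show ?thesis
    apply (intro conjI[OF _ conjI[OF _ conjI[OF _ conjI]]])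
        apply (intro allI impI, rule exist, assumption)
       apply (intro allI impI, elim conjE, rule covariance, assumption+)
      apply (intro allI impI, elim conjE, rule direct_sum, assumption+)
     apply (intro allI impI, elim conjE, rule linearity, assumption+)
    apply (intro allI impI, elim conjE, rule conjI)
     apply (rule ruelle_density_trivial(1)[OF c]; assumption)
    apply (rule ruelle_density_trivial(2)[OF c]; assumption)
    done
qed


end
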